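(* Let $d\ge1$, let $X,Y$ be Banach spaces, and let $\varphi:\mathbb{R}^d\to B(X,Y)$ be a function satisfying the following four conditions: (1) for every $a\in X$, $\varphi(\cdot)(a)$ is a measurable function from $\mathbb{R}^d$ to $Y$, and $\sup_{\xi\in\mathbb{R}^d}\|\varphi(\xi)\|_{B(X,Y)}<\infty$; (2) there exists a partition $\mathcal{R}$ of $\mathbb{R}^d$ into bounded rectangles such that $\varphi$ is strongly continuous on every $R\in\mathcal{R}$, i.e. $\varphi(\cdot)(a)$ is continuous from $R$ to $Y$ for every $a\in X$; (3) for every $a\in X$ and every $R\in\mathcal{R}$, the range of the restriction of $\varphi(\cdot)(a)$ to $R$ is contained in a finite dimensional subspace of $Y$; (4) for every $1<q<\infty$ and every $a\in X$ there exists a constant $C_{q,a}$ such that $\|T_\varphi(af)\|_{L_q(\mathbb{R}^d;Y)}\le C_{q,a}\|f\|_{L_q(\mathbb{R}^d)}$ for all compactly supported $C^\infty$ functions $f:\mathbb{R}^d\to\mathbb{C}$. Let $1<p<\infty$. (i) Assume that $\varphi$ is strongly continuous at every $m\in\mathbb{Z}^d$ (i.e. $\xi\mapsto\varphi(\xi)(a)$ is continuous at $m$ for every $a\in X$). Then $$\|M_\varphi\|_{p\to p}\le\|T_\varphi\|_{p\to p}\quad\text{and}\quad \|M_\varphi^{-1}\|_{p\to p}\le\|T_\varphi^{-1}\|_{p\to p}.$$ (ii) For $t>0$ define $\varphi^{(t)}$ by $\varphi^{(t)}(\xi)=\varphi(t\xi)$. Then $$\|T_\varphi\|_{p\to p}\le\liminf_{t\to0}\|M_{\varphi^{(t)}}\|_{p\to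 p}\quad\text{and}\quad \|T_\varphi^{-1}\|_{p\to p}\le\liminf_{t\to0}\|M_{\varphi^{(t)}}^{-1}\|_{p\to p}.$$
   Context: $B(X,Y)$ is the space of continuous linear operators from $X$ to $Y$; $L_p(\Omega;X)$ is the space of $p$-integrable $X$-valued functions. $\mathbb{T}^d$ is the $d$-torus with normalized Haar measure. The Fourier multiplier $T_\varphi$ on $\mathbb{R}^d$ is defined by $\widehat{T_\varphi(f)}(\xi)=\varphi(\xi)\widehat f(\xi)$, $\xi\in\mathbb{R}^d$, and the periodic Fourier multiplier $M_\varphi$ by $\widehat{M_\varphi(f)}(m)=\varphi(m)\widehat f(m)$, $m\in\mathbb{Z}^d$, for $f$ on $\mathbb{T}^d$ with values in $X$. The Fourier transform is $\widehat f(\xi)=\int f(x)e^{-2\pi i\xi\cdot x}dx$. $\|T_\varphi\|_{p\to p}$ and $\|T_\varphi^{-1}\|_{p\to p}$ denote respectively the best constants $\beta$ and $\alpha$ in $$\alpha^{-1}\|f\|_{L_p(\mathbb{R}^d;X)}\le\|T_\varphi(f)\|_{L_p(\mathbb{R}^d;Y)}\le\beta\|f\|_{L_p(\mathbb{R}^d;X)}$$ for all compactly supported $C^\infty$ functions $f$ on $\mathbb{R}^d$ with values in a finite dimensional subspace of $X$. $\|M_\varphi\|_{p\to p}$ and $\|M_\varphi^{-1}\|_{p\to p}$ denote respectively the best constants $\beta$ and $\alpha$ in $$\alpha^{-1}\|f\|_{L_p(\mathbb{T}^d;X)}\le\|M_\varphi(f)\|_{L_p(\mathbb{T}^d;Y)}\le\beta\|f\|_{L_p(\mathbb{T}^d;X)}$$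 for all trigonometric polynomials $f$ on $\mathbb{T}^d$ with coefficients in $X$. If one of these inequalities does not hold with any finite constant, the corresponding best constant is understood to be $\infty$. *)

theory Defs
  imports "HOL-Analysis.Analysis"
begin

subsection \<open>Complex Banach spaces\<close>

class complex_banach = banach +
  fixes scaleC :: "complex \<Rightarrow> 'a \<Rightarrow> 'a"  (infixr "*\<^sub>C" 75)
  assumes scaleC_add_right: "c *\<^sub>C (x + y) = c *\<^sub>C x + c *\<^sub>C y"
    and scaleC_add_left: "(b + c) *\<^sub>C x = b *\<^sub>C x + c *\<^sub>C x"
    and scaleC_scaleC: "b *\<^sub>C c *\<^sub>C x = (b * c) *\<^sub>C x"
    and scaleC_of_real: "complex_of_real r *\<^sub>C x = r *\<^sub>R x"
    and norm_scaleC: "norm (c *\<^sub>C x) = cmod c * norm x"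

lemma scaleC_one: "1 *\<^sub>C x = x"
  for x :: "'a::complex_banach"
  using scaleC_of_real[of 1 x] by simp

global_interpretation complex_vector: vector_space "scaleC :: complex \<Rightarrow> 'a \<Rightarrow> 'a::complex_banach"
  defines cspan = complex_vector.span
  by unfold_locales
    (simp_all add: scaleC_add_right scaleC_add_left scaleC_scaleC scaleC_one)

instantiation complex :: complex_banach
begin

definition scaleC_complex :: "complex \<Rightarrow> complex \<Rightarrow> complex"
  where "scaleC_complex = (*)"

instance
  by standard (simp_all add: scaleC_complex_def algebra_simps norm_mult scaleR_conv_of_real)

end

text \<open>The space \<open>B(X,Y)\<close>. The operator norm of a complex-linear operator is its norm as a
  real-linear one, so it is cut out of the library type of bounded real-linear operators.\<close>

definition bounded_clinear_ops :: "('x::complex_banach \<Rightarrow>\<^sub>L 'y::complex_banach) set"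
  where "bounded_clinear_ops = {L. \<forall>c x. blinfun_apply L (c *\<^sub>C x) = c *\<^sub>C blinfun_apply L x}"


subsection \<open>Test functions and \<open>L\<^sub>p\<close> norms\<close>

text \<open>On a finite dimensional domain, \<open>f\<close> is of class \<open>C\<^sup>k\<^sup>+\<^sup>1\<close> iff it is differentiable and all its
  directional derivatives are of class \<open>C\<^sup>k\<close>.\<close>

primrec C_class :: "nat \<Rightarrow> ('a::euclidean_space \<Rightarrow> 'b::real_normed_vector) \<Rightarrow> bool"
  where
    "C_class 0 f \<longleftrightarrow> continuous_on UNIV f"
  | "C_class (Suc k) f \<longleftrightarrow>
       (\<forall>x. f differentiable (at x)) \<and> (\<forall>v. C_class k (\<lambda>x. frechet_derivative f (at x) v))"

definition C_infinity_compact :: "('a::euclidean_space \<Rightarrow> 'b::real_normed_vector) \<Rightarrow> bool"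
  where "C_infinity_compact f \<longleftrightarrow> (\<forall>k. C_class k f) \<and> compact (closure {x. f x \<noteq> 0})"

definition in_fin_dim :: "'b::complex_banach set \<Rightarrow> bool"
  where "in_fin_dim S \<longleftrightarrow> (\<exists>B. finite B \<and> S \<subseteq> cspan B)"

definition test_functions :: "((real ^ 'd) \<Rightarrow> 'x::complex_banach) set"
  where "test_functions = {f. C_infinity_compact f \<and> in_fin_dim (range f)}"

definition Lp_norm :: "real \<Rightarrow> 'a::euclidean_space set \<Rightarrow> ('a \<Rightarrow> 'b::real_normed_vector) \<Rightarrow> ennreal"
  where "Lp_norm p S f =
    (let I = \<integral>\<^sup>+x\<in>S. ennreal (norm (f x) powr p) \<partial>lebesgue
     in if I = \<infinity> then \<infinity> else ennreal (enn2real I powr (1 / p)))"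


subsection \<open>Fourier multipliers on \<open>\<real>\<^sup>d\<close>\<close>

text \<open>Vector-valued integrals are Henstock--Kurzweil integrals: these extend the Bochner integral
  and, unlike the library's Bochner integral, do not require a separable target space.\<close>

definition character :: "real ^ 'd \<Rightarrow> real ^ 'd \<Rightarrow> complex"
  where "character \<xi> x = cis (2 * pi * (\<xi> \<bullet> x))"

definition fourier_transform :: "(real ^ 'd \<Rightarrow> 'x::complex_banach) \<Rightarrow> real ^ 'd \<Rightarrow> 'x"
  where "fourier_transform f \<xi> = integral UNIV (\<lambda>x. character (- \<xi>) x *\<^sub>C f x)"

text \<open>\<open>T\<^sub>\<phi> f\<close> is the inverse Fourier transform of \<open>\<xi> \<mapsto> \<phi>(\<xi>) (fourier_transform f \<xi>)\<close>, which is absolutely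
  integrable for a test function \<open>f\<close> and bounded strongly measurable \<open>\<phi>\<close>; \<open>T\<^sub>\<phi> f\<close> is then a
  bounded continuous function.\<close>

definition fourier_mult ::
    "(real ^ 'd \<Rightarrow> ('x::complex_banach \<Rightarrow>\<^sub>L 'y::complex_banach)) \<Rightarrow>
     (real ^ 'd \<Rightarrow> 'x) \<Rightarrow> real ^ 'd \<Rightarrow> 'y"
  where "fourier_mult \<phi> f x =
    integral UNIV (\<lambda>\<xi>. character \<xi> x *\<^sub>C blinfun_apply (\<phi> \<xi>) (fourier_transform f \<xi>))"

definition T_norm :: "real \<Rightarrow> (real ^ 'd \<Rightarrow> ('x::complex_banach \<Rightarrow>\<^sub>L 'y::complex_banach)) \<Rightarrow> ennreal"
  where "T_norm p \<phi> = Inf {\<beta>. \<beta> < \<infinity> \<and>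
    (\<forall>f\<in>test_functions. Lp_norm p UNIV (fourier_mult \<phi> f) \<le> \<beta> * Lp_norm p UNIV f)}"

definition T_inv_norm :: "real \<Rightarrow> (real ^ 'd \<Rightarrow> ('x::complex_banach \<Rightarrow>\<^sub>L 'y::complex_banach)) \<Rightarrow> ennreal"
  where "T_inv_norm p \<phi> = Inf {\<alpha>. \<alpha> < \<infinity> \<and>
    (\<forall>f\<in>test_functions. inverse \<alpha> * Lp_norm p UNIV f \<le> Lp_norm p UNIV (fourier_mult \<phi> f))}"


subsection \<open>Periodic Fourier multipliers\<close>

text \<open>Functions on the torus are \<open>1\<close>-periodic functions on \<open>\<real>\<^sup>d\<close>; normalized Haar measure is
  Lebesgue measure on the unit cube.\<close>

definition int_lattice :: "(real ^ 'd) set"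
  where "int_lattice = {m. \<forall>i. m $ i \<in> \<int>}"

definition unit_cube :: "(real ^ 'd) set"
  where "unit_cube = {x. \<forall>i. 0 \<le> x $ i \<and> x $ i \<le> 1}"

definition trig_polynomials :: "((real ^ 'd) \<Rightarrow> 'x::complex_banach) set"
  where "trig_polynomials =
    {(\<lambda>x. \<Sum>m\<in>F. character m x *\<^sub>C a m) | F a. finite F \<and> F \<subseteq> int_lattice}"

definition fourier_coeff :: "(real ^ 'd \<Rightarrow> 'x::complex_banach) \<Rightarrow> real ^ 'd \<Rightarrow> 'x"
  where "fourier_coeff f m = integral unit_cube (\<lambda>x. character (- m) x *\<^sub>C f x)"

text \<open>Meant for trigonometric polynomials, where the index set of the sum is finite.\<close>

definition periodic_mult ::
    "(real ^ 'd \<Rightarrow> ('x::complex_banach \<Rightarrow>\<^sub>L 'y::complex_banach)) \<Rightarrow>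
     (real ^ 'd \<Rightarrow> 'x) \<Rightarrow> real ^ 'd \<Rightarrow> 'y"
  where "periodic_mult \<phi> f x =
    (\<Sum>m | m \<in> int_lattice \<and> fourier_coeff f m \<noteq> 0.
      character m x *\<^sub>C blinfun_apply (\<phi> m) (fourier_coeff f m))"

definition M_norm :: "real \<Rightarrow> (real ^ 'd \<Rightarrow> ('x::complex_banach \<Rightarrow>\<^sub>L 'y::complex_banach)) \<Rightarrow> ennreal"
  where "M_norm p \<phi> = Inf {\<beta>. \<beta> < \<infinity> \<and>
    (\<forall>f\<in>trig_polynomials. Lp_norm p unit_cube (periodic_mult \<phi> f) \<le> \<beta> * Lp_norm p unit_cube f)}"

definition M_inv_norm :: "real \<Rightarrow> (real ^ 'd \<Rightarrow> ('x::complex_banach \<Rightarrow>\<^sub>L 'y::complex_banach)) \<Rightarrow> ennreal"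
  where "M_inv_norm p \<phi> = Inf {\<alpha>. \<alpha> < \<infinity> \<and>
    (\<forall>f\<in>trig_polynomials.
      inverse \<alpha> * Lp_norm p unit_cube f \<le> Lp_norm p unit_cube (periodic_mult \<phi> f))}"


subsection \<open>Partitions into bounded rectangles\<close>

definition bounded_rectangle :: "(real ^ 'd) set \<Rightarrow> bool"
  where "bounded_rectangle R \<longleftrightarrow>
    (\<exists>I :: 'd \<Rightarrow> real set. (\<forall>i. is_interval (I i) \<and> bounded (I i)) \<and> R = {x. \<forall>i. x $ i \<in> I i})"

text \<open>Sides may be degenerate, so that e.g. the dyadic rectangles can be completed to a partition
  of the whole space by rectangles inside the coordinate hyperplanes. Countability is automatic
  when no rectangle is degenerate (see the lemma below); in general it excludes the partition into
  points, for which continuity on each rectangle would be void.\<close>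

definition rectangle_partition :: "(real ^ 'd) set set \<Rightarrow> bool"
  where "rectangle_partition \<R> \<longleftrightarrow>
    partition_on UNIV \<R> \<and> countable \<R> \<and> (\<forall>R\<in>\<R>. bounded_rectangle R)"

lemma rectangle_partition_nondegenerate:
  assumes "partition_on UNIV \<R>" and "\<And>R. R \<in> \<R> \<Longrightarrow> bounded_rectangle R \<and> interior R \<noteq> {}"
  shows "rectangle_partition \<R>"
proof -
  have "countable \<R>"
    by (rule countable_disjoint_nonempty_interior_subsets)
      (use assms in \<open>auto simp: partition_on_def disjoint_def pairwise_def disjnt_def\<close>)
  then show ?thesis
    using assms by (auto simp: rectangle_partition_def)
qed

end

(* The Fourier transform of a test function is approximated in L1 by functions u supported away from
   the hyperplanes that contain the boundaries of the rectangles, with a uniform bound on the Lq norms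
   of their inverse transforms: cut-offs in one coordinate at a time keep the mixed difference bounds
   that give product decay |x_1|^-1 ... |x_d|^-1 of the inverse transform, uniformly in the width of the
   cut-off, and this is in Lq for every q > 1. For such u the symbol u(xi) phi(xi) a is continuous, so
   the Riemann sums over t Z^d, which are trigonometric polynomials of period 1/t, converge to the
   inverse Fourier integral, uniformly on the cell of side 1/t: at high frequencies a shift by about
   half a wave length makes both small. Bounds in Lq with q < p, which come from hypothesis (4),
   turn uniform convergence into convergence in Lp, and the periodic inequalities for phi(t .) pass to
   the limit; this is (ii). For (i), testing the inequality on f(eps x) P(x) for a trigonometric
   polynomial P and letting eps tend to 0 gives de Leeuw's transference; the error is small in sup
   norm and bounded in Lq, hence small in Lp. *)

theory Submission
  imports Defs
begin

text \<open>Hypothesis (4) bounds the operator on one vector at a time, and for Banach valued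
  functions there is no Plancherel theorem to add to it. Convergence is therefore first proved in
  sup norm, since an inverse transform is bounded by the L1 norm of its symbol; interpolation with
  an Lq bound, q = (1 + p) / 2, turns this into convergence in Lp. Here q > 1 is what hypothesis (4)
  and the q-integrability of the product decay ask for, and q < p leaves the sup norm a positive
  power.

  The Lq bound is needed for the Riemann sums too, uniformly in the mesh. It is obtained from
  hypothesis (4) by transference, which samples the multiplier at points of t Z^d and needs
  continuity there. The origin, for instance, is a sampling point for every t; hence symbols have to
  vanish near the hyperplanes.

  Values lie in arbitrary Banach spaces, possibly non-separable. Almost everywhere continuity takes
  the place of strong measurability, and dominated convergence is applied only to real functions,
  the norms, with multiples of one integrable weight as majorants of the symbols.\<close>

abbreviation cont :: "('a::topological_space \<Rightarrow> 'b::topological_space) \<Rightarrow> bool" where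
  "cont \<equiv> continuous_on UNIV"

section \<open>Smooth functions\<close>

text \<open>\<open>C_class\<close> speaks of \<open>frechet_derivative\<close>; by uniqueness of
  derivatives any exhibited derivative serves, which is how the closure properties below are
  proved.\<close>

lemma C_class_SucI:
  assumes "\<And>x. (f has_derivative f' x) (at x)" and "\<And>v. C_class k (\<lambda>x. f' x v)"
  shows "C_class (Suc k) f"
proof -
  have "frechet_derivative f (at x) = f' x" for x
    using frechet_derivative_at[OF assms(1)] by simp
  then show ?thesis
    using assms by (auto simp: differentiable_def)
qed

lemma C_class_SucD:
  assumes "C_class (Suc k) f"
  shows "(f has_derivative frechet_derivative f (at x)) (at x)"
    and "C_class k (\<lambda>x. frechet_derivative f (at x) v)"
  using assms by (auto simp: frechet_derivative_works)

lemma C_class_continuous: "C_class k f \<Longrightarrow> cont f"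
  by (cases k) (auto intro!: differentiable_imp_continuous_on simp: differentiable_on_def)

lemma C_class_decr: "C_class (Suc k) f \<Longrightarrow> C_class k f"
proof (induction k arbitrary: f)
  case 0
  then show ?case using C_class_continuous by (metis C_class.simps(1))
next
  case (Suc k)
  then show ?case
    by (metis C_class.simps(2))
qed

lemma C_class_const [simp]: "C_class k (\<lambda>x. c)"
proof (induction k arbitrary: c)
  case (Suc k)
  show ?case
    by (rule C_class_SucI[where f' = "\<lambda>_ _. 0"]) (auto intro: Suc)
qed simp

lemma C_class_bounded_linear:
  assumes L: "bounded_linear L"
  shows "C_class k f \<Longrightarrow> C_class k (\<lambda>x. L (f x))"
proof (induction k arbitrary: f)
  case 0
  then show ?case
    by (auto intro: bounded_linear.continuous_on[OF L])
next
  case (Suc k)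
  show ?case
    by (rule C_class_SucI[where f' = "\<lambda>x v. L (frechet_derivative f (at x) v)"])
      (auto intro!: bounded_linear.has_derivative[OF L] C_class_SucD(1)[OF Suc.prems] Suc.IH
        C_class_SucD(2)[OF Suc.prems])
qed

lemma C_class_add: "C_class k f \<Longrightarrow> C_class k g \<Longrightarrow> C_class k (\<lambda>x. f x + g x)"
proof (induction k arbitrary: f g)
  case 0
  then show ?case by (auto intro: continuous_on_add)
next
  case (Suc k)
  show ?case
    by (rule C_class_SucI[OF has_derivative_add])
      (auto intro!: C_class_SucD(1)[OF Suc.prems(1)] C_class_SucD(1)[OF Suc.prems(2)] Suc.IH
        C_class_SucD(2)[OF Suc.prems(1)] C_class_SucD(2)[OF Suc.prems(2)])
qed

lemma C_class_sum: "(\<And>i. i \<in> I \<Longrightarrow> C_class k (f i)) \<Longrightarrow> C_class k (\<lambda>x. \<Sum>i\<in>I. f i x)"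
  by (induction I rule: infinite_finite_induct) (auto intro: C_class_add)

lemma C_class_bilinear:
  assumes B: "bounded_bilinear B"
  shows "C_class k f \<Longrightarrow> C_class k g \<Longrightarrow> C_class k (\<lambda>x. B (f x) (g x))"
proof (induction k arbitrary: f g)
  case 0
  then show ?case by (auto intro: bounded_bilinear.continuous_on[OF B])
next
  case (Suc k)
  show ?case
    by (rule C_class_SucI[OF bounded_bilinear.FDERIV[OF B]])
      (auto intro!: C_class_add C_class_SucD(1)[OF Suc.prems(1)] C_class_SucD(1)[OF Suc.prems(2)] Suc.IH
        C_class_SucD(2)[OF Suc.prems(1)] C_class_SucD(2)[OF Suc.prems(2)]
        C_class_decr[OF Suc.prems(1)] C_class_decr[OF Suc.prems(2)])
qed

lemma C_class_compose_linear:
  assumes L: "bounded_linear L"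
  shows "C_class k f \<Longrightarrow> C_class k (\<lambda>x. f (L x))"
proof (induction k arbitrary: f)
  case 0
  then show ?case
    using continuous_on_compose2[OF _ linear_continuous_on[OF L]] by fastforce
next
  case (Suc k)
  have "((\<lambda>x. f (L x)) has_derivative (\<lambda>v. frechet_derivative f (at (L x)) (L v))) (at x)" for x
    using has_derivative_compose[OF bounded_linear_imp_has_derivative[OF L] C_class_SucD(1)[OF Suc.prems]] .
  then show ?case
    by (rule C_class_SucI) (rule Suc.IH[OF C_class_SucD(2)[OF Suc.prems]])
qed

lemma C_class_linear:
  assumes L: "bounded_linear L"
  shows "C_class k L"
proof (cases k)
  case 0
  then show ?thesis by (auto intro: linear_continuous_on L)
next
  case (Suc k)
  show ?thesis
    unfolding Suc by (rule C_class_SucI[OF bounded_linear_imp_has_derivative[OF L]]) simp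
qed

lemma has_derivative_character:
  "(character z has_derivative (\<lambda>v. (2 * pi * (z \<bullet> v)) *\<^sub>R (\<i> * character z x))) (at x)"
proof -
  have "((\<lambda>x. cis (2 * pi * (z \<bullet> x))) has_derivative
      (\<lambda>v. (2 * pi * (z \<bullet> v)) *\<^sub>R (\<i> * cis (2 * pi * (z \<bullet> x))))) (at x)"
    by (rule has_derivative_cis) (auto intro!: derivative_eq_intros)
  then show ?thesis
    by (simp add: character_def[abs_def])
qed

lemma continuous_character [continuous_intros]:
  assumes "continuous_on S f" "continuous_on S g"
  shows "continuous_on S (\<lambda>x. character (f x) (g x))"
  unfolding character_def by (intro continuous_intros assms)

lemma C_class_character: "C_class k (character z)"
proof (induction k)
  case 0
  then show ?case by (auto intro!: continuous_intros)
next
  case (Suc k)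
  show ?case
    by (rule C_class_SucI[OF has_derivative_character])
      (auto intro!: C_class_bounded_linear[OF bounded_linear_scaleR_right]
        C_class_bounded_linear[OF bounded_linear_mult_right] Suc)
qed

lemma closed_support_zero: "x \<notin> closure {x. f x \<noteq> 0} \<Longrightarrow> f x = 0"
  using closure_subset[of "{x. f x \<noteq> 0}"] by auto

lemma C_infinity_compact_mono:
  assumes "C_infinity_compact f" "\<And>k. C_class k g" "\<And>x. f x = 0 \<Longrightarrow> g x = 0"
  shows "C_infinity_compact g"
proof -
  have "closure {x. g x \<noteq> 0} \<subseteq> closure {x. f x \<noteq> 0}"
    using assms(3) by (intro closure_mono) auto
  then show ?thesis
    using assms unfolding C_infinity_compact_def
    by (metis closed_closure compact_Int_closed inf.absorb_iff2)
qed

lemma C_infinity_compactI: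
  assumes "\<And>k. C_class k g" "bounded {x. g x \<noteq> 0}"
  shows "C_infinity_compact g"
  using assms by (simp add: C_infinity_compact_def compact_closure)

lemma C_infinity_compactD:
  assumes "C_infinity_compact f"
  shows "C_class k f" "cont f" "bounded {x. f x \<noteq> 0}"
proof -
  show "C_class k f" using assms by (simp add: C_infinity_compact_def)
  show "cont f" using assms C_class_continuous by (auto simp: C_infinity_compact_def)
  have "compact (closure {x. f x \<noteq> 0})" using assms by (simp add: C_infinity_compact_def)
  then show "bounded {x. f x \<noteq> 0}"
    by (rule bounded_subset[OF compact_imp_bounded closure_subset])
qed

lemma C_infinity_compact_deriv:
  assumes "C_infinity_compact f"
  shows "C_infinity_compact (\<lambda>x. frechet_derivative f (at x) v)"
proof (rule C_infinity_compactI)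
  show "C_class k (\<lambda>x. frechet_derivative f (at x) v)" for k
    using assms by (metis C_infinity_compact_def C_class_SucD(2))
  have "frechet_derivative f (at x) v = 0" if x: "x \<notin> closure {x. f x \<noteq> 0}" for x
  proof -
    have "((\<lambda>x. 0) has_derivative (\<lambda>_. 0)) (at x)"
      by auto
    then have "(f has_derivative (\<lambda>_. 0)) (at x)"
      by (rule has_derivative_transform_within_open[where s = "- closure {x. f x \<noteq> 0}"])
        (use x in \<open>auto dest!: closed_support_zero\<close>)
    then show ?thesis
      using frechet_derivative_at by metis
  qed
  then have "{x. frechet_derivative f (at x) v \<noteq> 0} \<subseteq> closure {x. f x \<noteq> 0}"
    by blast
  moreover have "compact (closure {x. f x \<noteq> 0})"
    using assms by (simp add: C_infinity_compact_def)
  ultimately show "bounded {x. frechet_derivative f (at x) v \<noteq> 0}"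
    using bounded_subset compact_imp_bounded by blast
qed

lemma C_infinity_compact_mult:
  fixes f g :: "'a::euclidean_space \<Rightarrow> 'b::real_normed_algebra"
  assumes "C_infinity_compact f" "\<And>k. C_class k g"
  shows "C_infinity_compact (\<lambda>x. g x * f x)"
proof (rule C_infinity_compact_mono[OF assms(1)])
  show "C_class k (\<lambda>x. g x * f x)" for k
    by (rule C_class_bilinear[OF bounded_bilinear_mult assms(2) C_infinity_compactD(1)[OF assms(1)]])
qed simp

lemma C_infinity_compact_add:
  assumes "C_infinity_compact f" "C_infinity_compact g"
  shows "C_infinity_compact (\<lambda>x. f x + g x)"
proof (rule C_infinity_compactI)
  have "{x. f x + g x \<noteq> 0} \<subseteq> {x. f x \<noteq> 0} \<union> {x. g x \<noteq> 0}" by auto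
  then show "bounded {x. f x + g x \<noteq> 0}"
    using C_infinity_compactD(3)[OF assms(1)] C_infinity_compactD(3)[OF assms(2)]
    by (meson bounded_Un bounded_subset)
  show "C_class k (\<lambda>x. f x + g x)" for k
    by (rule C_class_add[OF C_infinity_compactD(1)[OF assms(1)] C_infinity_compactD(1)[OF assms(2)]])
qed

lemma C_infinity_compact_scale:
  fixes f :: "'a::euclidean_space \<Rightarrow> 'b::real_normed_vector"
  assumes "C_infinity_compact f" "r \<noteq> 0"
  shows "C_infinity_compact (\<lambda>x. f (r *\<^sub>R x))"
proof (rule C_infinity_compactI)
  show "C_class k (\<lambda>x. f (r *\<^sub>R x))" for k
    by (rule C_class_compose_linear[OF bounded_linear_scaleR_right C_infinity_compactD(1)[OF assms(1)]])
  have "{x. f (r *\<^sub>R x) \<noteq> 0} \<subseteq> (\<lambda>x. (1/r) *\<^sub>R x) ` {x. f x \<noteq> 0}"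
  proof
    fix x assume "x \<in> {x. f (r *\<^sub>R x) \<noteq> 0}"
    moreover have "x = (1/r) *\<^sub>R (r *\<^sub>R x)"
      using assms(2) by simp
    ultimately show "x \<in> (\<lambda>x. (1/r) *\<^sub>R x) ` {x. f x \<noteq> 0}"
      by blast
  qed
  then show "bounded {x. f (r *\<^sub>R x) \<noteq> 0}"
    using bounded_scaling[OF C_infinity_compactD(3)[OF assms(1)]] bounded_subset by blast
qed

subsection \<open>A bump function\<close>

text \<open>The functions \<open>x\<^sup>-\<^sup>n exp (- 1 / x)\<close>, extended by \<open>0\<close>, are closed under differentiation up to linear
  combinations, so all of them are smooth.\<close>

definition flat :: "nat \<Rightarrow> real \<Rightarrow> real" where
  "flat n x = (if x \<le> 0 then 0 else (1 / x) ^ n * exp (- (1 / x)))"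

lemma flat_tendsto_0: "(flat n \<longlongrightarrow> 0) (at 0)"
proof -
  have "((\<lambda>y::real. y ^ n * exp (- y)) \<longlongrightarrow> 0) at_top"
    using tendsto_power_div_exp_0[of n] by (simp add: exp_minus field_simps)
  then have "((\<lambda>x::real. (inverse x) ^ n * exp (- (inverse x))) \<longlongrightarrow> 0) (at_right 0)"
    by (rule filterlim_compose) (rule filterlim_inverse_at_top_right)
  then have r: "(flat n \<longlongrightarrow> 0) (at_right 0)"
    by (rule Lim_transform_eventually)
      (auto simp: eventually_at_filter flat_def inverse_eq_divide)
  have l: "(flat n \<longlongrightarrow> 0) (at_left 0)"
    by (rule tendsto_eventually) (auto simp: eventually_at_filter flat_def)
  show ?thesis
    using r l by (simp add: filterlim_split_at)
qed

lemma has_derivative_flat: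
  "(flat n has_real_derivative (flat (n + 2) x - real n * flat (n + 1) x)) (at x)"
proof -
  consider "x < 0" | "x = 0" | "x > 0" by linarith
  then show ?thesis
  proof cases
    case 1
    have "((\<lambda>_. 0) has_real_derivative 0) (at x)" by simp
    then have "(flat n has_real_derivative 0) (at x)"
      by (rule has_field_derivative_transform_within_open[where S = "{..<0}"])
        (use 1 in \<open>auto simp: flat_def\<close>)
    then show ?thesis using 1 by (simp add: flat_def)
  next
    case 2
    \<comment> \<open>At 0 the difference quotient of \<open>flat n\<close> is exactly
      \<open>flat (n + 1)\<close>, because dividing by h raises the power of 1/h by one. So
      differentiability at 0 is the limit already shown.\<close>
    have "(\<lambda>h. (flat n (0 + h) - flat n 0) / h) = flat (n + 1)"
      by (auto simp: flat_def fun_eq_iff)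
    then have "(flat n has_real_derivative 0) (at 0)"
      using flat_tendsto_0[of "n+1"] unfolding DERIV_def by simp
    then show ?thesis using 2 by (simp add: flat_def)
  next
    case 3
    have eq: "(1 / x) ^ n * exp (- (1 / x)) = flat n x" if "0 < x" for x
      using that by (simp add: flat_def)
    have "((\<lambda>x. (1 / x) ^ n * exp (- (1 / x))) has_real_derivative
        (real n * (1 / x) ^ (n - 1) * (- (1 / x)\<^sup>2)) * exp (- (1 / x))
          + (1 / x) ^ n * (exp (- (1 / x)) * (1 / x)\<^sup>2)) (at x)"
      using 3 by (auto intro!: derivative_eq_intros simp: power2_eq_square)
    moreover have "(real n * (1 / x) ^ (n - 1) * (- (1 / x)\<^sup>2)) * exp (- (1 / x))
          + (1 / x) ^ n * (exp (- (1 / x)) * (1 / x)\<^sup>2) = flat (n + 2) x - real n * flat (n + 1) x"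
      using 3 by (cases n) (simp_all add: flat_def power2_eq_square algebra_simps add_divide_distrib)
    ultimately have "((\<lambda>x. (1 / x) ^ n * exp (- (1 / x))) has_real_derivative
        (flat (n + 2) x - real n * flat (n + 1) x)) (at x)"
      by metis
    then show ?thesis
      by (rule has_field_derivative_transform_within_open[where S = "{0<..}"])
        (use 3 in \<open>auto simp: eq\<close>)
  qed
qed

lemma C_class_flat: "C_class k (flat n)"
proof (induction k arbitrary: n)
  case 0
  have "isCont (flat n) x" for x
    using DERIV_isCont[OF has_derivative_flat] .
  then show ?case
    by (simp add: continuous_at_imp_continuous_on)
next
  case (Suc k)
  show ?case
  proof (rule C_class_SucI)
    show "(flat n has_derivative (\<lambda>v. v *\<^sub>R (flat (n + 2) x + (- real n) *\<^sub>R flat (n + 1) x))) (at x)" for x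
      using has_derivative_flat[of n x] unfolding has_field_derivative_def
      by (simp add: mult.commute[of _ "flat (Suc (Suc n)) x - _"])
    show "C_class k (\<lambda>x. v *\<^sub>R (flat (n + 2) x + (- real n) *\<^sub>R flat (n + 1) x))" for v
      by (intro C_class_bounded_linear[OF bounded_linear_scaleR_right] C_class_add Suc)
  qed
qed

text \<open>All orders of smoothness are assumed at once so that the induction hypothesis applies to
  the derivative of \<open>f\<close>, which is again smooth, while \<open>g\<close> stays the
  same.\<close>

lemma C_class_compose_real:
  fixes f :: "real \<Rightarrow> real" and g :: "'a::euclidean_space \<Rightarrow> real"
  assumes "\<And>k. C_class k f" and "\<And>k. C_class k g"
  shows "C_class k (\<lambda>x. f (g x))"
  using assms
proof (induction k arbitrary: f)
  case 0
  then show ?case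
    using C_class_continuous[of 0 f] C_class_continuous[of 0 g]
    by (auto intro!: continuous_on_compose2[of UNIV f])
next
  case (Suc k)
  show ?case
  proof (rule C_class_SucI)
    show "((\<lambda>x. f (g x)) has_derivative
        (\<lambda>v. frechet_derivative f (at (g x)) (frechet_derivative g (at x) v))) (at x)" for x
      by (rule has_derivative_compose[OF C_class_SucD(1) C_class_SucD(1)]) (rule Suc.prems)+
    show "C_class k (\<lambda>x. frechet_derivative f (at (g x)) (frechet_derivative g (at x) v))" for v
    proof -
      have lin: "frechet_derivative f (at y) w = w * frechet_derivative f (at y) 1" for y w
        using linear_cmul[OF has_derivative_linear[OF C_class_SucD(1)[OF Suc.prems(1)]], of y w 1]
        by simp
      have "C_class j (\<lambda>x. frechet_derivative f (at x) 1)" for j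
        by (rule C_class_SucD(2)) (rule Suc.prems)
      then have "C_class k (\<lambda>x. frechet_derivative f (at (g x)) 1)"
        by (rule Suc.IH) (rule Suc.prems)
      then have "C_class k (\<lambda>x. frechet_derivative g (at x) v * frechet_derivative f (at (g x)) 1)"
        by (intro C_class_bilinear[OF bounded_bilinear_mult] C_class_SucD(2)[OF Suc.prems(2)])
      then show ?thesis
        by (subst lin)
    qed
  qed
qed

text \<open>The witness is exp(-1 / (1 - |x|^2)) inside the unit ball, extended by 0.\<close>

lemma exists_bump:
  "\<exists>\<psi> :: real ^ 'd \<Rightarrow> complex. C_infinity_compact \<psi> \<and> \<psi> 0 \<noteq> 0"
proof -
  define g where "g = (\<lambda>x :: real ^ 'd. flat 0 (1 + (- 1) *\<^sub>R (x \<bullet> x)))"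
  have g: "C_class k g" for k
    unfolding g_def
    by (rule C_class_compose_real[OF C_class_flat C_class_add[OF C_class_const
        C_class_bounded_linear[OF bounded_linear_scaleR_right C_class_bilinear[OF bounded_bilinear_inner
        C_class_linear[OF bounded_linear_ident] C_class_linear[OF bounded_linear_ident]]]]])
  have "C_infinity_compact (\<lambda>x. complex_of_real (g x))"
  proof (rule C_infinity_compactI)
    show "C_class k (\<lambda>x. complex_of_real (g x))" for k
      by (intro C_class_bounded_linear[OF bounded_linear_of_real] g)
    have "{x. complex_of_real (g x) \<noteq> 0} \<subseteq> cball 0 1"
      by (auto simp: g_def flat_def norm_eq_sqrt_inner not_le)
    then show "bounded {x. complex_of_real (g x) \<noteq> 0}"
      using bounded_cball bounded_subset by blast
  qed
  moreover have "complex_of_real (g 0) \<noteq> 0"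
    by (simp add: g_def flat_def)
  ultimately show ?thesis by blast
qed

section \<open>Henstock--Kurzweil integrals of almost everywhere continuous functions\<close>

lemma bounded_bilinear_scaleC:
  "bounded_bilinear (scaleC :: complex \<Rightarrow> 'a::complex_banach \<Rightarrow> 'a)"
proof
  fix a b :: complex and x y :: 'a and r :: real
  show "(a + b) *\<^sub>C x = a *\<^sub>C x + b *\<^sub>C x" "a *\<^sub>C (x + y) = a *\<^sub>C x + a *\<^sub>C y"
    by (simp_all add: scaleC_add_left scaleC_add_right)
  show "(r *\<^sub>R a) *\<^sub>C x = r *\<^sub>R a *\<^sub>C x"
    by (simp add: scaleR_conv_of_real scaleC_scaleC flip: scaleC_of_real)
  show "a *\<^sub>C (r *\<^sub>R x) = r *\<^sub>R a *\<^sub>C x"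
    by (simp add: scaleC_scaleC mult.commute flip: scaleC_of_real)
  show "\<exists>K. \<forall>a (x::'a). norm (a *\<^sub>C x) \<le> norm a * norm x * K"
    by (rule exI[of _ 1]) (simp add: norm_scaleC)
qed

interpretation scaleC: bounded_bilinear "scaleC :: complex \<Rightarrow> 'a::complex_banach \<Rightarrow> 'a"
  by (rule bounded_bilinear_scaleC)

lemmas continuous_scaleC [continuous_intros] = scaleC.continuous_on scaleC.continuous

text \<open>Over any tagged division the Riemann sums of \<open>f\<close> and \<open>s\<close>
  differ by at most the Riemann sum of \<open>h\<close>, which is close to its small integral. The
  Cauchy criterion thus passes from \<open>s\<close> to \<open>f\<close>. With all tolerances equal
  to e/5, each of two divisions costs 2e/5 and the comparison for \<open>s\<close> less than
  e/5.\<close>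

lemma integrable_on_cbox_approx:
  fixes f :: "'n::euclidean_space \<Rightarrow> 'a::banach"
  assumes "\<And>e. e > 0 \<Longrightarrow> \<exists>s h. s integrable_on cbox a b \<and> h integrable_on cbox a b \<and>
    (\<forall>x\<in>cbox a b. norm (f x - s x) \<le> h x) \<and> integral (cbox a b) h \<le> e"
  shows "f integrable_on cbox a b"
  unfolding integrable_Cauchy
proof (intro allI impI)
  fix e :: real assume e: "e > 0"
  then obtain s h where sh: "s integrable_on cbox a b" "h integrable_on cbox a b"
    "\<And>x. x \<in> cbox a b \<Longrightarrow> norm (f x - s x) \<le> h x" "integral (cbox a b) h \<le> e / 5"
    using assms[of "e / 5"] by (auto simp: field_simps)
  obtain \<gamma>1 where \<gamma>1: "gauge \<gamma>1" "\<And>\<D>1 \<D>2. \<D>1 tagged_division_of (cbox a b) \<Longrightarrow> \<gamma>1 fine \<D>1 \<Longrightarrow>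
      \<D>2 tagged_division_of (cbox a b) \<Longrightarrow> \<gamma>1 fine \<D>2 \<Longrightarrow>
      norm ((\<Sum>(x,K)\<in>\<D>1. measure lborel K *\<^sub>R s x) - (\<Sum>(x,K)\<in>\<D>2. measure lborel K *\<^sub>R s x)) < e / 5"
    using sh(1)[unfolded integrable_Cauchy, rule_format, of "e/5"] e by auto
  obtain \<gamma>2 where \<gamma>2: "gauge \<gamma>2" "\<And>\<D>. \<D> tagged_division_of (cbox a b) \<Longrightarrow> \<gamma>2 fine \<D> \<Longrightarrow>
      norm ((\<Sum>(x,K)\<in>\<D>. measure lborel K *\<^sub>R h x) - integral (cbox a b) h) < e / 5"
    using integrable_integral[OF sh(2), unfolded has_integral, rule_format, of "e/5"] e by auto
  have close: "norm ((\<Sum>(x,K)\<in>\<D>. measure lborel K *\<^sub>R f x) - (\<Sum>(x,K)\<in>\<D>. measure lborel K *\<^sub>R s x)) \<le> 2 * e / 5"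
    if \<D>: "\<D> tagged_division_of (cbox a b)" "\<gamma>2 fine \<D>" for \<D>
  proof -
    have "(\<Sum>(x,K)\<in>\<D>. measure lborel K *\<^sub>R f x) - (\<Sum>(x,K)\<in>\<D>. measure lborel K *\<^sub>R s x)
        = (\<Sum>(x,K)\<in>\<D>. measure lborel K *\<^sub>R (f x - s x))"
      by (simp add: sum_subtractf[symmetric] split_def scaleR_diff_right)
    also have "norm \<dots> \<le> (\<Sum>(x,K)\<in>\<D>. measure lborel K *\<^sub>R h x)"
    proof (rule sum_norm_le, clarify)
      fix x K assume "(x, K) \<in> \<D>"
      then have "x \<in> cbox a b"
        using \<D>(1) by (meson subset_iff tagged_division_ofD(2) tagged_division_ofD(3))
      then show "norm (measure lborel K *\<^sub>R (f x - s x)) \<le> measure lborel K *\<^sub>R h x"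
        using sh(3) by (simp add: mult_left_mono)
    qed
    also have "\<dots> \<le> 2 * e / 5"
      using \<gamma>2(2)[OF \<D>] sh(4) e unfolding real_norm_def abs_less_iff by linarith
    finally show ?thesis .
  qed
  show "\<exists>\<gamma>. gauge \<gamma> \<and> (\<forall>\<D>1 \<D>2. \<D>1 tagged_division_of (cbox a b) \<and> \<gamma> fine \<D>1 \<and>
            \<D>2 tagged_division_of (cbox a b) \<and> \<gamma> fine \<D>2 \<longrightarrow>
            norm ((\<Sum>(x,K)\<in>\<D>1. measure lborel K *\<^sub>R f x) - (\<Sum>(x,K)\<in>\<D>2. measure lborel K *\<^sub>R f x)) < e)"
  proof (intro exI conjI allI impI)
    show "gauge (\<lambda>x. \<gamma>1 x \<inter> \<gamma>2 x)"
      using \<gamma>1(1) \<gamma>2(1) by (rule gauge_Int)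
    fix \<D>1 \<D>2
    assume "\<D>1 tagged_division_of (cbox a b) \<and> (\<lambda>x. \<gamma>1 x \<inter> \<gamma>2 x) fine \<D>1 \<and>
            \<D>2 tagged_division_of (cbox a b) \<and> (\<lambda>x. \<gamma>1 x \<inter> \<gamma>2 x) fine \<D>2"
    then have *: "\<D>1 tagged_division_of (cbox a b)" "\<gamma>1 fine \<D>1" "\<gamma>2 fine \<D>1"
      "\<D>2 tagged_division_of (cbox a b)" "\<gamma>1 fine \<D>2" "\<gamma>2 fine \<D>2"
      by (auto simp: fine_Int)
    show "norm ((\<Sum>(x,K)\<in>\<D>1. measure lborel K *\<^sub>R f x) - (\<Sum>(x,K)\<in>\<D>2. measure lborel K *\<^sub>R f x)) < e"
      using close[OF *(1,3)] close[OF *(4,6)] \<gamma>1(2)[OF *(1,2,4,5)] by norm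
  qed
qed

text \<open>On boxes this is the previous lemma. For large boxes the integrals of \<open>f\<close>
  follow those of \<open>s\<close>, because the integral of \<open>h\<close> over any box is at most
  its integral over the whole space.\<close>

lemma integrable_on_approx:
  fixes f :: "'n::euclidean_space \<Rightarrow> 'a::banach"
  assumes "\<And>e. e > 0 \<Longrightarrow> \<exists>s h. s integrable_on UNIV \<and> h integrable_on UNIV \<and>
    (\<forall>x. norm (f x - s x) \<le> h x) \<and> integral UNIV h \<le> e"
  shows "f integrable_on UNIV"
proof -
  have *: "\<exists>s h. s integrable_on UNIV \<and> (\<forall>a b. s integrable_on cbox a b) \<and> (\<forall>a b. h integrable_on cbox a b) \<and>
    (\<forall>x. norm (f x - s x) \<le> h x) \<and> (\<forall>a b. integral (cbox a b) h \<le> e)" if e: "e > 0" for e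
  proof -
    obtain s h where sh: "s integrable_on UNIV" "h integrable_on UNIV"
      "\<And>x. norm (f x - s x) \<le> h x" "integral UNIV h \<le> e"
      using assms[OF e] by blast
    have i: "h integrable_on cbox a b" "s integrable_on cbox a b" for a b
      using integrable_on_subcbox sh(1,2) by blast+
    have "0 \<le> h x" for x
      using sh(3)[of x] norm_ge_zero order_trans by blast
    then have "integral (cbox a b) h \<le> e" for a b
      using integral_subset_le[OF _ i(1) sh(2), of a b] sh(4) by fastforce
    then show ?thesis using sh i by blast
  qed
  have int: "f integrable_on cbox a b" for a b
  proof (rule integrable_on_cbox_approx)
    fix e :: real assume "e > 0"
    from *[OF this] obtain s h where "s integrable_on cbox a b" "h integrable_on cbox a b"
      "\<forall>x. norm (f x - s x) \<le> h x" "integral (cbox a b) h \<le> e"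
      by metis
    then show "\<exists>s h. s integrable_on cbox a b \<and> h integrable_on cbox a b \<and>
      (\<forall>x\<in>cbox a b. norm (f x - s x) \<le> h x) \<and> integral (cbox a b) h \<le> e"
      by (intro exI[of _ s] exI[of _ h]) simp
  qed
  show ?thesis
  proof (subst integrable_alt, intro conjI allI impI)
    fix a b show "(\<lambda>x. if x \<in> UNIV then f x else 0) integrable_on cbox a b" using int by simp
  next
    fix e :: real assume e: "e > 0"
    obtain s h where sh: "s integrable_on UNIV" "\<And>a b. s integrable_on cbox a b" "\<And>a b. h integrable_on cbox a b"
      "\<And>x. norm (f x - s x) \<le> h x" "\<And>a b. integral (cbox a b) h \<le> e / 4"
      using *[of "e / 4"] e by auto
    have close: "norm (integral (cbox a b) f - integral (cbox a b) s) \<le> e / 4" for a b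
    proof -
      have "integral (cbox a b) f - integral (cbox a b) s = integral (cbox a b) (\<lambda>x. f x - s x)"
        by (rule Henstock_Kurzweil_Integration.integral_diff[symmetric]) (use int sh in auto)
      also have "norm \<dots> \<le> integral (cbox a b) h"
        by (rule integral_norm_bound_integral) (use int sh in \<open>auto intro: integrable_diff\<close>)
      finally show ?thesis using sh(5)[of a b] by simp
    qed
    obtain B where B: "B > 0" "\<And>a b c d. ball 0 B \<subseteq> cbox a b \<Longrightarrow> ball 0 B \<subseteq> cbox c d \<Longrightarrow>
      norm (integral (cbox a b) s - integral (cbox c d) s) < e / 4"
      using integrable_altD(2)[OF sh(1), of "e / 4"] e by auto
    show "\<exists>B>0. \<forall>a b c d. ball 0 B \<subseteq> cbox a b \<and> ball 0 B \<subseteq> cbox c d \<longrightarrow>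
      norm (integral (cbox a b) (\<lambda>x. if x \<in> UNIV then f x else 0) -
        integral (cbox c d) (\<lambda>x. if x \<in> UNIV then f x else 0)) < e"
    proof (intro exI conjI allI impI)
      fix a b c d :: 'n assume "ball 0 B \<subseteq> cbox a b \<and> ball 0 B \<subseteq> cbox c d"
      then have "norm (integral (cbox a b) s - integral (cbox c d) s) < e / 4"
        using B by blast
      then show "norm (integral (cbox a b) (\<lambda>x. if x \<in> UNIV then f x else 0) -
        integral (cbox c d) (\<lambda>x. if x \<in> UNIV then f x else 0)) < e"
        using close[of a b] close[of c d] e by simp norm
    qed (rule B)
  qed
qed

subsection \<open>Weights\<close>

lemma nn_integral_lborel_vec:
  assumes "\<And>i. f i \<in> borel_measurable borel"
  shows "(\<integral>\<^sup>+x. (\<Prod>i\<in>UNIV. f i (x $ i)) \<partial>(lborel :: (real ^ 'd) measure)) = (\<Prod>i\<in>(UNIV :: 'd set). (\<integral>\<^sup>+x. f i x \<partial>lborel))"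
proof -
  have B: "(Basis :: (real ^ 'd) set) = (\<lambda>i. axis i 1) ` UNIV"
    by (auto simp: Basis_vec_def)
  have inj: "inj (\<lambda>i. axis i 1 :: real ^ 'd)"
    by (auto simp: inj_on_def axis_eq_axis)
  define g where "g b = f (inv (\<lambda>i. axis i 1 :: real ^ 'd) b)" for b
  have g: "g (axis i 1) = f i" for i
    by (simp add: g_def inv_f_f[OF inj])
  have "(\<integral>\<^sup>+x. (\<Prod>b\<in>Basis. g b (x \<bullet> b)) \<partial>(lborel :: (real ^ 'd) measure)) = (\<Prod>b\<in>Basis. (\<integral>\<^sup>+x. g b x \<partial>lborel))"
    by (rule nn_integral_lborel_prod) (auto simp: g_def assms)
  then show ?thesis
    by (simp add: B prod.reindex[OF inj] g inner_axis)
qed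

lemma nn_integral_powr_weight_finite:
  assumes q: "q > (1::real)"
  shows "(\<integral>\<^sup>+x. ennreal ((max 1 \<bar>x\<bar>) powr (- q)) \<partial>lborel) < \<infinity>"
proof -
  let ?g = "\<lambda>x::real. ennreal (x powr (- q)) * indicator {1..} x"
  have "((\<lambda>x::real. x powr (- q)) has_integral - (1 powr (- q + 1)) / (- q + 1)) {1..}"
    by (rule has_integral_powr_to_inf) (use q in auto)
  from nn_integral_has_integral_lebesgue'[OF _ this]
  have g: "(\<integral>\<^sup>+x. ?g x \<partial>lborel) < \<infinity>"
    by simp
  have g': "(\<integral>\<^sup>+x. ?g (- x) \<partial>lborel) < \<infinity>"
    using g nn_integral_real_affine[of ?g "-1" 0] by simp
  have "(\<integral>\<^sup>+x. ennreal ((max 1 \<bar>x\<bar>) powr (- q)) \<partial>lborel)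
      \<le> (\<integral>\<^sup>+x. ?g x + (?g (- x) + indicator {-1..1} x) \<partial>lborel)"
    by (rule nn_integral_mono) (auto simp: indicator_def max_def)
  also have "\<dots> = (\<integral>\<^sup>+x. ?g x \<partial>lborel) + ((\<integral>\<^sup>+x. ?g (- x) \<partial>lborel) + (\<integral>\<^sup>+x. indicator {-1..1::real} x \<partial>lborel))"
    by (simp add: nn_integral_add)
  also have "\<dots> < \<infinity>"
    using g g' by (simp add: ennreal_add_less_top)
  finally show ?thesis .
qed

text \<open>The common majorant of all symbols. It is integrable, its product form lets the
  coordinates be treated separately, and it changes only by a factor under bounded shifts, hence
  under rounding to a grid.\<close>

definition weight :: "real ^ 'd \<Rightarrow> real" where
  "weight x = (\<Prod>i\<in>UNIV. 1 / (1 + (x $ i)\<^sup>2))"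

text \<open>The rate that one difference in each coordinate direction can give. It is not
  integrable, but its q-th power is for every q > 1.\<close>

definition decay :: "real ^ 'd \<Rightarrow> real" where
  "decay x = (\<Prod>i\<in>UNIV. 1 / max 1 \<bar>x $ i\<bar>)"

lemma weight_pos: "0 < weight x"
  unfolding weight_def by (intro prod_pos) (auto intro!: divide_pos_pos add_pos_nonneg)

lemma weight_nonneg [simp]: "0 \<le> weight x"
  using weight_pos[of x] by simp

lemma continuous_weight: "continuous_on S weight"
  unfolding weight_def[abs_def]
  by (intro continuous_intros) (simp add: add_nonneg_eq_0_iff)

lemma weight_measurable [measurable]: "weight \<in> borel_measurable borel"
  using continuous_weight by (rule borel_measurable_continuous_onI)

lemma nn_integral_weight_finite: "(\<integral>\<^sup>+x. ennreal (weight x) \<partial>(lborel :: (real ^ 'd) measure)) < \<infinity>"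
proof -
  have le: "1 / (1 + x\<^sup>2) \<le> (max 1 \<bar>x\<bar>) powr (- 2)" for x :: real
  proof -
    have "(max 1 \<bar>x\<bar>)\<^sup>2 \<le> 1 + x\<^sup>2"
      by (simp add: max_def)
    moreover have "(max 1 \<bar>x\<bar>) powr (- 2) = 1 / (max 1 \<bar>x\<bar>)\<^sup>2"
      by (simp add: powr_minus powr_numeral inverse_eq_divide)
    ultimately show ?thesis
      by (simp add: frac_le)
  qed
  have "(\<integral>\<^sup>+x. ennreal (1 / (1 + x\<^sup>2)) \<partial>lborel) \<le> (\<integral>\<^sup>+x. ennreal ((max 1 \<bar>x\<bar>) powr (- 2)) \<partial>lborel)"
    by (intro nn_integral_mono ennreal_leI le)
  also have "\<dots> < \<infinity>"
    by (rule nn_integral_powr_weight_finite) simp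
  finally have "(\<integral>\<^sup>+x. ennreal (1 / (1 + x\<^sup>2)) \<partial>lborel) < \<infinity>" .
  moreover have "(\<integral>\<^sup>+x. ennreal (weight x) \<partial>(lborel :: (real ^ 'd) measure)) = (\<Prod>i\<in>(UNIV::'d set). \<integral>\<^sup>+x. ennreal (1 / (1 + x\<^sup>2)) \<partial>lborel)"
    using nn_integral_lborel_vec[where f = "\<lambda>_ x. ennreal (1 / (1 + x\<^sup>2))"]
    unfolding weight_def by (subst prod_ennreal[symmetric]) simp_all
  ultimately show ?thesis
    by (simp add: power_less_top_ennreal)
qed

lemma integrable_weight: "integrable lebesgue weight"
proof -
  have "integrable lborel weight"
    by (rule integrableI_nonneg) (use nn_integral_weight_finite in auto)
  then show ?thesis
    by (simp add: integrable_completion)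
qed

lemma decay_nonneg [simp]: "0 \<le> decay x"
  unfolding decay_def by (intro prod_nonneg) auto

lemma decay_measurable [measurable]: "decay \<in> borel_measurable borel"
  unfolding decay_def[abs_def] by measurable

lemma nn_integral_decay_finite:
  assumes q: "q > 1"
  shows "(\<integral>\<^sup>+x. ennreal (decay x powr q) \<partial>(lborel :: (real ^ 'd) measure)) < \<infinity>"
proof -
  have eq: "(1 / max 1 \<bar>x\<bar>) powr q = (max 1 \<bar>x\<bar>) powr (- q)" for x :: real
    by (simp add: powr_minus powr_divide inverse_eq_divide)
  have "decay x powr q = (\<Prod>i\<in>UNIV. (max 1 \<bar>x $ i\<bar>) powr (- q))" for x :: "real ^ 'd"
    unfolding decay_def prod_powr_distrib eq ..
  then have "(\<integral>\<^sup>+x. ennreal (decay x powr q) \<partial>(lborel :: (real ^ 'd) measure))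
      = (\<Prod>i\<in>(UNIV::'d set). \<integral>\<^sup>+x. ennreal ((max 1 \<bar>x\<bar>) powr (- q)) \<partial>lborel)"
    using nn_integral_lborel_vec[where f = "\<lambda>_ x. ennreal (max 1 \<bar>x\<bar> powr (- q))"]
    by (simp add: prod_ennreal[symmetric])
  then show ?thesis
    using nn_integral_powr_weight_finite[OF q] by (simp add: power_less_top_ennreal)
qed

lemma weight_shift_coord:
  assumes "\<bar>r\<bar> \<le> (1::real)"
  shows "1 / (1 + (x + r)\<^sup>2) \<le> 3 * (1 / (1 + x\<^sup>2))"
proof -
  have "r\<^sup>2 \<le> 1" using assms by (simp add: abs_square_le_1)
  \<comment> \<open>The square (x + 2r)^2 is the difference of the two sides of the next
    inequality.\<close>
  moreover have "0 \<le> (x + 2 * r)\<^sup>2" by simp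
  then have "x\<^sup>2 \<le> 2 * (x + r)\<^sup>2 + 2 * r\<^sup>2" by (simp add: power2_eq_square algebra_simps)
  ultimately have "1 + x\<^sup>2 \<le> 3 + 2 * (x + r)\<^sup>2"
    by linarith
  then have "1 + x\<^sup>2 \<le> 3 * (1 + (x + r)\<^sup>2)"
    using zero_le_power2[of "x + r"] unfolding distrib_left by linarith
  moreover have "0 < 1 + x\<^sup>2" "0 < 1 + (x + r)\<^sup>2"
    by (auto intro: add_pos_nonneg)
  ultimately show ?thesis by (simp add: field_simps)
qed

lemma weight_le_shift:
  fixes x y :: "real ^ 'd"
  assumes "\<And>i. \<bar>y $ i - x $ i\<bar> \<le> 1"
  shows "weight y \<le> 3 ^ CARD('d) * weight x"
proof -
  have "weight y \<le> (\<Prod>i\<in>UNIV. 3 * (1 / (1 + (x $ i)\<^sup>2)))"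
    unfolding weight_def
  proof (rule prod_mono)
    fix i
    show "0 \<le> 1 / (1 + (y $ i)\<^sup>2) \<and> 1 / (1 + (y $ i)\<^sup>2) \<le> 3 * (1 / (1 + (x $ i)\<^sup>2))"
      using weight_shift_coord[of "y $ i - x $ i" "x $ i", OF assms] by simp
  qed
  also have "\<dots> = 3 ^ CARD('d) * weight x"
    by (simp add: weight_def prod.distrib prod_dividef)
  finally show ?thesis .
qed

subsection \<open>Almost everywhere continuous functions\<close>

text \<open>The regularity class for integrands: it makes Riemann sums converge almost everywhere,
  is stable under the algebraic operations, and gives measurable norms whatever the target space
  is.\<close>

definition ae_cont :: "('a::euclidean_space \<Rightarrow> 'b::topological_space) \<Rightarrow> bool" where
  "ae_cont f \<longleftrightarrow> (\<exists>N. negligible N \<and> (\<forall>x. x \<notin> N \<longrightarrow> isCont f x))"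

lemma ae_contI: "negligible N \<Longrightarrow> (\<And>x. x \<notin> N \<Longrightarrow> isCont f x) \<Longrightarrow> ae_cont f"
  by (auto simp: ae_cont_def)

lemma continuous_imp_ae_cont: "cont f \<Longrightarrow> ae_cont f"
  by (rule ae_contI[of "{}"]) (auto simp: continuous_on_eq_continuous_at)

lemma ae_cont_compose:
  assumes "ae_cont f" "\<And>x. isCont f x \<Longrightarrow> isCont h x"
  shows "ae_cont h"
  using assms unfolding ae_cont_def by metis

lemma ae_cont_compose2:
  assumes "ae_cont f" "ae_cont g" "\<And>x. isCont f x \<Longrightarrow> isCont g x \<Longrightarrow> isCont h x"
  shows "ae_cont h"
proof -
  obtain M N where "negligible M" "\<And>x. x \<notin> M \<Longrightarrow> isCont f x" "negligible N" "\<And>x. x \<notin> N \<Longrightarrow> isCont g x"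
    using assms(1,2) unfolding ae_cont_def by metis
  then show ?thesis
    by (intro ae_contI[of "M \<union> N"] assms(3)) auto
qed

lemma ae_cont_measurable:
  fixes f :: "'a::euclidean_space \<Rightarrow> 'b::euclidean_space"
  assumes "ae_cont f"
  shows "f \<in> borel_measurable lebesgue"
proof -
  obtain N where N: "negligible N" "\<And>x. x \<notin> N \<Longrightarrow> isCont f x"
    using assms by (auto simp: ae_cont_def)
  have S: "- N \<in> sets lebesgue"
    using negligible_imp_sets[OF N(1)] by (simp add: Compl_in_sets_lebesgue)
  have "continuous_on (- N) f"
    using N(2) by (simp add: continuous_at_imp_continuous_on)
  then have "f \<in> borel_measurable (lebesgue_on (- N))"
    using S by (rule continuous_imp_measurable_on_sets_lebesgue)
  then have "(\<lambda>x. if x \<in> - N then f x else 0) \<in> borel_measurable lebesgue"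
    using S by (rule borel_measurable_if_I)
  moreover have "AE x in lebesgue. (if x \<in> - N then f x else 0) = f x"
    unfolding eventually_ae_filter_negligible using N(1) by (intro exI[of _ N]) auto
  ultimately show ?thesis
    by (rule borel_measurable_AE)
qed

definition wbounded :: "real \<Rightarrow> (real ^ 'd \<Rightarrow> 'b::real_normed_vector) \<Rightarrow> bool" where
  "wbounded C f \<longleftrightarrow> (\<forall>x. norm (f x) \<le> C * weight x)"

text \<open>Only the real function \<open>norm (f x)\<close> is integrated, so the target space need
  not be separable.\<close>

definition L1 :: "(real ^ 'd \<Rightarrow> 'b::real_normed_vector) \<Rightarrow> real" where
  "L1 f = (\<integral>x. norm (f x) \<partial>lebesgue)"

lemma wboundedD: "wbounded C f \<Longrightarrow> norm (f x) \<le> C * weight x"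
  by (simp add: wbounded_def)

lemma wbounded_nonneg: "wbounded C f \<Longrightarrow> 0 \<le> C"
  using weight_pos[of 0] order_trans[OF norm_ge_zero wboundedD[of C f 0]]
  by (auto simp: zero_le_mult_iff not_le[symmetric])

lemma wbounded_mono: "wbounded C f \<Longrightarrow> (\<And>x. norm (g x) \<le> norm (f x)) \<Longrightarrow> wbounded C g"
  unfolding wbounded_def by (meson order_trans)

lemma wbounded_diff: "wbounded C f \<Longrightarrow> wbounded D g \<Longrightarrow> wbounded (C + D) (\<lambda>x. f x - g x)"
  unfolding wbounded_def distrib_right by (meson add_mono norm_triangle_ineq4 order_trans)

lemma wbounded_add: "wbounded C f \<Longrightarrow> wbounded D g \<Longrightarrow> wbounded (C + D) (\<lambda>x. f x + g x)"
  unfolding wbounded_def distrib_right by (meson add_mono norm_triangle_ineq order_trans)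

lemma ae_cont_norm: "ae_cont f \<Longrightarrow> ae_cont (\<lambda>x. norm (f x))"
  by (erule ae_cont_compose) (intro continuous_intros)

lemma ae_cont_diff:
  "ae_cont f \<Longrightarrow> ae_cont g \<Longrightarrow> ae_cont (\<lambda>x. f x - g x :: 'b::real_normed_vector)"
  by (erule (1) ae_cont_compose2) (intro continuous_intros)

lemma integrable_wbounded:
  fixes f :: "real ^ 'd \<Rightarrow> 'b::euclidean_space"
  assumes "f \<in> borel_measurable lebesgue" "wbounded C f"
  shows "integrable lebesgue f"
proof (rule Bochner_Integration.integrable_bound)
  show "integrable lebesgue (\<lambda>x :: real ^ 'd. C * weight x)"
    by (simp add: integrable_weight)
  show "AE x in lebesgue. norm (f x) \<le> norm (C * weight x)"
    using wboundedD[OF assms(2)] by (simp add: order_trans[OF _ abs_ge_self])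
qed (rule assms)

lemma integrable_norm_wbounded:
  "ae_cont f \<Longrightarrow> wbounded C f \<Longrightarrow> integrable lebesgue (\<lambda>x. norm (f x))"
  by (rule integrable_wbounded[of _ C]) (auto intro: ae_cont_measurable ae_cont_norm simp: wbounded_def)

lemma L1_nonneg [simp]: "0 \<le> L1 f"
  by (simp add: L1_def)

lemma L1_mono:
  assumes "ae_cont f" "wbounded C f" "ae_cont g" "wbounded D g" "\<And>x. norm (f x) \<le> norm (g x)"
  shows "L1 f \<le> L1 g"
  unfolding L1_def using assms by (intro integral_mono integrable_norm_wbounded) auto

lemma L1_tendsto_0:
  fixes f :: "nat \<Rightarrow> real ^ 'd \<Rightarrow> 'b::real_normed_vector"
  assumes "\<And>k. ae_cont (f k)" "\<And>k. wbounded C (f k)"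
    and "negligible N" "\<And>x. x \<notin> N \<Longrightarrow> (\<lambda>k. f k x) \<longlonglongrightarrow> 0"
  shows "(\<lambda>k. L1 (f k)) \<longlonglongrightarrow> 0"
proof -
  have "(\<lambda>k. \<integral>x. norm (f k x) \<partial>lebesgue) \<longlonglongrightarrow> (\<integral>x. 0 \<partial>(lebesgue :: (real ^ 'd) measure))"
  proof (rule Bochner_Integration.integral_dominated_convergence)
    show "integrable lebesgue (\<lambda>x :: real ^ 'd. C * weight x)"
      by (simp add: integrable_weight)
    show "(\<lambda>x. norm (f k x)) \<in> borel_measurable lebesgue" for k
      using assms(1) by (intro ae_cont_measurable ae_cont_norm)
    show "AE x in lebesgue. (\<lambda>k. norm (f k x)) \<longlonglongrightarrow> 0"
      unfolding eventually_ae_filter_negligible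
      using assms(3,4) by (intro exI[of _ N]) (auto intro: tendsto_norm_zero)
    show "AE x in lebesgue. norm (norm (f k x)) \<le> C * weight x" for k
      using assms(2) by (auto simp: wbounded_def)
  qed simp
  then show ?thesis by (simp add: L1_def)
qed

subsection \<open>Rounding to a grid\<close>

text \<open>Riemann sums over \<open>t \<int>\<^sup>d\<close> are integrals of functions of \<open>gfloor t z\<close>; the convention
  \<open>gfloor 0 z = z\<close> covers the integrals they converge to.\<close>

definition gfloor :: "real \<Rightarrow> real ^ 'd \<Rightarrow> real ^ 'd" where
  "gfloor t z = (if t = 0 then z else (\<chi> i. t * of_int \<lfloor>z $ i / t\<rfloor>))"

text \<open>The null set across which \<open>gfloor t\<close> may jump.\<close>

definition grid :: "real \<Rightarrow> (real ^ 'd) set" where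
  "grid t = {z. \<exists>i. \<exists>k::int. z $ i = t * of_int k}"

lemma gfloor_0 [simp]: "gfloor 0 z = z"
  by (simp add: gfloor_def)

lemma gfloor_bounds:
  assumes "0 < t"
  shows "gfloor t z $ i \<le> z $ i" "z $ i < gfloor t z $ i + t"
proof -
  have "t * of_int \<lfloor>z $ i / t\<rfloor> \<le> t * (z $ i / t)" "t * (z $ i / t) < t * (of_int \<lfloor>z $ i / t\<rfloor> + 1)"
    using assms by (intro mult_left_mono mult_strict_left_mono; linarith)+
  then show "gfloor t z $ i \<le> z $ i" "z $ i < gfloor t z $ i + t"
    using assms by (simp_all add: gfloor_def distrib_left)
qed

lemma gfloor_close: "0 \<le> t \<Longrightarrow> \<bar>gfloor t z $ i - z $ i\<bar> \<le> t"
  using gfloor_bounds[of t z i] by (cases "t = 0") auto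

lemma gfloor_eqI:
  assumes "0 < t" "\<And>i. t * of_int (k i) \<le> z $ i" "\<And>i. z $ i < t * of_int (k i) + t"
  shows "gfloor t z = (\<chi> i. t * of_int (k i))"
proof -
  have "\<lfloor>z $ i / t\<rfloor> = k i" for i
    using assms(1) assms(2)[of i] assms(3)[of i] by (intro floor_unique) (simp_all add: field_simps)
  then show ?thesis using assms(1) by (simp add: gfloor_def)
qed

lemma gfloor_shift:
  assumes "t = 0 \<or> (\<exists>k::int. s = t * of_int k)" "0 \<le> t"
  shows "gfloor t (z + s *\<^sub>R axis i 1) = gfloor t z + s *\<^sub>R axis i 1"
proof (cases "t = 0")
  case False
  then obtain k :: int where k: "s = t * of_int k" using assms by auto
  have "\<lfloor>(z $ j + s * axis i 1 $ j) / t\<rfloor> = \<lfloor>z $ j / t\<rfloor> + (if j = i then k else 0)" for j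
    using False by (auto simp: k axis_def add_divide_distrib)
  then show ?thesis
    using False by (simp add: gfloor_def vec_eq_iff axis_def k algebra_simps)
qed simp

lemma gfloor_tendsto:
  assumes "\<And>k. 0 \<le> t k" "t \<longlonglongrightarrow> 0"
  shows "(\<lambda>k. gfloor (t k) z) \<longlonglongrightarrow> z"
proof (rule vec_tendstoI)
  fix i
  have "(\<lambda>k. gfloor (t k) z $ i - z $ i) \<longlonglongrightarrow> 0"
    by (rule Lim_null_comparison[OF _ assms(2)]) (simp add: gfloor_close[OF assms(1)])
  then show "(\<lambda>k. gfloor (t k) z $ i) \<longlonglongrightarrow> z $ i"
    by (rule LIM_zero_cancel)
qed

lemma negligible_coord: "negligible {x :: real ^ 'd. x $ i = c}"
  using negligible_standard_hyperplane[of "axis i 1 :: real ^ 'd" c]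
  by (simp add: inner_axis axis_in_Basis_iff)

lemma negligible_grid: "negligible (grid t)"
proof -
  have "grid t = \<Union> (range (\<lambda>(i, k :: int). {x. x $ i = t * of_int k}))"
    by (auto simp: grid_def)
  then show ?thesis
  proof -
    have "negligible (\<Union> (range (\<lambda>(i, k :: int). {x :: real ^ 'a. x $ i = t * of_int k})))"
      by (rule negligible_countable_Union) (auto simp: negligible_coord)
    then show ?thesis by (simp add: \<open>grid t = _\<close>)
  qed
qed

text \<open>Off the grid \<open>gfloor t\<close> is locally constant, so nothing is asked of
  \<open>g\<close>. This is why for positive mesh a multiplier may be sampled even where it is
  discontinuous.\<close>

lemma isCont_gfloor:
  assumes t: "0 < t" and z: "z \<notin> grid t"
  shows "isCont (\<lambda>x. g (gfloor t x)) z"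
proof -
  define k where "k i = \<lfloor>z $ i / t\<rfloor>" for i
  define U where "U = (\<Inter>i. {x :: real ^ 'a. t * of_int (k i) < x $ i} \<inter> {x. x $ i < t * of_int (k i) + t})"
  have gz: "gfloor t z = (\<chi> i. t * of_int (k i))"
    using t by (simp add: gfloor_def k_def)
  have "open U"
    unfolding U_def
    by (intro open_INT open_Int ballI open_Collect_less continuous_intros) auto
  moreover have "z \<in> U"
  proof -
    have "z $ i \<noteq> t * of_int (k i)" for i
      using z by (auto simp: grid_def)
    then have "t * of_int (k i) < z $ i \<and> z $ i < t * of_int (k i) + t" for i
      using gfloor_bounds[OF t, of z i] unfolding gz by (metis less_le vec_lambda_beta)
    then show ?thesis
      unfolding U_def by blast
  qed
  moreover have "gfloor t x = gfloor t z" if "x \<in> U" for x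
    unfolding gz using that by (intro gfloor_eqI t) (auto simp: U_def less_imp_le)
  ultimately have "eventually (\<lambda>x. g (gfloor t x) = g (gfloor t z)) (nhds z)"
    unfolding eventually_nhds by metis
  then have "isCont (\<lambda>x. g (gfloor t x)) z = isCont (\<lambda>x. g (gfloor t z)) z"
    by (rule isCont_cong)
  then show ?thesis by simp
qed

lemma ae_cont_gfloor: "0 \<le> t \<Longrightarrow> t = 0 \<longrightarrow> ae_cont g \<Longrightarrow> ae_cont (\<lambda>x. g (gfloor t x))"
  by (cases "t = 0") (auto intro!: ae_contI[OF negligible_grid[of t]] isCont_gfloor)

lemma wbounded_gfloor:
  fixes g :: "real ^ 'd \<Rightarrow> 'b::real_normed_vector"
  assumes "wbounded C g" "0 \<le> t" "t \<le> 1"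
  shows "wbounded (3 ^ CARD('d) * C) (\<lambda>x. g (gfloor t x))"
  unfolding wbounded_def
proof
  fix x :: "real ^ 'd"
  have "norm (g (gfloor t x)) \<le> C * weight (gfloor t x)"
    by (rule wboundedD[OF assms(1)])
  also have "\<dots> \<le> C * (3 ^ CARD('d) * weight x)"
    by (intro mult_left_mono weight_le_shift wbounded_nonneg[OF assms(1)]
        order_trans[OF gfloor_close[OF assms(2)] assms(3)])
  finally show "norm (g (gfloor t x)) \<le> 3 ^ CARD('d) * C * weight x"
    by (simp add: mult_ac)
qed

text \<open>Off the grid the rounded function is a finite sum of constants on closed cells, and the
  overlapping faces of the cells lie in the grid, which is negligible. The factor \<open>f\<close>
  is there for the averages of periodic functions; f = 1 gives Riemann sums.\<close>

lemma has_integral_gfloor_weighted: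
  fixes G :: "real ^ 'd \<Rightarrow> 'b::banach" and f :: "real ^ 'd \<Rightarrow> real"
  assumes t: "0 < t" and F: "finite F" "F \<subseteq> int_lattice" and f: "cont f"
    and G: "\<And>x. x \<notin> (\<lambda>m. t *\<^sub>R m) ` F \<Longrightarrow> G x = 0"
  shows "((\<lambda>z. f z *\<^sub>R G (gfloor t z)) has_integral
    (\<Sum>m\<in>F. integral (cbox (t *\<^sub>R m) (t *\<^sub>R m + (\<chi> i. t))) f *\<^sub>R G (t *\<^sub>R m))) UNIV"
proof -
  let ?Q = "\<lambda>m. cbox (t *\<^sub>R m) (t *\<^sub>R m + (\<chi> i. t)) :: (real ^ 'd) set"
  have "((\<lambda>z. if z \<in> ?Q m then f z *\<^sub>R G (t *\<^sub>R m) else 0) has_integral integral (?Q m) f *\<^sub>R G (t *\<^sub>R m)) UNIV" for m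
  proof -
    have "f integrable_on ?Q m"
      by (intro integrable_continuous continuous_on_subset[OF f]) simp
    then show ?thesis
      unfolding has_integral_restrict_UNIV by (intro has_integral_scaleR_left integrable_integral)
  qed
  then have int: "((\<lambda>z. \<Sum>m\<in>F. if z \<in> ?Q m then f z *\<^sub>R G (t *\<^sub>R m) else 0) has_integral
      (\<Sum>m\<in>F. integral (?Q m) f *\<^sub>R G (t *\<^sub>R m))) UNIV"
    by (intro has_integral_sum F)
  have eq: "f z *\<^sub>R G (gfloor t z) = (\<Sum>m\<in>F. if z \<in> ?Q m then f z *\<^sub>R G (t *\<^sub>R m) else 0)"
    if z: "z \<notin> grid t" for z
  proof -
    have *: "z \<in> ?Q m \<longleftrightarrow> gfloor t z = t *\<^sub>R m" if "m \<in> F" for m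
    proof -
      have "\<forall>i. \<exists>k::int. m $ i = of_int k"
        using F(2) that by (auto simp: int_lattice_def elim!: Ints_cases)
      then obtain k :: "'d \<Rightarrow> int" where k: "\<And>i. m $ i = of_int (k i)" by metis
      then have m: "t *\<^sub>R m = (\<chi> i. t * of_int (k i))"
        by (simp add: vec_eq_iff)
      show ?thesis
      proof
        assume "z \<in> ?Q m"
        then have "t * of_int (k i) \<le> z $ i" "z $ i \<le> t * of_int (k i) + t" for i
          by (auto simp: mem_box_cart k)
        moreover have "z $ i \<noteq> t * of_int (k i) + t" for i
        proof
          assume "z $ i = t * of_int (k i) + t"
          then have "z $ i = t * of_int (k i + 1)" by (simp add: algebra_simps)
          then show False using z unfolding grid_def by blast
        qed
        ultimately show "gfloor t z = t *\<^sub>R m"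
          unfolding m by (intro gfloor_eqI t) (auto simp: less_le)
      next
        assume "gfloor t z = t *\<^sub>R m"
        then show "z \<in> ?Q m"
          using gfloor_bounds[OF t, of z] by (auto simp: mem_box_cart less_imp_le)
      qed
    qed
    have "(\<Sum>m\<in>F. if z \<in> ?Q m then f z *\<^sub>R G (t *\<^sub>R m) else 0)
        = (\<Sum>m\<in>F. if m = (1/t) *\<^sub>R gfloor t z then f z *\<^sub>R G (t *\<^sub>R m) else 0)"
      by (intro sum.cong refl) (use t in \<open>auto simp: *\<close>)
    also have "\<dots> = f z *\<^sub>R G (gfloor t z)"
    proof (cases "(1/t) *\<^sub>R gfloor t z \<in> F")
      case True
      then show ?thesis using t F(1) by simp
    next
      case False
      then have "gfloor t z \<notin> (\<lambda>m. t *\<^sub>R m) ` F" using t by auto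
      then show ?thesis using False F(1) G by simp
    qed
    finally show ?thesis by simp
  qed
  show ?thesis
    by (rule has_integral_spike[OF negligible_grid[of t] _ int]) (simp add: eq)
qed

lemma has_integral_gfloor:
  fixes G :: "real ^ 'd \<Rightarrow> 'b::banach"
  assumes t: "0 < t" and F: "finite F" "F \<subseteq> int_lattice"
    and G: "\<And>x. x \<notin> (\<lambda>m. t *\<^sub>R m) ` F \<Longrightarrow> G x = 0"
  shows "((\<lambda>z. G (gfloor t z)) has_integral (\<Sum>m\<in>F. t ^ CARD('d) *\<^sub>R G (t *\<^sub>R m))) UNIV"
proof -
  have "measure lborel (cbox (t *\<^sub>R m) (t *\<^sub>R m + (\<chi> i. t))) = t ^ CARD('d)" for m :: "real ^ 'd"
  proof -
    have "cbox (t *\<^sub>R m) (t *\<^sub>R m + (\<chi> i. t)) \<noteq> {}"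
      using t by (simp add: interval_ne_empty_cart)
    then show ?thesis
      by (simp add: content_cbox_cart)
  qed
  then show ?thesis
    using has_integral_gfloor_weighted[OF t F _ G, of "\<lambda>_. 1"] by simp
qed

definition lattice_box :: "nat \<Rightarrow> (real ^ 'd) set" where
  "lattice_box N = {m \<in> int_lattice. \<forall>i. \<bar>m $ i\<bar> \<le> real N}"

lemma finite_lattice_box: "finite (lattice_box N :: (real ^ 'd) set)"
proof -
  have "lattice_box N \<subseteq> (\<lambda>k. \<chi> i. of_int (k i)) ` (PiE (UNIV::'d set) (\<lambda>_. {- int N..int N}))"
  proof
    fix m :: "real ^ 'd" assume m: "m \<in> lattice_box N"
    then have "\<forall>i. \<exists>k::int. m $ i = of_int k"
      by (auto simp: lattice_box_def int_lattice_def elim!: Ints_cases)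
    then obtain k :: "'d \<Rightarrow> int" where k: "\<And>i. m $ i = of_int (k i)" by metis
    have "k i \<in> {- int N..int N}" for i
    proof -
      have "\<bar>real_of_int (k i)\<bar> \<le> real N"
        using m unfolding lattice_box_def k[of i, symmetric] by blast
      then show ?thesis by auto
    qed
    then show "m \<in> (\<lambda>k. \<chi> i. of_int (k i)) ` (PiE (UNIV::'d set) (\<lambda>_. {- int N..int N}))"
      by (intro image_eqI[of _ _ k]) (auto simp: vec_eq_iff k)
  qed
  then show ?thesis
    by (rule finite_subset) (intro finite_imageI finite_PiE, auto)
qed

lemma lattice_box_subset: "lattice_box N \<subseteq> int_lattice"
  by (auto simp: lattice_box_def)

lemma gfloor_in_lattice: "0 < t \<Longrightarrow> \<exists>m\<in>int_lattice. gfloor t z = t *\<^sub>R m"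
  by (intro bexI[of _ "\<chi> i. of_int \<lfloor>z $ i / t\<rfloor>"]) (auto simp: gfloor_def int_lattice_def vec_eq_iff)

lemma gfloor_in_lattice_box:
  assumes "0 < t" "\<And>i. \<bar>gfloor t z $ i\<bar> \<le> t * real N"
  shows "gfloor t z \<in> (\<lambda>m. t *\<^sub>R m) ` lattice_box N"
proof -
  obtain m where m: "m \<in> int_lattice" "gfloor t z = t *\<^sub>R m"
    using gfloor_in_lattice[OF assms(1)] by blast
  then have "\<bar>m $ i\<bar> \<le> real N" for i
    using assms(2)[of i] assms(1) by (simp add: abs_mult)
  then show ?thesis using m by (auto simp: lattice_box_def)
qed

subsection \<open>Integrability and dominated convergence\<close>

text \<open>The approximants are \<open>g\<close> rounded to finer and finer grids and cut off to
  finitely many cells. They converge almost everywhere by continuity, and the real function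
  \<open>norm (h n x)\<close> is dominated by a multiple of the weight, so its integral tends to
  0.\<close>

lemma integrable_on_wbounded:
  fixes g :: "real ^ 'd \<Rightarrow> 'b::banach"
  assumes g: "ae_cont g" "wbounded C g"
  shows "g integrable_on UNIV"
proof -
  define t where "t n = 1 / (real n + 1)" for n
  \<comment> \<open>With mesh 1/(n+1), lattice points of size up to (n+1)^2 fill the box of radius
    n+1, so every point is eventually covered.\<close>
  define G where "G n x = (if x \<in> (\<lambda>m. t n *\<^sub>R m) ` lattice_box ((n + 1) ^ 2) then g x else 0)" for n x
  define h where "h n x = g x - G n (gfloor (t n) x)" for n x
  have t: "0 < t n" "t n \<le> 1" for n by (auto simp: t_def)
  have t0: "t \<longlonglongrightarrow> 0"
    unfolding t_def using LIMSEQ_inverse_real_of_nat by (simp add: inverse_eq_divide add.commute)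
  have wG: "wbounded C (G n)" for n
    by (rule wbounded_mono[OF g(2)]) (simp add: G_def)
  have h_ac: "ae_cont (h n)" for n
    unfolding h_def using t[of n] by (intro ae_cont_diff g ae_cont_gfloor) auto
  have h_wb: "wbounded (C + 3 ^ CARD('d) * C) (h n)" for n
    unfolding h_def using t[of n] by (intro wbounded_diff g wbounded_gfloor wG) auto
  obtain N where N: "negligible N" "\<And>x. x \<notin> N \<Longrightarrow> isCont g x"
    using g(1) by (auto simp: ae_cont_def)
  have "(\<lambda>n. h n x) \<longlonglongrightarrow> 0" if "x \<notin> N" for x
  proof -
    have "(\<lambda>n. g (gfloor (t n) x)) \<longlonglongrightarrow> g x"
      by (rule isCont_tendsto_compose[OF N(2)[OF that]])
        (intro gfloor_tendsto t0, use t in \<open>auto intro: less_imp_le\<close>)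
    moreover have "eventually (\<lambda>n. g (gfloor (t n) x) = G n (gfloor (t n) x)) sequentially"
      unfolding eventually_sequentially
    proof (intro exI allI impI)
      fix n assume n: "nat \<lceil>norm x + 1\<rceil> \<le> n"
      have "\<bar>gfloor (t n) x $ i\<bar> \<le> t n * real ((n + 1) ^ 2)" for i
      proof -
        have "\<bar>gfloor (t n) x $ i\<bar> \<le> \<bar>x $ i\<bar> + 1"
          using gfloor_close[of "t n" x i] t[of n] by linarith
        also have "\<dots> \<le> norm x + 1"
          using component_le_norm_cart[of x i] by simp
        also have "\<dots> \<le> real n + 1"
          using n by linarith
        also have "\<dots> = t n * real ((n + 1) ^ 2)"
          by (simp add: t_def power2_eq_square field_simps)
        finally show ?thesis .
      qed
      then have "gfloor (t n) x \<in> (\<lambda>m. t n *\<^sub>R m) ` lattice_box ((n + 1) ^ 2)"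
        by (intro gfloor_in_lattice_box t)
      then show "g (gfloor (t n) x) = G n (gfloor (t n) x)"
        by (simp add: G_def)
    qed
    ultimately have "(\<lambda>n. G n (gfloor (t n) x)) \<longlonglongrightarrow> g x"
      by (rule Lim_transform_eventually)
    then show ?thesis
      unfolding h_def using tendsto_diff[OF tendsto_const, of _ "g x" sequentially "g x"] by simp
  qed
  with h_ac h_wb N(1) have lim: "(\<lambda>n. L1 (h n)) \<longlonglongrightarrow> 0"
    by (rule L1_tendsto_0)
  show ?thesis
  proof (rule integrable_on_approx)
    fix e :: real assume "e > 0"
    then obtain n where n: "L1 (h n) < e"
      using order_tendstoD(2)[OF lim] by (meson eventually_sequentially order_refl)
    have i: "integrable lebesgue (\<lambda>x. norm (h n x))"
      using h_ac h_wb by (rule integrable_norm_wbounded)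
    show "\<exists>s h. s integrable_on UNIV \<and> h integrable_on UNIV \<and>
        (\<forall>x. norm (g x - s x) \<le> h x) \<and> integral UNIV h \<le> e"
    proof (intro exI conjI allI)
      show "(\<lambda>x. G n (gfloor (t n) x)) integrable_on UNIV"
        by (rule has_integral_integrable[OF has_integral_gfloor[OF t(1) finite_lattice_box[of "(n + 1) ^ 2"] lattice_box_subset]])
          (simp add: G_def)
      show "(\<lambda>x. norm (h n x)) integrable_on UNIV"
        using i by (rule integrable_on_lebesgue)
      show "integral UNIV (\<lambda>x. norm (h n x)) \<le> e"
        using n integral_lebesgue[OF i] by (simp add: L1_def)
    qed (simp add: h_def)
  qed
qed

lemma norm_integral_le_L1:
  fixes g :: "real ^ 'd \<Rightarrow> 'b::banach"
  assumes g: "ae_cont g" "wbounded C g"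
  shows "norm (integral UNIV g) \<le> L1 g"
proof -
  have i: "integrable lebesgue (\<lambda>x. norm (g x))"
    using g by (rule integrable_norm_wbounded)
  have "norm (integral UNIV g) \<le> integral UNIV (\<lambda>x. norm (g x))"
    using integrable_on_wbounded[OF g] integrable_on_lebesgue[OF i]
    by (rule Henstock_Kurzweil_Integration.integral_norm_bound_integral) simp
  then show ?thesis
    using integral_lebesgue[OF i] by (simp add: L1_def)
qed

lemma norm_integral_diff_le_L1:
  fixes f g :: "real ^ 'd \<Rightarrow> 'b::banach"
  assumes "ae_cont f" "wbounded C f" "ae_cont g" "wbounded D g"
  shows "norm (integral UNIV f - integral UNIV g) \<le> L1 (\<lambda>x. f x - g x)"
proof -
  have "integral UNIV f - integral UNIV g = integral UNIV (\<lambda>x. f x - g x)"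
    using assms by (intro Henstock_Kurzweil_Integration.integral_diff[symmetric] integrable_on_wbounded)
  then show ?thesis
    using assms by (auto intro!: norm_integral_le_L1 ae_cont_diff wbounded_diff)
qed

section \<open>Oscillatory integrals and their Riemann sums\<close>

lemma norm_character [simp]: "norm (character z x) = 1"
  by (simp add: character_def)

lemma character_add_left: "character (z + \<eta>) x = character z x * character \<eta> x"
  by (simp add: character_def cis_mult inner_add_left distrib_left)

lemma character_add_right: "character z (x + y) = character z x * character z y"
  by (simp add: character_def cis_mult inner_add_right distrib_left)

lemma character_0 [simp]: "character 0 x = 1" "character z 0 = 1"
  by (simp_all add: character_def)

lemma character_scaleR: "character (t *\<^sub>R z) x = character z (t *\<^sub>R x)"
  by (simp add: character_def)

lemma character_commute: "character z x = character x z"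
  by (simp add: character_def inner_commute)

lemma norm_cis_diff: "norm (cis a - cis b) \<le> \<bar>a - b\<bar>"
proof -
  have "cis a - cis b = cis b * (exp (\<i> * of_real (a - b)) - 1)"
    by (simp add: cis_conv_exp algebra_simps flip: exp_add)
  then have "norm (cis a - cis b) = 2 * \<bar>sin ((a - b) / 2)\<bar>"
    by (simp only: norm_mult norm_cis dist_exp_i_1 mult_1_left)
  then show ?thesis
    using abs_sin_x_le_abs_x[of "(a - b) / 2"] by simp
qed

lemma norm_character_diff:
  "norm (character z x - character \<eta> x) \<le> 2 * pi * (norm (z - \<eta>) * norm x)"
proof -
  have "norm (character z x - character \<eta> x) \<le> \<bar>2 * pi * ((z - \<eta>) \<bullet> x)\<bar>"
    using norm_cis_diff[of "2 * pi * (z \<bullet> x)" "2 * pi * (\<eta> \<bullet> x)"]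
    by (simp add: character_def inner_diff_left right_diff_distrib)
  also have "\<dots> \<le> 2 * pi * (norm (z - \<eta>) * norm x)"
    using Cauchy_Schwarz_ineq2[of "z - \<eta>" x] by (simp add: abs_mult)
  finally show ?thesis .
qed

section \<open>Affine changes of variables in integrals over the whole space\<close>

lemma has_integral_UNIV_affine:
  fixes f :: "'n::euclidean_space \<Rightarrow> 'a::banach"
  assumes f: "(f has_integral I) UNIV" and m: "0 < m"
  shows "((\<lambda>x. f (m *\<^sub>R x + v)) has_integral I /\<^sub>R m ^ DIM('n)) UNIV"
proof (rule iffD2[OF has_integral'], intro allI impI)
  fix e :: real assume "e > 0"
  then have "e * m ^ DIM('n) > 0" using m by simp
  then obtain B where B: "B > 0" "\<And>a b. ball 0 B \<subseteq> cbox a b \<Longrightarrow>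
      \<exists>z. ((\<lambda>x. if x \<in> UNIV then f x else 0) has_integral z) (cbox a b) \<and> norm (z - I) < e * m ^ DIM('n)"
    using iffD1[OF has_integral' f, rule_format] by metis
  show "\<exists>B>0. \<forall>a b. ball 0 B \<subseteq> cbox a b \<longrightarrow>
      (\<exists>z. ((\<lambda>x. if x \<in> UNIV then f (m *\<^sub>R x + v) else 0) has_integral z) (cbox a b) \<and> norm (z - I /\<^sub>R m ^ DIM('n)) < e)"
  \<comment> \<open>The affine map sends the ball of this radius onto a set that contains the ball
    of radius B.\<close>
  proof (rule exI[of _ "(B + norm v) / m"], intro conjI allI impI)
    show "0 < (B + norm v) / m" using B(1) m norm_ge_zero[of v] by (intro divide_pos_pos) linarith+
    fix a b :: 'n assume ab: "ball 0 ((B + norm v) / m) \<subseteq> cbox a b"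
    let ?a = "m *\<^sub>R a + v" and ?b = "m *\<^sub>R b + v"
    have "ball 0 B \<subseteq> cbox ?a ?b"
    proof
      fix x :: 'n assume "x \<in> ball 0 B"
      then have "norm ((x - v) /\<^sub>R m) < (B + norm v) / m"
      proof -
        have "norm ((x - v) /\<^sub>R m) = norm (x - v) / m"
          unfolding norm_scaleR using m by (simp add: divide_inverse mult.commute)
        then show ?thesis
          using norm_triangle_ineq4[of x v] m \<open>x \<in> ball 0 B\<close> by (auto intro!: divide_strict_right_mono)
      qed
      then have "(x - v) /\<^sub>R m \<in> cbox a b" using ab by (auto simp del: norm_scaleR)
      then show "x \<in> cbox ?a ?b"
        using m by (auto simp: mem_box inner_diff_left inner_add_left field_simps)
    qed
    then obtain z where z: "(f has_integral z) (cbox ?a ?b)" "norm (z - I) < e * m ^ DIM('n)"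
      using B(2)[of ?a ?b] by auto
    have "((\<lambda>x. f (m *\<^sub>R x + v)) has_integral z /\<^sub>R m ^ DIM('n)) (cbox a b)"
    proof -
      have "(?a - v) /\<^sub>R m = a" "(?b - v) /\<^sub>R m = b" using m by simp_all
      then show ?thesis
        using has_integral_affinity'[OF z(1) m, of v] by metis
    qed
    moreover have "norm (z /\<^sub>R m ^ DIM('n) - I /\<^sub>R m ^ DIM('n)) < e"
    proof -
      have "norm (z /\<^sub>R m ^ DIM('n) - I /\<^sub>R m ^ DIM('n)) = norm (z - I) / m ^ DIM('n)"
        unfolding scaleR_diff_right[symmetric] norm_scaleR using m by (simp add: divide_inverse mult.commute)
      then show ?thesis
        using z(2) m by (simp add: pos_divide_less_eq)
    qed
    ultimately show "\<exists>z. ((\<lambda>x. if x \<in> UNIV then f (m *\<^sub>R x + v) else 0) has_integral z) (cbox a b) \<and>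
        norm (z - I /\<^sub>R m ^ DIM('n)) < e"
      by auto
  qed
qed

lemma has_integral_UNIV_shift:
  fixes f :: "'n::euclidean_space \<Rightarrow> 'a::banach"
  assumes "(f has_integral I) UNIV"
  shows "((\<lambda>x. f (x + v)) has_integral I) UNIV"
  using has_integral_UNIV_affine[OF assms, of 1 v] by simp

lemma integral_UNIV_shift:
  fixes f :: "'n::euclidean_space \<Rightarrow> 'a::banach"
  shows "integral UNIV (\<lambda>x. f (x + v)) = integral UNIV f"
proof (cases "f integrable_on UNIV")
  case True
  then show ?thesis
    by (intro integral_unique has_integral_UNIV_shift integrable_integral)
next
  case False
  \<comment> \<open>Shifting back would make \<open>f\<close> integrable, so neither side is
    integrable and both integrals have the default value 0.\<close>
  have "\<not> (\<lambda>x. f (x + v)) integrable_on UNIV"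
  proof
    assume "(\<lambda>x. f (x + v)) integrable_on UNIV"
    from has_integral_UNIV_shift[OF integrable_integral[OF this], of "- v"] have "f integrable_on UNIV"
      by (auto simp: integrable_on_def)
    then show False using False by simp
  qed
  then show ?thesis using False by (simp add: not_integrable_integral)
qed

text \<open>For \<open>t = 0\<close> the inverse Fourier transform of \<open>g\<close> at
  \<open>y\<close>; for \<open>t > 0\<close> its Riemann sum over t Z^d, of period 1/t in each
  coordinate. One formula lets identities and bounds be proved for both at once.\<close>

definition osc :: "real \<Rightarrow> (real ^ 'd \<Rightarrow> 'y::complex_banach) \<Rightarrow> real ^ 'd \<Rightarrow> 'y" where
  "osc t g y = integral UNIV (\<lambda>z. character (gfloor t z) y *\<^sub>C g (gfloor t z))"

text \<open>For positive mesh only the grid values of \<open>g\<close> count, so continuity is asked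
  for \<open>t = 0\<close> alone. The restriction to meshes at most 1 keeps the cost of rounding in
  the weight bounded.\<close>

definition admissible :: "real \<Rightarrow> real \<Rightarrow> (real ^ 'd \<Rightarrow> 'y::real_normed_vector) \<Rightarrow> bool" where
  "admissible t C g \<longleftrightarrow> 0 \<le> t \<and> t \<le> 1 \<and> wbounded C g \<and> (t = 0 \<longrightarrow> ae_cont g)"

section \<open>Bounds, linearity and continuity of the oscillatory integrals\<close>

lemma ae_cont_character:
  assumes "ae_cont g"
  shows "ae_cont (\<lambda>z. character z y *\<^sub>C g z)"
proof (rule ae_cont_compose[OF assms])
  fix x assume "isCont g x"
  moreover have "isCont (\<lambda>z. character z y) x"
    using continuous_character[of UNIV "\<lambda>z. z" "\<lambda>_. y"] by (simp add: continuous_on_eq_continuous_at)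
  ultimately show "isCont (\<lambda>z. character z y *\<^sub>C g z) x"
    by (intro scaleC.isCont)
qed

lemma admissible_integrand:
  fixes g :: "real ^ 'd \<Rightarrow> 'y::complex_banach"
  assumes "admissible t C g"
  shows "ae_cont (\<lambda>z. character (gfloor t z) y *\<^sub>C g (gfloor t z))"
    and "wbounded (3 ^ CARD('d) * C) (\<lambda>z. character (gfloor t z) y *\<^sub>C g (gfloor t z))"
    and "(\<lambda>z. character (gfloor t z) y *\<^sub>C g (gfloor t z)) integrable_on UNIV"
    and "ae_cont (\<lambda>z. g (gfloor t z))" "wbounded (3 ^ CARD('d) * C) (\<lambda>z. g (gfloor t z))"
proof -
  have t: "0 \<le> t" "t \<le> 1" and g: "wbounded C g" "t = 0 \<Longrightarrow> ae_cont g"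
    using assms by (auto simp: admissible_def)
  show a: "ae_cont (\<lambda>z. character (gfloor t z) y *\<^sub>C g (gfloor t z))"
    by (rule ae_cont_gfloor[OF t(1), of "\<lambda>z. character z y *\<^sub>C g z"]) (use g ae_cont_character in blast)
  show w: "wbounded (3 ^ CARD('d) * C) (\<lambda>z. character (gfloor t z) y *\<^sub>C g (gfloor t z))"
    by (rule wbounded_gfloor[OF _ t, of C "\<lambda>z. character z y *\<^sub>C g z"])
      (use g in \<open>simp add: wbounded_def norm_scaleC\<close>)
  show "(\<lambda>z. character (gfloor t z) y *\<^sub>C g (gfloor t z)) integrable_on UNIV"
    using a w by (rule integrable_on_wbounded)
  show "ae_cont (\<lambda>z. g (gfloor t z))"
    using t g by (intro ae_cont_gfloor) auto
  show "wbounded (3 ^ CARD('d) * C) (\<lambda>z. g (gfloor t z))"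
    using t g by (intro wbounded_gfloor) auto
qed

lemma osc_has_integral:
  "admissible t C g \<Longrightarrow> ((\<lambda>z. character (gfloor t z) y *\<^sub>C g (gfloor t z)) has_integral osc t g y) UNIV"
  unfolding osc_def by (rule integrable_integral) (rule admissible_integrand(3))

lemma norm_osc_le:
  fixes g :: "real ^ 'd \<Rightarrow> 'y::complex_banach"
  assumes "admissible t C g"
  shows "norm (osc t g y) \<le> L1 (\<lambda>z. g (gfloor t z))"
  using norm_integral_le_L1[OF admissible_integrand(1,2)[OF assms, of y]]
  by (simp add: osc_def L1_def norm_scaleC)

lemma osc_add:
  assumes "admissible t C f" "admissible t D g"
  shows "osc t (\<lambda>z. f z + g z) y = osc t f y + osc t g y"
  using has_integral_add[OF osc_has_integral[OF assms(1), of y] osc_has_integral[OF assms(2), of y]]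
  unfolding osc_def by (simp add: scaleC_add_right[symmetric] integral_unique)

lemma osc_diff:
  assumes "admissible t C f" "admissible t D g"
  shows "osc t (\<lambda>z. f z - g z) y = osc t f y - osc t g y"
  using has_integral_diff[OF osc_has_integral[OF assms(1), of y] osc_has_integral[OF assms(2), of y]]
  unfolding osc_def by (simp add: scaleC.diff_right[symmetric] integral_unique)

lemma osc_zero [simp]: "osc t (\<lambda>z. 0) y = 0"
  by (simp add: osc_def scaleC.zero_right)

lemma osc_scaleC_right:
  fixes u :: "real ^ 'd \<Rightarrow> complex"
  assumes "admissible t C u"
  shows "osc t (\<lambda>z. u z *\<^sub>C b) y = osc t u y *\<^sub>C b"
proof -
  have "((\<lambda>z. (character (gfloor t z) y *\<^sub>C u (gfloor t z)) *\<^sub>C b) has_integral osc t u y *\<^sub>C b) UNIV"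
    using has_integral_linear[OF osc_has_integral[OF assms, of y] scaleC.bounded_linear_left[of b]]
    by (simp add: o_def)
  then show ?thesis
    unfolding osc_def[of t "\<lambda>z. u z *\<^sub>C b"]
    by (simp add: scaleC_complex_def scaleC_scaleC integral_unique)
qed

lemma osc_scaleC_left:
  assumes "admissible t C g"
  shows "osc t (\<lambda>z. c *\<^sub>C g z) y = c *\<^sub>C osc t g y"
  using has_integral_linear[OF osc_has_integral[OF assms, of y] scaleC.bounded_linear_right[of c]]
  unfolding osc_def[of t "\<lambda>z. c *\<^sub>C g z"]
  by (simp add: scaleC_scaleC integral_unique o_def mult.commute)

lemma admissible_add: "admissible t C f \<Longrightarrow> admissible t D g \<Longrightarrow> admissible t (C + D) (\<lambda>z. f z + g z)"
  by (auto simp: admissible_def intro!: wbounded_add intro: ae_cont_compose2[OF _ _ isCont_add])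

lemma admissible_diff: "admissible t C f \<Longrightarrow> admissible t D g \<Longrightarrow> admissible t (C + D) (\<lambda>z. f z - g z)"
  by (auto simp: admissible_def intro!: wbounded_diff ae_cont_diff)

lemma admissible_scaleC: "admissible t C u \<Longrightarrow> admissible t (C * norm b) (\<lambda>z. u z *\<^sub>C (b :: 'y::complex_banach))"
proof -
  assume a: "admissible t C u"
  have "norm (u x *\<^sub>C b) \<le> C * norm b * weight x" for x
    using mult_right_mono[OF wboundedD[of C u x] norm_ge_zero[of b]] a
    by (simp add: admissible_def norm_scaleC mult_ac)
  then show ?thesis
    using a by (auto simp: admissible_def wbounded_def elim!: ae_cont_compose
        intro: bounded_linear.isCont[OF scaleC.bounded_linear_left])
qed

lemma admissible_sum:
  fixes f :: "'i \<Rightarrow> real ^ 'd \<Rightarrow> 'y::complex_banach"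
  assumes "finite I" "0 \<le> t" "t \<le> 1" "\<And>i. i \<in> I \<Longrightarrow> admissible t (C i) (f i)"
  shows "admissible t (\<Sum>i\<in>I. C i) (\<lambda>z. \<Sum>i\<in>I. f i z)"
  using assms
proof (induction I)
  case empty
  then show ?case
    by (auto simp: admissible_def wbounded_def intro: continuous_imp_ae_cont)
qed (simp add: admissible_add)

lemma osc_sum:
  fixes f :: "'i \<Rightarrow> real ^ 'd \<Rightarrow> 'y::complex_banach"
  assumes "finite I" "0 \<le> t" "t \<le> 1" "\<And>i. i \<in> I \<Longrightarrow> admissible t (C i) (f i)"
  shows "osc t (\<lambda>z. \<Sum>i\<in>I. f i z) y = (\<Sum>i\<in>I. osc t (f i) y)"
  using assms
proof (induction I)
  case (insert i I)
  then show ?case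
    using osc_add[OF insert.prems(3)[of i] admissible_sum[of I t C f]] by simp
qed simp

lemma osc_finite:
  fixes g :: "real ^ 'd \<Rightarrow> 'y::complex_banach"
  assumes t: "0 < t" and F: "finite F" "F \<subseteq> int_lattice"
    and g: "\<And>x. x \<notin> (\<lambda>m. t *\<^sub>R m) ` F \<Longrightarrow> g x = 0"
  shows "osc t g y = (\<Sum>m\<in>F. t ^ CARD('d) *\<^sub>R (character (t *\<^sub>R m) y *\<^sub>C g (t *\<^sub>R m)))"
  unfolding osc_def
  by (rule integral_unique, rule has_integral_gfloor[OF t F, of "\<lambda>z. character z y *\<^sub>C g z"])
    (simp add: g scaleC.zero_right)

text \<open>Mesh, symbol and point may vary together, so that one lemma yields the convergence of
  Riemann sums, continuity in \<open>y\<close> (mesh constantly 0) and the passage from difference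
  quotients to derivatives.\<close>

lemma osc_tendsto:
  fixes g :: "real ^ 'd \<Rightarrow> 'y::complex_banach"
  assumes t: "\<And>k. 0 \<le> t k" "\<And>k. t k \<le> 1" "t \<longlonglongrightarrow> 0" and y: "Y \<longlonglongrightarrow> y"
    and g: "\<And>k. wbounded C (G k)" "wbounded C g" "ae_cont g" "\<And>k. t k = 0 \<Longrightarrow> ae_cont (G k)"
    and N: "negligible N" "\<And>z. z \<notin> N \<Longrightarrow> (\<lambda>k. G k (gfloor (t k) z)) \<longlonglongrightarrow> g z"
  shows "(\<lambda>k. osc (t k) (G k) (Y k)) \<longlonglongrightarrow> osc 0 g y"
proof -
  let ?G = "\<lambda>k z. character (gfloor (t k) z) (Y k) *\<^sub>C G k (gfloor (t k) z)"
  have aG: "admissible (t k) C (G k)" for k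
    using t g by (auto simp: admissible_def)
  have ag: "admissible 0 C g"
    using g by (auto simp: admissible_def)
  note ig = admissible_integrand(1,2)[OF ag, of y, unfolded gfloor_0]
  have "(\<lambda>k. L1 (\<lambda>z. ?G k z - character z y *\<^sub>C g z)) \<longlonglongrightarrow> 0"
  proof (rule L1_tendsto_0[OF _ _ N(1)])
    show "ae_cont (\<lambda>z. ?G k z - character z y *\<^sub>C g z)" for k
      by (intro ae_cont_diff admissible_integrand(1)[OF aG] ig)
    show "wbounded (3 ^ CARD('d) * C + 3 ^ CARD('d) * C) (\<lambda>z. ?G k z - character z y *\<^sub>C g z)" for k
      by (intro wbounded_diff admissible_integrand(2)[OF aG] ig)
    fix z assume "z \<notin> N"
    have "(\<lambda>k. gfloor (t k) z \<bullet> Y k) \<longlonglongrightarrow> z \<bullet> y"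
      by (intro tendsto_inner gfloor_tendsto t y)
    then have "(\<lambda>k. 2 * pi * (gfloor (t k) z \<bullet> Y k)) \<longlonglongrightarrow> 2 * pi * (z \<bullet> y)"
      by (intro tendsto_mult_left)
    then have "(\<lambda>k. character (gfloor (t k) z) (Y k)) \<longlonglongrightarrow> character z y"
      unfolding character_def by (rule tendsto_cis)
    then have "(\<lambda>k. ?G k z) \<longlonglongrightarrow> character z y *\<^sub>C g z"
      by (rule scaleC.tendsto) (rule N(2)[OF \<open>z \<notin> N\<close>])
    then show "(\<lambda>k. ?G k z - character z y *\<^sub>C g z) \<longlonglongrightarrow> 0"
      by (rule LIM_zero)
  qed
  moreover have le: "norm (osc (t k) (G k) (Y k) - osc 0 g y) \<le> L1 (\<lambda>z. ?G k z - character z y *\<^sub>C g z)" for k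
    unfolding osc_def gfloor_0
    by (rule norm_integral_diff_le_L1[OF admissible_integrand(1,2)[OF aG] ig])
  ultimately have "(\<lambda>k. osc (t k) (G k) (Y k) - osc 0 g y) \<longlonglongrightarrow> 0"
    by (intro Lim_null_comparison[OF always_eventually[OF allI[OF le]]])
  then show ?thesis
    by (rule LIM_zero_cancel)
qed

lemma continuous_osc_0:
  fixes g :: "real ^ 'd \<Rightarrow> 'y::complex_banach"
  assumes "ae_cont g" "wbounded C g"
  shows "cont (osc 0 g)"
  unfolding continuous_on_sequentially
proof (intro allI ballI impI)
  fix Y and y :: "real ^ 'd"
  assume "(\<forall>n. Y n \<in> UNIV) \<and> Y \<longlonglongrightarrow> y"
  then show "(osc 0 g \<circ> Y) \<longlonglongrightarrow> osc 0 g y"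
    using osc_tendsto[of "\<lambda>_. 0" Y y C "\<lambda>_. g" g "{}"] assms by (simp add: o_def)
qed

text \<open>A shift by a multiple of the mesh permutes the cells, so the substitution in the
  integral is exact and only a character value comes out. This is the discrete form of integration
  by parts.\<close>

lemma osc_gfloor_shift:
  fixes g :: "real ^ 'd \<Rightarrow> 'y::complex_banach"
  assumes s: "t = 0 \<or> (\<exists>k::int. s = t * of_int k)" "0 \<le> t" and g: "admissible t C g"
    and gs: "admissible t C' (\<lambda>z. g (z - s *\<^sub>R axis i 1))"
  shows "osc t (\<lambda>z. g z - g (z - s *\<^sub>R axis i 1)) y = (1 - cis (2 * pi * (s * y $ i))) *\<^sub>C osc t g y"
proof -
  let ?v = "s *\<^sub>R axis i 1 :: real ^ 'd"
  have v: "gfloor t (z - ?v) = gfloor t z - ?v" for z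
  proof -
    have "t = 0 \<or> (\<exists>k::int. - s = t * of_int k)"
      using s(1) by (metis mult_minus_right of_int_minus)
    from gfloor_shift[OF this s(2), of z i] show ?thesis by simp
  qed
  have c: "character ?v y = cis (2 * pi * (s * y $ i))"
    by (simp add: character_def inner_axis inner_commute[of _ y])
  have "osc t (\<lambda>z. g (z - ?v)) y
      = integral UNIV (\<lambda>z. character ?v y *\<^sub>C (character (gfloor t (z - ?v)) y *\<^sub>C g (gfloor t (z - ?v))))"
    by (simp add: osc_def v scaleC_scaleC character_add_left[symmetric])
  also have "\<dots> = integral UNIV (\<lambda>z. character ?v y *\<^sub>C (character (gfloor t z) y *\<^sub>C g (gfloor t z)))"
    using integral_UNIV_shift[of "\<lambda>z. character ?v y *\<^sub>C (character (gfloor t z) y *\<^sub>C g (gfloor t z))" "- ?v"]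
    by simp
  also have "\<dots> = character ?v y *\<^sub>C osc t g y"
    using has_integral_linear[OF osc_has_integral[OF g, of y] scaleC.bounded_linear_right[of "character ?v y"]]
    by (simp add: o_def integral_unique)
  finally show ?thesis
    using osc_diff[OF g gs, of y] by (simp add: c scaleC.diff_left scaleC_one)
qed

text \<open>A product of commuting backward difference operators, one for each pair of direction and
  step. On the transform side every pair (i, s) becomes a factor 1 - exp(2 pi i s y_i).\<close>

primrec mdiff :: "('d \<times> real) list \<Rightarrow> (real ^ 'd \<Rightarrow> 'a::real_normed_vector) \<Rightarrow> real ^ 'd \<Rightarrow> 'a" where
  "mdiff [] g z = g z"
| "mdiff (p # xs) g z = mdiff xs g z - mdiff xs g (z - snd p *\<^sub>R axis (fst p) 1)"

lemma wbounded_shift: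
  fixes g :: "real ^ 'd \<Rightarrow> 'a::real_normed_vector"
  assumes "wbounded C g" "0 \<le> s" "s \<le> 1"
  shows "wbounded (3 ^ CARD('d) * C) (\<lambda>z. g (z - s *\<^sub>R axis i 1))"
  unfolding wbounded_def
proof
  fix x :: "real ^ 'd"
  have "norm (g (x - s *\<^sub>R axis i 1)) \<le> C * weight (x - s *\<^sub>R axis i 1)"
    by (rule wboundedD[OF assms(1)])
  also have "\<dots> \<le> C * (3 ^ CARD('d) * weight x)"
    by (intro mult_left_mono weight_le_shift wbounded_nonneg[OF assms(1)]) (use assms in \<open>auto simp: axis_def\<close>)
  finally show "norm (g (x - s *\<^sub>R axis i 1)) \<le> 3 ^ CARD('d) * C * weight x"
    by (simp add: mult_ac)
qed

lemma continuous_mdiff: "cont g \<Longrightarrow> cont (mdiff xs g)"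
proof (induction xs)
  case (Cons p xs)
  have "cont (\<lambda>z. mdiff xs g (z - snd p *\<^sub>R axis (fst p) 1))"
    by (rule continuous_on_compose2[OF Cons.IH[OF Cons.prems]]) (auto intro!: continuous_on_diff)
  then show ?case
    using Cons by (simp add: continuous_on_diff)
qed simp

lemma admissible_mdiff:
  fixes g :: "real ^ 'd \<Rightarrow> 'y::complex_banach"
  assumes "cont g" "admissible t C g" "\<forall>p\<in>set xs. 0 \<le> snd p \<and> snd p \<le> 1"
  shows "\<exists>D. admissible t D (mdiff xs g)"
  using assms(3)
proof (induction xs)
  case Nil
  have "mdiff [] g = g" by (simp add: fun_eq_iff)
  then show ?case using assms(2) by auto
next
  case (Cons p xs)
  then obtain D where D: "admissible t D (mdiff xs g)" by auto
  have "ae_cont (mdiff (p # xs) g)"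
    by (intro continuous_imp_ae_cont continuous_mdiff assms)
  moreover have "wbounded (D + 3 ^ CARD('d) * D) (mdiff (p # xs) g)"
  proof -
    have "wbounded (D + 3 ^ CARD('d) * D) (\<lambda>z. mdiff xs g z - mdiff xs g (z - snd p *\<^sub>R axis (fst p) 1))"
      using D Cons.prems by (intro wbounded_diff wbounded_shift) (auto simp: admissible_def)
    then show ?thesis by (simp add: wbounded_def)
  qed
  ultimately have "admissible t (D + 3 ^ CARD('d) * D) (mdiff (p # xs) g)"
    using D by (simp add: admissible_def del: mdiff.simps)
  then show ?case ..
qed

lemma osc_mdiff:
  fixes g :: "real ^ 'd \<Rightarrow> 'y::complex_banach"
  assumes g: "cont g" "admissible t C g"
    and xs: "\<forall>p\<in>set xs. 0 \<le> snd p \<and> snd p \<le> 1 \<and> (t = 0 \<or> (\<exists>k::int. snd p = t * of_int k))"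
  shows "osc t (mdiff xs g) y = (\<Prod>p\<leftarrow>xs. 1 - cis (2 * pi * (snd p * y $ fst p))) *\<^sub>C osc t g y"
  using xs
proof (induction xs)
  case Nil
  have "mdiff [] g = g" by (simp add: fun_eq_iff)
  then show ?case by (simp add: scaleC_one)
next
  case (Cons p xs)
  obtain D where D: "admissible t D (mdiff xs g)"
    using admissible_mdiff[OF g, of xs] Cons.prems by auto
  have c: "cont (\<lambda>z. mdiff xs g (z - snd p *\<^sub>R axis (fst p) 1))"
    by (rule continuous_on_compose2[OF continuous_mdiff[OF g(1)]]) (auto intro!: continuous_on_diff)
  have D': "admissible t (3 ^ CARD('d) * D) (\<lambda>z. mdiff xs g (z - snd p *\<^sub>R axis (fst p) 1))"
    using D Cons.prems continuous_imp_ae_cont[OF c] by (auto simp: admissible_def intro!: wbounded_shift)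
  have "mdiff (p # xs) g = (\<lambda>z. mdiff xs g z - mdiff xs g (z - snd p *\<^sub>R axis (fst p) 1))"
    by (simp add: fun_eq_iff)
  then have "osc t (mdiff (p # xs) g) y = (1 - cis (2 * pi * (snd p * y $ fst p))) *\<^sub>C osc t (mdiff xs g) y"
    using osc_gfloor_shift[OF _ _ D D', of y] Cons.prems g by (simp add: admissible_def)
  then show ?case
    using Cons by (simp add: scaleC_scaleC del: mdiff.simps)
qed

section \<open>Fourier transforms of test functions\<close>

lemma norm_diff_le_vector_derivative:
  fixes \<gamma> :: "real \<Rightarrow> 'b::real_normed_vector"
  assumes "\<And>r. (\<gamma> has_vector_derivative \<gamma>' r) (at r)" "0 \<le> s" "\<And>r. 0 \<le> r \<Longrightarrow> r \<le> s \<Longrightarrow> norm (\<gamma>' r) \<le> B"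
  shows "norm (\<gamma> 0 - \<gamma> s) \<le> s * B"
proof -
  have "norm (\<gamma> 0 - \<gamma> s) \<le> B * norm (0 - s)"
  proof (rule differentiable_bound[of "{0..s}" \<gamma> "\<lambda>r v. v *\<^sub>R \<gamma>' r"])
    show "(\<gamma> has_derivative (\<lambda>v. v *\<^sub>R \<gamma>' r)) (at r within {0..s})" for r
      using assms(1)[of r] unfolding has_vector_derivative_def by (rule has_derivative_at_withinI)
    show "onorm (\<lambda>v. v *\<^sub>R \<gamma>' r) \<le> B" if "r \<in> {0..s}" for r
      using assms(3)[of r] that onorm_scaleR_left[OF bounded_linear_ident, of "\<gamma>' r"]
      by (simp add: onorm_id)
  qed (use assms in auto)
  then show ?thesis using assms(2) by (simp add: mult.commute)
qed

lemma vector_derivative_sequence: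
  fixes \<gamma> :: "real \<Rightarrow> 'b::real_normed_vector"
  assumes "(\<gamma> has_vector_derivative D) (at 0)" "s \<longlonglongrightarrow> 0" "\<And>k. s k \<noteq> 0"
  shows "(\<lambda>k. (1 / s k) *\<^sub>R (\<gamma> (s k) - \<gamma> 0)) \<longlonglongrightarrow> D"
proof -
  have "((\<lambda>h. norm (\<gamma> (0 + h) - \<gamma> 0 - h *\<^sub>R D) / norm h) \<longlongrightarrow> 0) (at 0)"
    using assms(1) unfolding has_vector_derivative_def has_derivative_at by blast
  moreover have "filterlim s (at 0) sequentially"
    using assms(2,3) by (simp add: filterlim_at)
  ultimately have "(\<lambda>k. norm (\<gamma> (0 + s k) - \<gamma> 0 - s k *\<^sub>R D) / norm (s k)) \<longlonglongrightarrow> 0"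
    by (rule filterlim_compose)
  moreover have "norm (\<gamma> (0 + s k) - \<gamma> 0 - s k *\<^sub>R D) / norm (s k)
      = norm ((1 / s k) *\<^sub>R (\<gamma> (s k) - \<gamma> 0) - D)" for k
  proof -
    have "norm ((1 / s k) *\<^sub>R (\<gamma> (s k) - \<gamma> 0 - s k *\<^sub>R D)) = norm (\<gamma> (0 + s k) - \<gamma> 0 - s k *\<^sub>R D) / norm (s k)"
      unfolding norm_scaleR by simp
    then show ?thesis using assms(3)[of k] by (simp add: scaleR_diff_right)
  qed
  ultimately have "(\<lambda>k. norm ((1 / s k) *\<^sub>R (\<gamma> (s k) - \<gamma> 0) - D)) \<longlonglongrightarrow> 0"
    by simp
  then show ?thesis
    by (rule LIM_zero_cancel[OF tendsto_norm_zero_cancel])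
qed

lemma wbounded_mono_const: "wbounded C f \<Longrightarrow> C \<le> D \<Longrightarrow> wbounded D f"
  unfolding wbounded_def by (meson mult_right_mono order_trans weight_nonneg)

lemma wbounded_compact_support:
  fixes f :: "real ^ 'd \<Rightarrow> 'b::real_normed_vector"
  assumes "cont f" "bounded {x. f x \<noteq> 0}"
  shows "\<exists>C. wbounded C f"
proof -
  let ?K = "closure {x. f x \<noteq> 0}"
  have "compact ?K" using assms(2) by (simp add: compact_closure)
  moreover have "continuous_on ?K (\<lambda>x. norm (f x) / weight x)"
    by (intro continuous_intros continuous_weight continuous_on_subset[OF assms(1)])
      (auto simp: less_imp_neq[OF weight_pos, symmetric])
  ultimately have "bounded ((\<lambda>x. norm (f x) / weight x) ` ?K)"
    by (intro compact_imp_bounded compact_continuous_image)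
  then obtain C where C: "\<And>x. x \<in> ?K \<Longrightarrow> norm (norm (f x) / weight x) \<le> C" "0 < C"
    unfolding bounded_pos by auto
  have "norm (f x) \<le> C * weight x" for x
  proof (cases "x \<in> ?K")
    case True
    have "norm (f x) / weight x \<le> C"
      using C(1)[OF True] unfolding real_norm_def by linarith
    then show ?thesis
      using weight_pos[of x] by (simp add: pos_divide_le_eq)
  next
    case False
    then show ?thesis using closed_support_zero[of x f] C(2) by simp
  qed
  then show ?thesis by (auto simp: wbounded_def)
qed

lemma test_admissible:
  fixes f :: "real ^ 'd \<Rightarrow> 'b::real_normed_vector"
  assumes "C_infinity_compact f"
  shows "\<exists>C. admissible 0 C f"
  using wbounded_compact_support[OF C_infinity_compactD(2,3)[OF assms]]
    continuous_imp_ae_cont[OF C_infinity_compactD(2)[OF assms]]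
  by (auto simp: admissible_def)

text \<open>Integration by parts through the shift rule: the difference quotient with step s has
  transform (1 - exp(2 pi i s y_i)) / s times that of the test function. Both sides pass to the
  limit s = 0; the difference quotients are dominated through the mean value bound.\<close>

lemma osc_deriv:
  fixes \<psi> :: "real ^ 'd \<Rightarrow> complex"
  assumes \<psi>: "C_infinity_compact \<psi>"
  shows "osc 0 (\<lambda>x. frechet_derivative \<psi> (at x) (axis i 1)) y = (- 2 * pi * \<i> * y $ i) * osc 0 \<psi> y"
proof -
  let ?e = "axis i 1 :: real ^ 'd"
  define d where "d x = frechet_derivative \<psi> (at x) ?e" for x
  define s where "s k = 1 / (real k + 1)" for k :: nat
  have s: "0 < s k" "s k \<le> 1" for k by (auto simp: s_def)
  have s0: "s \<longlonglongrightarrow> 0"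
    unfolding s_def using LIMSEQ_inverse_real_of_nat by (simp add: inverse_eq_divide add.commute)
  define h where "h k x = complex_of_real (1 / s k) *\<^sub>C (\<psi> x - \<psi> (x - s k *\<^sub>R ?e))" for k x
  have \<gamma>: "((\<lambda>r. \<psi> (x - r *\<^sub>R ?e)) has_vector_derivative - d (x - r *\<^sub>R ?e)) (at r)" for x r
  proof -
    have A: "(\<psi> has_derivative frechet_derivative \<psi> (at (x - r *\<^sub>R ?e))) (at (x - r *\<^sub>R ?e))"
      by (rule C_class_SucD(1)[OF C_infinity_compactD(1)[OF \<psi>]])
    have B: "((\<lambda>r. x - r *\<^sub>R ?e) has_derivative (\<lambda>v. - (v *\<^sub>R ?e))) (at r)"
      by (auto intro!: derivative_eq_intros)
    have "((\<lambda>r. \<psi> (x - r *\<^sub>R ?e)) has_derivative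
        (\<lambda>v. frechet_derivative \<psi> (at (x - r *\<^sub>R ?e)) (- (v *\<^sub>R ?e)))) (at r)"
      by (rule has_derivative_compose[OF B A])
    moreover have "linear (frechet_derivative \<psi> (at (x - r *\<^sub>R ?e)))"
      by (rule has_derivative_linear[OF C_class_SucD(1)[OF C_infinity_compactD(1)[OF \<psi>]]])
    ultimately show ?thesis
      by (simp add: has_vector_derivative_def d_def linear_neg linear_cmul)
  qed
  have d: "C_infinity_compact d"
    unfolding d_def using \<psi> by (rule C_infinity_compact_deriv)
  obtain C where C: "admissible 0 C d" using test_admissible[OF d] by blast
  obtain C1 where C1: "admissible 0 C1 \<psi>" using test_admissible[OF \<psi>] by blast
  have c\<psi>: "cont (\<lambda>x. \<psi> (x - v))" for v
    by (rule continuous_on_compose2[OF C_infinity_compactD(2)[OF \<psi>]]) (auto intro!: continuous_on_diff)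
  have h_bound: "wbounded (3 ^ CARD('d) * C) (h k)" for k
    unfolding wbounded_def
  proof
    fix x
    have "norm (\<psi> (x - 0 *\<^sub>R ?e) - \<psi> (x - s k *\<^sub>R ?e)) \<le> s k * (3 ^ CARD('d) * C * weight x)"
    proof (rule norm_diff_le_vector_derivative[OF \<gamma>])
      fix r :: real assume "0 \<le> r" "r \<le> s k"
      then have "wbounded (3 ^ CARD('d) * C) (\<lambda>x. d (x - r *\<^sub>R ?e))"
        using C s[of k] by (intro wbounded_shift) (auto simp: admissible_def)
      then show "norm (- d (x - r *\<^sub>R ?e)) \<le> 3 ^ CARD('d) * C * weight x"
        by (simp add: wbounded_def)
    qed (use s less_imp_le in blast)
    then show "norm (h k x) \<le> 3 ^ CARD('d) * C * weight x"
      using s[of k] unfolding h_def norm_scaleC norm_of_real by (simp add: field_simps)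
  qed
  have "(\<lambda>k. osc 0 (h k) y) \<longlonglongrightarrow> osc 0 d y"
  proof (rule osc_tendsto[where t = "\<lambda>_. 0" and N = "{}" and C = "3 ^ CARD('d) * C"])
    show "wbounded (3 ^ CARD('d) * C) d"
      using C wbounded_nonneg[of C d] mult_right_mono[OF one_le_power[of "3::real" "CARD('d)"], of C]
      by (auto simp: admissible_def elim!: wbounded_mono_const)
    show "ae_cont d" using C by (simp add: admissible_def)
    show "ae_cont (h k)" for k
      unfolding h_def using c\<psi>[of 0] c\<psi>
      by (intro continuous_imp_ae_cont continuous_intros) auto
    fix x
    have "(\<lambda>k. (1 / s k) *\<^sub>R (\<psi> (x - s k *\<^sub>R ?e) - \<psi> (x - 0 *\<^sub>R ?e))) \<longlonglongrightarrow> - d (x - 0 *\<^sub>R ?e)"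
      using \<gamma>[of x 0] s0 s by (intro vector_derivative_sequence) (auto simp: less_imp_neq[symmetric])
    from tendsto_minus[OF this] show "(\<lambda>k. h k (gfloor 0 x)) \<longlonglongrightarrow> d x"
      unfolding h_def scaleC_of_real by (simp add: scaleR_diff_right)
  qed (use h_bound in auto)
  moreover have "osc 0 (h k) y = ((1 / s k) *\<^sub>R (1 - cis (2 * pi * (s k * y $ i)))) * osc 0 \<psi> y" for k
  proof -
    have ad': "admissible 0 (3 ^ CARD('d) * C1) (\<lambda>x. \<psi> (x - s k *\<^sub>R ?e))"
      using C1 s[of k] continuous_imp_ae_cont[OF c\<psi>] by (auto simp: admissible_def intro!: wbounded_shift)
    have "osc 0 (h k) y = complex_of_real (1 / s k) *\<^sub>C osc 0 (\<lambda>x. \<psi> x - \<psi> (x - s k *\<^sub>R ?e)) y"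
      unfolding h_def by (rule osc_scaleC_left[OF admissible_diff[OF C1 ad']])
    also have "\<dots> = complex_of_real (1 / s k) *\<^sub>C (1 - cis (2 * pi * (s k * y $ i))) *\<^sub>C osc 0 \<psi> y"
      by (subst osc_gfloor_shift[OF _ _ C1 ad']) auto
    finally show ?thesis
      by (simp add: scaleC_complex_def scaleR_conv_of_real)
  qed
  moreover have "(\<lambda>k. ((1 / s k) *\<^sub>R (1 - cis (2 * pi * (s k * y $ i)))) * osc 0 \<psi> y)
      \<longlonglongrightarrow> (- 2 * pi * \<i> * y $ i) * osc 0 \<psi> y"
  proof (rule tendsto_mult_right)
    have "((\<lambda>r. 1 - cis (2 * pi * (r * y $ i))) has_vector_derivative (- 2 * pi * \<i> * y $ i)) (at 0)"
      unfolding has_vector_derivative_def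
      by (auto intro!: derivative_eq_intros simp: scaleR_conv_of_real algebra_simps)
    from vector_derivative_sequence[OF this s0] s
    show "(\<lambda>k. (1 / s k) *\<^sub>R (1 - cis (2 * pi * (s k * y $ i)))) \<longlonglongrightarrow> (- 2 * pi * \<i> * y $ i)"
      by (auto simp: less_imp_neq[symmetric])
  qed
  ultimately show ?thesis
    unfolding d_def using LIMSEQ_unique by fastforce
qed

text \<open>The operator 1 - D_i^2 / (4 pi^2), with D_i the partial derivative, multiplies the
  transform by 1 + y_i^2. Applying it once for each coordinate produces the reciprocal of the
  weight.\<close>

lemma osc_test_weighted:
  fixes \<psi> :: "real ^ 'd \<Rightarrow> complex"
  assumes "finite A" "C_infinity_compact \<psi>"
  shows "\<exists>\<theta>. C_infinity_compact \<theta> \<and> (\<forall>y. osc 0 \<theta> y = of_real (\<Prod>i\<in>A. 1 + (y $ i)\<^sup>2) * osc 0 \<psi> y)"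
  using assms
proof (induction A)
  case empty
  then show ?case by auto
next
  case (insert i A)
  then obtain \<theta> where \<theta>: "C_infinity_compact \<theta>" "\<And>y. osc 0 \<theta> y = of_real (\<Prod>i\<in>A. 1 + (y $ i)\<^sup>2) * osc 0 \<psi> y"
    by blast
  let ?d = "\<lambda>f x. frechet_derivative f (at x) (axis i 1)"
  let ?c = "complex_of_real (- 1 / (4 * pi\<^sup>2))"
  have d: "C_infinity_compact (?d \<theta>)" "C_infinity_compact (?d (?d \<theta>))"
    using \<theta>(1) by (intro C_infinity_compact_deriv; assumption)+
  have cd: "C_infinity_compact (\<lambda>x. ?c * ?d (?d \<theta>) x)"
    by (intro C_infinity_compact_mult d) simp
  obtain C D where ad: "admissible 0 C \<theta>" "admissible 0 D (?d (?d \<theta>))"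
    using test_admissible d(2) \<theta>(1) by metis
  obtain E where cad: "admissible 0 E (\<lambda>x. ?c * ?d (?d \<theta>) x)"
    using test_admissible[OF cd] by blast
  have "osc 0 (\<lambda>x. \<theta> x + ?c * ?d (?d \<theta>) x) y = of_real (\<Prod>i\<in>insert i A. 1 + (y $ i)\<^sup>2) * osc 0 \<psi> y" for y
  proof -
    have "osc 0 (\<lambda>x. \<theta> x + ?c * ?d (?d \<theta>) x) y = osc 0 \<theta> y + ?c * osc 0 (?d (?d \<theta>)) y"
      using osc_add[OF ad(1) cad, of y] osc_scaleC_left[OF ad(2), of ?c y]
      by (simp add: scaleC_complex_def)
    also have "osc 0 (?d (?d \<theta>)) y = (- 2 * pi * \<i> * y $ i) * ((- 2 * pi * \<i> * y $ i) * osc 0 \<theta> y)"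
      unfolding osc_deriv[OF d(1)] osc_deriv[OF \<theta>(1)] ..
    also have "osc 0 \<theta> y + ?c * \<dots> = of_real (1 + (y $ i)\<^sup>2) * osc 0 \<theta> y"
      by (simp add: power2_eq_square field_simps)
    also have "\<dots> = of_real (\<Prod>i\<in>insert i A. 1 + (y $ i)\<^sup>2) * osc 0 \<psi> y"
      using insert.hyps by (simp add: \<theta>(2))
    finally show ?thesis .
  qed
  moreover have "C_infinity_compact (\<lambda>x. \<theta> x + ?c * ?d (?d \<theta>) x)"
    by (intro C_infinity_compact_add \<theta> cd)
  ultimately show ?case by blast
qed

lemma wbounded_osc_test:
  fixes \<psi> :: "real ^ 'd \<Rightarrow> complex"
  assumes "C_infinity_compact \<psi>"
  shows "\<exists>C. wbounded C (osc 0 \<psi>)"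
proof -
  obtain \<theta> where \<theta>: "C_infinity_compact \<theta>"
    "\<And>y. osc 0 \<theta> y = of_real (\<Prod>i\<in>UNIV. 1 + (y $ i)\<^sup>2) * osc 0 \<psi> y"
    using osc_test_weighted[OF finite_class.finite_UNIV assms] by blast
  obtain C where C: "admissible 0 C \<theta>" using test_admissible[OF \<theta>(1)] by blast
  have "norm (osc 0 \<psi> y) \<le> L1 \<theta> * weight y" for y
  proof -
    have p: "0 < (\<Prod>i\<in>UNIV. 1 + (y $ i)\<^sup>2)"
      by (intro prod_pos) (simp add: add_pos_nonneg)
    have "(\<Prod>i\<in>UNIV. 1 + (y $ i)\<^sup>2) * norm (osc 0 \<psi> y) = norm (osc 0 \<theta> y)"
      using p by (simp only: \<theta>(2) norm_mult norm_of_real abs_of_pos)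
    also have "\<dots> \<le> L1 \<theta>"
      using norm_osc_le[OF C, of y] by simp
    finally show ?thesis
      using p by (simp add: weight_def prod_dividef field_simps)
  qed
  then show ?thesis by (auto simp: wbounded_def)
qed

text \<open>Differentiation under the integral sign, over a box that contains the support.\<close>

lemma osc_has_vector_derivative:
  fixes \<psi> :: "real ^ 'd \<Rightarrow> complex"
  assumes \<psi>: "C_infinity_compact \<psi>"
  shows "((\<lambda>r. osc 0 \<psi> (y - r *\<^sub>R axis i 1)) has_vector_derivative
    - osc 0 (\<lambda>w. (2 * pi * \<i> * w $ i) * \<psi> w) (y - r *\<^sub>R axis i 1)) (at r)"
proof -
  let ?e = "axis i 1 :: real ^ 'd"
  obtain a b where ab: "{x. \<psi> x \<noteq> 0} \<subseteq> cbox a b"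
    using bounded_subset_cbox_symmetric[OF C_infinity_compactD(3)[OF \<psi>]] by metis
  have osc: "osc 0 (\<lambda>w. c w * \<psi> w) z = integral (cbox a b) (\<lambda>w. character w z * (c w * \<psi> w))" for c z
  proof -
    have "(\<lambda>w. character (gfloor 0 w) z *\<^sub>C (c (gfloor 0 w) * \<psi> (gfloor 0 w)))
        = (\<lambda>w. if w \<in> cbox a b then character w z * (c w * \<psi> w) else 0)"
      using ab by (auto simp: fun_eq_iff scaleC_complex_def)
    then show ?thesis
      unfolding osc_def by (simp only: integral_restrict_UNIV)
  qed
  have c\<psi>: "continuous_on S \<psi>" for S
    using C_infinity_compactD(2)[OF \<psi>] continuous_on_subset by blast
  have "((\<lambda>r. integral (cbox a b) (\<lambda>w. character w (y - r *\<^sub>R ?e) * (1 * \<psi> w))) has_vector_derivative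
     integral (cbox a b) (\<lambda>w. - (character w (y - r *\<^sub>R ?e) * (2 * pi * \<i> * w $ i * \<psi> w)))) (at r within UNIV)"
  proof (rule leibniz_rule_vector_derivative)
    fix r w
    have "((\<lambda>r. cis (2 * pi * (w \<bullet> (y - r *\<^sub>R ?e)))) has_derivative
       (\<lambda>v. (- (2 * pi * (v * w $ i))) *\<^sub>R (\<i> * cis (2 * pi * (w \<bullet> (y - r *\<^sub>R ?e)))))) (at r)"
      by (rule has_derivative_cis)
        (auto intro!: derivative_eq_intros simp: inner_diff_right inner_axis algebra_simps)
    from has_derivative_mult_left[OF this, of "1 * \<psi> w"]
    show "((\<lambda>r. character w (y - r *\<^sub>R ?e) * (1 * \<psi> w)) has_vector_derivative
        - (character w (y - r *\<^sub>R ?e) * (2 * pi * \<i> * w $ i * \<psi> w))) (at r within UNIV)"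
      unfolding has_vector_derivative_def character_def
      by (simp add: scaleR_conv_of_real mult_ac)
  next
    show "(\<lambda>w. character w (y - r *\<^sub>R ?e) * (1 * \<psi> w)) integrable_on cbox a b" for r
      by (intro integrable_continuous continuous_intros c\<psi>)
    show "continuous_on (UNIV \<times> cbox a b)
        (\<lambda>(r, w). - (character w (y - r *\<^sub>R ?e) * (2 * pi * \<i> * w $ i * \<psi> w)))"
      unfolding split_def
      by (intro continuous_intros continuous_on_compose2[OF c\<psi>[of UNIV]]) auto
  qed auto
  then show ?thesis
    using osc[of "\<lambda>_. 1"] osc[of "\<lambda>w. 2 * pi * \<i> * w $ i"]
    by (simp add: Henstock_Kurzweil_Integration.integral_neg)
qed

lemma mdiff_has_vector_derivative:
  assumes "\<And>y r. ((\<lambda>r. h (y - r *\<^sub>R axis i 1)) has_vector_derivative h' (y - r *\<^sub>R axis i 1)) (at r)"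
  shows "((\<lambda>r. mdiff xs h (y - r *\<^sub>R axis i 1)) has_vector_derivative mdiff xs h' (y - r *\<^sub>R axis i 1)) (at r)"
proof (induction xs arbitrary: y)
  case Nil
  then show ?case using assms by simp
next
  case (Cons p xs)
  have "y - r *\<^sub>R axis i 1 - snd p *\<^sub>R axis (fst p) 1 = y - snd p *\<^sub>R axis (fst p) 1 - r *\<^sub>R axis i 1" for r
    by simp
  then show ?case
    using has_vector_derivative_diff[OF Cons[of y] Cons[of "y - snd p *\<^sub>R axis (fst p) 1"]]
    by (simp only: mdiff.simps)
qed

lemma mdiff_uminus: "mdiff xs (\<lambda>x. - h x) y = - mdiff xs h y"
  by (induction xs arbitrary: y) auto

text \<open>A Lipschitz condition for all mixed first order differences, relative to the weight. The
  directions are distinct because piecewise linear cut-offs must preserve the condition, and these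
  gain only one factor of the step in each direction.\<close>

definition mixed_lip :: "real \<Rightarrow> (real ^ 'd \<Rightarrow> complex) \<Rightarrow> bool" where
  "mixed_lip C h \<longleftrightarrow> (\<forall>xs. distinct (map fst xs) \<and> (\<forall>p\<in>set xs. 0 \<le> snd p \<and> snd p \<le> 1) \<longrightarrow>
    wbounded (C * prod_list (map snd xs)) (mdiff xs h))"

text \<open>A difference with step s is at most s times the supremum of the derivative along the
  segment, and the derivative of a transform is the transform of the test function times 2 pi i z_i,
  again a test function. Hence the induction over directions with the test function arbitrary; the
  remaining differences commute with the derivative.\<close>

lemma mdiff_osc_test_bound:
  fixes \<psi> :: "real ^ 'd \<Rightarrow> complex"
  assumes "C_infinity_compact \<psi>"
  shows "\<exists>C\<ge>0. \<forall>xs. map fst xs = is \<and> (\<forall>p\<in>set xs. 0 \<le> snd p \<and> snd p \<le> 1) \<longrightarrow>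
    wbounded (C * prod_list (map snd xs)) (mdiff xs (osc 0 \<psi>))"
  using assms
proof (induction "is" arbitrary: \<psi>)
  case Nil
  then obtain C where "wbounded C (osc 0 \<psi>)" using wbounded_osc_test by blast
  moreover have "mdiff [] (osc 0 \<psi>) = osc 0 \<psi>" by (simp add: fun_eq_iff)
  ultimately show ?case using wbounded_nonneg[of C "osc 0 \<psi>"] by auto
next
  case (Cons i "is")
  let ?\<theta> = "\<lambda>z :: real ^ 'd. (2 * pi * \<i> * z $ i) * \<psi> z"
  have lin: "bounded_linear (\<lambda>z :: real ^ 'd. 2 * pi * \<i> * complex_of_real (z $ i))"
    by (intro bounded_linear_mult_right[THEN bounded_linear_compose] bounded_linear_of_real[THEN bounded_linear_compose]
        bounded_linear_vec_nth)
  have "C_infinity_compact ?\<theta>"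
    using C_infinity_compact_mult[OF Cons.prems C_class_linear[OF lin]] .
  from Cons.IH[OF this] obtain C where C: "C \<ge> 0" "\<And>xs. map fst xs = is \<Longrightarrow> \<forall>p\<in>set xs. 0 \<le> snd p \<and> snd p \<le> 1 \<Longrightarrow>
      wbounded (C * prod_list (map snd xs)) (mdiff xs (osc 0 ?\<theta>))"
    by blast
  show ?case
  proof (intro exI[of _ "3 ^ CARD('d) * C"] conjI allI impI)
    fix ys :: "('d \<times> real) list" assume ys: "map fst ys = i # is \<and> (\<forall>p\<in>set ys. 0 \<le> snd p \<and> snd p \<le> 1)"
    then obtain s xs where ysx: "ys = (i, s) # xs" "map fst xs = is" by (cases ys) auto
    show "wbounded (3 ^ CARD('d) * C * prod_list (map snd ys)) (mdiff ys (osc 0 \<psi>))"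
      unfolding wbounded_def
    proof
      fix y
      let ?P = "C * prod_list (map snd xs)"
      have w: "wbounded ?P (mdiff xs (osc 0 ?\<theta>))"
        using C(2)[OF ysx(2)] ys ysx(1) by simp
      have "norm (mdiff xs (osc 0 \<psi>) (y - 0 *\<^sub>R axis i 1) - mdiff xs (osc 0 \<psi>) (y - s *\<^sub>R axis i 1))
          \<le> s * (3 ^ CARD('d) * ?P * weight y)"
      proof (rule norm_diff_le_vector_derivative[OF mdiff_has_vector_derivative[OF osc_has_vector_derivative[OF Cons.prems]]])
        fix r :: real assume "0 \<le> r" "r \<le> s"
        then have "wbounded (3 ^ CARD('d) * ?P) (\<lambda>y. mdiff xs (osc 0 ?\<theta>) (y - r *\<^sub>R axis i 1))"
          using ys ysx(1) by (intro wbounded_shift w) auto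
        then show "norm (mdiff xs (\<lambda>y. - osc 0 ?\<theta> y) (y - r *\<^sub>R axis i 1)) \<le> 3 ^ CARD('d) * ?P * weight y"
          by (simp add: mdiff_uminus wbounded_def)
      qed (use ys ysx(1) in auto)
      then show "norm (mdiff ys (osc 0 \<psi>) y) \<le> 3 ^ CARD('d) * C * prod_list (map snd ys) * weight y"
        by (simp add: ysx(1) mult_ac)
    qed
  qed (use C in auto)
qed

text \<open>The constant above depends on the list of directions; there are finitely many lists
  without repetition, so the sum of the constants serves for all of them.\<close>

lemma mixed_lip_osc_test:
  fixes \<psi> :: "real ^ 'd \<Rightarrow> complex"
  assumes "C_infinity_compact \<psi>"
  shows "\<exists>C. mixed_lip C (osc 0 \<psi>)"
proof -
  obtain C :: "'d list \<Rightarrow> real" where C: "\<And>is. C is \<ge> 0" "\<And>xs. \<forall>p\<in>set xs. 0 \<le> snd p \<and> snd p \<le> 1 \<Longrightarrow>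
      wbounded (C (map fst xs) * prod_list (map snd xs)) (mdiff xs (osc 0 \<psi>))"
    using mdiff_osc_test_bound[OF assms] by metis
  have fin: "finite {is :: 'd list. distinct is}"
    using finite_subset_distinct[OF finite_class.finite_UNIV] by simp
  have "mixed_lip (\<Sum>is | distinct is. C is) (osc 0 \<psi>)"
    unfolding mixed_lip_def
  proof (intro allI impI)
    fix xs :: "('d \<times> real) list" assume xs: "distinct (map fst xs) \<and> (\<forall>p\<in>set xs. 0 \<le> snd p \<and> snd p \<le> 1)"
    have "C (map fst xs) \<le> (\<Sum>is | distinct is. C is)"
      using xs fin C(1) by (intro member_le_sum) auto
    moreover have "0 \<le> prod_list (map snd xs)"
      using xs by (intro prod_list_nonneg) auto
    ultimately have "C (map fst xs) * prod_list (map snd xs) * weight y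
        \<le> (\<Sum>is | distinct is. C is) * prod_list (map snd xs) * weight y" for y :: "real ^ 'd"
      by (intro mult_right_mono) auto
    then show "wbounded ((\<Sum>is | distinct is. C is) * prod_list (map snd xs)) (mdiff xs (osc 0 \<psi>))"
      using C(2)[of xs] xs unfolding wbounded_def by (meson order_trans)
  qed
  then show ?thesis ..
qed

section \<open>From the inverse transform to the Fourier transform\<close>

lemma fourier_transform_eq_osc: "fourier_transform f z = osc 0 f (- z)"
  unfolding fourier_transform_def osc_def by (simp add: character_commute[of "- z"])

lemma mixed_lip_cnj: "mixed_lip C h \<Longrightarrow> mixed_lip C (\<lambda>x. cnj (h x))"
proof -
  have "mdiff xs (\<lambda>x. cnj (h x)) y = cnj (mdiff xs h y)" for xs y
    by (induction xs arbitrary: y) auto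
  then show "mixed_lip C h \<Longrightarrow> mixed_lip C (\<lambda>x. cnj (h x))"
    by (simp add: mixed_lip_def wbounded_def)
qed

text \<open>Conjugation, rather than reflection, carries the bounds for \<open>osc 0\<close> over to
  the Fourier transform: it commutes with differences without reversing their direction.\<close>

lemma fourier_transform_cnj:
  fixes \<psi> :: "real ^ 'd \<Rightarrow> complex"
  assumes "C_infinity_compact \<psi>"
  shows "fourier_transform \<psi> z = cnj (osc 0 (\<lambda>x. cnj (\<psi> x)) z)"
proof -
  have "C_infinity_compact (\<lambda>x. cnj (\<psi> x))"
    using C_infinity_compact_mono[OF assms, of "\<lambda>x. cnj (\<psi> x)"]
      C_class_bounded_linear[OF bounded_linear_cnj C_infinity_compactD(1)[OF assms]] by simp
  then obtain C where C: "admissible 0 C (\<lambda>x. cnj (\<psi> x))"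
    using test_admissible by blast
  have "cnj (character x z) = character x (- z)" for x
    by (simp add: character_def cis_cnj)
  then show ?thesis
    using has_integral_linear[OF osc_has_integral[OF C, of z] bounded_linear_cnj]
    unfolding fourier_transform_eq_osc osc_def[of 0 \<psi>] by (simp add: o_def scaleC_complex_def integral_unique)
qed

lemma mixed_lip_fourier_transform:
  fixes \<psi> :: "real ^ 'd \<Rightarrow> complex"
  assumes "C_infinity_compact \<psi>"
  shows "\<exists>C. mixed_lip C (fourier_transform \<psi>)"
proof -
  have "C_infinity_compact (\<lambda>x. cnj (\<psi> x))"
    using C_infinity_compact_mono[OF assms, of "\<lambda>x. cnj (\<psi> x)"]
      C_class_bounded_linear[OF bounded_linear_cnj C_infinity_compactD(1)[OF assms]] by simp
  then obtain C where "mixed_lip C (osc 0 (\<lambda>x. cnj (\<psi> x)))"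
    using mixed_lip_osc_test by blast
  then show ?thesis
    using mixed_lip_cnj fourier_transform_cnj[OF assms] by (metis (no_types, lifting) ext)
qed

lemma mixed_lip_wbounded: "mixed_lip C h \<Longrightarrow> wbounded C h"
proof -
  have "mdiff [] h = h" by (simp add: fun_eq_iff)
  then show "mixed_lip C h \<Longrightarrow> wbounded C h"
    unfolding mixed_lip_def by (metis distinct.simps(1) empty_iff list.map(1) list.set(1) mult.right_neutral prod_list.Nil)
qed

lemma continuous_fourier_transform:
  fixes \<psi> :: "real ^ 'd \<Rightarrow> 'x::complex_banach"
  assumes "C_infinity_compact \<psi>"
  shows "cont (fourier_transform \<psi>)"
proof -
  obtain C where "admissible 0 C \<psi>" using test_admissible[OF assms] by blast
  then have "cont (osc 0 \<psi>)"
    by (intro continuous_osc_0) (auto simp: admissible_def)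
  then have "cont (\<lambda>z. osc 0 \<psi> (- z))"
    by (rule continuous_on_compose2) (auto intro: continuous_intros)
  then show ?thesis
    by (simp add: fourier_transform_eq_osc[abs_def])
qed

section \<open>Fourier series and Fourier inversion\<close>

lemma integral_lborel_prod_vec:
  fixes f :: "'d::finite \<Rightarrow> real \<Rightarrow> complex"
  assumes f: "\<And>i. integrable lborel (f i)"
  shows "(\<integral>x. (\<Prod>i\<in>UNIV. f i (x $ i)) \<partial>(lborel :: (real ^ 'd) measure)) = (\<Prod>i\<in>UNIV. \<integral>x. f i x \<partial>lborel)"
    and "integrable (lborel :: (real ^ 'd) measure) (\<lambda>x. \<Prod>i\<in>UNIV. f i (x $ i))"
proof -
  interpret product_sigma_finite "\<lambda>_ :: real ^ 'd. lborel :: real measure" by standard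
  have B: "(Basis :: (real ^ 'd) set) = (\<lambda>i. axis i 1) ` UNIV"
    by (auto simp: Basis_vec_def)
  have inj: "inj (\<lambda>i. axis i 1 :: real ^ 'd)"
    by (auto simp: inj_on_def axis_eq_axis)
  define g where "g b = f (inv (\<lambda>i. axis i 1 :: real ^ 'd) b)" for b
  have g: "g (axis i 1) = f i" for i
    by (simp add: g_def inv_f_f[OF inj])
  have int: "integrable lborel (g b)" for b by (simp add: g_def f)
  have m: "g b \<in> borel_measurable borel" for b
    using borel_measurable_integrable[OF int[of b]] by simp
  have coord: "(\<Sum>b\<in>Basis. x b *\<^sub>R b) \<bullet> c = x c" if "c \<in> Basis" for c and x :: "real ^ 'd \<Rightarrow> real"
    using that by (simp add: inner_sum_left inner_Basis if_distrib[of "(*) _"] cong: if_cong)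
  have prod: "(\<Prod>i\<in>UNIV. f i (x $ i)) = (\<Prod>b\<in>Basis. g b (x \<bullet> b))" for x :: "real ^ 'd"
    by (simp add: B prod.reindex[OF inj] g inner_axis)
  have meas: "(\<lambda>x. \<Prod>b\<in>Basis. g b (x \<bullet> b)) \<in> borel_measurable (borel :: (real ^ 'd) measure)"
    using m by measurable
  have "(\<integral>x. (\<Prod>i\<in>UNIV. f i (x $ i)) \<partial>(lborel :: (real ^ 'd) measure))
      = (\<integral>x. (\<Prod>b\<in>Basis. g b (x b)) \<partial>(\<Pi>\<^sub>M b\<in>(Basis :: (real ^ 'd) set). lborel))"
    unfolding prod by (subst lborel_eq, subst integral_distr) (use meas in \<open>auto simp: coord\<close>)
  also have "\<dots> = (\<Prod>b\<in>(Basis :: (real ^ 'd) set). \<integral>x. g b x \<partial>lborel)"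
    by (rule product_integral_prod) (auto simp: int)
  also have "\<dots> = (\<Prod>i\<in>UNIV. \<integral>x. f i x \<partial>lborel)"
    by (simp add: B prod.reindex[OF inj] g)
  finally show "(\<integral>x. (\<Prod>i\<in>UNIV. f i (x $ i)) \<partial>(lborel :: (real ^ 'd) measure)) = (\<Prod>i\<in>UNIV. \<integral>x. f i x \<partial>lborel)" .
  have "integrable (\<Pi>\<^sub>M b\<in>(Basis :: (real ^ 'd) set). lborel) (\<lambda>x. \<Prod>b\<in>Basis. g b (x b))"
    by (rule product_integrable_prod) (auto simp: int)
  then show "integrable (lborel :: (real ^ 'd) measure) (\<lambda>x. \<Prod>i\<in>UNIV. f i (x $ i))"
    unfolding prod by (subst lborel_eq, subst integrable_distr_eq) (use meas in \<open>auto simp: coord\<close>)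
qed

lemma integral_cis_period:
  fixes L :: real
  assumes "0 < L"
  shows "integral {a..a + L} (\<lambda>x. cis (2 * pi * (of_int n / L * x))) = (if n = 0 then complex_of_real L else 0)"
proof (cases "n = 0")
  case True
  have "cis (2 * pi * (of_int n / L * x)) = 1" for x
    using True by simp
  then show ?thesis using True assms by (simp add: scaleR_conv_of_real less_imp_le)
next
  case False
  let ?c = "2 * pi * (of_int n / L)"
  have c: "?c \<noteq> 0" using False assms by simp
  have "((\<lambda>x. cis (2 * pi * (of_int n / L * x))) has_integral
      (cis (?c * (a + L)) / (\<i> * of_real ?c) - cis (?c * a) / (\<i> * of_real ?c))) {a..a + L}"
  proof (rule fundamental_theorem_of_calculus)
    fix x
    have "((\<lambda>x. cis (?c * x)) has_derivative (\<lambda>v. (v * ?c) *\<^sub>R (\<i> * cis (?c * x)))) (at x within {a..a + L})"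
      by (rule has_derivative_cis) (use assms in \<open>auto intro!: derivative_eq_intros\<close>)
    from has_derivative_mult_left[OF this, of "1 / (\<i> * of_real ?c)"]
    have "((\<lambda>x. cis (?c * x) * (1 / (\<i> * of_real ?c))) has_derivative
      (\<lambda>v. (v * ?c) *\<^sub>R (\<i> * cis (?c * x)) * (1 / (\<i> * of_real ?c)))) (at x within {a..a + L})" .
    moreover have "(\<lambda>v. (v * ?c) *\<^sub>R (\<i> * cis (?c * x)) * (1 / (\<i> * of_real ?c))) = (\<lambda>v. v *\<^sub>R cis (2 * pi * (of_int n / L * x)))"
    proof -
      have "(v * c) *\<^sub>R (\<i> * z) * (1 / (\<i> * of_real c)) = v *\<^sub>R z" if "c \<noteq> 0" for v c :: real and z
      proof -
        have "\<i> * (complex_of_real v * (\<i> * z)) = (\<i> * \<i>) * (complex_of_real v * z)"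
          by (simp only: mult_ac)
        then show ?thesis using that by (simp add: scaleR_conv_of_real)
      qed
      then show ?thesis using c by (simp only: mult.assoc not_False_eq_True)
    qed
    ultimately show "((\<lambda>x. cis (?c * x) / (\<i> * of_real ?c)) has_vector_derivative
        cis (2 * pi * (of_int n / L * x))) (at x within {a..a + L})"
      by (simp add: has_vector_derivative_def)
  qed (use assms in simp)
  moreover have "cis (?c * (a + L)) = cis (?c * a)"
  proof -
    have "?c * (a + L) = ?c * a + 2 * pi * of_int n"
      using assms by (simp add: distrib_left)
    moreover have "cis (2 * pi * of_int n) = 1"
      by (rule cis_multiple_2pi) simp
    ultimately show ?thesis by (simp add: cis_mult[symmetric])
  qed
  ultimately show ?thesis using False by (simp add: integral_unique)
qed

text \<open>Fubini's theorem reduces it to one coordinate, where a non-zero frequency is integrated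
  over whole periods.\<close>

lemma integral_character_cube:
  fixes a k :: "real ^ 'd"
  assumes L: "0 < L" and k: "k \<in> int_lattice"
  shows "integral (cbox a (a + (\<chi> i. L))) (character ((1 / L) *\<^sub>R k)) = (if k = 0 then of_real (L ^ CARD('d)) else 0)"
proof -
  have "\<forall>i. \<exists>n::int. k $ i = of_int n"
    using k by (auto simp: int_lattice_def elim!: Ints_cases)
  then obtain n :: "'d \<Rightarrow> int" where n: "\<And>i. k $ i = of_int (n i)" by metis
  define f where "f i x = indicator {a $ i..a $ i + L} x *\<^sub>R cis (2 * pi * (of_int (n i) / L * x))" for i x
  have c: "continuous_on {a $ i..a $ i + L} (\<lambda>x. cis (2 * pi * (of_int (n i) / L * x)))" for i
    by (intro continuous_intros)
  have si: "set_integrable lborel {a $ i..a $ i + L} (\<lambda>x. cis (2 * pi * (of_int (n i) / L * x)))" for i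
    by (rule borel_integrable_atLeastAtMost') (rule c)
  then have f: "integrable lborel (f i)" for i
    unfolding f_def set_integrable_def .
  have fi: "(\<integral>x. f i x \<partial>lborel) = (if n i = 0 then of_real L else 0)" for i
    using set_borel_integral_eq_integral(2)[OF si[of i]] integral_cis_period[OF L, of "a $ i" "n i"]
    by (simp add: f_def set_lebesgue_integral_def)
  have ind: "(\<Prod>i\<in>UNIV. f i (x $ i)) = indicator (cbox a (a + (\<chi> i. L))) x *\<^sub>R character ((1 / L) *\<^sub>R k) x" for x
  proof -
    have "(\<Prod>i\<in>UNIV. f i (x $ i)) = (\<Prod>i\<in>UNIV. complex_of_real (indicator {a $ i..a $ i + L} (x $ i))) * (\<Prod>i\<in>UNIV. cis (2 * pi * (of_int (n i) / L * x $ i)))"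
      by (simp add: f_def prod.distrib scaleR_conv_of_real)
    also have "(\<Prod>i\<in>UNIV. complex_of_real (indicator {a $ i..a $ i + L} (x $ i))) = of_real (indicator (cbox a (a + (\<chi> i. L))) x)"
    proof (cases "x \<in> cbox a (a + (\<chi> i. L))")
      case True
      then show ?thesis by (auto simp: mem_box_cart intro!: prod.neutral)
    next
      case False
      then obtain i where "x $ i \<notin> {a $ i..a $ i + L}" by (auto simp: mem_box_cart)
      then show ?thesis using False by (auto intro!: exI[of _ i])
    qed
    also have "(\<Prod>i\<in>UNIV. cis (2 * pi * (of_int (n i) / L * x $ i))) = character ((1 / L) *\<^sub>R k) x"
    proof -
      have "(\<Prod>i\<in>A. cis (g i)) = cis (\<Sum>i\<in>A. g i)" if "finite A" for A and g :: "'d \<Rightarrow> real"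
        using that by induction (auto simp: cis_mult)
      then show ?thesis
        by (simp add: character_def inner_vec_def n sum_distrib_left)
    qed
    finally show ?thesis by (simp add: scaleR_conv_of_real)
  qed
  have int: "integrable lborel (\<lambda>x. indicator (cbox a (a + (\<chi> i. L))) x *\<^sub>R character ((1 / L) *\<^sub>R k) x)"
    using integral_lborel_prod_vec(2)[of f, OF f] by (simp add: ind)
  have "integral (cbox a (a + (\<chi> i. L))) (character ((1 / L) *\<^sub>R k))
      = (\<integral>x. indicator (cbox a (a + (\<chi> i. L))) x *\<^sub>R character ((1 / L) *\<^sub>R k) x \<partial>lborel)"
    using set_borel_integral_eq_integral(2)[of "cbox a (a + (\<chi> i. L))" "character ((1 / L) *\<^sub>R k)"] int
    by (simp add: set_integrable_def set_lebesgue_integral_def)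
  also have "\<dots> = (\<Prod>i\<in>UNIV. \<integral>x. f i x \<partial>lborel)"
    using integral_lborel_prod_vec(1)[of f, OF f] by (simp add: ind)
  also have "\<dots> = (if k = 0 then of_real (L ^ CARD('d)) else 0)"
  proof (cases "k = 0")
    case True
    then have "n i = 0" for i using n[of i] by simp
    then show ?thesis using True by (simp add: fi)
  next
    case False
    then obtain i where "n i \<noteq> 0" using n by (auto simp: vec_eq_iff)
    then show ?thesis using False by (auto simp: fi)
  qed
  finally show ?thesis .
qed

text \<open>The kernel q^N with q the product of (1 + cos(2 pi (y_i - x0_i) / L)) / 2 is a
  trigonometric polynomial that concentrates at \<open>x0\<close>, so a continuous function
  orthogonal to all of them vanishes there. The point is interior because on the boundary the kernel
  would peak at the opposite faces as well; no periodicity of \<open>D\<close> is assumed.\<close>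

lemma fourier_uniqueness_cube:
  fixes D :: "real ^ 'd \<Rightarrow> complex" and L :: real
  defines "Q \<equiv> cbox (\<chi> i. - (L / 2)) (\<chi> i. L / 2) :: (real ^ 'd) set"
  assumes L: "0 < L" and D: "continuous_on Q D"
    and zero: "\<And>n. n \<in> int_lattice \<Longrightarrow> integral Q (\<lambda>y. D y * character ((1 / L) *\<^sub>R n) y) = 0"
    and x0: "\<And>i. \<bar>x0 $ i\<bar> < L / 2"
  shows "D x0 = 0"
proof (rule ccontr)
  assume nz: "D x0 \<noteq> 0"
  define qi where "qi i y = (1 + cos (2 * pi * ((y $ i - x0 $ i) / L))) / 2" for i :: 'd and y :: "real ^ 'd"
  define q where "q y = (\<Prod>i\<in>UNIV. qi i y)" for y
  \<comment> \<open>The functions whose product with \<open>D\<close> still has vanishing Fourier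
    coefficients. The class is shown to be closed under multiplication by each \<open>qi\<close>,
    hence to contain all powers of \<open>q\<close>.\<close>
  define Z where "Z g \<longleftrightarrow> continuous_on Q g \<and>
    (\<forall>n\<in>int_lattice. integral Q (\<lambda>y. D y * of_real (g y) * character ((1 / L) *\<^sub>R n) y) = 0)" for g :: "real ^ 'd \<Rightarrow> real"
  have cq: "continuous_on S (qi i)" for S i
    unfolding qi_def by (intro continuous_intros) (use L in auto)
  have Z_qi: "Z (\<lambda>y. g y * qi i y)" if g: "Z g" for g i
    unfolding Z_def
  proof (intro conjI ballI)
    show "continuous_on Q (\<lambda>y. g y * qi i y)"
      using g by (intro continuous_intros cq) (simp add: Z_def)
    fix n :: "real ^ 'd" assume n: "n \<in> int_lattice"
    let ?e = "axis i 1 :: real ^ 'd" and ?w = "2 * pi * (x0 $ i / L)"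
    let ?I = "\<lambda>n y. D y * of_real (g y) * character ((1 / L) *\<^sub>R n) y"
    have lat: "n + ?e \<in> int_lattice" "n - ?e \<in> int_lattice"
      using n by (auto simp: int_lattice_def axis_def)
    have hi: "(?I m has_integral 0) Q" if "m \<in> int_lattice" for m
    proof -
      have "?I m integrable_on Q"
        unfolding Q_def using g D
        by (intro integrable_continuous continuous_intros) (auto simp: Z_def Q_def)
      then show ?thesis using g that by (simp add: Z_def has_integral_iff)
    qed
    \<comment> \<open>Since \<open>qi\<close> is 1/2 plus a quarter of two conjugate exponentials,
      multiplication by it only mixes the frequencies n, n + e_i and n - e_i.\<close>
    have "((\<lambda>y. ?I n y * (1 / 2) + ?I (n + ?e) y * (cis (- ?w) / 4) + ?I (n - ?e) y * (cis ?w / 4)) has_integral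
        0 * (1 / 2) + 0 * (cis (- ?w) / 4) + 0 * (cis ?w / 4)) Q"
      by (intro has_integral_add has_integral_mult_left hi n lat)
    moreover have "?I n y * (1 / 2) + ?I (n + ?e) y * (cis (- ?w) / 4) + ?I (n - ?e) y * (cis ?w / 4)
      = D y * of_real (g y * qi i y) * character ((1 / L) *\<^sub>R n) y" for y
    proof -
      let ?u = "2 * pi * (y $ i / L)"
      have ch: "character ((1 / L) *\<^sub>R (n + ?e)) y = character ((1 / L) *\<^sub>R n) y * cis ?u"
        "character ((1 / L) *\<^sub>R (n - ?e)) y = character ((1 / L) *\<^sub>R n) y * cis (- ?u)"
        by (simp_all add: character_def inner_add_left inner_diff_left inner_axis inner_commute[of _ y] cis_mult
            add_divide_distrib diff_divide_distrib algebra_simps)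
      have "cis z + cis (- z) = 2 * of_real (cos z)" for z
        by (simp add: complex_eq_iff)
      then have "cis (?u - ?w) + cis (- (?u - ?w)) = 2 * of_real (cos (?u - ?w))" .
      moreover have "?u - ?w = 2 * pi * ((y $ i - x0 $ i) / L)"
        by (simp add: diff_divide_distrib right_diff_distrib)
      ultimately have "cis ?u * cis (- ?w) + cis (- ?u) * cis ?w = 4 * of_real (qi i y) - 2"
        by (simp add: qi_def cis_mult field_simps)
      then have "1 / 2 + (cis ?u * cis (- ?w) + cis (- ?u) * cis ?w) / 4 = of_real (qi i y)"
        by (simp add: field_simps)
      moreover have "?I n y * (1 / 2) + ?I (n + ?e) y * (cis (- ?w) / 4) + ?I (n - ?e) y * (cis ?w / 4)
        = ?I n y * (1 / 2 + (cis ?u * cis (- ?w) + cis (- ?u) * cis ?w) / 4)"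
        unfolding ch by (simp add: algebra_simps add_divide_distrib)
      ultimately show ?thesis by simp
    qed
    ultimately show "integral Q (\<lambda>y. D y * of_real (g y * qi i y) * character ((1 / L) *\<^sub>R n) y) = 0"
      by (simp add: integral_unique)
  qed
  have Z_prod: "Z (\<lambda>y. g y * (\<Prod>i\<in>A. qi i y))" if "finite A" "Z g" for A g
    using that
  proof (induction A)
    case (insert i A)
    then show ?case
      using Z_qi[of "\<lambda>y. g y * (\<Prod>i\<in>A. qi i y)" i] by (simp add: mult_ac)
  qed simp
  have Zq: "Z (\<lambda>y. q y ^ N)" for N
  proof (induction N)
    case 0
    then show ?case using zero by (simp add: Z_def)
  next
    case (Suc N)
    then show ?case
      using Z_prod[OF finite_class.finite_UNIV Suc] by (simp add: q_def mult.commute)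
  qed
  define w where "w y = Re (cnj (D x0) * D y)" for y
  have cw: "continuous_on Q w"
    unfolding w_def by (intro continuous_intros D)
  have cqq: "continuous_on S q" for S
    unfolding q_def by (intro continuous_intros cq)
  have x0Q: "x0 \<in> Q"
    unfolding Q_def mem_box_cart
  proof (intro allI conjI)
    show "(\<chi> i. - (L / 2)) $ i \<le> x0 $ i" "x0 $ i \<le> (\<chi> i. L / 2) $ i" for i
      using x0[of i] by auto
  qed
  have hw: "((\<lambda>y. w y * q y ^ N) has_integral 0) Q" for N
  proof -
    have "((\<lambda>y. D y * of_real (q y ^ N)) has_integral 0) Q"
    proof -
      have "(\<lambda>y. D y * of_real (q y ^ N)) integrable_on Q"
        unfolding Q_def using D cqq by (intro integrable_continuous continuous_intros) (auto simp: Q_def)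
      moreover have "(0 :: real ^ 'd) \<in> int_lattice" by (simp add: int_lattice_def)
      ultimately show ?thesis
        using Zq[of N] by (auto simp: Z_def has_integral_iff dest!: bspec[of _ _ 0])
    qed
    from has_integral_linear[OF has_integral_mult_right[OF this, of "cnj (D x0)"] bounded_linear_Re]
    have "((\<lambda>y. Re (cnj (D x0) * (D y * of_real (q y ^ N)))) has_integral 0) Q"
      by (simp add: o_def)
    moreover have "Re (cnj (D x0) * (D y * of_real (q y ^ N))) = w y * q y ^ N" for y
      unfolding w_def mult.assoc[symmetric] by simp
    ultimately show ?thesis by simp
  qed
  have wpos: "0 < w x0"
    using nz by (simp add: w_def complex_eq_iff sum_power2_gt_zero_iff flip: power2_eq_square)
  obtain r where r: "0 < r" "\<And>y. y \<in> Q \<Longrightarrow> dist y x0 < r \<Longrightarrow> \<bar>w y - w x0\<bar> < w x0 / 2"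
    using cw x0Q wpos unfolding continuous_on_iff dist_real_def by (metis half_gt_zero)
  have wr: "w x0 / 2 \<le> w y" if "y \<in> Q" "dist y x0 < r" for y
    using r(2)[OF that] by linarith
  have qi01: "0 \<le> qi i y" "qi i y \<le> 1" for i y
  proof -
    have "0 \<le> (1 + cos z) / 2" "(1 + cos z) / 2 \<le> 1" for z :: real
      using cos_ge_minus_one[of z] cos_le_one[of z] by (simp_all add: field_simps; linarith)+
    then show "0 \<le> qi i y" "qi i y \<le> 1" unfolding qi_def by blast+
  qed
  have q0: "0 \<le> q y" "q y \<le> 1" for y
    unfolding q_def by (auto intro!: prod_nonneg prod_le_1 qi01)
  have q1: "q y < 1" if yQ: "y \<in> Q" and yx: "y \<noteq> x0" for y
  proof -
    obtain i where i: "y $ i \<noteq> x0 $ i" using yx by (auto simp: vec_eq_iff)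
    have "qi i y \<noteq> 1"
    proof
      assume "qi i y = 1"
      then have "cos (2 * pi * ((y $ i - x0 $ i) / L)) = 1" by (simp add: qi_def)
      then obtain n :: int where "2 * pi * ((y $ i - x0 $ i) / L) = of_int n * 2 * pi"
        by (metis cos_one_2pi_int)
      then have "2 * pi * ((y $ i - x0 $ i) / L) = 2 * pi * of_int n" by (simp only: mult_ac)
      then have n: "(y $ i - x0 $ i) / L = of_int n"
        unfolding mult_cancel_left by simp
      have "\<bar>y $ i\<bar> \<le> L / 2" proof -
        have "- (L / 2) \<le> y $ i" "y $ i \<le> L / 2" using yQ by (auto simp: Q_def mem_box_cart)
        then show ?thesis by linarith
      qed
      then have "\<bar>y $ i - x0 $ i\<bar> < L" using x0[of i] by linarith
      then have "\<bar>(y $ i - x0 $ i) / L\<bar> < 1" using L by simp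
      then have "n = 0" unfolding n by linarith
      then show False using n i L by simp
    qed
    then have "qi i y < 1" using qi01 less_le by blast
    moreover have "q y \<le> qi i y"
    proof -
      have "q y = qi i y * (\<Prod>j\<in>UNIV - {i}. qi j y)"
        unfolding q_def by (rule prod.remove) auto
      also have "\<dots> \<le> qi i y * 1"
        by (intro mult_left_mono prod_le_1) (auto simp: qi01)
      finally show ?thesis by simp
    qed
    ultimately show ?thesis by simp
  qed
  obtain A where A: "0 \<le> A" "A < 1" "\<And>y. y \<in> Q \<Longrightarrow> r \<le> dist y x0 \<Longrightarrow> q y \<le> A"
  proof (cases "Q \<inter> {y. r \<le> dist y x0} = {}")
    case True
    then show ?thesis using that[of 0] by auto
  next
    case False
    have "compact (Q \<inter> {y. r \<le> dist y x0})"
      unfolding Q_def by (intro compact_Int_closed compact_cbox closed_Collect_le continuous_intros)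
    from continuous_attains_sup[OF this False cqq]
    obtain y where y: "y \<in> Q" "r \<le> dist y x0" "\<And>z. z \<in> Q \<Longrightarrow> r \<le> dist z x0 \<Longrightarrow> q z \<le> q y"
      by auto
    then show ?thesis using that[of "q y"] q0 q1[of y] r(1) by force
  qed
  \<comment> \<open>A level strictly between the maximum \<open>A\<close> of \<open>q\<close> away
    from \<open>x0\<close> and its value 1 at \<open>x0\<close>; near \<open>x0\<close> the kernel
    stays above it.\<close>
  define B where "B = (1 + A) / 2"
  have B: "A < B" "B < 1" "0 < B" using A by (auto simp: B_def)
  have "continuous (at x0) q" using cqq[of UNIV] by (simp add: continuous_on_eq_continuous_at)
  then obtain \<rho> where \<rho>0: "0 < \<rho>" "\<And>y. dist y x0 < \<rho> \<Longrightarrow> dist (q y) (q x0) < 1 - B"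
    using B(2) unfolding continuous_at_eps_delta by (auto dest: spec[of _ "1 - B"])
  have "q x0 = 1" by (simp add: q_def qi_def)
  then have \<rho>: "0 < \<rho>" "B < q y" if "dist y x0 < \<rho>" for y
    using \<rho>0(1) \<rho>0(2)[OF that] by (auto simp: dist_real_def)
  have "x0 \<in> interior Q"
    unfolding Q_def interior_cbox mem_box_cart
  proof (intro allI conjI)
    show "(\<chi> i. - (L / 2)) $ i < x0 $ i" "x0 $ i < (\<chi> i. L / 2) $ i" for i
      using x0[of i] by auto
  qed
  then obtain \<rho>' where \<rho>': "0 < \<rho>'" "ball x0 \<rho>' \<subseteq> Q"
    by (meson mem_interior)
  obtain a b where ab: "x0 \<in> box a b" "cbox a b \<subseteq> ball x0 (min \<rho>' (min r \<rho>))"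
    by (rule open_contains_cbox[of "ball x0 (min \<rho>' (min r \<rho>))" x0]) (use r(1) \<rho>0(1) \<rho>'(1) in auto)
  have V: "y \<in> Q" "w x0 / 2 \<le> w y" "B \<le> q y" if "y \<in> cbox a b" for y
  proof -
    have y: "y \<in> ball x0 (min \<rho>' (min r \<rho>))" using that ab(2) by blast
    then show "y \<in> Q" using \<rho>'(2) by auto
    then show "w x0 / 2 \<le> w y" using y by (intro wr) (auto simp: dist_commute)
    show "B \<le> q y" using \<rho>(2)[of y] y by (auto simp: dist_commute)
  qed
  have cV: "0 < measure lborel (cbox a b)"
    using ab(1) by (intro content_pos_lt) (auto simp: mem_box)
  have "bounded (w ` Q)"
    using cw unfolding Q_def by (intro compact_imp_bounded compact_continuous_image compact_cbox)
  then obtain M where M: "0 < M" "\<And>y. y \<in> Q \<Longrightarrow> \<bar>w y\<bar> \<le> M"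
    unfolding bounded_pos by auto
  \<comment> \<open>The vanishing integral balances a contribution of order B^N from a small box
    around \<open>x0\<close> against one of order A^N from far away. In between \<open>w\<close> is
    positive and only helps.\<close>
  have key: "(w x0 / 2) * measure lborel (cbox a b) \<le> M * measure lborel Q * (A / B) ^ N" for N
  proof -
    have "((\<lambda>y. (if y \<in> cbox a b then (w x0 / 2) * B ^ N else 0) - M * A ^ N) has_integral
        (w x0 / 2) * B ^ N * measure lborel (cbox a b) - M * A ^ N * measure lborel Q) Q"
    proof (rule has_integral_diff)
      have "((\<lambda>y. (w x0 / 2) * B ^ N) has_integral (w x0 / 2) * B ^ N * measure lborel (cbox a b)) (cbox a b)"
        using has_integral_const[of "(w x0 / 2) * B ^ N" a b] by (simp add: mult.commute)
      moreover have "cbox a b \<subseteq> Q" using V(1) by blast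
      ultimately show "((\<lambda>y. if y \<in> cbox a b then (w x0 / 2) * B ^ N else 0) has_integral
          (w x0 / 2) * B ^ N * measure lborel (cbox a b)) Q"
        by (simp add: has_integral_restrict)
      show "((\<lambda>y. M * A ^ N) has_integral M * A ^ N * measure lborel Q) Q"
        unfolding Q_def using has_integral_const[of "M * A ^ N"] by (simp add: mult.commute)
    qed
    then have "(w x0 / 2) * B ^ N * measure lborel (cbox a b) - M * A ^ N * measure lborel Q \<le> 0"
    proof (rule has_integral_le[OF _ hw[of N]])
      fix y assume y: "y \<in> Q"
      show "(if y \<in> cbox a b then (w x0 / 2) * B ^ N else 0) - M * A ^ N \<le> w y * q y ^ N"
      proof (cases "y \<in> cbox a b")
        case True
        have "(w x0 / 2) * B ^ N \<le> w y * q y ^ N"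
          using V[OF True] wpos B by (intro mult_mono power_mono) auto
        moreover have "0 \<le> M * A ^ N" using M A by simp
        ultimately show ?thesis using True by simp
      next
        case False
        have "- (M * A ^ N) \<le> w y * q y ^ N"
        proof (cases "dist y x0 < r")
          case True
          then have "0 \<le> w y" using wr[OF y] wpos by linarith
          then have "0 \<le> w y * q y ^ N" using q0 by simp
          moreover have "0 \<le> M * A ^ N" using M A by simp
          ultimately show ?thesis by linarith
        next
          case False
          have "\<bar>w y * q y ^ N\<bar> \<le> M * A ^ N"
            unfolding abs_mult using M(2)[OF y] A(3)[OF y] False q0[of y] M(1)
            by (intro mult_mono) (auto intro!: power_mono simp: power_abs)
          then show ?thesis by linarith
        qed
        then show ?thesis using False by simp
      qed
    qed
    then have "(w x0 / 2) * measure lborel (cbox a b) * B ^ N \<le> M * measure lborel Q * A ^ N"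
      by (simp add: mult_ac)
    then show ?thesis
      using B(3) by (simp add: power_divide field_simps)
  qed
  have "(\<lambda>N. M * measure lborel Q * (A / B) ^ N) \<longlonglongrightarrow> M * measure lborel Q * 0"
    using A B by (intro tendsto_mult_left LIMSEQ_power_zero) auto
  then have "(w x0 / 2) * measure lborel (cbox a b) \<le> M * measure lborel Q * 0"
    by (rule LIMSEQ_le_const) (use key in auto)
  moreover have "0 < (w x0 / 2) * measure lborel (cbox a b)"
    using wpos cV by (intro mult_pos_pos) auto
  ultimately show False by linarith
qed

section \<open>Partial sums over lattice boxes\<close>

lemma lattice_box_mono: "M \<le> N \<Longrightarrow> lattice_box M \<subseteq> lattice_box N"
  unfolding lattice_box_def by (auto intro: order_trans)

lemma in_lattice_box: "m \<in> int_lattice \<Longrightarrow> \<exists>N. m \<in> lattice_box N"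
proof -
  assume m: "m \<in> int_lattice"
  have "\<bar>m $ i\<bar> \<le> real (nat \<lceil>norm m\<rceil>)" for i
    using component_le_norm_cart[of m i] by linarith
  then have "m \<in> lattice_box (nat \<lceil>norm m\<rceil>)" using m by (simp add: lattice_box_def)
  then show ?thesis ..
qed

lemma lattice_truncation_tendsto_0:
  fixes h :: "real ^ 'd \<Rightarrow> 'b::real_normed_vector"
  assumes h: "wbounded C h" and t: "0 < t" "t \<le> 1"
  shows "(\<lambda>N. L1 (\<lambda>z. if gfloor t z \<in> (\<lambda>m. t *\<^sub>R m) ` lattice_box N then 0 else h (gfloor t z))) \<longlonglongrightarrow> 0"
proof (rule L1_tendsto_0[where N = "{}"])
  let ?g = "\<lambda>N x. if x \<in> (\<lambda>m. t *\<^sub>R m) ` lattice_box N then 0 else h x"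
  show "ae_cont (\<lambda>z. ?g N (gfloor t z))" for N
    using t by (intro ae_cont_gfloor) auto
  show "wbounded (3 ^ CARD('d) * C) (\<lambda>z. ?g N (gfloor t z))" for N
    using t by (intro wbounded_gfloor wbounded_mono[OF h]) auto
  fix z :: "real ^ 'd"
  obtain m where m: "m \<in> int_lattice" "gfloor t z = t *\<^sub>R m"
    using gfloor_in_lattice[OF t(1)] by blast
  obtain M where M: "m \<in> lattice_box M" using in_lattice_box[OF m(1)] by blast
  have "eventually (\<lambda>N. ?g N (gfloor t z) = 0) sequentially"
    using eventually_ge_at_top[of M] by eventually_elim (use M m(2) lattice_box_mono in fastforce)
  then show "(\<lambda>N. ?g N (gfloor t z)) \<longlonglongrightarrow> 0"
    by (rule tendsto_eventually)
qed simp

text \<open>The Riemann sum of mesh 1/L is the Fourier series of the test function on the cube of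
  side L. It converges uniformly, so by orthogonality it has the same coefficients as the function,
  and uniqueness applies at interior points.\<close>

lemma fourier_series:
  fixes \<psi> :: "real ^ 'd \<Rightarrow> complex"
  assumes \<psi>: "C_infinity_compact \<psi>" and L: "1 \<le> L"
    and supp: "\<And>x. \<psi> x \<noteq> 0 \<Longrightarrow> x \<in> cbox (\<chi> i. - (L / 2)) (\<chi> i. L / 2)"
    and y: "\<And>i. \<bar>y $ i\<bar> < L / 2"
  shows "osc (1 / L) (fourier_transform \<psi>) y = \<psi> y"
proof -
  define Q where "Q = (cbox (\<chi> i. - (L / 2)) (\<chi> i. L / 2) :: (real ^ 'd) set)"
  define t where "t = 1 / L"
  have t: "0 < t" "t \<le> 1" using L by (auto simp: t_def)
  define h where "h = fourier_transform \<psi>"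
  obtain C where C: "wbounded C h"
    using mixed_lip_fourier_transform[OF \<psi>] mixed_lip_wbounded unfolding h_def by blast
  have adh: "admissible t C h" using C t by (simp add: admissible_def)
  define B where "B N = (\<lambda>m. t *\<^sub>R m) ` (lattice_box N :: (real ^ 'd) set)" for N
  define S where "S N = osc t (\<lambda>x. if x \<in> B N then h x else 0)" for N
  define e where "e N = L1 (\<lambda>z. if gfloor t z \<in> B N then 0 else h (gfloor t z))" for N
  have e0: "e \<longlonglongrightarrow> 0"
    using lattice_truncation_tendsto_0[OF C t] by (simp add: e_def[abs_def] B_def)
  have adN: "admissible t C (\<lambda>x. if x \<in> B N then h x else 0)" for N
    using t by (auto simp: admissible_def intro: wbounded_mono[OF C])
  have diff: "norm (osc t h x - S N x) \<le> e N" for N x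
  proof -
    have "osc t h x - S N x = osc t (\<lambda>x. h x - (if x \<in> B N then h x else 0)) x"
      unfolding S_def using osc_diff[OF adh adN[of N], of x] by simp
    also have "norm \<dots> \<le> L1 (\<lambda>z. h (gfloor t z) - (if gfloor t z \<in> B N then h (gfloor t z) else 0))"
      by (rule norm_osc_le[OF admissible_diff[OF adh adN]])
    also have "(\<lambda>z. h (gfloor t z) - (if gfloor t z \<in> B N then h (gfloor t z) else 0))
        = (\<lambda>z. if gfloor t z \<in> B N then 0 else h (gfloor t z))"
      by auto
    finally show ?thesis by (simp add: e_def)
  qed
  have S_eq: "S N x = (\<Sum>m\<in>lattice_box N. of_real (t ^ CARD('d)) * h (t *\<^sub>R m) * character (t *\<^sub>R m) x)" for N x
    unfolding S_def
    by (subst osc_finite[OF t(1) finite_lattice_box[of N] lattice_box_subset])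
      (auto simp: B_def scaleR_conv_of_real scaleC_complex_def mult_ac intro!: sum.cong)
  have cS: "cont (S N)" for N
    unfolding S_eq[abs_def] by (intro continuous_intros)
  have "uniform_limit UNIV S (osc t h) sequentially"
  proof (rule uniform_limitI)
    fix r :: real assume "r > 0"
    with e0 have "eventually (\<lambda>N. e N < r) sequentially" by (rule order_tendstoD)
    then show "eventually (\<lambda>N. \<forall>x\<in>UNIV. dist (S N x) (osc t h x) < r) sequentially"
    proof eventually_elim
      case (elim N)
      then show ?case using diff by (auto simp: dist_norm norm_minus_commute intro: le_less_trans)
    qed
  qed
  then have cO: "cont (osc t h)"
    by (rule uniform_limit_theorem[rotated]) (auto simp: cS)
  have c\<psi>: "continuous_on A \<psi>" for A
    using C_infinity_compactD(2)[OF \<psi>] continuous_on_subset by blast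
  have Q0: "Q = cbox (\<chi> i. - (L / 2)) ((\<chi> i. - (L / 2)) + (\<chi> i. L))"
    unfolding Q_def by (rule arg_cong2[of _ _ _ _ cbox]) (auto simp: vec_eq_iff)
  have orth: "integral Q (character (t *\<^sub>R k)) = (if k = 0 then of_real (L ^ CARD('d)) else 0)" if "k \<in> int_lattice" for k
    using integral_character_cube[OF _ that, of L] L unfolding Q0 t_def by simp
  have coeff: "integral Q (\<lambda>x. osc t h x * character (t *\<^sub>R (- n)) x) = h (t *\<^sub>R n)" if n: "n \<in> int_lattice" for n
  proof -
    let ?c = "character (t *\<^sub>R (- n))"
    obtain M where M: "n \<in> lattice_box M" using in_lattice_box[OF n] by blast
    have SN: "integral Q (\<lambda>x. S N x * ?c x) = h (t *\<^sub>R n)" if N: "M \<le> N" for N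
    proof -
      have "((\<lambda>x. \<Sum>m\<in>lattice_box N. of_real (t ^ CARD('d)) * h (t *\<^sub>R m) * character (t *\<^sub>R (m - n)) x) has_integral
          (\<Sum>m\<in>lattice_box N. of_real (t ^ CARD('d)) * h (t *\<^sub>R m) * (if m - n = 0 then of_real (L ^ CARD('d)) else 0))) Q"
      proof (intro has_integral_sum finite_lattice_box has_integral_mult_right)
        fix m :: "real ^ 'd" assume "m \<in> lattice_box N"
        then have "m - n \<in> int_lattice" using n by (auto simp: lattice_box_def int_lattice_def)
        moreover have "character (t *\<^sub>R (m - n)) integrable_on Q"
          unfolding Q_def by (intro integrable_continuous continuous_intros)
        ultimately show "(character (t *\<^sub>R (m - n)) has_integral (if m - n = 0 then of_real (L ^ CARD('d)) else 0)) Q"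
          unfolding orth[OF \<open>m - n \<in> int_lattice\<close>, symmetric] by blast
      qed
      moreover have "S N x * ?c x = (\<Sum>m\<in>lattice_box N. of_real (t ^ CARD('d)) * h (t *\<^sub>R m) * character (t *\<^sub>R (m - n)) x)" for x
      proof -
        have "character (t *\<^sub>R m) x * ?c x = character (t *\<^sub>R (m - n)) x" for m
          by (simp add: character_add_left[symmetric] scaleR_diff_right)
        then show ?thesis
          unfolding S_eq by (simp add: sum_distrib_right mult.assoc)
      qed
      moreover have "(\<Sum>m\<in>lattice_box N. of_real (t ^ CARD('d)) * h (t *\<^sub>R m) * (if m - n = 0 then of_real (L ^ CARD('d)) else 0))
          = h (t *\<^sub>R n)"
      proof -
        have "n \<in> lattice_box N" using M lattice_box_mono[OF N] by blast
        moreover have "(\<Sum>m\<in>lattice_box N. of_real (t ^ CARD('d)) * h (t *\<^sub>R m) * (if m - n = 0 then of_real (L ^ CARD('d)) else 0))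
          = (\<Sum>m\<in>lattice_box N. if m = n then h (t *\<^sub>R n) * (of_real (t ^ CARD('d)) * of_real (L ^ CARD('d))) else 0)"
          by (intro sum.cong refl) (simp split: if_splits)
        moreover have one: "of_real (t ^ CARD('d)) * of_real (L ^ CARD('d)) = (1 :: complex)"
          using L by (simp add: t_def power_one_over flip: of_real_mult)
        ultimately show ?thesis
          by (simp only: sum.delta[OF finite_lattice_box] if_True one mult_1_right)
      qed
      ultimately show ?thesis by (simp add: integral_unique)
    qed
    have "norm (integral Q (\<lambda>x. osc t h x * ?c x) - h (t *\<^sub>R n)) \<le> e N * measure lborel Q" if N: "M \<le> N" for N
    proof -
      have i: "(\<lambda>x. osc t h x * ?c x) integrable_on Q" "(\<lambda>x. S N x * ?c x) integrable_on Q"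
        unfolding Q_def
        by (intro integrable_continuous continuous_intros continuous_on_subset[OF cO] continuous_on_subset[OF cS]; simp)+
      have "integral Q (\<lambda>x. osc t h x * ?c x) - h (t *\<^sub>R n) = integral Q (\<lambda>x. osc t h x * ?c x - S N x * ?c x)"
        using SN[OF N] i by (simp add: Henstock_Kurzweil_Integration.integral_diff)
      also have "norm \<dots> \<le> integral Q (\<lambda>x. e N)"
      proof (rule Henstock_Kurzweil_Integration.integral_norm_bound_integral)
        show "(\<lambda>x. osc t h x * ?c x - S N x * ?c x) integrable_on Q"
          using i by (rule integrable_diff)
        show "norm (osc t h x * ?c x - S N x * ?c x) \<le> e N" for x
          using diff[where N = N and x = x] by (simp add: norm_mult flip: left_diff_distrib)
      qed (simp add: Q_def integrable_on_const)
      also have "\<dots> = e N * measure lborel Q"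
        by (simp add: Q_def)
      finally show ?thesis .
    qed
    moreover have "(\<lambda>N. e N * measure lborel Q) \<longlonglongrightarrow> 0"
      using tendsto_mult_right[OF e0, of "measure lborel Q"] by simp
    ultimately have "norm (integral Q (\<lambda>x. osc t h x * ?c x) - h (t *\<^sub>R n)) \<le> 0"
      by (intro LIMSEQ_le_const[of "\<lambda>N. e N * measure lborel Q"]) auto
    then show ?thesis by simp
  qed
  have "(\<lambda>x. \<psi> x - osc t h x) y = 0"
  proof (rule fourier_uniqueness_cube[of L])
    show "continuous_on (cbox (\<chi> i. - (L / 2)) (\<chi> i. L / 2)) (\<lambda>x. \<psi> x - osc t h x)"
      by (intro continuous_intros c\<psi> continuous_on_subset[OF cO]) simp
    fix n :: "real ^ 'd" assume n: "n \<in> int_lattice"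
    then have n': "- n \<in> int_lattice" by (simp add: int_lattice_def)
    have "fourier_transform \<psi> (t *\<^sub>R (- n)) = integral UNIV (\<lambda>x. if x \<in> Q then \<psi> x * character (t *\<^sub>R n) x else 0)"
      unfolding fourier_transform_def
    proof (rule arg_cong[of _ _ "integral UNIV"], rule ext)
      fix x
      have "character (- (t *\<^sub>R - n)) x = character (t *\<^sub>R n) x" by simp
      then show "character (- (t *\<^sub>R - n)) x *\<^sub>C \<psi> x = (if x \<in> Q then \<psi> x * character (t *\<^sub>R n) x else 0)"
        using supp[of x] by (auto simp: scaleC_complex_def Q_def)
    qed
    then have 1: "integral Q (\<lambda>x. \<psi> x * character (t *\<^sub>R n) x) = h (t *\<^sub>R (- n))"
      unfolding h_def integral_restrict_UNIV by simp
    have 2: "integral Q (\<lambda>x. osc t h x * character (t *\<^sub>R n) x) = h (t *\<^sub>R (- n))"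
      using coeff[OF n'] by simp
    have i: "(\<lambda>x. \<psi> x * character (t *\<^sub>R n) x) integrable_on Q" "(\<lambda>x. osc t h x * character (t *\<^sub>R n) x) integrable_on Q"
      unfolding Q_def
      by (intro integrable_continuous continuous_intros continuous_on_subset[OF cO] c\<psi>; simp)+
    show "integral (cbox (\<chi> i. - (L / 2)) (\<chi> i. L / 2)) (\<lambda>x. (\<psi> x - osc t h x) * character ((1 / L) *\<^sub>R n) x) = 0"
      using Henstock_Kurzweil_Integration.integral_diff[OF i] 1 2
      by (simp add: left_diff_distrib Q_def t_def)
  qed (use L y in auto)
  then show ?thesis by (simp add: t_def h_def)
qed

text \<open>As soon as the cube of side k + 1 contains the support and has the point in its
  interior, the Riemann sum of mesh 1/(k+1) equals the value of the test function; its limit is the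
  inverse Fourier integral.\<close>

lemma fourier_inversion:
  fixes \<psi> :: "real ^ 'd \<Rightarrow> complex"
  assumes \<psi>: "C_infinity_compact \<psi>"
  shows "osc 0 (fourier_transform \<psi>) y = \<psi> y"
proof -
  define t where "t k = 1 / (real k + 1)" for k :: nat
  have t: "0 < t k" "t k \<le> 1" for k by (auto simp: t_def)
  have t0: "t \<longlonglongrightarrow> 0"
    unfolding t_def using LIMSEQ_inverse_real_of_nat by (simp add: inverse_eq_divide add.commute)
  obtain C where C: "wbounded C (fourier_transform \<psi>)"
    using mixed_lip_fourier_transform[OF \<psi>] mixed_lip_wbounded by blast
  have c: "cont (fourier_transform \<psi>)"
    by (rule continuous_fourier_transform[OF \<psi>])
  have "(\<lambda>k. osc (t k) (fourier_transform \<psi>) y) \<longlonglongrightarrow> osc 0 (fourier_transform \<psi>) y"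
  proof (rule osc_tendsto[where C = C and N = "{}"])
    fix z
    have "isCont (fourier_transform \<psi>) z" using c by (simp add: continuous_on_eq_continuous_at)
    then show "(\<lambda>k. fourier_transform \<psi> (gfloor (t k) z)) \<longlonglongrightarrow> fourier_transform \<psi> z"
      by (rule isCont_tendsto_compose) (intro gfloor_tendsto t0 less_imp_le t)
  qed (use t t0 C continuous_imp_ae_cont[OF c] in \<open>auto intro: less_imp_le\<close>)
  moreover have "eventually (\<lambda>k. osc (t k) (fourier_transform \<psi>) y = \<psi> y) sequentially"
  proof -
    obtain R where R: "0 < R" "\<And>x. \<psi> x \<noteq> 0 \<Longrightarrow> norm x \<le> R"
      using C_infinity_compactD(3)[OF \<psi>] unfolding bounded_pos by auto
    show ?thesis
    proof (rule eventually_sequentiallyI[of "nat \<lceil>2 * R + 2 * norm y\<rceil>"])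
      fix k assume "nat \<lceil>2 * R + 2 * norm y\<rceil> \<le> k"
      then have k: "2 * R + 2 * norm y \<le> real k" by linarith
      have "osc (1 / (real k + 1)) (fourier_transform \<psi>) y = \<psi> y"
      proof (rule fourier_series[OF \<psi>])
        fix x assume "\<psi> x \<noteq> 0"
        then have "norm x \<le> R" by (rule R(2))
        then have "\<bar>x $ i\<bar> \<le> (real k + 1) / 2" for i
          using component_le_norm_cart[of x i] k norm_ge_zero[of y] unfolding le_divide_eq_numeral1 by linarith
        then show "x \<in> cbox (\<chi> i. - ((real k + 1) / 2)) (\<chi> i. (real k + 1) / 2)"
          unfolding mem_box_cart abs_le_iff by (simp add: minus_le_iff)
      next
        fix i
        show "\<bar>y $ i\<bar> < (real k + 1) / 2"
          using component_le_norm_cart[of y i] k R(1) unfolding less_divide_eq_numeral1 by linarith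
      qed simp
      then show "osc (t k) (fourier_transform \<psi>) y = \<psi> y" by (simp add: t_def)
    qed
  qed
  ultimately show ?thesis
    using LIMSEQ_unique tendsto_eventually by metis
qed

section \<open>Powers of \<open>L\<^sub>p\<close> norms\<close>

text \<open>Powers are used instead of norms: they are additive over sets, obey monotone and
  dominated convergence directly, and need no separate treatment of infinite values. Only the final
  statement returns to \<open>Lp_norm\<close>.\<close>

definition Lpow :: "real \<Rightarrow> 'a::euclidean_space set \<Rightarrow> ('a \<Rightarrow> 'b::real_normed_vector) \<Rightarrow> ennreal" where
  "Lpow p S f = (\<integral>\<^sup>+x\<in>S. ennreal (norm (f x) powr p) \<partial>lborel)"

lemma Lp_norm_eq_Lpow:
  "Lp_norm p S f = (if Lpow p S f = \<infinity> then \<infinity> else ennreal (enn2real (Lpow p S f) powr (1 / p)))"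
  by (simp add: Lp_norm_def Lpow_def nn_integral_completion Let_def)

lemma Lp_norm_le_iff:
  assumes "0 < p" "0 < c"
  shows "Lp_norm p S f \<le> ennreal c * Lp_norm p T g \<longleftrightarrow> Lpow p S f \<le> ennreal (c powr p) * Lpow p T g"
proof (cases "Lpow p T g = \<infinity>")
  case True
  then show ?thesis
    using assms by (simp add: Lp_norm_eq_Lpow ennreal_mult_top)
next
  case False
  then obtain b where b: "Lpow p T g = ennreal b" "0 \<le> b"
    by (cases "Lpow p T g") auto
  show ?thesis
  proof (cases "Lpow p S f = \<infinity>")
    case True
    then show ?thesis
      using assms b by (simp add: Lp_norm_eq_Lpow ennreal_mult[symmetric] top_unique)
  next
    case F: False
    then obtain a where a: "Lpow p S f = ennreal a" "0 \<le> a"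
      by (cases "Lpow p S f") auto
    have "a powr (1 / p) \<le> c * b powr (1 / p) \<longleftrightarrow> a \<le> c powr p * b"
    proof -
      have "c * b powr (1 / p) = (c powr p * b) powr (1 / p)"
        using assms b by (simp add: powr_mult powr_powr)
      then show ?thesis
        using assms a b powr_mono2[of "1 / p" a "c powr p * b"] powr_less_mono2[of "1 / p" "c powr p * b" a]
        by (auto simp: not_le[symmetric] simp del: powr_mono2)
    qed
    then show ?thesis
      using a b assms by (simp add: Lp_norm_eq_Lpow ennreal_mult[symmetric])
  qed
qed

lemma Lpow_measurable:
  fixes f :: "'a::euclidean_space \<Rightarrow> 'b::real_normed_vector"
  assumes "cont f"
  shows "(\<lambda>x. ennreal (norm (f x) powr p)) \<in> borel_measurable borel"
proof -
  have "(\<lambda>x. norm (f x)) \<in> borel_measurable borel"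
    by (intro borel_measurable_continuous_onI continuous_intros assms)
  then show ?thesis by measurable
qed

lemma Lpow_mono_set: "S \<subseteq> T \<Longrightarrow> Lpow p S f \<le> Lpow p T f"
  unfolding Lpow_def by (intro nn_integral_mono) (auto simp: indicator_def)

lemma Lpow_cong: "(\<And>x. x \<in> S \<Longrightarrow> norm (f x) = norm (g x)) \<Longrightarrow> Lpow p S f = Lpow p S g"
  unfolding Lpow_def by (intro nn_integral_cong) (auto simp: indicator_def)

lemma Lpow_interpolate:
  fixes f :: "'a::euclidean_space \<Rightarrow> 'b::real_normed_vector"
  assumes "cont f" "S \<in> sets borel" "0 < q" "q < p" "\<And>x. x \<in> S \<Longrightarrow> norm (f x) \<le> \<sigma>"
  shows "Lpow p S f \<le> ennreal (\<sigma> powr (p - q)) * Lpow q S f"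
proof -
  have "ennreal (norm (f x) powr p) * indicator S x \<le> ennreal (\<sigma> powr (p - q)) * (ennreal (norm (f x) powr q) * indicator S x)" for x
  proof (cases "x \<in> S")
    case True
    have "norm (f x) powr p = norm (f x) powr (p - q) * norm (f x) powr q"
      by (simp add: powr_add[symmetric])
    also have "\<dots> \<le> \<sigma> powr (p - q) * norm (f x) powr q"
      using assms True by (intro mult_right_mono powr_mono2) auto
    finally show ?thesis
      using True by (simp add: ennreal_mult[symmetric])
  qed simp
  then have "Lpow p S f \<le> (\<integral>\<^sup>+x. ennreal (\<sigma> powr (p - q)) * (ennreal (norm (f x) powr q) * indicator S x) \<partial>lborel)"
    unfolding Lpow_def by (intro nn_integral_mono)
  also have "\<dots> = ennreal (\<sigma> powr (p - q)) * Lpow q S f"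
    unfolding Lpow_def using assms(2) Lpow_measurable[OF assms(1), of q]
    by (intro nn_integral_cmult borel_measurable_times_ennreal borel_measurable_indicator) simp_all
  finally show ?thesis .
qed

text \<open>The smaller of b and d * a decides which term absorbs the other. The gain over the usual
  constant 2^p is that the factor of the first term can be taken close to 1.\<close>

lemma powr_add_le:
  fixes a b :: real
  assumes "0 \<le> a" "0 \<le> b" "0 < d" "0 < p"
  shows "(a + b) powr p \<le> (1 + d) powr p * a powr p + (1 + 1 / d) powr p * b powr p"
proof (cases "b \<le> d * a")
  case True
  then have "(a + b) powr p \<le> ((1 + d) * a) powr p"
    using assms by (intro powr_mono2) (auto simp: distrib_right)
  also have "\<dots> = (1 + d) powr p * a powr p"
    using assms by (simp add: powr_mult)
  also have "\<dots> \<le> (1 + d) powr p * a powr p + (1 + 1 / d) powr p * b powr p"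
    by simp
  finally show ?thesis .
next
  case False
  then have "a \<le> b / d" using assms by (simp add: field_simps)
  then have "(a + b) powr p \<le> ((1 + 1 / d) * b) powr p"
    using assms by (intro powr_mono2) (auto simp: distrib_right)
  also have "\<dots> = (1 + 1 / d) powr p * b powr p"
    using assms by (simp add: powr_mult)
  also have "\<dots> \<le> (1 + d) powr p * a powr p + (1 + 1 / d) powr p * b powr p"
    by simp
  finally show ?thesis .
qed

lemma Lpow_triangle:
  fixes f :: "'a::euclidean_space \<Rightarrow> 'b::real_normed_vector" and g :: "'a \<Rightarrow> 'c::real_normed_vector"
    and h :: "'a \<Rightarrow> 'e::real_normed_vector"
  assumes "cont g" "cont h" "S \<in> sets borel" "0 < p" "0 < d"
    and "\<And>x. x \<in> S \<Longrightarrow> norm (f x) \<le> norm (g x) + norm (h x)"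
  shows "Lpow p S f \<le> ennreal ((1 + d) powr p) * Lpow p S g + ennreal ((1 + 1 / d) powr p) * Lpow p S h"
proof -
  let ?A = "ennreal ((1 + d) powr p)" and ?B = "ennreal ((1 + 1 / d) powr p)"
  have "ennreal (norm (f x) powr p) * indicator S x \<le>
      ?A * (ennreal (norm (g x) powr p) * indicator S x) + ?B * (ennreal (norm (h x) powr p) * indicator S x)" for x
  proof (cases "x \<in> S")
    case True
    have "norm (f x) powr p \<le> (norm (g x) + norm (h x)) powr p"
      using assms True by (intro powr_mono2) auto
    also have "\<dots> \<le> (1 + d) powr p * norm (g x) powr p + (1 + 1 / d) powr p * norm (h x) powr p"
      using assms by (intro powr_add_le) auto
    finally show ?thesis
      using True by (simp add: ennreal_mult[symmetric] ennreal_plus[symmetric] del: ennreal_plus)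
  qed simp
  then have "Lpow p S f \<le> (\<integral>\<^sup>+x. ?A * (ennreal (norm (g x) powr p) * indicator S x) + ?B * (ennreal (norm (h x) powr p) * indicator S x) \<partial>lborel)"
    unfolding Lpow_def by (intro nn_integral_mono)
  also have "\<dots> = ?A * Lpow p S g + ?B * Lpow p S h"
    unfolding Lpow_def using assms(3) Lpow_measurable[OF assms(1)] Lpow_measurable[OF assms(2)]
    by (simp add: nn_integral_add nn_integral_cmult)
  finally show ?thesis .
qed

lemma ennreal_tendsto_cmult_0: "(e \<longlonglongrightarrow> 0) \<Longrightarrow> (\<lambda>k. ennreal D * e k) \<longlonglongrightarrow> 0"
  using ennreal_tendsto_cmult[of "ennreal D" e 0 sequentially] by simp

text \<open>The factor \<open>1 + d\<close> is the price of a triangle inequality for \<open>p\<close>-th powers of \<open>L\<^sub>p\<close> norms.\<close>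

lemma perturbed_inequality_limit:
  fixes a a' b b' e f :: "nat \<Rightarrow> ennreal"
  assumes p: "0 < p" and c: "0 < c"
    and a': "\<And>d. 0 < d \<Longrightarrow> \<exists>D. \<forall>k. a' k \<le> ennreal ((1 + d) powr p) * a k + ennreal D * e k"
    and b: "\<And>d. 0 < d \<Longrightarrow> \<exists>D. \<forall>k. b k \<le> ennreal ((1 + d) powr p) * b' k + ennreal D * f k"
    and ab: "\<And>k. a k \<le> ennreal c * b k"
    and lim: "e \<longlonglongrightarrow> 0" "f \<longlonglongrightarrow> 0" "a' \<longlonglongrightarrow> A" "b' \<longlonglongrightarrow> B"
  shows "A \<le> ennreal c * B"
proof (cases "B = \<infinity>")
  case True
  then show ?thesis using c by (simp add: ennreal_mult_top)
next
  case False
  then obtain r where r: "B = ennreal r" "0 \<le> r" by (cases B) auto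
  \<comment> \<open>For fixed \<open>d\<close> the error terms disappear as k grows; afterwards
    \<open>d\<close> tends to 0 along 1/(n+1).\<close>
  have le: "A \<le> ennreal ((1 + d) powr p * (c * ((1 + d) powr p * r)))" if d: "0 < d" for d
  proof -
    let ?K = "ennreal ((1 + d) powr p)"
    obtain D where D: "\<And>k. a' k \<le> ?K * a k + ennreal D * e k" using a'[OF d] by blast
    obtain E where E: "\<And>k. b k \<le> ?K * b' k + ennreal E * f k" using b[OF d] by blast
    have "(\<lambda>k. ?K * (ennreal c * (?K * b' k + ennreal E * f k)) + ennreal D * e k) \<longlonglongrightarrow> ?K * (ennreal c * (?K * B + 0)) + 0"
      by (intro tendsto_add ennreal_tendsto_cmult ennreal_tendsto_cmult_0 lim) auto
    moreover have "a' k \<le> ?K * (ennreal c * (?K * b' k + ennreal E * f k)) + ennreal D * e k" for k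
      using D[of k] E[of k] ab[of k]
      by (meson add_right_mono mult_left_mono order_trans zero_le)
    ultimately have "A \<le> ?K * (ennreal c * (?K * B + 0)) + 0"
      using lim(3) by (intro LIMSEQ_le) auto
    then show ?thesis
      using r c by (simp add: ennreal_mult[symmetric])
  qed
  have "(\<lambda>n. (1 + 1 / real (Suc n)) powr p * (c * ((1 + 1 / real (Suc n)) powr p * r))) \<longlonglongrightarrow>
      (1 + 0) powr p * (c * ((1 + 0) powr p * r))"
    by (intro tendsto_intros lim_1_over_n[THEN LIMSEQ_Suc]) auto
  then have "(\<lambda>n. ennreal ((1 + 1 / real (Suc n)) powr p * (c * ((1 + 1 / real (Suc n)) powr p * r)))) \<longlonglongrightarrow> ennreal (c * r)"
    by (intro tendsto_ennrealI) simp
  then have "A \<le> ennreal (c * r)"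
    by (rule LIMSEQ_le_const) (intro exI[of _ 0] allI impI le, simp)
  then show ?thesis
    using r c by (simp add: ennreal_mult)
qed

section \<open>Decay of oscillatory integrals\<close>

lemma norm_one_minus_cis:
  assumes "1 / 4 \<le> \<bar>x\<bar>" "\<bar>x\<bar> \<le> 1 / 2"
  shows "1 \<le> norm (1 - cis (2 * pi * x))"
proof -
  have "cos (2 * pi * \<bar>x\<bar>) \<le> cos (pi / 2)"
    using assms by (intro cos_monotone_0_pi_le) auto
  moreover have "cos (2 * pi * \<bar>x\<bar>) = cos (2 * pi * x)"
    by (cases "0 \<le> x") auto
  ultimately have "1 \<le> Re (1 - cis (2 * pi * x))" by simp
  then show ?thesis
    using complex_Re_le_cmod[of "1 - cis (2 * pi * x)"] by linarith
qed

text \<open>Half a wave length, rounded down to a multiple of the mesh. Rounding loses at most half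
  of it: with k the integer part of 1/(2 theta), both k theta + theta > 1/2 and theta <= k theta
  hold, whence k theta >= 1/4.\<close>

lemma exists_step:
  fixes t z :: real
  assumes "0 \<le> t" "t * \<bar>z\<bar> \<le> 1 / 2" "1 \<le> \<bar>z\<bar>"
  shows "\<exists>s. 0 \<le> s \<and> s \<le> 1 / (2 * \<bar>z\<bar>) \<and> (t = 0 \<or> (\<exists>k::int. s = t * of_int k)) \<and> 1 / 4 \<le> \<bar>s * z\<bar> \<and> \<bar>s * z\<bar> \<le> 1 / 2"
proof (cases "t = 0")
  case True
  then show ?thesis
    using assms by (intro exI[of _ "1 / (2 * \<bar>z\<bar>)"]) (auto simp: abs_mult)
next
  case False
  define \<theta> where "\<theta> = t * \<bar>z\<bar>"
  have \<theta>: "0 < \<theta>" "\<theta> \<le> 1 / 2" using False assms by (auto simp: \<theta>_def)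
  define k where "k = \<lfloor>1 / (2 * \<theta>)\<rfloor>"
  have k1: "1 \<le> k" using \<theta> by (simp add: k_def le_floor_iff field_simps)
  have k: "of_int k \<le> 1 / (2 * \<theta>)" "1 / (2 * \<theta>) < of_int k + 1"
    by (simp_all add: k_def)
  have up: "of_int k * \<theta> \<le> 1 / 2" using k(1) \<theta> by (simp add: field_simps)
  have "1 / 2 < of_int k * \<theta> + \<theta>" using k(2) \<theta> by (simp add: field_simps)
  moreover have "\<theta> \<le> of_int k * \<theta>" using k1 \<theta> by simp
  ultimately have lo: "1 / 4 \<le> of_int k * \<theta>" by linarith
  have "t * of_int k \<le> 1 / (2 * \<bar>z\<bar>)"
    using up assms(3) by (simp add: \<theta>_def field_simps)
  then show ?thesis
    using assms False k1 up lo
    by (intro exI[of _ "t * of_int k"]) (auto simp: abs_mult \<theta>_def mult_ac)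
qed

text \<open>One difference is taken in each direction with |y_i| >= 1, by the step of
  \<open>exists_step\<close>. The factors 1 - exp(2 pi i s_i y_i) then have modulus at least 1,
  while the L1 norm of the mixed difference brings the product of the steps, each at most 1/(2
  |y_i|). The other directions contribute factors 1 to \<open>decay\<close>.\<close>

lemma norm_osc_le_decay:
  fixes h :: "real ^ 'd \<Rightarrow> complex"
  assumes h: "cont h" "admissible t C h"
    and K: "\<And>xs. distinct (map fst xs) \<Longrightarrow> \<forall>p\<in>set xs. 0 \<le> snd p \<and> snd p \<le> 1 \<Longrightarrow>
      L1 (\<lambda>z. mdiff xs h (gfloor t z)) \<le> K * prod_list (map snd xs)"
    and y: "\<And>i. t * \<bar>y $ i\<bar> \<le> 1 / 2"
  shows "norm (osc t h y) \<le> K * decay y"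
proof -
  have t: "0 \<le> t" using h by (simp add: admissible_def)
  have K0: "0 \<le> K"
    using order_trans[OF L1_nonneg K[of "[]"]] by simp
  define A where "A = {i. 1 \<le> \<bar>y $ i\<bar>}"
  obtain s where s: "\<And>i. i \<in> A \<Longrightarrow> 0 \<le> s i \<and> s i \<le> 1 / (2 * \<bar>y $ i\<bar>) \<and> (t = 0 \<or> (\<exists>k::int. s i = t * of_int k))
      \<and> 1 / 4 \<le> \<bar>s i * y $ i\<bar> \<and> \<bar>s i * y $ i\<bar> \<le> 1 / 2"
    using exists_step[OF t y] unfolding A_def mem_Collect_eq by metis
  obtain js where js: "set js = A" "distinct js"
    using finite_distinct_list[of A] by auto
  define xs where "xs = map (\<lambda>i. (i, s i)) js"
  have fst: "map fst xs = js" by (simp add: xs_def o_def)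
  have s1: "s i \<le> 1" if "i \<in> A" for i
  proof -
    have "1 / (2 * \<bar>y $ i\<bar>) \<le> 1" using that by (simp add: A_def field_simps)
    then show ?thesis using s[OF that] by linarith
  qed
  have xs: "\<forall>p\<in>set xs. 0 \<le> snd p \<and> snd p \<le> 1 \<and> (t = 0 \<or> (\<exists>k::int. snd p = t * of_int k))"
    using s s1 by (auto simp: xs_def js)
  have ge1: "1 \<le> norm (\<Prod>p\<leftarrow>xs. 1 - cis (2 * pi * (snd p * y $ fst p)))"
  proof -
    have "1 \<le> norm (\<Prod>p\<leftarrow>zs. 1 - cis (2 * pi * (snd p * y $ fst p)))" if "set zs \<subseteq> set xs" for zs
      using that
    proof (induction zs)
      case (Cons p zs)
      then obtain i where "p = (i, s i)" "i \<in> A" by (auto simp: xs_def js)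
      then have "1 \<le> norm (1 - cis (2 * pi * (snd p * y $ fst p)))"
        using norm_one_minus_cis[of "s i * y $ i"] s by auto
      then show ?case
        using Cons mult_mono[of 1 _ 1] by (fastforce simp: norm_mult)
    qed simp
    then show ?thesis by simp
  qed
  obtain D where D: "admissible t D (mdiff xs h)"
    using admissible_mdiff[OF h, of xs] xs by auto
  have "norm (osc t h y) \<le> norm (\<Prod>p\<leftarrow>xs. 1 - cis (2 * pi * (snd p * y $ fst p))) * norm (osc t h y)"
    using mult_right_mono[OF ge1, of "norm (osc t h y)"] by simp
  also have "\<dots> = norm (osc t (mdiff xs h) y)"
    by (simp add: osc_mdiff[OF h xs] norm_scaleC)
  also have "\<dots> \<le> L1 (\<lambda>z. mdiff xs h (gfloor t z))"
    by (rule norm_osc_le[OF D])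
  also have "\<dots> \<le> K * prod_list (map snd xs)"
    using xs js by (intro K) (auto simp: fst)
  also have "prod_list (map snd xs) = (\<Prod>i\<in>A. s i)"
    using prod.distinct_set_conv_list[OF js(2), of s] by (simp add: xs_def o_def js)
  also have "(\<Prod>i\<in>A. s i) \<le> (\<Prod>i\<in>A. 1 / max 1 \<bar>y $ i\<bar>)"
  proof (rule prod_mono)
    fix i assume i: "i \<in> A"
    then have "1 / (2 * \<bar>y $ i\<bar>) \<le> 1 / max 1 \<bar>y $ i\<bar>"
      by (intro divide_left_mono) (auto simp: A_def max_def)
    then show "0 \<le> s i \<and> s i \<le> 1 / max 1 \<bar>y $ i\<bar>" using s[OF i] by linarith
  qed
  also have "(\<Prod>i\<in>A. 1 / max 1 \<bar>y $ i\<bar>) = decay y"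
    unfolding decay_def by (intro prod.mono_neutral_left) (auto simp: A_def max_def)
  finally show ?thesis using K0 by (simp add: mult_left_mono)
qed

lemma mixed_lip_decay:
  fixes h :: "real ^ 'd \<Rightarrow> complex"
  assumes h: "cont h" "mixed_lip C h" and t: "0 \<le> t" "t \<le> 1"
    and y: "\<And>i. t * \<bar>y $ i\<bar> \<le> 1 / 2"
  shows "norm (osc t h y) \<le> 3 ^ CARD('d) * C * L1 (weight :: real ^ 'd \<Rightarrow> real) * decay y"
proof (rule norm_osc_le_decay[OF h(1) _ _ y])
  show "admissible t C h"
    using mixed_lip_wbounded[OF h(2)] t continuous_imp_ae_cont[OF h(1)] by (simp add: admissible_def)
  fix xs :: "('d \<times> real) list" assume xs: "distinct (map fst xs)" "\<forall>p\<in>set xs. 0 \<le> snd p \<and> snd p \<le> 1"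
  let ?P = "C * prod_list (map snd xs)"
  have w: "wbounded (3 ^ CARD('d) * ?P) (\<lambda>z. mdiff xs h (gfloor t z))"
    using h(2) xs t by (intro wbounded_gfloor) (auto simp: mixed_lip_def)
  have "L1 (\<lambda>z. mdiff xs h (gfloor t z)) \<le> (\<integral>x. 3 ^ CARD('d) * ?P * weight x \<partial>(lebesgue :: (real ^ 'd) measure))"
    unfolding L1_def
  proof (rule integral_mono)
    show "integrable lebesgue (\<lambda>z. norm (mdiff xs h (gfloor t z)))"
      using t continuous_imp_ae_cont[OF continuous_mdiff[OF h(1)]]
      by (intro integrable_norm_wbounded[OF _ w] ae_cont_gfloor) auto
  qed (use wboundedD[OF w] integrable_weight in auto)
  then show "L1 (\<lambda>z. mdiff xs h (gfloor t z)) \<le> 3 ^ CARD('d) * C * L1 (weight :: real ^ 'd \<Rightarrow> real) * prod_list (map snd xs)"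
    by (simp add: L1_def mult_ac)
qed

section \<open>Multiplication of a symbol by a function of one coordinate\<close>

lemma mdiff_mult_coord:
  fixes h :: "real ^ 'd \<Rightarrow> complex" and \<rho> :: "real \<Rightarrow> real"
  assumes "i \<notin> set (map fst xs)"
  shows "mdiff xs (\<lambda>z. h z * of_real (\<rho> (z $ i))) z = mdiff xs h z * of_real (\<rho> (z $ i))"
  using assms by (induction xs arbitrary: z) (auto simp: axis_def left_diff_distrib)

text \<open>The discrete product rule. The function of z_i is unaffected by differences in other
  directions, so only the one entry with direction i can fall on it, and \<open>h\<close> is then
  differenced in the remaining directions at a shifted point.\<close>

lemma mdiff_mult_coord_step:
  fixes h :: "real ^ 'd \<Rightarrow> complex" and \<rho> :: "real \<Rightarrow> real"
  assumes "distinct (map fst xs)" "(i, s) \<in> set xs"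
  shows "mdiff xs (\<lambda>z. h z * of_real (\<rho> (z $ i))) z = mdiff xs h z * of_real (\<rho> (z $ i))
    + mdiff (filter (\<lambda>p. fst p \<noteq> i) xs) h (z - s *\<^sub>R axis i 1) * of_real (\<rho> (z $ i) - \<rho> (z $ i - s))"
  using assms
proof (induction xs arbitrary: z)
  case (Cons p xs)
  show ?case
  proof (cases "p = (i, s)")
    case True
    then have i: "i \<notin> set (map fst xs)" using Cons.prems by auto
    then have "filter (\<lambda>p. fst p \<noteq> i) xs = xs" by (auto simp: filter_id_conv)
    then show ?thesis
      using True by (simp add: mdiff_mult_coord[OF i] algebra_simps)
  next
    case False
    then have is': "(i, s) \<in> set xs" using Cons.prems by auto
    then have "i \<in> fst ` set xs" by force
    then have "fst p \<noteq> i" using Cons.prems(1) by auto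
    then have f: "filter (\<lambda>p. fst p \<noteq> i) (p # xs) = p # filter (\<lambda>p. fst p \<noteq> i) xs" by simp
    have d: "distinct (map fst xs)" using Cons.prems by simp
    let ?\<eta> = "z - snd p *\<^sub>R axis (fst p) 1"
    have \<eta>: "?\<eta> $ i = z $ i" "?\<eta> - s *\<^sub>R axis i 1 = z - s *\<^sub>R axis i 1 - snd p *\<^sub>R axis (fst p) 1"
      using \<open>fst p \<noteq> i\<close> by (simp_all add: axis_def)
    show ?thesis
      unfolding f mdiff.simps Cons.IH[OF d is', of z] Cons.IH[OF d is', of ?\<eta>] \<eta>
      by (simp only: left_diff_distrib) simp
  qed
qed simp

lemma prod_list_filter_step:
  fixes xs :: "('d \<times> real) list"
  assumes "distinct (map fst xs)" "(i, s) \<in> set xs"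
  shows "prod_list (map snd xs) = s * prod_list (map snd (filter (\<lambda>p. fst p \<noteq> i) xs))"
  using assms
proof (induction xs)
  case (Cons p xs)
  show ?case
  proof (cases "p = (i, s)")
    case True
    then have "filter (\<lambda>p. fst p \<noteq> i) xs = xs" using Cons.prems by (force simp: filter_id_conv)
    then show ?thesis using True by simp
  next
    case False
    then have is': "(i, s) \<in> set xs" using Cons.prems by auto
    then have "i \<in> fst ` set xs" by force
    then have "fst p \<noteq> i" using Cons.prems(1) by auto
    then show ?thesis using Cons is' by simp
  qed
qed simp

text \<open>In the product rule the first term keeps the constant C, and the second trades the step
  s in direction i for the Lipschitz bound K s; the factor 3^d pays for the shift of the
  weight.\<close>

lemma mixed_lip_mult_coord:
  fixes h :: "real ^ 'd \<Rightarrow> complex" and \<rho> :: "real \<Rightarrow> real"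
  assumes h: "mixed_lip C h" and \<rho>: "\<And>x. \<bar>\<rho> x\<bar> \<le> 1" "\<And>x s. 0 \<le> s \<Longrightarrow> \<bar>\<rho> x - \<rho> (x - s)\<bar> \<le> K * s" and K: "0 \<le> K"
  shows "mixed_lip (C + 3 ^ CARD('d) * C * K) (\<lambda>z. h z * of_real (\<rho> (z $ i)))"
  unfolding mixed_lip_def
proof (intro allI impI)
  fix xs :: "('d \<times> real) list"
  assume xs: "distinct (map fst xs) \<and> (\<forall>p\<in>set xs. 0 \<le> snd p \<and> snd p \<le> 1)"
  let ?h = "\<lambda>z. h z * of_real (\<rho> (z $ i))"
  let ?P = "prod_list (map snd xs)"
  have P0: "0 \<le> ?P" using xs by (intro prod_list_nonneg) auto
  have C0: "0 \<le> C" using mixed_lip_wbounded[OF h] by (rule wbounded_nonneg)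
  have w: "wbounded (C * ?P) (mdiff xs h)" using h xs by (simp add: mixed_lip_def)
  show "wbounded ((C + 3 ^ CARD('d) * C * K) * ?P) (mdiff xs ?h)"
  proof (cases "i \<in> set (map fst xs)")
    case False
    have "wbounded (C * ?P) (mdiff xs ?h)"
      by (rule wbounded_mono[OF w])
        (use \<rho>(1) in \<open>simp add: mdiff_mult_coord[OF False] norm_mult mult_left_le\<close>)
    then show ?thesis
      by (rule wbounded_mono_const) (use P0 C0 K in \<open>simp add: distrib_right\<close>)
  next
    case True
    then obtain s where s: "(i, s) \<in> set xs" by auto
    let ?ys = "filter (\<lambda>p. fst p \<noteq> i) xs"
    have ys: "distinct (map fst ?ys)" "\<forall>p\<in>set ?ys. 0 \<le> snd p \<and> snd p \<le> 1"
      using xs by (auto simp: distinct_map_filter)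
    have s01: "0 \<le> s" "s \<le> 1" using xs s by auto
    have "wbounded (C * prod_list (map snd ?ys)) (mdiff ?ys h)"
      using h ys by (simp add: mixed_lip_def)
    then have w': "wbounded (3 ^ CARD('d) * (C * prod_list (map snd ?ys))) (\<lambda>z. mdiff ?ys h (z - s *\<^sub>R axis i 1))"
      by (rule wbounded_shift) (use s01 in auto)
    show ?thesis
      unfolding wbounded_def
    proof
      fix z
      have "norm (mdiff xs ?h z) \<le> norm (mdiff xs h z) * \<bar>\<rho> (z $ i)\<bar>
          + norm (mdiff ?ys h (z - s *\<^sub>R axis i 1)) * \<bar>\<rho> (z $ i) - \<rho> (z $ i - s)\<bar>"
        unfolding mdiff_mult_coord_step[OF conjunct1[OF xs] s]
        by (rule order_trans[OF norm_triangle_ineq]) (simp add: norm_mult del: of_real_diff)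
      also have "\<dots> \<le> C * ?P * weight z * 1 + 3 ^ CARD('d) * (C * prod_list (map snd ?ys)) * weight z * (K * s)"
        using wboundedD[OF w, of z] wboundedD[OF w', of z] \<rho>(1)[of "z $ i"] \<rho>(2)[OF s01(1), of "z $ i"] C0 P0 s01 K ys
        by (intro add_mono mult_mono) (auto intro!: mult_nonneg_nonneg prod_list_nonneg)
      also have "\<dots> = (C + 3 ^ CARD('d) * C * K) * ?P * weight z"
        unfolding prod_list_filter_step[OF conjunct1[OF xs] s] by (simp add: algebra_simps)
      finally show "norm (mdiff xs ?h z) \<le> (C + 3 ^ CARD('d) * C * K) * ?P * weight z" .
    qed
  qed
qed

subsection \<open>Trapezoidal cutoffs\<close>

text \<open>A plateau of half-width d with linear flanks. Only first differences in each coordinate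
  are ever taken, so Lipschitz continuity is enough.\<close>

definition trapezoid :: "real \<Rightarrow> real \<Rightarrow> real" where
  "trapezoid d x = min 1 (max 0 (2 - \<bar>x\<bar> / d))"

lemma trapezoid_bounds: "0 \<le> trapezoid d x" "trapezoid d x \<le> 1"
  by (auto simp: trapezoid_def)

lemma trapezoid_eq_1: "0 < d \<Longrightarrow> \<bar>x\<bar> \<le> d \<Longrightarrow> trapezoid d x = 1"
  by (simp add: trapezoid_def min_def max_def field_simps)

lemma trapezoid_eq_0: "0 < d \<Longrightarrow> 2 * d \<le> \<bar>x\<bar> \<Longrightarrow> trapezoid d x = 0"
  by (simp add: trapezoid_def field_simps)

lemma continuous_trapezoid [continuous_intros]:
  "0 < d \<Longrightarrow> continuous_on S f \<Longrightarrow> continuous_on S (\<lambda>x. trapezoid d (f x))"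
  unfolding trapezoid_def by (intro continuous_intros) auto

lemma trapezoid_lipschitz:
  assumes "0 < d" "0 \<le> s"
  shows "\<bar>trapezoid d x - trapezoid d (x - s)\<bar> \<le> 1 / d * s"
proof -
  have "\<bar>trapezoid d x - trapezoid d (x - s)\<bar> \<le> \<bar>\<bar>x\<bar> / d - \<bar>x - s\<bar> / d\<bar>"
    by (simp add: trapezoid_def min_def max_def abs_minus_commute)
  also have "\<dots> = \<bar>\<bar>x\<bar> - \<bar>x - s\<bar>\<bar> / d"
    using assms(1) by (simp add: diff_divide_distrib[symmetric])
  also have "\<dots> \<le> s / d"
    using assms by (intro divide_right_mono) auto
  finally show ?thesis by simp
qed

text \<open>The L1 modulus of continuity is independent of the width. For s <= d the slope 1/d acts
  on an interval of length 4d + s; for s > d the two functions are bounded by the indicators of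
  their supports, of total length 8d.\<close>

lemma nn_integral_trapezoid_diff:
  assumes "0 < d" "0 \<le> s"
  shows "(\<integral>\<^sup>+x. ennreal \<bar>trapezoid d (x - c) - trapezoid d (x - s - c)\<bar> \<partial>lborel) \<le> ennreal (8 * s)"
proof (cases "s \<le> d")
  case True
  have "(\<integral>\<^sup>+x. ennreal \<bar>trapezoid d (x - c) - trapezoid d (x - s - c)\<bar> \<partial>lborel)
      \<le> (\<integral>\<^sup>+x. ennreal (1 / d * s) * indicator {c - 2 * d..c + 2 * d + s} x \<partial>lborel)"
  proof (rule nn_integral_mono)
    fix x
    show "ennreal \<bar>trapezoid d (x - c) - trapezoid d (x - s - c)\<bar> \<le> ennreal (1 / d * s) * indicator {c - 2 * d..c + 2 * d + s} x"
    proof (cases "x \<in> {c - 2 * d..c + 2 * d + s}")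
      case True
      then show ?thesis
        using trapezoid_lipschitz[OF assms, of "x - c"] by (simp add: algebra_simps ennreal_leI)
    next
      case False
      then have "2 * d \<le> \<bar>x - c\<bar>" "2 * d \<le> \<bar>x - s - c\<bar>" using assms by auto
      then show ?thesis using assms by (simp add: trapezoid_eq_0)
    qed
  qed
  also have "\<dots> = ennreal (1 / d * s * (4 * d + s))"
    using assms by (simp add: nn_integral_cmult_indicator ennreal_mult[symmetric] algebra_simps)
  also have "\<dots> \<le> ennreal (8 * s)"
  proof (rule ennreal_leI)
    have "s * (4 * d + s) \<le> s * (8 * d)" using True assms by (intro mult_left_mono) auto
    then show "1 / d * s * (4 * d + s) \<le> 8 * s" using assms by (simp add: field_simps)
  qed
  finally show ?thesis .
next
  case False
  have "(\<integral>\<^sup>+x. ennreal \<bar>trapezoid d (x - c) - trapezoid d (x - s - c)\<bar> \<partial>lborel)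
      \<le> (\<integral>\<^sup>+x. indicator {c - 2 * d..c + 2 * d} x + indicator {c + s - 2 * d..c + s + 2 * d} x \<partial>lborel)"
  proof (rule nn_integral_mono)
    fix x
    have *: "trapezoid d (x - c) \<le> indicator {c - 2 * d..c + 2 * d} x" for x c
      using trapezoid_bounds[of d "x - c"] trapezoid_eq_0[OF assms(1), of "x - c"]
      by (auto simp: indicator_def abs_le_iff not_le)
    have "\<bar>trapezoid d (x - c) - trapezoid d (x - s - c)\<bar> \<le> trapezoid d (x - c) + trapezoid d (x - (c + s))"
      using trapezoid_bounds[of d "x - c"] trapezoid_bounds[of d "x - s - c"] by (simp add: algebra_simps abs_le_iff)
    also have "\<dots> \<le> indicator {c - 2 * d..c + 2 * d} x + indicator {c + s - 2 * d..c + s + 2 * d} x"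
      using *[of x c] *[of x "c + s"] by (intro add_mono) auto
    finally show "ennreal \<bar>trapezoid d (x - c) - trapezoid d (x - s - c)\<bar>
        \<le> indicator {c - 2 * d..c + 2 * d} x + indicator {c + s - 2 * d..c + s + 2 * d} x"
      by (auto simp: indicator_def ennreal_le_iff2 split: if_splits)
        (metis ennreal_1 ennreal_leI ennreal_numeral one_add_one)+
  qed
  also have "\<dots> = ennreal (8 * d)"
    using assms by (simp add: nn_integral_add ennreal_plus[symmetric] del: ennreal_plus)
  also have "\<dots> \<le> ennreal (8 * s)"
    using False by (intro ennreal_leI) auto
  finally show ?thesis .
qed

text \<open>In coordinate i the weight is replaced by 1 and the previous bound is used; each of the
  other coordinates contributes the integral of 1/(1 + x^2).\<close>

lemma integral_weight_trapezoid_diff: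
  "\<exists>E\<ge>0. \<forall>d c s (i :: 'd::finite). 0 < d \<longrightarrow> 0 \<le> s \<longrightarrow>
    (\<integral>x. weight x * \<bar>trapezoid d (x $ i - c) - trapezoid d (x $ i - s - c)\<bar> \<partial>(lebesgue :: (real ^ 'd) measure)) \<le> E * s"
proof -
  define \<kappa> where "\<kappa> = (\<integral>\<^sup>+x. ennreal (1 / (1 + x\<^sup>2)) \<partial>lborel)"
  have "(\<integral>\<^sup>+x. ennreal (weight x) \<partial>(lborel :: (real ^ 'd) measure)) = \<kappa> ^ CARD('d)"
    using nn_integral_lborel_vec[where 'd = 'd and f = "\<lambda>_ x. ennreal (1 / (1 + x\<^sup>2))"]
    unfolding weight_def \<kappa>_def by (subst prod_ennreal[symmetric]) simp_all
  then have "\<kappa> < \<infinity>"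
    using nn_integral_weight_finite[where 'd = 'd] by (simp add: power_less_top_ennreal)
  then obtain k where k: "\<kappa> = ennreal k" "0 \<le> k" by (cases \<kappa>) auto
  define E where "E = k ^ (CARD('d) - 1) * 8"
  have "(\<integral>x. weight x * \<bar>trapezoid d (x $ i - c) - trapezoid d (x $ i - s - c)\<bar> \<partial>(lebesgue :: (real ^ 'd) measure)) \<le> E * s"
    if ds: "0 < d" "0 \<le> s" for d c s and i :: 'd
  proof -
    let ?w = "\<lambda>x :: real. 1 / (1 + x\<^sup>2)" and ?\<tau> = "\<lambda>x. \<bar>trapezoid d (x - c) - trapezoid d (x - s - c)\<bar>"
    define g where "g j x = (if j = i then ?\<tau> x else ?w x)" for j :: 'd and x
    have c\<tau>: "cont ?\<tau>" using ds by (intro continuous_intros) auto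
    have m: "g j \<in> borel_measurable borel" for j
      using borel_measurable_continuous_onI[OF c\<tau>] by (simp add: g_def[abs_def])
    have g0: "0 \<le> g j x" for j x by (simp add: g_def)
    have le: "weight x * ?\<tau> (x $ i) \<le> (\<Prod>j\<in>UNIV. g j (x $ j))" for x :: "real ^ 'd"
    proof -
      have "weight x = ?w (x $ i) * (\<Prod>j\<in>UNIV - {i}. ?w (x $ j))"
        unfolding weight_def by (rule prod.remove) auto
      also have "\<dots> \<le> 1 * (\<Prod>j\<in>UNIV - {i}. ?w (x $ j))"
        by (intro mult_right_mono prod_nonneg) (auto simp: divide_le_eq_1 add_pos_nonneg)
      finally have "weight x * ?\<tau> (x $ i) \<le> ?\<tau> (x $ i) * (\<Prod>j\<in>UNIV - {i}. ?w (x $ j))"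
        using mult_right_mono[of "weight x" "1 * (\<Prod>j\<in>UNIV - {i}. ?w (x $ j))" "?\<tau> (x $ i)"] by (simp add: mult.commute)
      also have "(\<Prod>j\<in>UNIV - {i}. ?w (x $ j)) = (\<Prod>j\<in>UNIV - {i}. g j (x $ j))"
        by (intro prod.cong) (auto simp: g_def)
      also have "?\<tau> (x $ i) * \<dots> = (\<Prod>j\<in>UNIV. g j (x $ j))"
        by (subst (2) prod.remove[of _ i]) (auto simp: g_def)
      finally show ?thesis .
    qed
    have "(\<integral>\<^sup>+x. ennreal (weight x * ?\<tau> (x $ i)) \<partial>(lborel :: (real ^ 'd) measure)) \<le> (\<integral>\<^sup>+x. (\<Prod>j\<in>UNIV. ennreal (g j (x $ j))) \<partial>lborel)"
      using le by (intro nn_integral_mono) (simp add: prod_ennreal g0 ennreal_leI)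
    also have "\<dots> = (\<Prod>j\<in>(UNIV::'d set). \<integral>\<^sup>+x. ennreal (g j x) \<partial>lborel)"
      using m by (intro nn_integral_lborel_vec) simp
    also have "\<dots> = (\<integral>\<^sup>+x. ennreal (?\<tau> x) \<partial>lborel) * (\<Prod>j\<in>UNIV - {i}. \<integral>\<^sup>+x. ennreal (g j x) \<partial>lborel)"
      by (subst prod.remove[of _ i]) (auto simp: g_def)
    also have "(\<Prod>j\<in>UNIV - {i}. \<integral>\<^sup>+x. ennreal (g j x) \<partial>lborel) = \<kappa> ^ (CARD('d) - 1)"
      by (subst prod.cong[where h = "\<lambda>_. \<kappa>", OF refl]) (auto simp: g_def \<kappa>_def card_Diff_singleton)
    also have "(\<integral>\<^sup>+x. ennreal (?\<tau> x) \<partial>lborel) * \<kappa> ^ (CARD('d) - 1) \<le> ennreal (8 * s) * \<kappa> ^ (CARD('d) - 1)"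
      using nn_integral_trapezoid_diff[OF ds] by (intro mult_right_mono) auto
    also have "\<dots> = ennreal (E * s)"
      using k ds by (simp add: E_def ennreal_power ennreal_mult[symmetric] mult_ac)
    finally have nn: "(\<integral>\<^sup>+x. ennreal (weight x * ?\<tau> (x $ i)) \<partial>(lborel :: (real ^ 'd) measure)) \<le> ennreal (E * s)" .
    have "(\<integral>x. weight x * ?\<tau> (x $ i) \<partial>(lebesgue :: (real ^ 'd) measure))
        = enn2real (\<integral>\<^sup>+x. ennreal (weight x * ?\<tau> (x $ i)) \<partial>(lborel :: (real ^ 'd) measure))"
    proof (subst integral_eq_nn_integral)
      have "cont (\<lambda>x :: real ^ 'd. weight x * ?\<tau> (x $ i))"
        using ds by (intro continuous_intros continuous_weight) auto
      from ae_cont_measurable[OF continuous_imp_ae_cont[OF this]]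
      show "(\<lambda>x :: real ^ 'd. weight x * ?\<tau> (x $ i)) \<in> borel_measurable lebesgue" .
    qed (auto simp: nn_integral_completion)
    also have "\<dots> \<le> enn2real (ennreal (E * s))"
      using nn by (intro enn2real_mono) auto
    finally show ?thesis using k ds by (simp add: E_def)
  qed
  then show ?thesis using k by (intro exI[of _ E]) (auto simp: E_def)
qed

text \<open>The bound does not depend on the width \<open>d\<close> because the total variation of the cutoff does not.\<close>

lemma trapezoid_decay:
  fixes h :: "real ^ 'd \<Rightarrow> complex"
  assumes h: "cont h" "mixed_lip C h"
  shows "\<exists>K. \<forall>d y. 0 < d \<longrightarrow> norm (osc 0 (\<lambda>z. h z * of_real (trapezoid d (z $ i - c))) y) \<le> K * decay y"
proof -
  obtain E where E: "0 \<le> E" "\<And>d c s (i :: 'd). 0 < d \<Longrightarrow> 0 \<le> s \<Longrightarrow>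
    (\<integral>x. weight x * \<bar>trapezoid d (x $ i - c) - trapezoid d (x $ i - s - c)\<bar> \<partial>(lebesgue :: (real ^ 'd) measure)) \<le> E * s"
    using integral_weight_trapezoid_diff[where 'd = 'd] by auto
  let ?W = "L1 (weight :: real ^ 'd \<Rightarrow> real)"
  \<comment> \<open>The first summand accounts for all differences falling on \<open>h\<close>, the
    second for one of them falling on the cut-off, whose variation is integrated against the
    weight.\<close>
  define K where "K = C * ?W + 3 ^ CARD('d) * C * E"
  have C0: "0 \<le> C" using mixed_lip_wbounded[OF h(2)] by (rule wbounded_nonneg)
  have K0: "0 \<le> K" using C0 E(1) by (simp add: K_def)
  have "norm (osc 0 (\<lambda>z. h z * of_real (trapezoid d (z $ i - c))) y) \<le> K * decay y" if d: "0 < d" for d y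
  proof (rule norm_osc_le_decay)
    let ?h = "\<lambda>z. h z * of_real (trapezoid d (z $ i - c))"
    define \<rho> where "\<rho> x = trapezoid d (x - c)" for x
    have \<rho>1: "\<bar>\<rho> x\<bar> \<le> 1" for x using trapezoid_bounds[of d "x - c"] by (simp add: \<rho>_def)
    show ch: "cont ?h"
      using d by (intro continuous_intros h) auto
    have wh: "wbounded C h" by (rule mixed_lip_wbounded[OF h(2)])
    have "wbounded C ?h"
      by (rule wbounded_mono[OF wh]) (use \<rho>1 in \<open>auto simp: norm_mult \<rho>_def mult_left_le\<close>)
    then show "admissible 0 C ?h"
      using continuous_imp_ae_cont[OF ch] by (simp add: admissible_def)
    fix xs :: "('d \<times> real) list" assume xs: "distinct (map fst xs)" "\<forall>p\<in>set xs. 0 \<le> snd p \<and> snd p \<le> 1"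
    let ?P = "prod_list (map snd xs)"
    have P0: "0 \<le> ?P" using xs by (intro prod_list_nonneg) auto
    have w: "wbounded (C * ?P) (mdiff xs h)" using h xs by (simp add: mixed_lip_def)
    have iw: "integrable lebesgue (\<lambda>x :: real ^ 'd. c * weight x :: real)" for c :: real
      by (simp add: integrable_weight)
    obtain D where "admissible 0 D (mdiff xs ?h)"
      using admissible_mdiff[OF ch \<open>admissible 0 C ?h\<close>, of xs] xs(2) by auto
    then have im: "integrable lebesgue (\<lambda>z. norm (mdiff xs ?h z))"
      by (intro integrable_norm_wbounded) (auto simp: admissible_def)
    have "L1 (mdiff xs ?h) \<le> K * ?P"
    proof (cases "i \<in> set (map fst xs)")
      case False
      have "L1 (mdiff xs ?h) \<le> (\<integral>x. C * ?P * weight x \<partial>(lebesgue :: (real ^ 'd) measure))"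
        unfolding L1_def
      proof (rule integral_mono[OF im iw])
        fix x
        have "norm (mdiff xs ?h x) \<le> norm (mdiff xs h x)"
          using mdiff_mult_coord[OF False, of h \<rho> x] \<rho>1 by (simp add: \<rho>_def norm_mult mult_left_le)
        then show "norm (mdiff xs ?h x) \<le> C * ?P * weight x"
          using wboundedD[OF w, of x] by linarith
      qed
      also have "\<dots> = C * ?W * ?P" by (simp add: L1_def)
      also have "\<dots> \<le> K * ?P"
        using P0 C0 E(1) by (intro mult_right_mono) (auto simp: K_def)
      finally show ?thesis .
    next
      case True
      then obtain s where s: "(i, s) \<in> set xs" by auto
      let ?ys = "filter (\<lambda>p. fst p \<noteq> i) xs"
      let ?Q = "prod_list (map snd ?ys)"
      have ys: "distinct (map fst ?ys)" "\<forall>p\<in>set ?ys. 0 \<le> snd p \<and> snd p \<le> 1"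
        using xs by (auto simp: distinct_map_filter)
      have Q0: "0 \<le> ?Q" using ys by (intro prod_list_nonneg) auto
      have s01: "0 \<le> s" "s \<le> 1" using xs s by auto
      have "wbounded (C * ?Q) (mdiff ?ys h)"
        using h ys by (simp add: mixed_lip_def)
      then have w': "wbounded (3 ^ CARD('d) * (C * ?Q)) (\<lambda>z. mdiff ?ys h (z - s *\<^sub>R axis i 1))"
        by (rule wbounded_shift) (use s01 in auto)
      let ?t = "\<lambda>x :: real ^ 'd. weight x * \<bar>trapezoid d (x $ i - c) - trapezoid d (x $ i - s - c)\<bar>"
      have it: "integrable lebesgue ?t"
      proof (rule integrable_wbounded)
        have "cont ?t" using d by (intro continuous_intros continuous_weight) auto
        from ae_cont_measurable[OF continuous_imp_ae_cont[OF this]] show "?t \<in> borel_measurable lebesgue" .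
        show "wbounded 1 ?t"
          using trapezoid_bounds[of d] by (auto simp: wbounded_def abs_mult abs_le_iff intro!: mult_left_le) (smt (verit) trapezoid_bounds)+
      qed
      have "L1 (mdiff xs ?h) \<le> (\<integral>x. C * ?P * weight x + 3 ^ CARD('d) * (C * ?Q) * ?t x \<partial>lebesgue)"
        unfolding L1_def
      proof (rule integral_mono[OF im])
        show "integrable lebesgue (\<lambda>x. C * ?P * weight x + 3 ^ CARD('d) * (C * ?Q) * ?t x)"
          using iw[of "C * ?P"] it by (intro Bochner_Integration.integrable_add integrable_mult_right) auto
        fix x
        have "norm (mdiff xs ?h x) \<le> norm (mdiff xs h x) * \<bar>\<rho> (x $ i)\<bar>
            + norm (mdiff ?ys h (x - s *\<^sub>R axis i 1)) * \<bar>\<rho> (x $ i) - \<rho> (x $ i - s)\<bar>"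
          using mdiff_mult_coord_step[OF xs(1) s, of h \<rho> x]
            norm_triangle_ineq[of "mdiff xs h x * of_real (\<rho> (x $ i))" "mdiff ?ys h (x - s *\<^sub>R axis i 1) * of_real (\<rho> (x $ i) - \<rho> (x $ i - s))"]
          by (simp add: norm_mult \<rho>_def flip: of_real_diff)
        also have "\<dots> \<le> C * ?P * weight x * 1 + 3 ^ CARD('d) * (C * ?Q) * weight x * \<bar>\<rho> (x $ i) - \<rho> (x $ i - s)\<bar>"
          using wboundedD[OF w, of x] wboundedD[OF w', of x] \<rho>1[of "x $ i"] C0 P0 Q0
          by (intro add_mono mult_mono) auto
        finally show "norm (mdiff xs ?h x) \<le> C * ?P * weight x + 3 ^ CARD('d) * (C * ?Q) * ?t x"
          by (simp add: \<rho>_def mult_ac)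
      qed
      also have "\<dots> = C * ?P * ?W + 3 ^ CARD('d) * (C * ?Q) * (\<integral>x. ?t x \<partial>lebesgue)"
        using integrable_weight it by (subst Bochner_Integration.integral_add) (auto simp: L1_def)
      also have "\<dots> \<le> C * ?P * ?W + 3 ^ CARD('d) * (C * ?Q) * (E * s)"
        using E(2)[OF d s01(1), of i c] C0 Q0 by (intro add_left_mono mult_left_mono) auto
      also have "\<dots> = K * ?P"
        unfolding prod_list_filter_step[OF xs(1) s] K_def by (simp add: algebra_simps)
      finally show ?thesis .
    qed
    then show "L1 (\<lambda>z. mdiff xs ?h (gfloor 0 z)) \<le> K * ?P" by simp
  qed simp
  then show ?thesis by blast
qed

section \<open>Means of periodic functions\<close>

lemma nn_integral_lborel_affine:
  fixes v :: "'a::euclidean_space"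
  assumes [measurable]: "f \<in> borel_measurable borel" and c: "c \<noteq> 0"
  shows "(\<integral>\<^sup>+x. f x \<partial>lborel) = ennreal (\<bar>c\<bar> ^ DIM('a)) * (\<integral>\<^sup>+x. f (v + c *\<^sub>R x) \<partial>lborel)"
  by (subst lborel_affine[OF c, of v])
    (simp add: nn_integral_density nn_integral_distr nn_integral_cmult)

lemma Lpow_scale:
  fixes f :: "real ^ 'd \<Rightarrow> 'b::real_normed_vector"
  assumes f: "cont f" and T: "T \<in> sets borel" and r: "0 < r"
  shows "Lpow p T f = ennreal (r ^ CARD('d)) * Lpow p {x. r *\<^sub>R x \<in> T} (\<lambda>x. f (r *\<^sub>R x))"
proof -
  have m: "(\<lambda>x. ennreal (norm (f x) powr p) * indicator T x) \<in> borel_measurable borel"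
    using T by (intro borel_measurable_times_ennreal Lpow_measurable[OF f] borel_measurable_indicator)
  have "indicator T (r *\<^sub>R x) = (indicator {x. r *\<^sub>R x \<in> T} x :: ennreal)" for x
    by (simp add: indicator_def)
  then show ?thesis
    using nn_integral_lborel_affine[OF m, of r 0] r by (simp add: Lpow_def)
qed

lemma Lpow_UNIV_scale:
  fixes f :: "real ^ 'd \<Rightarrow> 'b::real_normed_vector"
  assumes f: "cont f" and r: "0 < r"
  shows "ennreal (r ^ CARD('d)) * Lpow p UNIV (\<lambda>x. f (r *\<^sub>R x)) = Lpow p UNIV f"
  using Lpow_scale[OF f _ r, of UNIV p] by simp

definition periodic :: "real \<Rightarrow> (real ^ 'd \<Rightarrow> 'b) \<Rightarrow> bool" where
  "periodic L f \<longleftrightarrow> (\<forall>x. \<forall>m\<in>int_lattice. f (x + L *\<^sub>R m) = f x)"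

abbreviation cube :: "real \<Rightarrow> (real ^ 'd) set" where
  "cube L \<equiv> cbox 0 (\<chi> i. L)"

lemma integral_periodic_cell:
  fixes H :: "real ^ 'd \<Rightarrow> real"
  assumes H: "cont H" "periodic L H" and m: "m \<in> int_lattice" and r: "0 < r"
  shows "integral (cbox ((r * L) *\<^sub>R m) ((r * L) *\<^sub>R m + (\<chi> i. r * L))) (\<lambda>y. H ((1 / r) *\<^sub>R y))
    = r ^ CARD('d) * integral (cube L) H"
proof -
  have "(H has_integral integral (cube L) H) (cube L)"
    by (intro integrable_integral integrable_continuous continuous_on_subset[OF H(1)]) simp
  from has_integral_affinity'[OF this, of "1 / r" "- (L *\<^sub>R m)"] r
  have "((\<lambda>y. H ((1 / r) *\<^sub>R y + - (L *\<^sub>R m))) has_integral integral (cube L) H /\<^sub>R (1 / r) ^ CARD('d))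
      (cbox ((0 - - (L *\<^sub>R m)) /\<^sub>R (1 / r)) (((\<chi> i. L) - - (L *\<^sub>R m)) /\<^sub>R (1 / r)))"
    by simp
  moreover have "(0 - - (L *\<^sub>R m)) /\<^sub>R (1 / r) = (r * L) *\<^sub>R m"
    "((\<chi> i. L) - - (L *\<^sub>R m)) /\<^sub>R (1 / r) = (r * L) *\<^sub>R m + (\<chi> i. r * L)"
    by (simp_all add: vec_eq_iff algebra_simps)
  moreover have "H ((1 / r) *\<^sub>R y + - (L *\<^sub>R m)) = H ((1 / r) *\<^sub>R y)" for y
  proof -
    have "- m \<in> int_lattice" using m by (simp add: int_lattice_def)
    then have "H ((1 / r) *\<^sub>R y + L *\<^sub>R (- m)) = H ((1 / r) *\<^sub>R y)"
      using H(2) unfolding periodic_def by blast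
    then show ?thesis by simp
  qed
  ultimately have "((\<lambda>y. H ((1 / r) *\<^sub>R y)) has_integral integral (cube L) H /\<^sub>R (1 / r) ^ CARD('d))
      (cbox ((r * L) *\<^sub>R m) ((r * L) *\<^sub>R m + (\<chi> i. r * L)))"
    by (simp only:)
  then show ?thesis
    using r by (simp add: integral_unique power_divide field_simps)
qed

lemma integral_UNIV_pos:
  fixes k :: "real ^ 'd \<Rightarrow> real"
  assumes k: "cont k" "bounded {x. k x \<noteq> 0}" and nonneg: "\<And>x. 0 \<le> k x" and pos: "0 < k 0"
  shows "0 < integral UNIV k"
proof -
  obtain C where C: "wbounded C k" using wbounded_compact_support[OF k] by blast
  have iU: "k integrable_on UNIV" by (rule integrable_on_wbounded[OF continuous_imp_ae_cont[OF k(1)] C])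
  let ?Q = "cbox 0 (\<chi> i. 1) :: (real ^ 'd) set"
  have iQ: "k integrable_on ?Q" by (intro integrable_continuous continuous_on_subset[OF k(1)]) simp
  have "integral ?Q k \<le> integral UNIV k"
    using nonneg by (intro integral_subset_le iQ iU) auto
  moreover have "0 \<le> integral ?Q k"
    using nonneg by (intro Henstock_Kurzweil_Integration.integral_nonneg iQ) auto
  moreover have "integral ?Q k \<noteq> 0"
  proof
    assume "integral ?Q k = 0"
    then have "(k has_integral 0) ?Q" using iQ by (simp add: has_integral_iff)
    then have "k 0 = 0"
      by (rule has_integral_0_cbox_imp_0[rotated 2])
        (auto intro!: continuous_on_subset[OF k(1)] simp: nonneg interval_ne_empty_cart mem_box_cart)
    then show False using pos by simp
  qed
  ultimately show ?thesis by linarith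
qed

text \<open>Rounding \<open>k\<close> to the grid of mesh r L makes it constant on the period cells
  of H(y / r). There the integral of H(y / r) is exactly its mean times the volume, so what is left
  is the mean times a Riemann sum of \<open>k\<close>; the rounding error vanishes in L1.\<close>

lemma periodic_mean_tendsto:
  fixes H k :: "real ^ 'd \<Rightarrow> real"
  assumes H: "cont H" "periodic L H" "\<And>x. \<bar>H x\<bar> \<le> M" and L: "0 < L"
    and k: "cont k" "bounded {x. k x \<noteq> 0}"
    and r: "\<And>n. 0 < r n" "\<And>n. r n * L \<le> 1" "r \<longlonglongrightarrow> 0"
  shows "(\<lambda>n. integral UNIV (\<lambda>y. H ((1 / r n) *\<^sub>R y) * k y)) \<longlonglongrightarrow> integral (cube L) H / L ^ CARD('d) * integral UNIV k"
proof -
  define s where "s n = r n * L" for n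
  have s: "0 < s n" "s n \<le> 1" for n using r L by (auto simp: s_def)
  have s0: "s \<longlonglongrightarrow> 0" unfolding s_def using tendsto_mult_left_zero[OF r(3)] by simp
  obtain C where C: "wbounded C k" using wbounded_compact_support[OF k] by blast
  have ack: "ae_cont k" by (rule continuous_imp_ae_cont[OF k(1)])
  have M0: "0 \<le> M" using H(3)[of 0] by linarith
  let ?c = "3 ^ CARD('d) * C"
  have wk: "wbounded ?c (\<lambda>y. k (gfloor (s n) y))" "ae_cont (\<lambda>y. k (gfloor (s n) y))" for n
    using s[of n] by (auto intro!: wbounded_gfloor[OF C] ae_cont_gfloor)
  have cH: "cont (\<lambda>y. H ((1 / r n) *\<^sub>R y))" for n
    by (intro continuous_on_compose2[OF H(1)] continuous_intros) auto
  have wH: "wbounded (M * D) (\<lambda>y. H ((1 / r n) *\<^sub>R y) * g y)" if "wbounded D g" for D n and g :: "real ^ 'd \<Rightarrow> real"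
    unfolding wbounded_def
  proof
    fix x
    have "\<bar>H ((1 / r n) *\<^sub>R x)\<bar> * \<bar>g x\<bar> \<le> M * (D * weight x)"
      using H(3) wboundedD[OF that, of x] M0 by (intro mult_mono) auto
    then show "norm (H ((1 / r n) *\<^sub>R x) * g x) \<le> M * D * weight x" by (simp add: abs_mult mult.assoc)
  qed
  have aH: "ae_cont (\<lambda>y. H ((1 / r n) *\<^sub>R y) * g y)" if "ae_cont g" for n and g :: "real ^ 'd \<Rightarrow> real"
    by (rule ae_cont_compose2[OF continuous_imp_ae_cont[OF cH[of n]] that]) (rule isCont_mult)
  define A where "A n = integral UNIV (\<lambda>y. H ((1 / r n) *\<^sub>R y) * k y)" for n
  define B where "B n = integral UNIV (\<lambda>y. H ((1 / r n) *\<^sub>R y) * k (gfloor (s n) y))" for n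
  define D where "D n = integral UNIV (\<lambda>y. k (gfloor (s n) y))" for n
  have L0: "(\<lambda>n. L1 (\<lambda>y. k y - k (gfloor (s n) y))) \<longlonglongrightarrow> 0"
  proof (rule L1_tendsto_0[where N = "{}"])
    show "ae_cont (\<lambda>y. k y - k (gfloor (s n) y))" "wbounded (C + ?c) (\<lambda>y. k y - k (gfloor (s n) y))" for n
      by (intro ae_cont_diff wbounded_diff ack C wk)+
    fix y
    have "(\<lambda>n. k (gfloor (s n) y)) \<longlonglongrightarrow> k y"
      using k(1) gfloor_tendsto[of s y] s0 s
      by (intro isCont_tendsto_compose[of _ k]) (auto simp: continuous_on_eq_continuous_at less_imp_le)
    then show "(\<lambda>n. k y - k (gfloor (s n) y)) \<longlonglongrightarrow> 0"
      using tendsto_diff[OF tendsto_const, of _ "k y" sequentially "k y"] by simp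
  qed simp
  have AB: "norm (A n - B n) \<le> M * L1 (\<lambda>y. k y - k (gfloor (s n) y))" for n
  proof -
    let ?d = "\<lambda>y. k y - k (gfloor (s n) y)"
    have d: "ae_cont ?d" "wbounded (C + ?c) ?d"
      by (intro ae_cont_diff wbounded_diff ack C wk)+
    have "norm (A n - B n) \<le> L1 (\<lambda>y. H ((1 / r n) *\<^sub>R y) * k y - H ((1 / r n) *\<^sub>R y) * k (gfloor (s n) y))"
      unfolding A_def B_def by (rule norm_integral_diff_le_L1[OF aH[OF ack] wH[OF C] aH[OF wk(2)] wH[OF wk(1)]])
    also have "\<dots> = L1 (\<lambda>y. H ((1 / r n) *\<^sub>R y) * ?d y)"
      by (simp add: right_diff_distrib)
    also have "\<dots> \<le> L1 (\<lambda>y. M * ?d y)"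
    proof (rule L1_mono[OF aH[OF d(1)] wH[OF d(2)]])
      show "ae_cont (\<lambda>y. M * ?d y)"
        by (rule ae_cont_compose[OF d(1)]) (rule isCont_mult[OF continuous_const])
      show "wbounded (M * (C + ?c)) (\<lambda>y. M * ?d y)"
        using d(2) M0 by (simp add: wbounded_def abs_mult mult.assoc mult_left_mono)
      show "norm (H ((1 / r n) *\<^sub>R y) * ?d y) \<le> norm (M * ?d y)" for y
        using H(3) M0 by (simp add: abs_mult mult_right_mono)
    qed
    also have "\<dots> = M * L1 ?d"
      using M0 by (simp add: L1_def abs_mult)
    finally show ?thesis .
  qed
  have AB0: "(\<lambda>n. A n - B n) \<longlonglongrightarrow> 0"
    by (rule Lim_null_comparison[OF always_eventually[OF allI[OF AB]]])
      (use tendsto_mult_left[OF L0, of M] in simp)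
  have D0: "D \<longlonglongrightarrow> integral UNIV k"
  proof -
    have "norm (D n - integral UNIV k) \<le> L1 (\<lambda>y. k y - k (gfloor (s n) y))" for n
      using norm_integral_diff_le_L1[OF ack C wk(2,1)[of n]] by (simp add: D_def norm_minus_commute)
    then have "(\<lambda>n. D n - integral UNIV k) \<longlonglongrightarrow> 0"
      by (intro Lim_null_comparison[OF always_eventually[OF allI] L0])
    then show ?thesis by (rule LIM_zero_cancel)
  qed
  have BD: "B n = integral (cube L) H / L ^ CARD('d) * D n" for n
  proof -
    obtain R where R: "\<And>x. k x \<noteq> 0 \<Longrightarrow> norm x \<le> R" using k(2) by (auto simp: bounded_iff)
    define N where "N = nat \<lceil>R / s n\<rceil>"
    let ?F = "lattice_box N :: (real ^ 'd) set"
    define G where "G x = (if x \<in> (\<lambda>m. s n *\<^sub>R m) ` ?F then k x else 0)" for x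
    have kG: "k (gfloor (s n) y) = G (gfloor (s n) y)" for y
    proof (cases "k (gfloor (s n) y) = 0")
      case False
      have "\<bar>gfloor (s n) y $ i\<bar> \<le> s n * real N" for i
      proof -
        have "\<bar>gfloor (s n) y $ i\<bar> \<le> R" using R[OF False] component_le_norm_cart order_trans by blast
        also have "R = s n * (R / s n)" using s(1)[of n] by simp
        also have "\<dots> \<le> s n * real N" using s(1)[of n] by (intro mult_left_mono) (auto simp: N_def real_nat_ceiling_ge)
        finally show ?thesis .
      qed
      then have "gfloor (s n) y \<in> (\<lambda>m. s n *\<^sub>R m) ` ?F"
        by (intro gfloor_in_lattice_box s)
      then show ?thesis by (simp add: G_def)
    qed (simp add: G_def)
    have G: "\<And>x. x \<notin> (\<lambda>m. s n *\<^sub>R m) ` ?F \<Longrightarrow> G x = 0" by (simp add: G_def)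
    have 1: "D n = (\<Sum>m\<in>?F. s n ^ CARD('d) * G (s n *\<^sub>R m))"
      using has_integral_gfloor[OF s(1)[of n] finite_lattice_box[of N] lattice_box_subset, of G, OF G] by (simp add: D_def kG integral_unique)
    have 2: "B n = (\<Sum>m\<in>?F. r n ^ CARD('d) * integral (cube L) H * G (s n *\<^sub>R m))"
    proof -
      have "B n = (\<Sum>m\<in>?F. integral (cbox (s n *\<^sub>R m) (s n *\<^sub>R m + (\<chi> i. s n))) (\<lambda>y. H ((1 / r n) *\<^sub>R y)) * G (s n *\<^sub>R m))"
        using has_integral_gfloor_weighted[OF s(1)[of n] finite_lattice_box[of N] lattice_box_subset cH[of n], of G, OF G] by (simp add: B_def kG integral_unique)
      also have "\<dots> = (\<Sum>m\<in>?F. r n ^ CARD('d) * integral (cube L) H * G (s n *\<^sub>R m))"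
        using lattice_box_subset unfolding s_def
        by (intro sum.cong refl) (subst integral_periodic_cell[OF H(1,2) _ r(1)], auto)
      finally show ?thesis .
    qed
    have e: "s n ^ CARD('d) = r n ^ CARD('d) * L ^ CARD('d)" by (simp add: s_def power_mult_distrib)
    show ?thesis
      unfolding 1 2 e sum_distrib_left using L by (intro sum.cong) auto
  qed
  have "(\<lambda>n. integral (cube L) H / L ^ CARD('d) * D n) \<longlonglongrightarrow> integral (cube L) H / L ^ CARD('d) * integral UNIV k"
    by (intro tendsto_mult_left D0)
  then have "B \<longlonglongrightarrow> integral (cube L) H / L ^ CARD('d) * integral UNIV k"
    by (simp add: BD[abs_def])
  from tendsto_add[OF AB0 this] show ?thesis
    by (simp add: A_def)
qed

lemma bounded_periodic:
  fixes P :: "real ^ 'd \<Rightarrow> 'b::real_normed_vector"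
  assumes P: "cont P" "periodic L P" and L: "0 < L"
  shows "\<exists>M. \<forall>x. norm (P x) \<le> M"
proof -
  have "bounded (P ` cube L)"
    by (intro compact_imp_bounded compact_continuous_image compact_cbox continuous_on_subset[OF P(1)]) simp
  then obtain M where M: "\<And>x. x \<in> cube L \<Longrightarrow> norm (P x) \<le> M" unfolding bounded_iff by auto
  have "norm (P x) \<le> M" for x
  proof -
    obtain m where m: "m \<in> int_lattice" "gfloor L x = L *\<^sub>R m" using gfloor_in_lattice[OF L] by blast
    have "x - L *\<^sub>R m \<in> cube L"
      using gfloor_bounds[OF L, of x] unfolding m(2) by (auto simp: mem_box_cart less_imp_le algebra_simps)
    moreover have "P (x - L *\<^sub>R m + L *\<^sub>R m) = P (x - L *\<^sub>R m)"
      using P(2) m(1) unfolding periodic_def by blast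
    ultimately show ?thesis using M by simp
  qed
  then show ?thesis by blast
qed

section \<open>Limits of p-th powers for modulated periodic functions\<close>

lemma Lpow_cbox_eq_integral:
  fixes P :: "real ^ 'd \<Rightarrow> 'b::real_normed_vector"
  assumes P: "cont P" and p: "0 < p"
  shows "Lpow p (cbox a b) P = ennreal (integral (cbox a b) (\<lambda>x. norm (P x) powr p))"
proof -
  have "((\<lambda>x. norm (P x) powr p) has_integral integral (cbox a b) (\<lambda>x. norm (P x) powr p)) (cbox a b)"
    using p by (intro integrable_integral integrable_continuous continuous_on_powr' continuous_intros
        continuous_on_subset[OF P]) auto
  from nn_integral_has_integral_lebesgue'[OF _ this] show ?thesis
    by (simp add: Lpow_def)
qed

lemma Lpow_compact_support_eq_integral:
  fixes f :: "real ^ 'd \<Rightarrow> 'b::real_normed_vector"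
  assumes f: "cont f" "bounded {x. f x \<noteq> 0}" and p: "0 < p"
  shows "Lpow p UNIV f = ennreal (integral UNIV (\<lambda>x. norm (f x) powr p))"
proof -
  have c: "cont (\<lambda>x. norm (f x) powr p)"
    using p by (intro continuous_on_powr' continuous_intros f) auto
  have "bounded {x. norm (f x) powr p \<noteq> 0}" using f(2) by simp
  then obtain C where "wbounded C (\<lambda>x. norm (f x) powr p)" using wbounded_compact_support[OF c] by blast
  then have "((\<lambda>x. norm (f x) powr p) has_integral integral UNIV (\<lambda>x. norm (f x) powr p)) UNIV"
    by (intro integrable_integral integrable_on_wbounded continuous_imp_ae_cont c)
  from nn_integral_has_integral_lebesgue'[OF _ this] show ?thesis
    by (simp add: Lpow_def)
qed

text \<open>After the substitution y = r x the normalized power is the integral of |P(y / r)|^p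
  against |psi(y)|^p, to which the convergence of periodic means applies.\<close>

lemma Lpow_modulated_tendsto:
  fixes P :: "real ^ 'd \<Rightarrow> 'b::complex_banach" and \<psi> :: "real ^ 'd \<Rightarrow> complex"
  assumes P: "cont P" "periodic L P" and L: "0 < L" and p: "0 < p"
    and \<psi>: "cont \<psi>" "bounded {x. \<psi> x \<noteq> 0}"
    and r: "\<And>n. 0 < r n" "\<And>n. r n * L \<le> 1" "r \<longlonglongrightarrow> 0"
  shows "(\<lambda>n. ennreal (r n ^ CARD('d)) * Lpow p UNIV (\<lambda>x. \<psi> (r n *\<^sub>R x) *\<^sub>C P x)) \<longlonglongrightarrow>
    ennreal (1 / L ^ CARD('d)) * Lpow p (cube L) P * Lpow p UNIV \<psi>"
proof -
  let ?H = "\<lambda>x. norm (P x) powr p" and ?k = "\<lambda>x. norm (\<psi> x) powr p"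
  obtain M where M: "\<And>x. norm (P x) \<le> M" using bounded_periodic[OF P L] by blast
  have cP: "cont (\<lambda>y. P ((1 / r n) *\<^sub>R y))" for n
    by (intro continuous_on_compose2[OF P(1)] continuous_intros) auto
  have eq: "ennreal (r n ^ CARD('d)) * Lpow p UNIV (\<lambda>x. \<psi> (r n *\<^sub>R x) *\<^sub>C P x)
      = ennreal (integral UNIV (\<lambda>y. ?H ((1 / r n) *\<^sub>R y) * ?k y))" for n
  proof -
    let ?f = "\<lambda>y. \<psi> y *\<^sub>C P ((1 / r n) *\<^sub>R y)"
    have c: "cont ?f" by (intro continuous_intros \<psi> cP)
    have "bounded {y. ?f y \<noteq> 0}"
      by (rule bounded_subset[OF \<psi>(2)]) (auto simp: scaleC.zero_left)
    then have "Lpow p UNIV ?f = ennreal (integral UNIV (\<lambda>y. norm (?f y) powr p))"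
      by (intro Lpow_compact_support_eq_integral c p)
    also have "(\<lambda>y. norm (?f y) powr p) = (\<lambda>y. ?H ((1 / r n) *\<^sub>R y) * ?k y)"
      by (simp add: norm_scaleC powr_mult mult.commute)
    finally show ?thesis
      using Lpow_UNIV_scale[OF c r(1)[of n], of p] r(1)[of n] by simp
  qed
  have "(\<lambda>n. integral UNIV (\<lambda>y. ?H ((1 / r n) *\<^sub>R y) * ?k y)) \<longlonglongrightarrow> integral (cube L) ?H / L ^ CARD('d) * integral UNIV ?k"
  proof (rule periodic_mean_tendsto[OF _ _ _ L _ _ r])
    show "cont ?H" "cont ?k"
      using p by (intro continuous_on_powr' continuous_intros P \<psi>; simp)+
    show "periodic L ?H" using P(2) by (simp add: periodic_def)
    show "bounded {x. ?k x \<noteq> 0}" using \<psi>(2) by simp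
    show "\<bar>?H x\<bar> \<le> M powr p" for x using M p by (simp add: powr_mono2)
  qed
  then have "(\<lambda>n. ennreal (integral UNIV (\<lambda>y. ?H ((1 / r n) *\<^sub>R y) * ?k y))) \<longlonglongrightarrow> ennreal (integral (cube L) ?H / L ^ CARD('d) * integral UNIV ?k)"
    by (rule tendsto_ennrealI)
  moreover have "ennreal (integral (cube L) ?H / L ^ CARD('d) * integral UNIV ?k)
      = ennreal (1 / L ^ CARD('d)) * Lpow p (cube L) P * Lpow p UNIV \<psi>"
  proof -
    have "0 \<le> integral (cube L) ?H"
      using p by (intro Henstock_Kurzweil_Integration.integral_nonneg integrable_continuous continuous_on_powr'
          continuous_intros continuous_on_subset[OF P(1)]) auto
    then show ?thesis
      unfolding Lpow_cbox_eq_integral[OF P(1) p] Lpow_compact_support_eq_integral[OF \<psi> p]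
      using L by (simp add: ennreal_mult'[symmetric] ennreal_mult''[symmetric])
  qed
  ultimately show ?thesis by (simp add: eq)
qed

lemma exists_scales:
  assumes L: "0 < (L :: real)"
  shows "\<exists>r :: nat \<Rightarrow> real. (\<forall>n. 0 < r n) \<and> (\<forall>n. r n * L \<le> 1) \<and> (\<forall>n. r n \<le> 1) \<and> r \<longlonglongrightarrow> 0"
proof -
  define r where "r n = 1 / ((real n + 1) * (1 + L))" for n :: nat
  have "1 * L \<le> (real n + 1) * (1 + L)" "1 * 1 \<le> (real n + 1) * (1 + L)" for n
    using L by (intro mult_mono; simp)+
  then have "0 < r n" "r n * L \<le> 1" "r n \<le> 1" for n
    using L by (simp_all add: r_def divide_le_eq_1)
  moreover have "r \<longlonglongrightarrow> 0"
  proof -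
    have "(\<lambda>n. inverse (real (Suc n)) * (1 / (1 + L))) \<longlonglongrightarrow> 0 * (1 / (1 + L))"
      by (intro tendsto_mult LIMSEQ_inverse_real_of_nat tendsto_const)
    moreover have "inverse (real (Suc n)) * (1 / (1 + L)) = r n" for n by (simp add: r_def field_simps)
    ultimately show ?thesis by simp
  qed
  ultimately show ?thesis by blast
qed

text \<open>Instead of cutting the cell and moving the pieces, the means of the function and of its
  translate by \<open>a\<close> are compared: after rescaling the translation is by r a, which tends
  to 0, so the two means agree.\<close>

lemma Lpow_cube_shift:
  fixes P :: "real ^ 'd \<Rightarrow> 'b::real_normed_vector" and a :: "real ^ 'd"
  assumes P: "cont P" "periodic L P" and L: "0 < L" and p: "0 < p"
  shows "Lpow p (cbox a (a + (\<chi> i. L))) P = Lpow p (cube L) P"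
proof -
  let ?H = "\<lambda>x. norm (P x) powr p"
  obtain M where M: "\<And>x. norm (P x) \<le> M" using bounded_periodic[OF P L] by blast
  have H: "cont ?H" "periodic L ?H" "\<And>x. \<bar>?H x\<bar> \<le> M powr p"
  proof -
    show "cont ?H" using p by (intro continuous_on_powr' continuous_intros P) simp
    show "periodic L ?H" using P(2) by (simp add: periodic_def)
    show "\<bar>?H x\<bar> \<le> M powr p" for x using M p by (simp add: powr_mono2)
  qed
  define H' where "H' x = ?H (x + a)" for x
  have H': "cont H'" "periodic L H'" "\<And>x. \<bar>H' x\<bar> \<le> M powr p"
  proof -
    show "cont H'" unfolding H'_def
      by (intro continuous_on_compose2[OF H(1)] continuous_intros) auto
    show "periodic L H'"
      unfolding periodic_def H'_def
    proof (intro allI ballI)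
      fix x m :: "real ^ 'd" assume "m \<in> int_lattice"
      then have "?H ((x + a) + L *\<^sub>R m) = ?H (x + a)" using H(2) unfolding periodic_def by blast
      then show "?H (x + L *\<^sub>R m + a) = ?H (x + a)" by (simp add: add_ac)
    qed
    show "\<bar>H' x\<bar> \<le> M powr p" for x using H(3) by (simp add: H'_def)
  qed
  obtain \<psi> :: "real ^ 'd \<Rightarrow> complex" where \<psi>: "C_infinity_compact \<psi>" "\<psi> 0 \<noteq> 0" using exists_bump by blast
  define k where "k x = norm (\<psi> x)" for x
  have k: "cont k" "bounded {x. k x \<noteq> 0}"
    using C_infinity_compactD(2,3)[OF \<psi>(1)] by (auto simp: k_def[abs_def] intro!: continuous_intros)
  obtain C where C: "wbounded C k" using wbounded_compact_support[OF k] by blast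
  have ik: "0 < integral UNIV k"
    using \<psi>(2) by (intro integral_UNIV_pos k) (auto simp: k_def)
  obtain r where r: "\<And>n. 0 < r n" "\<And>n. r n * L \<le> 1" and r1: "\<And>n. r n \<le> 1" and r0: "r \<longlonglongrightarrow> 0"
    using exists_scales[OF L] by metis
  let ?A = "\<lambda>n. integral UNIV (\<lambda>y. ?H ((1 / r n) *\<^sub>R y) * k y)"
  let ?B = "\<lambda>n. integral UNIV (\<lambda>y. H' ((1 / r n) *\<^sub>R y) * k y)"
  have lA: "?A \<longlonglongrightarrow> integral (cube L) ?H / L ^ CARD('d) * integral UNIV k"
    by (rule periodic_mean_tendsto[OF H L k r r0])
  have lB: "?B \<longlonglongrightarrow> integral (cube L) H' / L ^ CARD('d) * integral UNIV k"
    by (rule periodic_mean_tendsto[OF H' L k r r0])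
  have "(\<lambda>n. ?B n - ?A n) \<longlonglongrightarrow> 0"
  proof (rule Lim_null_comparison)
    obtain R where R: "\<And>x. k x \<noteq> 0 \<Longrightarrow> norm x \<le> R" using k(2) by (auto simp: bounded_iff)
    have cks: "cont (\<lambda>y. k (y - r n *\<^sub>R a))" for n
      by (intro continuous_on_compose2[OF k(1)] continuous_intros) auto
    have kb: "bounded (range k)"
    proof -
      obtain K where "\<And>x. norm (k x) \<le> C * weight x" using wboundedD[OF C] by blast
      moreover have "weight x \<le> 1" for x :: "real ^ 'd"
        unfolding weight_def by (intro prod_le_1) (auto simp: divide_le_eq_1 add_pos_nonneg)
      ultimately have "norm (k x) \<le> C" for x
        using wbounded_nonneg[OF C] mult_left_mono[of "weight x" 1 C] by (meson mult.right_neutral order_trans mult_left_le)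
      then show ?thesis by (auto simp: bounded_iff)
    qed
    then obtain K where K: "\<And>x. k x \<le> K" by (auto simp: bounded_iff) (meson abs_le_D1)
    \<comment> \<open>A cone that majorizes all translates of \<open>k\<close> by vectors no longer
      than \<open>a\<close>, so that a single weight bound serves for the whole sequence.\<close>
    obtain f where f: "cont f" "bounded {x. f x \<noteq> 0}" "\<And>x y :: real ^ 'd. norm y \<le> norm a \<Longrightarrow> k (x - y) \<le> f x"
    proof
      let ?f = "\<lambda>x :: real ^ 'd. \<bar>K\<bar> * max 0 (R + norm a + 1 - norm x)"
      show "cont ?f" by (intro continuous_intros)
      show "bounded {x. ?f x \<noteq> 0}"
        by (rule bounded_subset[OF bounded_cball[of 0 "R + norm a + 1"]]) (auto simp: max_def split: if_splits)
      show "k (x - y) \<le> ?f x" if "norm y \<le> norm a" for x y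
      proof (cases "k (x - y) = 0")
        case False
        then have "norm (x - y) \<le> R" by (rule R)
        then have "norm x \<le> R + norm a" using norm_triangle_sub[of x y] that by linarith
        then have "\<bar>K\<bar> * 1 \<le> ?f x" by (intro mult_left_mono) auto
        then show ?thesis using K[of "x - y"] by linarith
      qed simp
    qed
    obtain C' where C': "wbounded C' f" using wbounded_compact_support[OF f(1,2)] by blast
    have wks: "wbounded C' (\<lambda>y. k (y - r n *\<^sub>R a))" for n
    proof (rule wbounded_mono[OF C'])
      fix x
      have "norm (r n *\<^sub>R a) \<le> norm a" using r(1)[of n] r1[of n] by (simp add: mult_left_le_one_le)
      from f(3)[OF this, of x] show "norm (k (x - r n *\<^sub>R a)) \<le> norm (f x)" by (simp add: k_def)
    qed
    have M0: "0 \<le> M powr p" by simp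
    show "eventually (\<lambda>n. norm (?B n - ?A n) \<le> M powr p * L1 (\<lambda>y. k (y - r n *\<^sub>R a) - k y)) sequentially"
    proof (rule always_eventually, rule allI)
      fix n
      let ?d = "\<lambda>y. k (y - r n *\<^sub>R a) - k y"
      have wH: "wbounded (M powr p * D) (\<lambda>y. ?H ((1 / r n) *\<^sub>R y) * g y)" if "wbounded D g" for D and g :: "real ^ 'd \<Rightarrow> real"
        unfolding wbounded_def
      proof
        fix x
        have "\<bar>?H ((1 / r n) *\<^sub>R x)\<bar> * \<bar>g x\<bar> \<le> M powr p * (D * weight x)"
          using H(3) wboundedD[OF that, of x] M0 by (intro mult_mono) auto
        then show "norm (?H ((1 / r n) *\<^sub>R x) * g x) \<le> M powr p * D * weight x" by (simp add: abs_mult mult.assoc)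
      qed
      have cH: "cont (\<lambda>y. ?H ((1 / r n) *\<^sub>R y))"
        by (intro continuous_on_compose2[OF H(1)] continuous_intros) auto
      have "?B n = integral UNIV (\<lambda>y. ?H ((1 / r n) *\<^sub>R y) * k (y - r n *\<^sub>R a))"
      proof -
        define g where "g y = ?H ((1 / r n) *\<^sub>R y) * k (y - r n *\<^sub>R a)" for y
        have "(\<lambda>y. H' ((1 / r n) *\<^sub>R y) * k y) = (\<lambda>y. g (y + r n *\<^sub>R a))"
          using r(1)[of n] by (simp add: g_def H'_def scaleR_add_right)
        then have "?B n = integral UNIV (\<lambda>y. g (y + r n *\<^sub>R a))" by simp
        also have "\<dots> = integral UNIV g" by (rule integral_UNIV_shift)
        finally show ?thesis by (simp add: g_def[abs_def])
      qed
      then have "norm (?B n - ?A n) \<le> L1 (\<lambda>y. ?H ((1 / r n) *\<^sub>R y) * k (y - r n *\<^sub>R a) - ?H ((1 / r n) *\<^sub>R y) * k y)"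
        using norm_integral_diff_le_L1[OF continuous_imp_ae_cont[OF continuous_on_mult[OF cH cks]] wH[OF wks]
            continuous_imp_ae_cont[OF continuous_on_mult[OF cH k(1)]] wH[OF C]] by simp
      also have "\<dots> = L1 (\<lambda>y. ?H ((1 / r n) *\<^sub>R y) * ?d y)" by (simp add: right_diff_distrib)
      also have "\<dots> \<le> L1 (\<lambda>y. M powr p * ?d y)"
      proof (rule L1_mono)
        have cd: "cont ?d" by (intro continuous_intros cks k)
        show "ae_cont (\<lambda>y. ?H ((1 / r n) *\<^sub>R y) * ?d y)" by (intro continuous_imp_ae_cont continuous_on_mult cH cd)
        show "ae_cont (\<lambda>y. M powr p * ?d y)" by (intro continuous_imp_ae_cont continuous_intros cd)
        show "wbounded (M powr p * (C' + C)) (\<lambda>y. ?H ((1 / r n) *\<^sub>R y) * ?d y)" by (intro wH wbounded_diff wks C)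
        show "wbounded (M powr p * (C' + C)) (\<lambda>y. M powr p * ?d y)"
          using wbounded_diff[OF wks C, of n] by (simp add: wbounded_def abs_mult mult.assoc mult_left_mono)
        show "norm (?H ((1 / r n) *\<^sub>R y) * ?d y) \<le> norm (M powr p * ?d y)" for y
          using H(3) by (simp add: abs_mult mult_right_mono)
      qed
      also have "\<dots> = M powr p * L1 ?d" by (simp add: L1_def abs_mult)
      finally show "norm (?B n - ?A n) \<le> M powr p * L1 ?d" .
    qed
    have "(\<lambda>n. L1 (\<lambda>y. k (y - r n *\<^sub>R a) - k y)) \<longlonglongrightarrow> 0"
    proof (rule L1_tendsto_0[where N = "{}"])
      show "ae_cont (\<lambda>y. k (y - r n *\<^sub>R a) - k y)" for n
        by (intro continuous_imp_ae_cont continuous_intros cks k)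
      show "wbounded (C' + C) (\<lambda>y. k (y - r n *\<^sub>R a) - k y)" for n
        by (intro wbounded_diff wks C)
      fix y
      have "(\<lambda>n. y - r n *\<^sub>R a) \<longlonglongrightarrow> y - 0 *\<^sub>R a" by (intro tendsto_intros r0)
      then have "(\<lambda>n. k (y - r n *\<^sub>R a)) \<longlonglongrightarrow> k y"
        using k(1) by (intro isCont_tendsto_compose[of _ k]) (auto simp: continuous_on_eq_continuous_at)
      then show "(\<lambda>n. k (y - r n *\<^sub>R a) - k y) \<longlonglongrightarrow> 0" by (rule LIM_zero)
    qed simp
    from tendsto_mult_left[OF this, of "M powr p"]
    show "(\<lambda>n. M powr p * L1 (\<lambda>y. k (y - r n *\<^sub>R a) - k y)) \<longlonglongrightarrow> 0" by simp
  qed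
  from tendsto_add[OF this lA] have "?B \<longlonglongrightarrow> integral (cube L) ?H / L ^ CARD('d) * integral UNIV k" by simp
  from LIMSEQ_unique[OF lB this] have eq: "integral (cube L) H' = integral (cube L) ?H"
    using ik L by simp
  have "(?H has_integral integral (cbox a (a + (\<chi> i. L))) ?H) (cbox a (a + (\<chi> i. L)))"
    by (intro integrable_integral integrable_continuous continuous_on_subset[OF H(1)]) simp
  from has_integral_shift_cbox[OF this, of a] have "(H' has_integral integral (cbox a (a + (\<chi> i. L))) ?H) (cube L)"
    by (simp add: H'_def[abs_def])
  then show ?thesis
    using eq unfolding Lpow_cbox_eq_integral[OF P(1) p] by (simp add: integral_unique)
qed

section \<open>Transference\<close>

text \<open>The exceptional null set does not depend on the vector, so continuity off it applies to
  all vectors at once.\<close>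

definition multiplier :: "(real ^ 'd \<Rightarrow> ('x::complex_banach \<Rightarrow>\<^sub>L 'y::complex_banach)) \<Rightarrow> real \<Rightarrow> bool" where
  "multiplier \<phi> B \<longleftrightarrow> (\<forall>z. \<phi> z \<in> bounded_clinear_ops) \<and> (\<forall>z. norm (\<phi> z) \<le> B) \<and>
    (\<exists>N. negligible N \<and> (\<forall>z. z \<notin> N \<longrightarrow> (\<forall>a. isCont (\<lambda>z. blinfun_apply (\<phi> z) a) z)))"

lemma multiplier_norm_le:
  assumes "multiplier \<phi> B"
  shows "norm (blinfun_apply (\<phi> z) a) \<le> B * norm a"
proof -
  have "norm (blinfun_apply (\<phi> z) a) \<le> norm (\<phi> z) * norm a" by (rule norm_blinfun)
  also have "\<dots> \<le> B * norm a" using assms by (intro mult_right_mono) (auto simp: multiplier_def)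
  finally show ?thesis .
qed

lemma multiplier_bound_nonneg: "multiplier \<phi> B \<Longrightarrow> 0 \<le> B"
  unfolding multiplier_def by (meson norm_ge_zero order_trans)

lemma multiplier_scaleC:
  "multiplier \<phi> B \<Longrightarrow> blinfun_apply (\<phi> z) (c *\<^sub>C a) = c *\<^sub>C blinfun_apply (\<phi> z) a"
  by (auto simp: multiplier_def bounded_clinear_ops_def)

lemma multiplier_ae_cont:
  assumes "multiplier \<phi> B"
  shows "ae_cont (\<lambda>z. blinfun_apply (\<phi> z) a)"
  using assms unfolding multiplier_def ae_cont_def by metis

lemma multiplier_admissible:
  fixes u :: "real ^ 'd \<Rightarrow> complex"
  assumes \<phi>: "multiplier \<phi> B" and u: "admissible t C u"
  shows "admissible t (C * (B * norm a)) (\<lambda>z. u z *\<^sub>C blinfun_apply (\<phi> z) a)"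
proof -
  have "norm (u z *\<^sub>C blinfun_apply (\<phi> z) a) \<le> C * (B * norm a) * weight z" for z
  proof -
    have "norm (u z) * norm (blinfun_apply (\<phi> z) a) \<le> (C * weight z) * (B * norm a)"
      using u multiplier_norm_le[OF \<phi>, of z a] wboundedD[of C u z]
      by (intro mult_mono) (auto simp: admissible_def intro: order_trans[OF norm_ge_zero])
    then show ?thesis by (simp add: norm_scaleC mult_ac)
  qed
  moreover have "t = 0 \<longrightarrow> ae_cont (\<lambda>z. u z *\<^sub>C blinfun_apply (\<phi> z) a)"
    using u ae_cont_compose2[OF _ multiplier_ae_cont[OF \<phi>] scaleC.isCont] by (auto simp: admissible_def)
  ultimately show ?thesis
    using u by (simp add: admissible_def wbounded_def)
qed

section \<open>Linearity and continuity of the multiplier operators\<close>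

lemma fourier_transform_scaleC_right:
  fixes g :: "real ^ 'd \<Rightarrow> complex"
  assumes "admissible 0 C g"
  shows "fourier_transform (\<lambda>x. g x *\<^sub>C a) z = fourier_transform g z *\<^sub>C a"
  unfolding fourier_transform_eq_osc by (rule osc_scaleC_right[OF assms])

lemma fourier_transform_sum:
  fixes f :: "'i \<Rightarrow> real ^ 'd \<Rightarrow> 'y::complex_banach"
  assumes "finite I" "\<And>i. i \<in> I \<Longrightarrow> admissible 0 (C i) (f i)"
  shows "fourier_transform (\<lambda>x. \<Sum>i\<in>I. f i x) z = (\<Sum>i\<in>I. fourier_transform (f i) z)"
  unfolding fourier_transform_eq_osc using assms by (intro osc_sum[where C = C]) auto

lemma admissible_fourier_transform:
  fixes \<psi> :: "real ^ 'd \<Rightarrow> complex"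
  assumes "C_infinity_compact \<psi>"
  shows "\<exists>C. admissible 0 C (fourier_transform \<psi>)"
  using mixed_lip_fourier_transform[OF assms] mixed_lip_wbounded
    continuous_imp_ae_cont[OF continuous_fourier_transform[OF assms]]
  by (auto simp: admissible_def)

lemma fourier_mult_scaleC:
  fixes \<psi> :: "real ^ 'd \<Rightarrow> complex"
  assumes \<phi>: "multiplier \<phi> B" and \<psi>: "C_infinity_compact \<psi>"
  shows "fourier_mult \<phi> (\<lambda>x. \<psi> x *\<^sub>C a) = osc 0 (\<lambda>z. fourier_transform \<psi> z *\<^sub>C blinfun_apply (\<phi> z) a)"
proof -
  obtain C where "admissible 0 C \<psi>" using test_admissible[OF \<psi>] by blast
  then show ?thesis
    by (simp add: fun_eq_iff fourier_mult_def osc_def fourier_transform_scaleC_right multiplier_scaleC[OF \<phi>])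
qed

lemma fourier_mult_sum:
  fixes \<psi> :: "'i \<Rightarrow> real ^ 'd \<Rightarrow> complex"
  assumes \<phi>: "multiplier \<phi> B" and I: "finite I" and \<psi>: "\<And>i. i \<in> I \<Longrightarrow> C_infinity_compact (\<psi> i)"
  shows "fourier_mult \<phi> (\<lambda>x. \<Sum>i\<in>I. \<psi> i x *\<^sub>C a i) y = (\<Sum>i\<in>I. fourier_mult \<phi> (\<lambda>x. \<psi> i x *\<^sub>C a i) y)"
proof -
  have "\<forall>i\<in>I. \<exists>C. admissible 0 C (\<psi> i)" "\<forall>i\<in>I. \<exists>C. admissible 0 C (fourier_transform (\<psi> i))"
    using \<psi> test_admissible admissible_fourier_transform by blast+
  then obtain C D where C: "\<And>i. i \<in> I \<Longrightarrow> admissible 0 (C i) (\<psi> i)"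
    and D: "\<And>i. i \<in> I \<Longrightarrow> admissible 0 (D i) (fourier_transform (\<psi> i))"
    by metis
  have "fourier_transform (\<lambda>x. \<Sum>i\<in>I. \<psi> i x *\<^sub>C a i) z = (\<Sum>i\<in>I. fourier_transform (\<psi> i) z *\<^sub>C a i)" for z
    by (subst fourier_transform_sum[OF I admissible_scaleC[OF C]])
      (auto intro!: sum.cong fourier_transform_scaleC_right C)
  then have "fourier_mult \<phi> (\<lambda>x. \<Sum>i\<in>I. \<psi> i x *\<^sub>C a i) y
      = osc 0 (\<lambda>z. \<Sum>i\<in>I. fourier_transform (\<psi> i) z *\<^sub>C blinfun_apply (\<phi> z) (a i)) y"
    by (simp add: fourier_mult_def osc_def blinfun.sum_right multiplier_scaleC[OF \<phi>])
  also have "\<dots> = (\<Sum>i\<in>I. osc 0 (\<lambda>z. fourier_transform (\<psi> i) z *\<^sub>C blinfun_apply (\<phi> z) (a i)) y)"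
    by (rule osc_sum[OF I _ _ multiplier_admissible[OF \<phi> D]]) auto
  finally show ?thesis
    using \<psi> by (simp add: fourier_mult_scaleC[OF \<phi>])
qed

lemma continuous_fourier_mult:
  fixes \<psi> :: "real ^ 'd \<Rightarrow> complex"
  assumes \<phi>: "multiplier \<phi> B" and \<psi>: "C_infinity_compact \<psi>"
  shows "cont (fourier_mult \<phi> (\<lambda>x. \<psi> x *\<^sub>C a))"
proof -
  obtain C where "admissible 0 C (fourier_transform \<psi>)" using admissible_fourier_transform[OF \<psi>] by blast
  from multiplier_admissible[OF \<phi> this, of a] show ?thesis
    unfolding fourier_mult_scaleC[OF \<phi> \<psi>] by (intro continuous_osc_0) (auto simp: admissible_def)
qed

lemma C_infinity_compact_modulate:
  fixes \<psi> :: "real ^ 'd \<Rightarrow> complex"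
  assumes "C_infinity_compact \<psi>" "0 < r"
  shows "C_infinity_compact (\<lambda>x. character m x * \<psi> (r *\<^sub>R x))"
  using assms by (intro C_infinity_compact_mult C_infinity_compact_scale C_class_character) auto

lemma fourier_transform_modulate:
  fixes \<psi> :: "real ^ 'd \<Rightarrow> complex"
  assumes \<psi>: "C_infinity_compact \<psi>" and r: "0 < r"
  shows "fourier_transform (\<lambda>x. character m x * \<psi> (r *\<^sub>R x)) z
    = fourier_transform \<psi> ((1 / r) *\<^sub>R (z - m)) /\<^sub>R r ^ CARD('d)"
proof -
  obtain C where C: "admissible 0 C \<psi>" using test_admissible[OF \<psi>] by blast
  let ?\<eta> = "(1 / r) *\<^sub>R (z - m)"
  have "((\<lambda>x. character x (- ?\<eta>) * \<psi> x) has_integral fourier_transform \<psi> ?\<eta>) UNIV"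
    using osc_has_integral[OF C, of "- ?\<eta>"] by (simp add: fourier_transform_eq_osc scaleC_complex_def)
  from has_integral_UNIV_affine[OF this r, of 0]
  have "((\<lambda>x. character (r *\<^sub>R x) (- ?\<eta>) * \<psi> (r *\<^sub>R x)) has_integral fourier_transform \<psi> ?\<eta> /\<^sub>R r ^ CARD('d)) UNIV"
    by simp
  moreover have "character (r *\<^sub>R x) (- ?\<eta>) = character (- z) x * character m x" for x
    using r by (simp add: character_scaleR character_commute[of x] character_add_left[symmetric])
  ultimately show ?thesis
    unfolding fourier_transform_def by (simp add: scaleC_complex_def mult.assoc integral_unique)
qed

lemma L1_affine:
  fixes g :: "real ^ 'd \<Rightarrow> 'b::real_normed_vector"
  assumes g: "ae_cont g" "wbounded C g" and h: "ae_cont (\<lambda>x. g (r *\<^sub>R x + v))" "wbounded D (\<lambda>x. g (r *\<^sub>R x + v))" and r: "0 < r"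
  shows "L1 (\<lambda>x. g (r *\<^sub>R x + v)) = L1 g / r ^ CARD('d)"
proof -
  have "((\<lambda>x. norm (g x)) has_integral L1 g) UNIV"
    unfolding L1_def by (rule has_integral_integral_lebesgue[OF integrable_norm_wbounded[OF g]])
  from has_integral_UNIV_affine[OF this r, of v]
  have "((\<lambda>x. norm (g (r *\<^sub>R x + v))) has_integral L1 g /\<^sub>R r ^ CARD('d)) UNIV" by simp
  moreover have 2: "((\<lambda>x. norm (g (r *\<^sub>R x + v))) has_integral L1 (\<lambda>x. g (r *\<^sub>R x + v))) UNIV"
    unfolding L1_def by (rule has_integral_integral_lebesgue[OF integrable_norm_wbounded[OF h]])
  ultimately show ?thesis
    using has_integral_unique[OF 2] by (simp add: divide_inverse mult.commute)
qed

lemma Lpow_sum: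
  fixes f :: "'i \<Rightarrow> 'a::euclidean_space \<Rightarrow> 'b::real_normed_vector"
  assumes "finite I" "\<And>i. i \<in> I \<Longrightarrow> cont (f i)" "S \<in> sets borel" "0 < p"
    and "\<And>x. x \<in> S \<Longrightarrow> norm (F x) \<le> (\<Sum>i\<in>I. norm (f i x))"
  shows "Lpow p S F \<le> ennreal (real (card I) powr p) * (\<Sum>i\<in>I. Lpow p S (f i))"
proof -
  have "ennreal (norm (F x) powr p) * indicator S x \<le>
      ennreal (real (card I) powr p) * (\<Sum>i\<in>I. ennreal (norm (f i x) powr p) * indicator S x)" for x
  proof (cases "x \<in> S")
    case True
    have "norm (F x) powr p \<le> real (card I) powr p * (\<Sum>i\<in>I. norm (f i x) powr p)"
    proof (cases "I = {}")
      case False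
      define M where "M = Max ((\<lambda>i. norm (f i x)) ` I)"
      have M: "norm (f i x) \<le> M" if "i \<in> I" for i
        using assms(1) that by (simp add: M_def)
      have "M \<in> (\<lambda>i. norm (f i x)) ` I"
        unfolding M_def using assms(1) False by (intro Max_in) auto
      then obtain j where j: "j \<in> I" "M = norm (f j x)" by blast
      have "norm (F x) \<le> (\<Sum>i\<in>I. M)"
        using assms(5)[OF True] M by (meson order_trans sum_mono)
      then have "norm (F x) powr p \<le> (real (card I) * M) powr p"
        using assms(4) by (intro powr_mono2) auto
      also have "\<dots> = real (card I) powr p * M powr p"
        using j by (simp add: powr_mult)
      also have "M powr p \<le> (\<Sum>i\<in>I. norm (f i x) powr p)"
        unfolding j(2) using assms(1) j(1) by (intro member_le_sum) auto
      finally show ?thesis by (simp add: mult_left_mono)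
    qed (use assms(5)[OF True] assms(4) in auto)
    then have "ennreal (norm (F x) powr p) \<le> ennreal (real (card I) powr p * (\<Sum>i\<in>I. norm (f i x) powr p))"
      by (rule ennreal_leI)
    then show ?thesis
      using True by (simp add: ennreal_mult sum_nonneg sum_ennreal)
  qed simp
  then have "Lpow p S F \<le> (\<integral>\<^sup>+x. ennreal (real (card I) powr p) * (\<Sum>i\<in>I. ennreal (norm (f i x) powr p) * indicator S x) \<partial>lborel)"
    unfolding Lpow_def by (intro nn_integral_mono)
  also have "\<dots> = ennreal (real (card I) powr p) * (\<Sum>i\<in>I. Lpow p S (f i))"
  proof -
    have m: "(\<lambda>x. ennreal (norm (f i x) powr p) * indicator S x) \<in> borel_measurable lborel" if "i \<in> I" for i
      using assms(3) Lpow_measurable[OF assms(2)[OF that], of p]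
      by (intro borel_measurable_times_ennreal borel_measurable_indicator) simp_all
    show ?thesis
      unfolding Lpow_def using m by (subst nn_integral_cmult) (auto simp: nn_integral_sum)
  qed
  finally show ?thesis .
qed

lemma Lpow_scaleC_right:
  fixes f :: "'a::euclidean_space \<Rightarrow> complex"
  assumes "cont f" "S \<in> sets borel"
  shows "Lpow p S (\<lambda>x. f x *\<^sub>C b) = ennreal (norm b powr p) * Lpow p S f"
proof -
  have "(\<lambda>x. ennreal (norm (f x) powr p) * indicator S x) \<in> borel_measurable lborel"
    using assms(2) Lpow_measurable[OF assms(1), of p]
    by (intro borel_measurable_times_ennreal borel_measurable_indicator) simp_all
  then show ?thesis
    unfolding Lpow_def
    by (subst nn_integral_cmult[symmetric])
      (auto simp: norm_scaleC powr_mult ennreal_mult mult_ac intro!: nn_integral_cong)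
qed

lemma Lpow_compact_support_finite:
  fixes f :: "real ^ 'd \<Rightarrow> 'b::real_normed_vector"
  assumes "cont f" "bounded {x. f x \<noteq> 0}" "0 < p"
  shows "Lpow p UNIV f < \<infinity>"
  by (simp add: Lpow_compact_support_eq_integral[OF assms])

text \<open>This is the only way in which the hypothesis on the scalar multipliers enters.\<close>

lemma Lpow_interpolate_tendsto_0:
  fixes f :: "nat \<Rightarrow> 'a::euclidean_space \<Rightarrow> 'b::real_normed_vector"
  assumes "\<And>n. cont (f n)" "\<And>n. S n \<in> sets borel" "0 < q" "q < p"
    and \<sigma>: "\<And>n x. x \<in> S n \<Longrightarrow> norm (f n x) \<le> \<sigma> n" "\<sigma> \<longlonglongrightarrow> 0" "\<And>n. 0 \<le> \<sigma> n"
    and K: "\<And>n. w n * Lpow q (S n) (f n) \<le> ennreal K"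
  shows "(\<lambda>n. w n * Lpow p (S n) (f n)) \<longlonglongrightarrow> 0"
proof (rule tendsto_sandwich[OF _ _ tendsto_const])
  have "w n * Lpow p (S n) (f n) \<le> ennreal (\<sigma> n powr (p - q)) * ennreal K" for n
  proof -
    have "w n * Lpow p (S n) (f n) \<le> w n * (ennreal (\<sigma> n powr (p - q)) * Lpow q (S n) (f n))"
      using assms by (intro mult_left_mono Lpow_interpolate) auto
    also have "\<dots> = ennreal (\<sigma> n powr (p - q)) * (w n * Lpow q (S n) (f n))" by (simp add: mult_ac)
    also have "\<dots> \<le> ennreal (\<sigma> n powr (p - q)) * ennreal K" by (intro mult_left_mono K) simp
    finally show ?thesis .
  qed
  then show "eventually (\<lambda>n. w n * Lpow p (S n) (f n) \<le> ennreal (\<sigma> n powr (p - q)) * ennreal K) sequentially"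
    by simp
  have "(\<lambda>n. \<sigma> n powr (p - q)) \<longlonglongrightarrow> 0 powr (p - q)"
    using assms by (intro tendsto_powr' tendsto_const \<sigma>) auto
  then have "(\<lambda>n. ennreal (\<sigma> n powr (p - q))) \<longlonglongrightarrow> 0"
    using tendsto_ennrealI by fastforce
  then have "(\<lambda>n. ennreal K * ennreal (\<sigma> n powr (p - q))) \<longlonglongrightarrow> 0"
    by (rule ennreal_tendsto_cmult_0)
  then show "(\<lambda>n. ennreal (\<sigma> n powr (p - q)) * ennreal K) \<longlonglongrightarrow> 0"
    by (simp add: mult.commute)
qed simp

lemma multiplier_affine:
  fixes \<phi> :: "real ^ 'd \<Rightarrow> ('x::complex_banach \<Rightarrow>\<^sub>L 'y::complex_banach)"
  assumes \<phi>: "multiplier \<phi> B" and r: "0 < r"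
  shows "multiplier (\<lambda>z. \<phi> (r *\<^sub>R z + v)) B"
proof -
  obtain N where N: "negligible N" "\<And>z a. z \<notin> N \<Longrightarrow> isCont (\<lambda>z. blinfun_apply (\<phi> z) a) z"
    using \<phi> unfolding multiplier_def by blast
  let ?N = "(\<lambda>z. (1 / r) *\<^sub>R (z - v)) ` N"
  have "negligible ?N"
    by (rule negligible_differentiable_image_negligible[OF _ N(1)])
      (auto simp: differentiable_on_def intro!: derivative_intros)
  moreover have "isCont (\<lambda>z. blinfun_apply (\<phi> (r *\<^sub>R z + v)) a) z" if "z \<notin> ?N" for z a
  proof -
    have "z = (1 / r) *\<^sub>R ((r *\<^sub>R z + v) - v)" using r by simp
    then have "r *\<^sub>R z + v \<notin> N" using that by blast
    then show ?thesis
      by (intro isCont_o2[of z "\<lambda>z. r *\<^sub>R z + v" "\<lambda>\<zeta>. blinfun_apply (\<phi> \<zeta>) a"] N(2) continuous_intros)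
  qed
  ultimately show ?thesis
    using \<phi> unfolding multiplier_def by blast
qed

text \<open>Hypothesis (4) for a single vector, in terms of q-th powers and for all exponents at
  once.\<close>

definition Lq_bounded :: "(real ^ 'd \<Rightarrow> ('x::complex_banach \<Rightarrow>\<^sub>L 'y::complex_banach)) \<Rightarrow> 'x \<Rightarrow> bool" where
  "Lq_bounded \<phi> a \<longleftrightarrow> (\<forall>q>1. \<exists>C. \<forall>f. C_infinity_compact f \<longrightarrow>
    Lpow q UNIV (fourier_mult \<phi> (\<lambda>x. f x *\<^sub>C a)) \<le> ennreal C * Lpow q UNIV f)"

text \<open>The transform of the modulated and dilated bump concentrates at \<open>m\<close>, where
  the multiplier is continuous, so the operator acts on it almost like the constant
  \<open>blinfun_apply (\<phi> m)\<close>. The weight r^d makes the powers of the bump independent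
  of n.\<close>

lemma transference_error_single:
  fixes \<phi> :: "real ^ 'd \<Rightarrow> ('x::complex_banach \<Rightarrow>\<^sub>L 'y::complex_banach)" and \<psi> :: "real ^ 'd \<Rightarrow> complex"
  assumes \<phi>: "multiplier \<phi> B" and bd: "Lq_bounded \<phi> a" and cont: "isCont (\<lambda>z. blinfun_apply (\<phi> z) a) m"
    and \<psi>: "C_infinity_compact \<psi>" and p: "1 < p" and r: "\<And>n. 0 < r n" "r \<longlonglongrightarrow> 0"
  defines "g \<equiv> \<lambda>n x. character m x * \<psi> (r n *\<^sub>R x)"
  shows "(\<lambda>n. ennreal (r n ^ CARD('d)) * Lpow p UNIV (\<lambda>x. fourier_mult \<phi> (\<lambda>x. g n x *\<^sub>C a) x - g n x *\<^sub>C blinfun_apply (\<phi> m) a)) \<longlonglongrightarrow> 0"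
proof -
  let ?b = "blinfun_apply (\<phi> m) a"
  define E where "E n x = fourier_mult \<phi> (\<lambda>x. g n x *\<^sub>C a) x - g n x *\<^sub>C ?b" for n x
  define h where "h n \<eta> = fourier_transform \<psi> \<eta> *\<^sub>C (blinfun_apply (\<phi> (r n *\<^sub>R \<eta> + m)) a - ?b)" for n \<eta>
  define q where "q = (1 + p) / 2"
  have q: "1 < q" "q < p" using p by (auto simp: q_def)
  have g: "C_infinity_compact (g n)" for n
    unfolding g_def by (rule C_infinity_compact_modulate[OF \<psi> r(1)])
  obtain C where C: "admissible 0 C (fourier_transform \<psi>)" using admissible_fourier_transform[OF \<psi>] by blast
  have ad: "admissible 0 (D * (B * norm a) + D * norm ?b) (\<lambda>z. u z *\<^sub>C (blinfun_apply (\<theta> z) a - ?b))"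
    if "multiplier \<theta> B" "admissible 0 D u" for \<theta> D and u :: "real ^ 'd \<Rightarrow> complex"
    unfolding scaleC.diff_right
    by (intro admissible_diff multiplier_admissible[OF that] admissible_scaleC that(2))
  have \<phi>n: "multiplier (\<lambda>\<eta>. \<phi> (r n *\<^sub>R \<eta> + m)) B" for n
    by (rule multiplier_affine[OF \<phi> r(1)])
  have h: "admissible 0 (C * (B * norm a) + C * norm ?b) (h n)" for n
    unfolding h_def by (rule ad[OF \<phi>n C])
  have "(\<lambda>n. L1 (h n)) \<longlonglongrightarrow> 0"
  proof (rule L1_tendsto_0[where N = "{}"])
    show "ae_cont (h n)" "wbounded (C * (B * norm a) + C * norm ?b) (h n)" for n
      using h by (auto simp: admissible_def)
    fix \<eta>
    have "(\<lambda>n. r n *\<^sub>R \<eta> + m) \<longlonglongrightarrow> 0 *\<^sub>R \<eta> + m" by (intro tendsto_intros r)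
    then have "(\<lambda>n. blinfun_apply (\<phi> (r n *\<^sub>R \<eta> + m)) a) \<longlonglongrightarrow> ?b"
      by (intro isCont_tendsto_compose[OF cont]) simp
    then have "(\<lambda>n. blinfun_apply (\<phi> (r n *\<^sub>R \<eta> + m)) a - ?b) \<longlonglongrightarrow> 0" by (rule LIM_zero)
    from scaleC.tendsto[OF tendsto_const this, of "fourier_transform \<psi> \<eta>"]
    show "(\<lambda>n. h n \<eta>) \<longlonglongrightarrow> 0" by (simp add: h_def scaleC.zero_right)
  qed simp
  moreover have sup: "norm (E n x) \<le> L1 (h n)" for n x
  proof -
    obtain D where D: "admissible 0 D (fourier_transform (g n))" using admissible_fourier_transform[OF g] by blast
    let ?u = "\<lambda>z. fourier_transform (g n) z *\<^sub>C (blinfun_apply (\<phi> z) a - ?b)"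
    have "osc 0 ?u x = osc 0 (\<lambda>z. fourier_transform (g n) z *\<^sub>C blinfun_apply (\<phi> z) a) x
        - osc 0 (\<lambda>z. fourier_transform (g n) z *\<^sub>C ?b) x"
      unfolding scaleC.diff_right by (rule osc_diff[OF multiplier_admissible[OF \<phi> D] admissible_scaleC[OF D]])
    then have E: "E n x = osc 0 ?u x"
      by (simp add: E_def fourier_mult_scaleC[OF \<phi> g] osc_scaleC_right[OF D] fourier_inversion[OF g])
    have "norm (E n x) \<le> L1 ?u"
      unfolding E using norm_osc_le[OF ad[OF \<phi> D], of x] by simp
    \<comment> \<open>In the variable eta = (z - m) / r the factor r^(-d) of the transform cancels
      the Jacobian, so the error symbol has the same L1 norm as \<open>h n\<close>. The latter tends
      to 0 by dominated convergence.\<close>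
    also have "?u = (\<lambda>z. h n ((1 / r n) *\<^sub>R z + (- (1 / r n)) *\<^sub>R m) /\<^sub>R r n ^ CARD('d))"
      using r(1)[of n] unfolding g_def fourier_transform_modulate[OF \<psi> r(1)] h_def
      by (simp add: scaleC.scaleR_left scaleR_diff_right fun_eq_iff)
    also have "L1 \<dots> = L1 (\<lambda>z. h n ((1 / r n) *\<^sub>R z + (- (1 / r n)) *\<^sub>R m)) / r n ^ CARD('d)"
      using r(1)[of n] by (simp add: L1_def divide_inverse mult.commute)
    also have "L1 (\<lambda>z. h n ((1 / r n) *\<^sub>R z + (- (1 / r n)) *\<^sub>R m)) = L1 (h n) / (1 / r n) ^ CARD('d)"
    proof (rule L1_affine)
      have eq: "(\<lambda>z. h n ((1 / r n) *\<^sub>R z + (- (1 / r n)) *\<^sub>R m)) = (\<lambda>z. (r n ^ CARD('d)) *\<^sub>R ?u z)"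
        using r(1)[of n] unfolding g_def fourier_transform_modulate[OF \<psi> r(1)] h_def
        by (simp add: scaleC.scaleR_left scaleR_diff_right fun_eq_iff)
      have u: "ae_cont ?u" "wbounded (D * (B * norm a) + D * norm ?b) ?u"
        using ad[OF \<phi> D] by (auto simp: admissible_def)
      show "ae_cont (\<lambda>z. h n ((1 / r n) *\<^sub>R z + (- (1 / r n)) *\<^sub>R m))"
        unfolding eq by (rule ae_cont_compose[OF u(1)]) (rule continuous_scaleR[OF continuous_const])
      show "wbounded (r n ^ CARD('d) * (D * (B * norm a) + D * norm ?b)) (\<lambda>z. h n ((1 / r n) *\<^sub>R z + (- (1 / r n)) *\<^sub>R m))"
        unfolding eq wbounded_def
      proof
        fix x
        show "norm ((r n ^ CARD('d)) *\<^sub>R ?u x) \<le> r n ^ CARD('d) * (D * (B * norm a) + D * norm ?b) * weight x"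
          unfolding norm_scaleR mult.assoc[of "r n ^ CARD('d)"]
          using r(1)[of n] by (auto intro!: mult_left_mono wboundedD[OF u(2)])
      qed
    qed (use h[of n] r(1)[of n] in \<open>auto simp: admissible_def\<close>)
    finally show ?thesis
      using r(1)[of n] by (simp add: power_divide)
  qed
  have cE: "cont (E n)" for n
    unfolding E_def
    by (intro continuous_intros continuous_fourier_mult[OF \<phi> g] C_infinity_compactD(2)[OF g])
  \<comment> \<open>Both terms of the error are bounded in Lq by multiples of the bump: the first by
    hypothesis (4), the second because it is the bump times a fixed vector.\<close>
  have "\<exists>K. \<forall>n. ennreal (r n ^ CARD('d)) * Lpow q UNIV (E n) \<le> ennreal K"
  proof -
    obtain A where A: "\<And>f. C_infinity_compact f \<Longrightarrow>
        Lpow q UNIV (fourier_mult \<phi> (\<lambda>x. f x *\<^sub>C a)) \<le> ennreal A * Lpow q UNIV f"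
      using bd q(1) unfolding Lq_bounded_def by blast
    have c\<psi>: "cont \<psi>" by (rule C_infinity_compactD[OF \<psi>])
    have "Lpow q UNIV \<psi> < \<infinity>"
      using q by (intro Lpow_compact_support_finite C_infinity_compactD[OF \<psi>]) auto
    then obtain K0 where K0: "Lpow q UNIV \<psi> = ennreal K0" "0 \<le> K0" by (cases "Lpow q UNIV \<psi>") auto
    let ?c = "ennreal ((1 + 1) powr q)"
    have "ennreal (r n ^ CARD('d)) * Lpow q UNIV (E n) \<le> ?c * (ennreal A * ennreal K0) + ?c * (ennreal (norm ?b powr q) * ennreal K0)" for n
    proof -
      have gs: "ennreal (r n ^ CARD('d)) * Lpow q UNIV (g n) = ennreal K0"
      proof -
        have "Lpow q UNIV (g n) = Lpow q UNIV (\<lambda>x. \<psi> (r n *\<^sub>R x))"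
          by (rule Lpow_cong) (simp add: g_def norm_mult)
        then show ?thesis using Lpow_UNIV_scale[OF c\<psi> r(1)] K0 by simp
      qed
      have "Lpow q UNIV (E n) \<le> ennreal ((1 + 1) powr q) * Lpow q UNIV (fourier_mult \<phi> (\<lambda>x. g n x *\<^sub>C a))
          + ennreal ((1 + 1 / 1) powr q) * Lpow q UNIV (\<lambda>x. g n x *\<^sub>C ?b)"
        by (rule Lpow_triangle)
          (use q in \<open>auto simp: E_def intro!: continuous_fourier_mult[OF \<phi> g] continuous_intros C_infinity_compactD(2)[OF g] norm_triangle_ineq4\<close>)
      also have "\<dots> \<le> ?c * (ennreal A * Lpow q UNIV (g n)) + ?c * (ennreal (norm ?b powr q) * Lpow q UNIV (g n))"
        using A[OF g[of n]]
        by (intro add_mono mult_left_mono) (auto simp: Lpow_scaleC_right C_infinity_compactD(2)[OF g])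
      finally have "ennreal (r n ^ CARD('d)) * Lpow q UNIV (E n)
          \<le> ennreal (r n ^ CARD('d)) * (?c * (ennreal A * Lpow q UNIV (g n)) + ?c * (ennreal (norm ?b powr q) * Lpow q UNIV (g n)))"
        by (intro mult_left_mono) auto
      also have "\<dots> = ?c * (ennreal A * (ennreal (r n ^ CARD('d)) * Lpow q UNIV (g n)))
          + ?c * (ennreal (norm ?b powr q) * (ennreal (r n ^ CARD('d)) * Lpow q UNIV (g n)))"
        by (simp add: distrib_left mult_ac)
      finally show ?thesis by (simp only: gs)
    qed
    moreover have "?c * (ennreal A * ennreal K0) + ?c * (ennreal (norm ?b powr q) * ennreal K0) < \<infinity>"
      by (simp add: ennreal_mult_less_top)
    ultimately show ?thesis
      by (metis ennreal_enn2real infinity_ennreal_def)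
  qed
  then obtain K where "\<And>n. ennreal (r n ^ CARD('d)) * Lpow q UNIV (E n) \<le> ennreal K" by blast
  ultimately have "(\<lambda>n. ennreal (r n ^ CARD('d)) * Lpow p UNIV (E n)) \<longlonglongrightarrow> 0"
    using q by (intro Lpow_interpolate_tendsto_0[OF cE _ _ q(2) sup, where K = K]) auto
  then show ?thesis by (simp add: E_def[abs_def])
qed

section \<open>Trigonometric polynomials and transference\<close>

definition trig :: "(real ^ 'd) set \<Rightarrow> (real ^ 'd \<Rightarrow> 'x::complex_banach) \<Rightarrow> real ^ 'd \<Rightarrow> 'x" where
  "trig F a y = (\<Sum>m\<in>F. character m y *\<^sub>C a m)"

lemma continuous_trig: "continuous_on S (trig F a)"
  unfolding trig_def[abs_def] by (intro continuous_intros)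

lemma periodic_trig:
  assumes "0 < L" "F \<subseteq> (\<lambda>m. (1 / L) *\<^sub>R m) ` int_lattice"
  shows "periodic L (trig F a)"
  unfolding periodic_def
proof (intro allI ballI)
  fix x n :: "real ^ 'a" assume n: "n \<in> int_lattice"
  have "character m (x + L *\<^sub>R n) = character m x" if mF: "m \<in> F" for m
  proof -
    obtain k where k: "k \<in> int_lattice" "m = (1 / L) *\<^sub>R k" using assms(2) mF by auto
    have "k \<bullet> n \<in> \<int>"
      using k(1) n unfolding inner_vec_def int_lattice_def by (auto intro!: Ints_sum Ints_mult)
    then have "cis (2 * pi * (k \<bullet> n)) = 1" by (rule cis_multiple_2pi)
    then have "character m (L *\<^sub>R n) = 1" using assms(1) by (simp add: character_def k(2))
    then show ?thesis by (simp add: character_add_right)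
  qed
  then show "trig F a (x + L *\<^sub>R n) = trig F a x" by (simp add: trig_def)
qed

lemma transference_error:
  fixes \<phi> :: "real ^ 'd \<Rightarrow> ('x::complex_banach \<Rightarrow>\<^sub>L 'y::complex_banach)" and \<psi> :: "real ^ 'd \<Rightarrow> complex"
  assumes \<phi>: "multiplier \<phi> B" and F: "finite F"
    and bd: "\<And>m. m \<in> F \<Longrightarrow> Lq_bounded \<phi> (a m)" and cont: "\<And>m. m \<in> F \<Longrightarrow> isCont (\<lambda>z. blinfun_apply (\<phi> z) (a m)) m"
    and \<psi>: "C_infinity_compact \<psi>" and p: "1 < p" and r: "\<And>n. 0 < r n" "r \<longlonglongrightarrow> 0"
  shows "(\<lambda>n. ennreal (r n ^ CARD('d)) * Lpow p UNIV (\<lambda>x. fourier_mult \<phi> (\<lambda>x. \<psi> (r n *\<^sub>R x) *\<^sub>C trig F a x) x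
      - \<psi> (r n *\<^sub>R x) *\<^sub>C trig F (\<lambda>m. blinfun_apply (\<phi> m) (a m)) x)) \<longlonglongrightarrow> 0"
proof -
  define g where "g m n x = character m x * \<psi> (r n *\<^sub>R x)" for m n x
  define E where "E m n x = fourier_mult \<phi> (\<lambda>x. g m n x *\<^sub>C a m) x - g m n x *\<^sub>C blinfun_apply (\<phi> m) (a m)" for m n x
  have g: "C_infinity_compact (g m n)" for m n
    unfolding g_def by (rule C_infinity_compact_modulate[OF \<psi> r(1)])
  have cE: "cont (E m n)" for m n
    unfolding E_def by (intro continuous_intros continuous_fourier_mult[OF \<phi> g] C_infinity_compactD(2)[OF g])
  have tr: "\<psi> (r n *\<^sub>R x) *\<^sub>C trig F b x = (\<Sum>m\<in>F. g m n x *\<^sub>C b m)" for n x and b :: "real ^ 'd \<Rightarrow> 'c::complex_banach"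
    by (simp add: trig_def scaleC.sum_right scaleC_scaleC g_def mult.commute)
  have eq: "fourier_mult \<phi> (\<lambda>x. \<psi> (r n *\<^sub>R x) *\<^sub>C trig F a x) x
      - \<psi> (r n *\<^sub>R x) *\<^sub>C trig F (\<lambda>m. blinfun_apply (\<phi> m) (a m)) x = (\<Sum>m\<in>F. E m n x)" for n x
    unfolding tr by (simp add: fourier_mult_sum[OF \<phi> F g] E_def sum_subtractf)
  have "(\<lambda>n. ennreal (real (card F) powr p) * (\<Sum>m\<in>F. ennreal (r n ^ CARD('d)) * Lpow p UNIV (E m n)))
      \<longlonglongrightarrow> ennreal (real (card F) powr p) * (\<Sum>m\<in>F. 0)"
    unfolding E_def g_def
    by (intro ennreal_tendsto_cmult tendsto_sum transference_error_single[OF \<phi> bd cont \<psi> p r]) auto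
  then have lim: "(\<lambda>n. ennreal (real (card F) powr p) * (\<Sum>m\<in>F. ennreal (r n ^ CARD('d)) * Lpow p UNIV (E m n))) \<longlonglongrightarrow> 0"
    by simp
  show ?thesis
    unfolding eq
  proof (rule tendsto_sandwich[OF _ _ tendsto_const lim])
    have "ennreal (r n ^ CARD('d)) * Lpow p UNIV (\<lambda>x. \<Sum>m\<in>F. E m n x)
        \<le> ennreal (real (card F) powr p) * (\<Sum>m\<in>F. ennreal (r n ^ CARD('d)) * Lpow p UNIV (E m n))" for n
    proof -
      have "Lpow p UNIV (\<lambda>x. \<Sum>m\<in>F. E m n x) \<le> ennreal (real (card F) powr p) * (\<Sum>m\<in>F. Lpow p UNIV (E m n))"
        using p by (intro Lpow_sum[OF F cE]) (auto intro: norm_sum)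
      then have "ennreal (r n ^ CARD('d)) * Lpow p UNIV (\<lambda>x. \<Sum>m\<in>F. E m n x)
          \<le> ennreal (r n ^ CARD('d)) * (ennreal (real (card F) powr p) * (\<Sum>m\<in>F. Lpow p UNIV (E m n)))"
        by (intro mult_left_mono) auto
      then show ?thesis by (simp add: sum_distrib_left mult_ac)
    qed
    then show "eventually (\<lambda>n. ennreal (r n ^ CARD('d)) * Lpow p UNIV (\<lambda>x. \<Sum>m\<in>F. E m n x)
        \<le> ennreal (real (card F) powr p) * (\<Sum>m\<in>F. ennreal (r n ^ CARD('d)) * Lpow p UNIV (E m n))) sequentially"
      by simp
  qed simp
qed

lemma Lpow_test_pos:
  fixes \<psi> :: "real ^ 'd \<Rightarrow> complex"
  assumes \<psi>: "C_infinity_compact \<psi>" "\<psi> 0 \<noteq> 0" and p: "0 < p"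
  shows "0 < Lpow p UNIV \<psi>"
proof -
  have "cont (\<lambda>x. norm (\<psi> x) powr p)"
    using p by (intro continuous_on_powr' continuous_intros C_infinity_compactD[OF \<psi>(1)]) auto
  moreover have "bounded {x. norm (\<psi> x) powr p \<noteq> 0}"
    using C_infinity_compactD(3)[OF \<psi>(1)] by simp
  ultimately have "0 < integral UNIV (\<lambda>x. norm (\<psi> x) powr p)"
    using \<psi>(2) by (intro integral_UNIV_pos) auto
  then show ?thesis
    using C_infinity_compactD(2,3)[OF \<psi>(1)] p by (simp add: Lpow_compact_support_eq_integral)
qed

lemma mult_cancel_le_ennreal:
  fixes a b c d e :: ennreal
  assumes "a * b * c \<le> d * (a * e * c)" "0 < a" "a < \<infinity>" "0 < c" "c < \<infinity>"
  shows "b \<le> d * e"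
proof -
  have "(a * c) * b \<le> (a * c) * (d * e)" using assms(1) by (simp add: mult_ac)
  moreover have "a * c \<noteq> 0" "a * c \<noteq> top"
    using assms by (auto simp: ennreal_mult_eq_top_iff)
  ultimately show ?thesis by (simp add: ennreal_mult_le_mult_iff)
qed

text \<open>With weights r^d, the powers of both modulated functions converge to their powers over
  the cell times a common factor, and the inequality passes to the limit in either direction because
  the operator error vanishes. The period is left free: L = 1 serves for (i), and L = 1/t carries
  hypothesis (4) over to Riemann sums.\<close>

lemma transference:
  fixes \<phi> :: "real ^ 'd \<Rightarrow> ('x::complex_banach \<Rightarrow>\<^sub>L 'y::complex_banach)" and a :: "real ^ 'd \<Rightarrow> 'x"
  assumes \<phi>: "multiplier \<phi> B" and L: "0 < L" and F: "finite F" "F \<subseteq> (\<lambda>m. (1 / L) *\<^sub>R m) ` int_lattice"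
    and bd: "\<And>m. m \<in> F \<Longrightarrow> Lq_bounded \<phi> (a m)" and cont: "\<And>m. m \<in> F \<Longrightarrow> isCont (\<lambda>z. blinfun_apply (\<phi> z) (a m)) m"
    and p: "1 < p" and c: "0 < c"
  defines "b \<equiv> \<lambda>m. blinfun_apply (\<phi> m) (a m)"
  shows "(\<forall>\<psi>. C_infinity_compact \<psi> \<longrightarrow> Lpow p UNIV (fourier_mult \<phi> (\<lambda>x. \<psi> x *\<^sub>C trig F a x))
      \<le> ennreal c * Lpow p UNIV (\<lambda>x. \<psi> x *\<^sub>C trig F a x)) \<Longrightarrow> Lpow p (cube L) (trig F b) \<le> ennreal c * Lpow p (cube L) (trig F a)" (is "?A \<Longrightarrow> _")
    and "(\<forall>\<psi>. C_infinity_compact \<psi> \<longrightarrow> Lpow p UNIV (\<lambda>x. \<psi> x *\<^sub>C trig F a x)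
      \<le> ennreal c * Lpow p UNIV (fourier_mult \<phi> (\<lambda>x. \<psi> x *\<^sub>C trig F a x))) \<Longrightarrow> Lpow p (cube L) (trig F a) \<le> ennreal c * Lpow p (cube L) (trig F b)" (is "?B \<Longrightarrow> _")
proof -
  obtain \<psi> :: "real ^ 'd \<Rightarrow> complex" where \<psi>: "C_infinity_compact \<psi>" "\<psi> 0 \<noteq> 0" using exists_bump by blast
  obtain r where r: "\<And>n. 0 < r n" "\<And>n. r n * L \<le> 1" "r \<longlonglongrightarrow> 0"
    using exists_scales[OF L] by metis
  have p0: "0 < p" using p by simp
  let ?w = "\<lambda>n. ennreal (r n ^ CARD('d))"
  let ?f = "\<lambda>n x. \<psi> (r n *\<^sub>R x) *\<^sub>C trig F a x" and ?h = "\<lambda>n x. \<psi> (r n *\<^sub>R x) *\<^sub>C trig F b x"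
  let ?T = "\<lambda>n. fourier_mult \<phi> (?f n)"
  have \<psi>n: "C_infinity_compact (\<lambda>x. \<psi> (r n *\<^sub>R x))" for n
    using r(1)[of n] by (intro C_infinity_compact_scale \<psi>) simp
  have limf: "(\<lambda>n. ?w n * Lpow p UNIV (?f n)) \<longlonglongrightarrow> ennreal (1 / L ^ CARD('d)) * Lpow p (cube L) (trig F a) * Lpow p UNIV \<psi>"
    by (intro Lpow_modulated_tendsto continuous_trig periodic_trig L F p0 C_infinity_compactD[OF \<psi>(1)] r)
  have limh: "(\<lambda>n. ?w n * Lpow p UNIV (?h n)) \<longlonglongrightarrow> ennreal (1 / L ^ CARD('d)) * Lpow p (cube L) (trig F b) * Lpow p UNIV \<psi>"
    by (intro Lpow_modulated_tendsto continuous_trig periodic_trig L F p0 C_infinity_compactD[OF \<psi>(1)] r)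
  have err: "(\<lambda>n. ?w n * Lpow p UNIV (\<lambda>x. ?T n x - ?h n x)) \<longlonglongrightarrow> 0"
    unfolding b_def by (rule transference_error[OF \<phi> F(1) bd cont \<psi>(1) p r(1,3)])
  have ch: "cont (?h n)" for n
    by (intro continuous_intros continuous_trig C_infinity_compactD(2)[OF \<psi>n])
  have cT: "cont (?T n)" for n
  proof -
    have "?T n = (\<lambda>x. \<Sum>m\<in>F. fourier_mult \<phi> (\<lambda>x. (character m x * \<psi> (r n *\<^sub>R x)) *\<^sub>C a m) x)"
      using fourier_mult_sum[OF \<phi> F(1) C_infinity_compact_modulate[OF \<psi>(1) r(1)], where a = a]
      by (simp add: trig_def scaleC.sum_right scaleC_scaleC mult.commute fun_eq_iff)
    then show ?thesis
      by (simp only:) (intro continuous_intros continuous_fourier_mult[OF \<phi>] C_infinity_compact_modulate[OF \<psi>(1) r(1)])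
  qed
  have cd: "cont (\<lambda>x. ?T n x - ?h n x)" for n
    by (intro continuous_on_diff cT ch)
  have pert: "\<exists>D. \<forall>n. ?w n * Lpow p UNIV (f1 n) \<le> ennreal ((1 + d) powr p) * (?w n * Lpow p UNIV (f2 n))
      + ennreal D * (?w n * Lpow p UNIV (\<lambda>x. ?T n x - ?h n x))"
    if "0 < d" "\<And>n. cont (f2 n)" "\<And>n x. norm (f1 n x) \<le> norm (f2 n x) + norm (?T n x - ?h n x)"
    for d and f1 f2 :: "nat \<Rightarrow> real ^ 'd \<Rightarrow> 'y"
  proof (intro exI allI)
    fix n
    have "Lpow p UNIV (f1 n) \<le> ennreal ((1 + d) powr p) * Lpow p UNIV (f2 n)
        + ennreal ((1 + 1 / d) powr p) * Lpow p UNIV (\<lambda>x. ?T n x - ?h n x)"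
      by (rule Lpow_triangle[OF that(2) cd _ p0 that(1) that(3)]) simp
    then have "?w n * Lpow p UNIV (f1 n) \<le> ?w n * (ennreal ((1 + d) powr p) * Lpow p UNIV (f2 n)
        + ennreal ((1 + 1 / d) powr p) * Lpow p UNIV (\<lambda>x. ?T n x - ?h n x))"
      by (intro mult_left_mono) auto
    then show "?w n * Lpow p UNIV (f1 n) \<le> ennreal ((1 + d) powr p) * (?w n * Lpow p UNIV (f2 n))
      + ennreal ((1 + 1 / d) powr p) * (?w n * Lpow p UNIV (\<lambda>x. ?T n x - ?h n x))"
      by (simp add: distrib_left mult_ac)
  qed
  have triv: "\<exists>D. \<forall>n. g n \<le> ennreal ((1 + d) powr p) * g n + ennreal D * e n" if "0 < d" for d and g e :: "nat \<Rightarrow> ennreal"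
  proof (intro exI allI)
    fix n
    have "1 \<le> (1 + d) powr p" using that p by (intro ge_one_powr_ge_zero) auto
    then have "1 * g n \<le> ennreal ((1 + d) powr p) * g n"
      using ennreal_leI[of 1 "(1 + d) powr p"] by (intro mult_right_mono) auto
    then show "g n \<le> ennreal ((1 + d) powr p) * g n + ennreal 0 * e n" by simp
  qed
  \<comment> \<open>The common factors of the two limits. They can be cancelled because they are
    finite and positive; positivity for the bump comes from its non-zero value at 0.\<close>
  have fin: "0 < ennreal (1 / L ^ CARD('d))" "ennreal (1 / L ^ CARD('d)) < \<infinity>" "0 < Lpow p UNIV \<psi>" "Lpow p UNIV \<psi> < \<infinity>"
    using L Lpow_test_pos[OF \<psi> p0] Lpow_compact_support_finite[OF C_infinity_compactD(2,3)[OF \<psi>(1)] p0] by auto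
  show "Lpow p (cube L) (trig F b) \<le> ennreal c * Lpow p (cube L) (trig F a)" if ?A
  proof (rule mult_cancel_le_ennreal[OF _ fin], rule perturbed_inequality_limit[OF p0 c _ _ _ err tendsto_const limh limf])
    show "\<exists>D. \<forall>n. ?w n * Lpow p UNIV (?h n) \<le> ennreal ((1 + d) powr p) * (?w n * Lpow p UNIV (?T n))
      + ennreal D * (?w n * Lpow p UNIV (\<lambda>x. ?T n x - ?h n x))" if "0 < d" for d
      by (rule pert[OF that cT]) (subst norm_minus_commute, rule norm_triangle_sub)
    show "\<exists>D. \<forall>n. ?w n * Lpow p UNIV (?f n) \<le> ennreal ((1 + d) powr p) * (?w n * Lpow p UNIV (?f n)) + ennreal D * 0" if "0 < d" for d
      by (rule triv[OF that])
    show "?w n * Lpow p UNIV (?T n) \<le> ennreal c * (?w n * Lpow p UNIV (?f n))" for n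
      using mult_left_mono[OF that[rule_format, OF \<psi>n[of n]], of "?w n"] by (simp add: mult_ac)
  qed
  show "Lpow p (cube L) (trig F a) \<le> ennreal c * Lpow p (cube L) (trig F b)" if ?B
  proof (rule mult_cancel_le_ennreal[OF _ fin], rule perturbed_inequality_limit[OF p0 c _ _ _ tendsto_const err limf limh])
    show "\<exists>D. \<forall>n. ?w n * Lpow p UNIV (?T n) \<le> ennreal ((1 + d) powr p) * (?w n * Lpow p UNIV (?h n))
      + ennreal D * (?w n * Lpow p UNIV (\<lambda>x. ?T n x - ?h n x))" if "0 < d" for d
      by (rule pert[OF that ch]) (rule norm_triangle_sub)
    show "\<exists>D. \<forall>n. ?w n * Lpow p UNIV (?f n) \<le> ennreal ((1 + d) powr p) * (?w n * Lpow p UNIV (?f n)) + ennreal D * 0" if "0 < d" for d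
      by (rule triv[OF that])
    show "?w n * Lpow p UNIV (?f n) \<le> ennreal c * (?w n * Lpow p UNIV (?T n))" for n
      using mult_left_mono[OF that[rule_format, OF \<psi>n[of n]], of "?w n"] by (simp add: mult_ac)
  qed
qed

section \<open>Test functions in coordinates\<close>

text \<open>Bounded coefficients make the span closed, since Cauchy sequences converge
  coefficientwise. A new basis vector then has positive distance from the closed span of the others,
  which bounds its own coefficient and continues the induction.\<close>

lemma finite_dim_coefficients_bounded:
  fixes B :: "'x::complex_banach set"
  assumes "finite B" "complex_vector.independent B"
  shows "\<exists>K\<ge>0. \<forall>c. \<forall>b\<in>B. norm (c b) \<le> K * norm (\<Sum>b\<in>B. c b *\<^sub>C b)"
    and "closed (cspan B)"
proof -
  have closed: "closed (cspan B)"
    if B: "finite B" and K: "\<And>c b. b \<in> B \<Longrightarrow> norm (c b) \<le> K * norm (\<Sum>b\<in>B. c b *\<^sub>C b)" "0 \<le> K"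
    for B :: "'x set" and K
    unfolding closed_sequential_limits
  proof (intro allI impI, elim conjE)
    fix x l assume x: "\<forall>n. x n \<in> cspan B" "x \<longlonglongrightarrow> l"
    have "\<forall>n. \<exists>c. x n = (\<Sum>b\<in>B. c b *\<^sub>C b)"
      using x(1) unfolding complex_vector.span_finite[OF B] by blast
    then obtain c where c: "\<And>n. x n = (\<Sum>b\<in>B. c n b *\<^sub>C b)" by metis
    have "Cauchy (\<lambda>n. c n b)" if b: "b \<in> B" for b
    proof (rule metric_CauchyI)
      fix e :: real assume "0 < e"
      then have "0 < e / (K + 1)" using K(2) by simp
      then obtain M where M: "\<And>m n. M \<le> m \<Longrightarrow> M \<le> n \<Longrightarrow> dist (x m) (x n) < e / (K + 1)"
        using LIMSEQ_imp_Cauchy[OF x(2)] unfolding Cauchy_def by meson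
      have "dist (c m b) (c n b) < e" if "M \<le> m" "M \<le> n" for m n
      proof -
        have "norm (c m b - c n b) \<le> K * norm (\<Sum>b\<in>B. (c m b - c n b) *\<^sub>C b)"
          using K(1)[OF b, of "\<lambda>b. c m b - c n b"] .
        also have "(\<Sum>b\<in>B. (c m b - c n b) *\<^sub>C b) = x m - x n"
          by (simp add: c scaleC.diff_left sum_subtractf)
        also have "K * norm (x m - x n) \<le> (K + 1) * norm (x m - x n)"
          by (intro mult_right_mono) auto
        also have "\<dots> < (K + 1) * (e / (K + 1))"
          using M[OF that] K(2) by (intro mult_strict_left_mono) (auto simp: dist_norm)
        finally show ?thesis using K(2) by (simp add: dist_norm)
      qed
      then show "\<exists>M. \<forall>m\<ge>M. \<forall>n\<ge>M. dist (c m b) (c n b) < e" by blast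
    qed
    then have "\<forall>b\<in>B. \<exists>d. (\<lambda>n. c n b) \<longlonglongrightarrow> d"
      using Cauchy_convergent_iff convergent_def by blast
    then obtain d where d: "\<And>b. b \<in> B \<Longrightarrow> (\<lambda>n. c n b) \<longlonglongrightarrow> d b" by metis
    have "x \<longlonglongrightarrow> (\<Sum>b\<in>B. d b *\<^sub>C b)"
      unfolding c[abs_def] by (intro tendsto_sum scaleC.tendsto tendsto_const d)
    then have "l = (\<Sum>b\<in>B. d b *\<^sub>C b)" using x(2) LIMSEQ_unique by blast
    then show "l \<in> cspan B" unfolding complex_vector.span_finite[OF B] by blast
  qed
  show K: "\<exists>K\<ge>0. \<forall>c. \<forall>b\<in>B. norm (c b) \<le> K * norm (\<Sum>b\<in>B. c b *\<^sub>C b)"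
    using assms
  proof (induction B)
    case empty
    show ?case by (intro exI[of _ 0]) simp
  next
    case (insert b0 B)
    have ind: "complex_vector.independent B" "b0 \<notin> cspan B"
      using insert by (simp_all add: complex_vector.independent_insert)
    then obtain K where K: "0 \<le> K" "\<And>c b. b \<in> B \<Longrightarrow> norm (c b) \<le> K * norm (\<Sum>b\<in>B. c b *\<^sub>C b)"
      using insert.IH by metis
    have "open (- cspan B)" using closed[OF insert.hyps(1) K(2,1)] by auto
    then obtain s where s: "0 < s" "ball b0 s \<subseteq> - cspan B"
      using ind(2) by (meson ComplI openE)
    have span: "(\<Sum>b\<in>B. c b *\<^sub>C b) \<in> cspan B" for c
      unfolding complex_vector.span_finite[OF insert.hyps(1)] by blast
    \<comment> \<open>Dividing by the coefficient of \<open>b0\<close> gives a vector of norm at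
      least the distance s, whence 1/s. The second entry bounds the other coefficients after the
      multiple of \<open>b0\<close> has been subtracted.\<close>
    let ?K = "max (1 / s) (K * (1 + norm b0 / s))"
    show ?case
    proof (intro exI[of _ ?K] conjI allI ballI)
      show "0 \<le> ?K" using s(1) by (simp add: le_max_iff_disj)
      fix c b assume b: "b \<in> insert b0 B"
      let ?y = "\<Sum>b\<in>B. c b *\<^sub>C b" and ?x = "\<Sum>b\<in>insert b0 B. c b *\<^sub>C b"
      have x: "?x = c b0 *\<^sub>C b0 + ?y" using insert.hyps by simp
      have c0: "norm (c b0) \<le> 1 / s * norm ?x"
      proof (cases "c b0 = 0")
        case True
        then show ?thesis using s(1) by simp
      next
        case False
        let ?z = "\<Sum>b\<in>B. (- c b / c b0) *\<^sub>C b"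
        have "?z \<notin> ball b0 s" using span[of "\<lambda>b. - c b / c b0"] s(2) by blast
        then have d: "s \<le> norm (b0 - ?z)" by (simp add: dist_norm)
        have eq: "c b0 *\<^sub>C (b0 - ?z) = ?x"
          using False by (simp add: x scaleC.diff_right scaleC.add_right scaleC.sum_right scaleC_scaleC scaleC.minus_left sum_negf)
        have "norm ?x = norm (c b0) * norm (b0 - ?z)"
          unfolding norm_scaleC[symmetric] eq ..
        then have "norm (c b0) * s \<le> norm ?x" using mult_left_mono[OF d, of "norm (c b0)"] by simp
        then show ?thesis using s(1) by (simp add: field_simps)
      qed
      show "norm (c b) \<le> ?K * norm ?x"
      proof (cases "b = b0")
        case True
        have "1 / s * norm ?x \<le> ?K * norm ?x" by (intro mult_right_mono) auto
        from order_trans[OF c0 this] show ?thesis unfolding True .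
      next
        case False
        then have "norm (c b) \<le> K * norm ?y" using b K(2)[of b c] by simp
        also have "norm ?y \<le> norm ?x + norm (c b0) * norm b0"
          using norm_triangle_ineq4[of ?x "c b0 *\<^sub>C b0"] by (simp add: x norm_scaleC)
        also have "\<dots> \<le> norm ?x + 1 / s * norm ?x * norm b0"
          using c0 by (intro add_left_mono mult_right_mono) auto
        also have "\<dots> = (1 + norm b0 / s) * norm ?x" by (simp add: algebra_simps)
        finally have "norm (c b) \<le> K * ((1 + norm b0 / s) * norm ?x)" using K(1) by (simp add: mult_left_mono)
        also have "\<dots> = K * (1 + norm b0 / s) * norm ?x" by simp
        also have "\<dots> \<le> ?K * norm ?x" by (intro mult_right_mono) auto
        finally show ?thesis .
      qed
    qed
  qed
  then show "closed (cspan B)" using closed[OF assms(1)] by meson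
qed

text \<open>The coordinate is linear and bounded only on the subspace, so the chain rule requires
  derivatives to stay there. They do, as limits of difference quotients in a closed
  subspace.\<close>

lemma C_class_coordinate:
  fixes F :: "'a::euclidean_space \<Rightarrow> 'x::complex_banach"
  assumes coord: "\<And>v w. v \<in> S \<Longrightarrow> w \<in> S \<Longrightarrow> coord (v + w) = coord v + coord w"
      "\<And>v r. v \<in> S \<Longrightarrow> coord (r *\<^sub>R v) = r *\<^sub>R coord v" "\<And>v. v \<in> S \<Longrightarrow> norm (coord v) \<le> K * norm v"
    and S: "closed S" "\<And>v w. v \<in> S \<Longrightarrow> w \<in> S \<Longrightarrow> v + w \<in> S" "\<And>v r. v \<in> S \<Longrightarrow> r *\<^sub>R v \<in> S" and K: "0 \<le> K"
  shows "C_class k F \<Longrightarrow> (\<And>x. F x \<in> S) \<Longrightarrow> C_class k (\<lambda>x. coord (F x) :: complex)"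
proof (induction k arbitrary: F)
  case 0
  have "norm (coord (F y) - coord (F x)) \<le> K * norm (F y - F x)" for x y
  proof -
    have mem: "- 1 *\<^sub>R F x \<in> S" by (rule S(3)[OF "0.prems"(2)])
    then have "coord (F y + - 1 *\<^sub>R F x) = coord (F y) + - 1 *\<^sub>R coord (F x)"
      using coord(1)[OF "0.prems"(2)] coord(2)[OF "0.prems"(2)] by metis
    then show ?thesis using coord(3)[OF S(2)[OF "0.prems"(2)[of y] mem]] by simp
  qed
  note le = this
  have "isCont (\<lambda>x. coord (F x)) x" for x
  proof -
    have "isCont F x" using "0.prems"(1) by (simp add: continuous_on_eq_continuous_at)
    then have "((\<lambda>y. K * norm (F y - F x)) \<longlongrightarrow> K * norm (F x - F x)) (at x)"
      unfolding isCont_def by (intro tendsto_intros)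
    then have "((\<lambda>y. coord (F y) - coord (F x)) \<longlongrightarrow> 0) (at x)"
      by (intro Lim_null_comparison[OF always_eventually[OF allI[OF le]]]) simp
    then show ?thesis unfolding isCont_def by (rule LIM_zero_cancel)
  qed
  then show ?case by (simp add: continuous_at_imp_continuous_on)
next
  case (Suc k)
  let ?F' = "\<lambda>x. frechet_derivative F (at x)"
  have der: "(F has_derivative ?F' x) (at x)" for x by (rule C_class_SucD(1)[OF Suc.prems(1)])
  have sub: "v - w \<in> S" if "v \<in> S" "w \<in> S" for v w
    using S(2)[OF that(1) S(3)[OF that(2), of "- 1"]] by simp
  have csub: "coord (v - w) = coord v - coord w" if "v \<in> S" "w \<in> S" for v w
    using coord(1)[OF that(1) S(3)[OF that(2), of "- 1"]] coord(2)[OF that(2), of "- 1"] by simp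
  have mem: "?F' x v \<in> S" for x v
  proof -
    have "((\<lambda>r. F (x + r *\<^sub>R v)) has_derivative (\<lambda>h. ?F' (x + 0 *\<^sub>R v) (h *\<^sub>R v))) (at 0)"
      by (rule has_derivative_compose[of "\<lambda>r. x + r *\<^sub>R v" "\<lambda>h. h *\<^sub>R v" 0 UNIV F])
        (use der[of x] in \<open>auto intro!: derivative_eq_intros\<close>)
    then have "((\<lambda>r. F (x + r *\<^sub>R v)) has_vector_derivative ?F' x v) (at 0)"
      using linear_cmul[OF has_derivative_linear[OF der[of x]]] by (simp add: has_vector_derivative_def)
    from vector_derivative_sequence[OF this, of "\<lambda>n. inverse (real (Suc n))"]
    have "(\<lambda>n. (1 / inverse (real (Suc n))) *\<^sub>R (F (x + inverse (real (Suc n)) *\<^sub>R v) - F (x + 0 *\<^sub>R v))) \<longlonglongrightarrow> ?F' x v"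
      using LIMSEQ_inverse_real_of_nat by simp
    moreover have mem: "(1 / inverse (real (Suc n))) *\<^sub>R (F (x + inverse (real (Suc n)) *\<^sub>R v) - F (x + 0 *\<^sub>R v)) \<in> S" for n
      by (intro S(3) sub Suc.prems)
    ultimately show ?thesis
      by (intro closed_sequentially[OF S(1) mem])
  qed
  have lin: "linear (\<lambda>v. coord (?F' x v))" for x
  proof
    have l: "linear (?F' x)" by (rule has_derivative_linear[OF der])
    show "coord (?F' x (v + w)) = coord (?F' x v) + coord (?F' x w)" for v w
      by (simp add: linear_add[OF l] coord(1)[OF mem mem])
    show "coord (?F' x (r *\<^sub>R v)) = r *\<^sub>R coord (?F' x v)" for v r
      by (simp add: linear_cmul[OF l] coord(2)[OF mem])
  qed
  show ?case
  proof (rule C_class_SucI)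
    show "C_class k (\<lambda>x. coord (?F' x v))" for v
      by (rule Suc.IH[OF C_class_SucD(2)[OF Suc.prems(1)] mem])
    fix x
    show "((\<lambda>x. coord (F x)) has_derivative (\<lambda>v. coord (?F' x v))) (at x)"
      unfolding has_derivative_at
    proof
      show "bounded_linear (\<lambda>v. coord (?F' x v))" using lin linear_conv_bounded_linear by blast
      have lim: "((\<lambda>h. K * (norm (F (x + h) - F x - ?F' x h) / norm h)) \<longlongrightarrow> K * 0) (at 0)"
        using der[of x] unfolding has_derivative_at by (intro tendsto_mult_left) blast
      have le: "norm (norm (coord (F (x + h)) - coord (F x) - coord (?F' x h)) / norm h)
          \<le> K * (norm (F (x + h) - F x - ?F' x h) / norm h)" for h
      proof -
        have "coord (F (x + h)) - coord (F x) - coord (?F' x h) = coord (F (x + h) - F x - ?F' x h)"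
          by (simp add: csub sub mem Suc.prems)
        then have "norm (coord (F (x + h)) - coord (F x) - coord (?F' x h)) \<le> K * norm (F (x + h) - F x - ?F' x h)"
          using coord(3)[OF sub[OF sub[OF Suc.prems(2) Suc.prems(2)] mem]] by metis
        from divide_right_mono[OF this, of "norm h"] show ?thesis by simp
      qed
      show "((\<lambda>h. norm (coord (F (x + h)) - coord (F x) - coord (?F' x h)) / norm h) \<longlongrightarrow> 0) (at 0)"
        by (rule Lim_null_comparison[OF always_eventually[OF allI[OF le]] lim[unfolded mult_zero_right]])
    qed
  qed
qed

text \<open>Writing values in a basis of the finite dimensional span reduces vector-valued test
  functions to scalar ones times fixed vectors, the form in which hypothesis (4) applies.\<close>

lemma test_function_decomposition:
  fixes f :: "real ^ 'd \<Rightarrow> 'x::complex_banach"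
  assumes "f \<in> test_functions"
  shows "\<exists>B g. finite B \<and> (\<forall>b\<in>B. C_infinity_compact (g b)) \<and> f = (\<lambda>x. \<Sum>b\<in>B. g b x *\<^sub>C b)"
proof -
  obtain B0 where f: "C_infinity_compact f" "finite B0" "range f \<subseteq> cspan B0"
    using assms unfolding test_functions_def in_fin_dim_def by blast
  obtain B where B: "B \<subseteq> B0" "complex_vector.independent B" "B0 \<subseteq> cspan B"
    by (rule complex_vector.maximal_independent_subset)
  have fin: "finite B" using B(1) f(2) finite_subset by blast
  obtain K where K: "0 \<le> K" "\<And>c b. b \<in> B \<Longrightarrow> norm (c b) \<le> K * norm (\<Sum>b\<in>B. c b *\<^sub>C b)"
    using finite_dim_coefficients_bounded(1)[OF fin B(2)] by metis
  let ?r = "complex_vector.representation B"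
  have fB: "f x \<in> cspan B" for x
    using f(3) complex_vector.span_mono[OF B(3)] by (auto simp: complex_vector.span_span)
  have rep: "(\<Sum>b\<in>B. ?r v b *\<^sub>C b) = v" if "v \<in> cspan B" for v
    using complex_vector.sum_representation_eq[OF B(2) that fin] by simp
  have "C_infinity_compact (\<lambda>x. ?r (f x) b)" if b: "b \<in> B" for b
  proof (rule C_infinity_compact_mono[OF f(1)])
    show "C_class k (\<lambda>x. ?r (f x) b)" for k
    proof (rule C_class_coordinate[where S = "cspan B" and coord = "\<lambda>v. ?r v b" and K = K])
      show "?r (v + w) b = ?r v b + ?r w b" if "v \<in> cspan B" "w \<in> cspan B" for v w
        using complex_vector.representation_add[OF B(2) that(2,1)] by (simp add: add.commute)
      show "?r (r *\<^sub>R v) b = r *\<^sub>R ?r v b" if "v \<in> cspan B" for v r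
        using complex_vector.representation_scale[OF B(2) that, of "of_real r"]
        by (simp add: scaleC_of_real scaleR_conv_of_real)
      show "norm (?r v b) \<le> K * norm v" if "v \<in> cspan B" for v
        using K(2)[OF b, of "?r v"] rep[OF that] by simp
      show "closed (cspan B)" by (rule finite_dim_coefficients_bounded(2)[OF fin B(2)])
      show "r *\<^sub>R v \<in> cspan B" if "v \<in> cspan B" for v r
        using complex_vector.span_scale[OF that, of "of_real r"] by (simp add: scaleC_of_real)
    qed (use f(1) C_infinity_compactD(1) K(1) fB complex_vector.span_add in blast)+
    show "?r (f x) b = 0" if "f x = 0" for x
      using that by (simp add: complex_vector.representation_zero)
  qed
  moreover have "f = (\<lambda>x. \<Sum>b\<in>B. ?r (f x) b *\<^sub>C b)"
    using rep[OF fB] by (simp add: fun_eq_iff)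
  ultimately show ?thesis
    using fin by (intro exI[of _ B] exI[of _ "\<lambda>b x. ?r (f x) b"]) blast
qed

section \<open>Uniform convergence of Riemann sums\<close>

text \<open>A period cell of the Riemann sums of mesh t. It is centred at 0 so that t |y_i| <= 1/2
  holds on it, as \<open>exists_step\<close> requires, and so that the cells exhaust the space as t
  tends to 0.\<close>

definition torus :: "real \<Rightarrow> (real ^ 'd) set" where
  "torus t = cbox (\<chi> i. - (1 / (2 * t))) (\<chi> i. 1 / (2 * t))"

lemma torus_iff: "0 < t \<Longrightarrow> y \<in> torus t \<longleftrightarrow> (\<forall>i. t * \<bar>y $ i\<bar> \<le> 1 / 2)"
proof -
  assume t: "0 < t"
  have "t * \<bar>z\<bar> \<le> 1 / 2 \<longleftrightarrow> - (1 / (2 * t)) \<le> z \<and> z \<le> 1 / (2 * t)" for z :: real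
  proof -
    have "t * \<bar>z\<bar> \<le> 1 / 2 \<longleftrightarrow> \<bar>z\<bar> \<le> 1 / (2 * t)" using t by (simp add: field_simps)
    then show ?thesis by (simp add: abs_le_iff minus_le_iff conj_commute)
  qed
  then show ?thesis by (simp add: torus_def mem_box_cart)
qed

lemma torus_sets [simp]: "torus t \<in> sets borel"
  by (simp add: torus_def)

lemma eventually_in_torus:
  assumes "\<And>k. 0 < t k" "t \<longlonglongrightarrow> 0"
  shows "eventually (\<lambda>k. y \<in> torus (t k)) sequentially"
proof -
  have "(\<lambda>k. t k * norm y) \<longlonglongrightarrow> 0 * norm y" by (intro tendsto_intros assms)
  then have "eventually (\<lambda>k. t k * norm y < 1 / 2) sequentially" by (intro order_tendstoD) auto
  then show ?thesis
  proof eventually_elim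
    case (elim k)
    have "t k * \<bar>y $ i\<bar> \<le> t k * norm y" for i
      using assms(1)[of k] component_le_norm_cart by (intro mult_left_mono) auto
    then show ?case using elim torus_iff[OF assms(1)] by (meson less_imp_le order_trans)
  qed
qed

lemma Lpow_torus:
  fixes P :: "real ^ 'd \<Rightarrow> 'b::real_normed_vector"
  assumes "cont P" "periodic (1 / t) P" "0 < t" "0 < p"
  shows "Lpow p (torus t) P = Lpow p (cube (1 / t)) P"
proof -
  have "(\<chi> i. - (1 / (2 * t))) + (\<chi> i. 1 / t) = ((\<chi> i. 1 / (2 * t)) :: real ^ 'd)"
    using assms(3) by (simp add: vec_eq_iff field_simps)
  then show ?thesis
    using Lpow_cube_shift[OF assms(1,2) _ assms(4), of "\<chi> i. - (1 / (2 * t))"] assms(3)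
    by (simp add: torus_def)
qed

text \<open>The frequency set is determined by S alone, not by the support of \<open>g\<close>. Thus
  a symbol and its image under the multiplier become trigonometric polynomials over the same
  frequencies.\<close>

lemma osc_eq_trig:
  fixes S :: "(real ^ 'd) set"
  assumes t: "0 < t" and S: "bounded S"
  shows "finite (S \<inter> (\<lambda>m. t *\<^sub>R m) ` int_lattice)"
    and "\<And>g :: real ^ 'd \<Rightarrow> 'y::complex_banach. (\<And>x. x \<notin> S \<Longrightarrow> g x = 0) \<Longrightarrow>
      osc t g = trig (S \<inter> (\<lambda>m. t *\<^sub>R m) ` int_lattice) (\<lambda>m. of_real (t ^ CARD('d)) *\<^sub>C g m)"
proof -
  obtain R where R: "\<And>x. x \<in> S \<Longrightarrow> norm x \<le> R" using S unfolding bounded_iff by blast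
  define N where "N = nat \<lceil>R / t\<rceil>"
  define M where "M = {m \<in> lattice_box N. t *\<^sub>R m \<in> S}"
  have M: "finite M" "M \<subseteq> int_lattice" using finite_lattice_box[of N] lattice_box_subset by (auto simp: M_def)
  have inj: "inj_on (\<lambda>m. t *\<^sub>R m) M" using t by (simp add: inj_on_def)
  have mem: "m \<in> M" if m: "m \<in> int_lattice" "t *\<^sub>R m \<in> S" for m
  proof -
    have "\<bar>m $ i\<bar> \<le> real N" for i
    proof -
      have "t * \<bar>m $ i\<bar> \<le> t * norm m" using t component_le_norm_cart[of m i] by (intro mult_left_mono) auto
      also have "\<dots> \<le> R" using R[OF m(2)] t by simp
      finally have "\<bar>m $ i\<bar> \<le> R / t" using t by (simp add: field_simps)
      then show ?thesis unfolding N_def using real_nat_ceiling_ge order_trans by blast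
    qed
    then show ?thesis using m by (auto simp: M_def lattice_box_def)
  qed
  have F: "S \<inter> (\<lambda>m. t *\<^sub>R m) ` int_lattice = (\<lambda>m. t *\<^sub>R m) ` M"
    using mem M(2) by (auto simp: M_def)
  show "finite (S \<inter> (\<lambda>m. t *\<^sub>R m) ` int_lattice)" using M(1) F by simp
  show "osc t g = trig (S \<inter> (\<lambda>m. t *\<^sub>R m) ` int_lattice) (\<lambda>m. of_real (t ^ CARD('d)) *\<^sub>C g m)"
    if g: "\<And>x. x \<notin> S \<Longrightarrow> g x = 0" for g :: "real ^ 'd \<Rightarrow> 'y"
  proof
    fix y
    define G where "G x = (if x \<in> (\<lambda>m. t *\<^sub>R m) ` M then g x else 0)" for x
    have "g (gfloor t z) = G (gfloor t z)" for z
    proof -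
      obtain m where "m \<in> int_lattice" "gfloor t z = t *\<^sub>R m" using gfloor_in_lattice[OF t] by blast
      then show ?thesis using g mem by (auto simp: G_def)
    qed
    then have "osc t g y = osc t G y" by (simp add: osc_def)
    also have "\<dots> = (\<Sum>m\<in>M. t ^ CARD('d) *\<^sub>R (character (t *\<^sub>R m) y *\<^sub>C G (t *\<^sub>R m)))"
      by (rule osc_finite[OF t M]) (simp add: G_def)
    also have "\<dots> = trig ((\<lambda>m. t *\<^sub>R m) ` M) (\<lambda>m. of_real (t ^ CARD('d)) *\<^sub>C g m) y"
      unfolding trig_def using inj
      by (auto simp: sum.reindex G_def scaleC_of_real[symmetric] scaleC_scaleC mult.commute simp del: of_real_power intro!: sum.cong)
    finally show "osc t g y = trig (S \<inter> (\<lambda>m. t *\<^sub>R m) ` int_lattice) (\<lambda>m. of_real (t ^ CARD('d)) *\<^sub>C g m) y"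
      unfolding F .
  qed
qed

text \<open>Uniform continuity is measured against the minimum of the weight on a ball of radius M +
  1, where M bounds the support. For steps at most 1, a point outside that ball and its translate
  both lie outside the support.\<close>

lemma wbounded_difference:
  fixes g :: "real ^ 'd \<Rightarrow> 'y::real_normed_vector"
  assumes g: "cont g" "bounded {x. g x \<noteq> 0}" and e: "0 < e"
  shows "\<exists>d>0. \<forall>s i. 0 \<le> s \<and> s \<le> d \<longrightarrow> wbounded e (\<lambda>w. g w - g (w - s *\<^sub>R axis i 1))"
proof -
  obtain M where M: "0 < M" "\<And>x. g x \<noteq> 0 \<Longrightarrow> norm x \<le> M" using g(2) unfolding bounded_pos by auto
  have "continuous_on (cball 0 (M + 1)) (weight :: real ^ 'd \<Rightarrow> real)" by (rule continuous_weight)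
  moreover have "cball 0 (M + 1) \<noteq> ({} :: (real ^ 'd) set)" using M(1) by simp
  ultimately have "\<exists>z\<in>cball 0 (M + 1). \<forall>x\<in>cball 0 (M + 1). (weight :: real ^ 'd \<Rightarrow> real) z \<le> weight (x :: real ^ 'd)"
    by (intro continuous_attains_inf compact_cball)
  then obtain z where z: "\<And>x :: real ^ 'd. x \<in> cball 0 (M + 1) \<Longrightarrow> weight (z :: real ^ 'd) \<le> weight x" by blast
  have "uniformly_continuous_on (cball 0 (M + 2)) g"
    by (intro compact_uniformly_continuous continuous_on_subset[OF g(1)]) auto
  then obtain d where d: "0 < d" "\<And>x y. x \<in> cball 0 (M + 2) \<Longrightarrow> y \<in> cball 0 (M + 2) \<Longrightarrow> dist y x < d \<Longrightarrow> dist (g y) (g x) < e * weight z"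
    unfolding uniformly_continuous_on_def using e weight_pos[of z] by (metis mult_pos_pos)
  have "wbounded e (\<lambda>w. g w - g (w - s *\<^sub>R axis i 1))" if s: "0 \<le> s" "s \<le> min 1 (d / 2)" for s and i :: 'd
    unfolding wbounded_def
  proof
    fix w :: "real ^ 'd"
    let ?\<eta> = "w - s *\<^sub>R axis i 1"
    have n: "norm (s *\<^sub>R (axis i 1 :: real ^ 'd)) = s" using s by simp
    show "norm (g w - g ?\<eta>) \<le> e * weight w"
    proof (cases "norm w \<le> M + 1")
      case True
      have "norm ?\<eta> \<le> norm w + s" using norm_triangle_ineq4[of w "s *\<^sub>R axis i 1"] n by simp
      then have "dist (g w) (g ?\<eta>) < e * weight z"
        using True s d(1) by (intro d(2)) (auto simp: dist_norm norm_minus_commute)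
      also have "\<dots> \<le> e * weight w" using True e z by (intro mult_left_mono) auto
      finally show ?thesis by (simp add: dist_norm)
    next
      case False
      have "norm w \<le> norm ?\<eta> + s" using norm_triangle_sub[of w ?\<eta>] n by simp
      then have "M < norm ?\<eta>" "M < norm w" using False s by auto
      then have "g w = 0" "g ?\<eta> = 0" using M(2) by (meson not_le)+
      then show ?thesis using e by simp
    qed
  qed
  then show ?thesis using d(1) by (intro exI[of _ "min 1 (d / 2)"]) auto
qed

lemma L1_wbounded_gfloor:
  fixes g :: "real ^ 'd \<Rightarrow> 'y::real_normed_vector"
  assumes "cont g" "wbounded C g" "0 \<le> t" "t \<le> 1"
  shows "L1 (\<lambda>z. g (gfloor t z)) \<le> 3 ^ CARD('d) * C * L1 (weight :: real ^ 'd \<Rightarrow> real)"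
proof -
  have w: "wbounded (3 ^ CARD('d) * C) (\<lambda>z. g (gfloor t z))" by (rule wbounded_gfloor[OF assms(2-4)])
  have "L1 (\<lambda>z. g (gfloor t z)) \<le> (\<integral>x. 3 ^ CARD('d) * C * weight x \<partial>(lebesgue :: (real ^ 'd) measure))"
    unfolding L1_def
  proof (rule integral_mono)
    show "integrable lebesgue (\<lambda>z. norm (g (gfloor t z)))"
      using assms continuous_imp_ae_cont by (intro integrable_norm_wbounded[OF _ w] ae_cont_gfloor) auto
  qed (use wboundedD[OF w] in \<open>auto simp: integrable_weight\<close>)
  then show ?thesis by (simp add: L1_def)
qed

text \<open>Shifting a sum over \<open>t \<int>\<^sup>d\<close> by about half a wave length leaves a difference of nearby values.\<close>

lemma osc_small_at_infinity:
  fixes g :: "real ^ 'd \<Rightarrow> 'y::complex_banach"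
  assumes g: "cont g" "bounded {x. g x \<noteq> 0}" and e: "0 < e"
  shows "\<exists>R. \<forall>t y i. 0 \<le> t \<and> t \<le> 1 \<and> t * \<bar>y $ i\<bar> \<le> 1 / 2 \<and> R \<le> \<bar>y $ i\<bar> \<longrightarrow> norm (osc t g y) \<le> e"
proof -
  define W where "W = 3 ^ CARD('d) * L1 (weight :: real ^ 'd \<Rightarrow> real)"
  have W: "0 \<le> W" by (simp add: W_def)
  have "0 < e / (W + 1)" using e W by simp
  then obtain r where r: "0 < r" "\<And>s i. 0 \<le> s \<Longrightarrow> s \<le> r \<Longrightarrow> wbounded (e / (W + 1)) (\<lambda>z. g z - g (z - s *\<^sub>R axis i 1))"
    using wbounded_difference[OF g] by metis
  obtain C where C: "wbounded C g" using wbounded_compact_support[OF g] by blast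
  have "norm (osc t g y) \<le> e" if t: "0 \<le> t" "t \<le> 1" and y: "t * \<bar>y $ i\<bar> \<le> 1 / 2" "max 1 (1 / (2 * r)) \<le> \<bar>y $ i\<bar>" for t y i
  proof -
    obtain s where s: "0 \<le> s" "s \<le> 1 / (2 * \<bar>y $ i\<bar>)" "t = 0 \<or> (\<exists>k::int. s = t * of_int k)"
      "1 / 4 \<le> \<bar>s * y $ i\<bar>" "\<bar>s * y $ i\<bar> \<le> 1 / 2"
      using exists_step[OF t(1) y(1)] y(2) by auto
    have y1: "1 \<le> \<bar>y $ i\<bar>" "1 / (2 * r) \<le> \<bar>y $ i\<bar>" using y(2) by auto
    \<comment> \<open>A large |y_i| forces the half wave length below r, the range of steps for
      which the difference is small relative to the weight.\<close>
    have "1 / (2 * \<bar>y $ i\<bar>) \<le> r" "1 / (2 * \<bar>y $ i\<bar>) \<le> 1" using y1 r(1) by (simp_all add: field_simps)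
    then have s': "s \<le> r" "s \<le> 1" using s(2) by linarith+
    let ?d = "\<lambda>z. g z - g (z - s *\<^sub>R axis i 1)"
    have cs: "cont (\<lambda>z. g (z - s *\<^sub>R axis i 1))"
      by (rule continuous_on_compose2[OF g(1)]) (auto intro!: continuous_intros)
    have ad: "admissible t C g" using C t continuous_imp_ae_cont[OF g(1)] by (simp add: admissible_def)
    have ads: "admissible t (3 ^ CARD('d) * C) (\<lambda>z. g (z - s *\<^sub>R axis i 1))"
      using wbounded_shift[OF C s(1) s'(2)] t continuous_imp_ae_cont[OF cs] by (simp add: admissible_def)
    have wd: "wbounded (e / (W + 1)) ?d" by (rule r(2)[OF s(1) s'(1)])
    have cd: "cont ?d" by (intro continuous_on_diff g cs)
    have add: "admissible t (e / (W + 1)) ?d" using wd t continuous_imp_ae_cont[OF cd] by (simp add: admissible_def)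
    have "norm (osc t g y) \<le> norm (1 - cis (2 * pi * (s * y $ i))) * norm (osc t g y)"
      using mult_right_mono[OF norm_one_minus_cis[OF s(4,5)], of "norm (osc t g y)"] by simp
    also have "\<dots> = norm (osc t ?d y)"
      by (simp add: osc_gfloor_shift[OF s(3) t(1) ad ads] norm_scaleC)
    also have "\<dots> \<le> L1 (\<lambda>z. ?d (gfloor t z))" by (rule norm_osc_le[OF add])
    also have "\<dots> \<le> 3 ^ CARD('d) * (e / (W + 1)) * L1 (weight :: real ^ 'd \<Rightarrow> real)"
      by (rule L1_wbounded_gfloor[OF cd wd t])
    also have "\<dots> = W * e / (W + 1)" by (simp add: W_def)
    also have "\<dots> \<le> e" using W e by (simp add: field_simps)
    finally show ?thesis .
  qed
  then show ?thesis by blast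
qed

text \<open>Rounding moves a frequency by at most d t, which changes the character at
  \<open>y\<close> by at most 2 pi d t |y|. On bounded sets of \<open>y\<close> the L1 error is
  therefore uniformly small.\<close>

lemma osc_tendsto_locally_uniformly:
  fixes g :: "real ^ 'd \<Rightarrow> 'y::complex_banach"
  assumes g: "cont g" "bounded {x. g x \<noteq> 0}" and t: "\<And>k. 0 < t k" "\<And>k. t k \<le> 1" "t \<longlonglongrightarrow> 0" and e: "0 < e"
  shows "eventually (\<lambda>k. \<forall>y. norm y \<le> R \<longrightarrow> norm (osc (t k) g y - osc 0 g y) \<le> e) sequentially"
proof -
  obtain C where C: "wbounded C g" using wbounded_compact_support[OF g] by blast
  have ag: "ae_cont g" by (rule continuous_imp_ae_cont[OF g(1)])
  have ad: "admissible (t k) C g" for k using C t(1)[of k] t(2)[of k] by (simp add: admissible_def)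
  have ad0: "admissible 0 C g" using C ag by (simp add: admissible_def)
  define D where "D = real CARD('d)"
  define A where "A k = L1 (\<lambda>z. g (gfloor (t k) z) - g z) + 2 * pi * (D * t k * \<bar>R\<bar>) * L1 g" for k
  note ac = ae_cont_diff[OF admissible_integrand(4)[OF ad] ag] wbounded_diff[OF admissible_integrand(5)[OF ad] C]
  have "(\<lambda>k. L1 (\<lambda>z. g (gfloor (t k) z) - g z)) \<longlonglongrightarrow> 0"
  proof (rule L1_tendsto_0[OF ac, where N = "{}"])
    fix z
    have "(\<lambda>k. g (gfloor (t k) z)) \<longlonglongrightarrow> g z"
      using g(1) gfloor_tendsto[of t z] t
      by (intro isCont_tendsto_compose[of _ g]) (auto simp: continuous_on_eq_continuous_at less_imp_le)
    then show "(\<lambda>k. g (gfloor (t k) z) - g z) \<longlonglongrightarrow> 0" by (rule LIM_zero)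
  qed simp
  then have "A \<longlonglongrightarrow> 0 + 2 * pi * (D * 0 * \<bar>R\<bar>) * L1 g"
    unfolding A_def by (intro tendsto_intros t(3))
  then have "eventually (\<lambda>k. A k < e) sequentially" using e by (intro order_tendstoD) auto
  then have ev: "eventually (\<lambda>k. A k < e) sequentially" .
  have le: "norm (osc (t k) g y - osc 0 g y) \<le> A k" if y: "norm y \<le> R" for k y
  proof -
    let ?G = "\<lambda>z. character (gfloor (t k) z) y *\<^sub>C g (gfloor (t k) z) - character (gfloor 0 z) y *\<^sub>C g (gfloor 0 z)"
    have "norm (osc (t k) g y - osc 0 g y) \<le> L1 ?G"
      unfolding osc_def by (rule norm_integral_diff_le_L1[OF admissible_integrand(1,2)[OF ad] admissible_integrand(1,2)[OF ad0]])
    also have "\<dots> \<le> (\<integral>z. norm (g (gfloor (t k) z) - g z) + 2 * pi * (D * t k * \<bar>R\<bar>) * norm (g z) \<partial>lebesgue)"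
      unfolding L1_def
    proof (rule integral_mono)
      show "integrable lebesgue (\<lambda>z. norm (?G z))"
        by (rule integrable_norm_wbounded[OF ae_cont_diff[OF admissible_integrand(1)[OF ad] admissible_integrand(1)[OF ad0]]
            wbounded_diff[OF admissible_integrand(2)[OF ad] admissible_integrand(2)[OF ad0]]])
      show "integrable lebesgue (\<lambda>z. norm (g (gfloor (t k) z) - g z) + 2 * pi * (D * t k * \<bar>R\<bar>) * norm (g z))"
        using integrable_norm_wbounded[OF ac] integrable_norm_wbounded[OF ag C]
        by (intro Bochner_Integration.integrable_add integrable_mult_right) auto
      fix z :: "real ^ 'd"
      let ?c = "\<lambda>z. character z y"
      have "norm (gfloor (t k) z - z) \<le> (\<Sum>i\<in>UNIV. \<bar>(gfloor (t k) z - z) $ i\<bar>)" by (rule norm_le_l1_cart)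
      also have "\<dots> \<le> (\<Sum>i\<in>(UNIV::'d set). t k)"
        using gfloor_close[of "t k" z] t(1)[of k] by (intro sum_mono) auto
      finally have "norm (gfloor (t k) z - z) \<le> D * t k" by (simp add: D_def)
      then have "norm (gfloor (t k) z - z) * norm y \<le> D * t k * \<bar>R\<bar>"
        using y t(1)[of k] by (intro mult_mono) (auto simp: D_def)
      then have "2 * pi * (norm (gfloor (t k) z - z) * norm y) \<le> 2 * pi * (D * t k * \<bar>R\<bar>)"
        by (intro mult_left_mono) auto
      then have c: "norm (?c (gfloor (t k) z) - ?c z) \<le> 2 * pi * (D * t k * \<bar>R\<bar>)"
        using norm_character_diff[of "gfloor (t k) z" y z] by linarith
      have "?G z = ?c (gfloor (t k) z) *\<^sub>C (g (gfloor (t k) z) - g z) + (?c (gfloor (t k) z) - ?c z) *\<^sub>C g z"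
        by (simp add: scaleC.diff_left scaleC.diff_right)
      also have "norm \<dots> \<le> norm (g (gfloor (t k) z) - g z) + norm (?c (gfloor (t k) z) - ?c z) * norm (g z)"
        by (rule order_trans[OF norm_triangle_ineq]) (simp add: norm_scaleC)
      also have "\<dots> \<le> norm (g (gfloor (t k) z) - g z) + 2 * pi * (D * t k * \<bar>R\<bar>) * norm (g z)"
        using c by (intro add_left_mono mult_right_mono) auto
      finally show "norm (?G z) \<le> norm (g (gfloor (t k) z) - g z) + 2 * pi * (D * t k * \<bar>R\<bar>) * norm (g z)" .
    qed
    also have "\<dots> = A k"
      unfolding A_def L1_def using integrable_norm_wbounded[OF ac] integrable_norm_wbounded[OF ag C]
      by (subst Bochner_Integration.integral_add) auto
    finally show ?thesis .
  qed
  show ?thesis by (rule eventually_mono[OF ev]) (meson le less_imp_le order_trans)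
qed

text \<open>If some coordinate of \<open>y\<close> is large, both the sum and the integral are at
  most e/4; otherwise \<open>y\<close> stays in a fixed ball and convergence is locally uniform. The
  sequence of suprema over the cells is the explicit error bound.\<close>

lemma osc_tendsto_uniformly_torus:
  fixes g :: "real ^ 'd \<Rightarrow> 'y::complex_banach"
  assumes g: "cont g" "bounded {x. g x \<noteq> 0}" and t: "\<And>k. 0 < t k" "\<And>k. t k \<le> 1" "t \<longlonglongrightarrow> 0"
  shows "\<exists>\<sigma>. \<sigma> \<longlonglongrightarrow> 0 \<and> (\<forall>k. 0 \<le> \<sigma> k) \<and> (\<forall>k. \<forall>y\<in>torus (t k). norm (osc (t k) g y - osc 0 g y) \<le> \<sigma> k)"
proof -
  obtain C where C: "wbounded C g" using wbounded_compact_support[OF g] by blast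
  have ag: "ae_cont g" by (rule continuous_imp_ae_cont[OF g(1)])
  have ad: "admissible s C g" if "0 \<le> s" "s \<le> 1" for s using C ag that by (simp add: admissible_def)
  define K where "K = 3 ^ CARD('d) * C * L1 (weight :: real ^ 'd \<Rightarrow> real)"
  have bd: "norm (osc s g y) \<le> K" if "0 \<le> s" "s \<le> 1" for s and y :: "real ^ 'd"
    using norm_osc_le[OF ad[OF that], of y] L1_wbounded_gfloor[OF g(1) C that] by (simp add: K_def)
  define \<sigma> where "\<sigma> k = (SUP y\<in>torus (t k) :: (real ^ 'd) set. norm (osc (t k) g y - osc 0 g y))" for k
  have bdd: "bdd_above ((\<lambda>y. norm (osc (t k) g y - osc 0 g y)) ` torus (t k))" for k
  proof (rule bdd_aboveI2)
    fix y :: "real ^ 'd"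
    have "norm (osc (t k) g y - osc 0 g y) \<le> norm (osc (t k) g y) + norm (osc 0 g y)" by (rule norm_triangle_ineq4)
    also have "\<dots> \<le> K + K" using t(1)[of k] t(2)[of k] by (intro add_mono bd) auto
    finally show "norm (osc (t k) g y - osc 0 g y) \<le> K + K" .
  qed
  have 0: "(0 :: real ^ 'd) \<in> torus (t k)" for k using torus_iff[OF t(1)[of k], of 0] by simp
  have le: "norm (osc (t k) g y - osc 0 g y) \<le> \<sigma> k" if "y \<in> torus (t k)" for k and y :: "real ^ 'd"
    unfolding \<sigma>_def by (rule cSUP_upper[OF that bdd])
  have nonneg: "0 \<le> \<sigma> k" for k using le[OF 0] norm_ge_zero order_trans by blast
  have "\<sigma> \<longlonglongrightarrow> 0"
  proof (rule LIMSEQ_I)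
    fix e :: real assume e: "0 < e"
    then have e4: "0 < e / 4" by simp
    obtain R where R: "\<And>s y i. 0 \<le> s \<Longrightarrow> s \<le> 1 \<Longrightarrow> s * \<bar>y $ i\<bar> \<le> 1 / 2 \<Longrightarrow> R \<le> \<bar>y $ i\<bar> \<Longrightarrow> norm (osc s g y) \<le> e / 4"
      using osc_small_at_infinity[OF g e4] by metis
    have "eventually (\<lambda>k. \<forall>y. norm y \<le> real CARD('d) * \<bar>R\<bar> \<longrightarrow> norm (osc (t k) g y - osc 0 g y) \<le> e / 4) sequentially"
      by (rule osc_tendsto_locally_uniformly[OF g t e4])
    then obtain k0 where k0: "\<And>k y. k0 \<le> k \<Longrightarrow> norm y \<le> real CARD('d) * \<bar>R\<bar> \<Longrightarrow> norm (osc (t k) g y - osc 0 g y) \<le> e / 4"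
      unfolding eventually_sequentially by blast
    have "norm (\<sigma> k - 0) < e" if k: "k0 \<le> k" for k
    proof -
      have "\<sigma> k \<le> e / 2"
        unfolding \<sigma>_def
      proof (rule cSUP_least)
        show "torus (t k) \<noteq> ({} :: (real ^ 'd) set)" using 0 by blast
        fix y :: "real ^ 'd" assume y: "y \<in> torus (t k)"
        show "norm (osc (t k) g y - osc 0 g y) \<le> e / 2"
        proof (cases "\<exists>i. R \<le> \<bar>y $ i\<bar>")
          case True
          then obtain i where i: "R \<le> \<bar>y $ i\<bar>" by blast
          have "norm (osc (t k) g y) \<le> e / 4"
            using y torus_iff[OF t(1)] t(1)[of k] t(2)[of k] by (intro R[OF _ _ _ i]) auto
          moreover have "norm (osc 0 g y) \<le> e / 4" by (intro R[OF _ _ _ i]) auto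
          ultimately show ?thesis using norm_triangle_ineq4[of "osc (t k) g y" "osc 0 g y"] by linarith
        next
          case False
          have "norm y \<le> (\<Sum>i\<in>UNIV. \<bar>y $ i\<bar>)" by (rule norm_le_l1_cart)
          also have "\<dots> \<le> (\<Sum>i\<in>(UNIV::'d set). \<bar>R\<bar>)"
            using False by (intro sum_mono) (meson abs_ge_self le_cases order_trans)
          finally have "norm y \<le> real CARD('d) * \<bar>R\<bar>" by simp
          then have "norm (osc (t k) g y - osc 0 g y) \<le> e / 4" by (rule k0[OF k])
          then show ?thesis using e by linarith
        qed
      qed
      then show ?thesis using nonneg[of k] e by simp
    qed
    then show "\<exists>k0. \<forall>k\<ge>k0. norm (\<sigma> k - 0) < e" by blast
  qed
  then show ?thesis using nonneg le by blast
qed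

section \<open>Passing from periodic to Euclidean inequalities\<close>

lemma Lpow_integrand_tendsto:
  fixes f :: "nat \<Rightarrow> 'a::euclidean_space \<Rightarrow> 'b::real_normed_vector"
  assumes "0 < p" "eventually (\<lambda>k. y \<in> S k) sequentially" "(\<lambda>k. f k y) \<longlonglongrightarrow> g y"
  shows "(\<lambda>k. ennreal (norm (f k y) powr p) * indicator (S k) y) \<longlonglongrightarrow> ennreal (norm (g y) powr p)"
proof -
  have "(\<lambda>k. ennreal (norm (f k y) powr p)) \<longlonglongrightarrow> ennreal (norm (g y) powr p)"
    using assms(1) by (intro tendsto_ennrealI tendsto_powr' tendsto_norm assms(3) tendsto_const) auto
  then show ?thesis
    by (rule Lim_transform_eventually) (use assms(2) in \<open>auto elim!: eventually_mono simp: indicator_def\<close>)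
qed

lemma Lpow_dominated_convergence:
  fixes f :: "nat \<Rightarrow> 'a::euclidean_space \<Rightarrow> 'b::real_normed_vector"
  assumes f: "\<And>k. cont (f k)" "cont g" "\<And>k. S k \<in> sets borel" and p: "0 < p"
    and S: "\<And>y. eventually (\<lambda>k. y \<in> S k) sequentially" and lim: "\<And>y. (\<lambda>k. f k y) \<longlonglongrightarrow> g y"
    and w: "w \<in> borel_measurable borel" "(\<integral>\<^sup>+y. w y \<partial>lborel) < \<infinity>"
      "\<And>k y. y \<in> S k \<Longrightarrow> ennreal (norm (f k y) powr p) \<le> w y"
  shows "(\<lambda>k. Lpow p (S k) (f k)) \<longlonglongrightarrow> Lpow p UNIV g"
proof -
  have "(\<lambda>k. \<integral>\<^sup>+y. ennreal (norm (f k y) powr p) * indicator (S k) y \<partial>lborel)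
      \<longlonglongrightarrow> (\<integral>\<^sup>+y. ennreal (norm (g y) powr p) \<partial>lborel)"
  proof (rule nn_integral_dominated_convergence[where w = w])
    show "(\<lambda>y. ennreal (norm (f k y) powr p) * indicator (S k) y) \<in> borel_measurable lborel" for k
      using Lpow_measurable[OF f(1)[of k], of p] f(3)[of k] by simp
    show "(\<lambda>y. ennreal (norm (g y) powr p)) \<in> borel_measurable lborel"
      using Lpow_measurable[OF f(2), of p] by simp
    show "AE y in lborel. ennreal (norm (f k y) powr p) * indicator (S k) y \<le> w y" for k
      using w(3)[of _ k] by (intro AE_I2) (auto simp: indicator_def)
    show "AE y in lborel. (\<lambda>k. ennreal (norm (f k y) powr p) * indicator (S k) y) \<longlonglongrightarrow> ennreal (norm (g y) powr p)"
      by (intro AE_I2 Lpow_integrand_tendsto p S lim)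
  qed (use w in auto)
  then show ?thesis by (simp add: Lpow_def)
qed

lemma Lpow_fatou:
  fixes f :: "nat \<Rightarrow> 'a::euclidean_space \<Rightarrow> 'b::real_normed_vector"
  assumes f: "\<And>k. cont (f k)" "\<And>k. S k \<in> sets borel" and p: "0 < p"
    and S: "\<And>y. eventually (\<lambda>k. y \<in> S k) sequentially" and lim: "\<And>y. (\<lambda>k. f k y) \<longlonglongrightarrow> g y"
    and le: "\<And>k. Lpow p (S k) (f k) \<le> E k" "E \<longlonglongrightarrow> E'"
  shows "Lpow p UNIV g \<le> E'"
proof -
  have "liminf (\<lambda>k. ennreal (norm (f k y) powr p) * indicator (S k) y) = ennreal (norm (g y) powr p)" for y
    by (rule lim_imp_Liminf[OF sequentially_bot Lpow_integrand_tendsto[OF p S lim]])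
  then have "Lpow p UNIV g = (\<integral>\<^sup>+y. liminf (\<lambda>k. ennreal (norm (f k y) powr p) * indicator (S k) y) \<partial>lborel)"
    by (simp add: Lpow_def)
  also have "\<dots> \<le> liminf (\<lambda>k. \<integral>\<^sup>+y. ennreal (norm (f k y) powr p) * indicator (S k) y \<partial>lborel)"
    using Lpow_measurable[OF f(1), where p = p] f(2) by (intro nn_integral_liminf) simp
  also have "\<dots> \<le> liminf E"
    using le(1) by (intro Liminf_mono always_eventually) (simp add: Lpow_def)
  also have "\<dots> = E'" by (rule lim_imp_Liminf[OF sequentially_bot le(2)])
  finally show ?thesis .
qed

lemma Lpow_decay_bounded:
  assumes q: "1 < q"
  shows "\<exists>M. \<forall>S (f :: real ^ 'd \<Rightarrow> 'b::real_normed_vector). (\<forall>y\<in>S. norm (f y) \<le> K * decay y) \<longrightarrow> Lpow q S f \<le> ennreal M"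
proof -
  let ?I = "\<integral>\<^sup>+x. ennreal (decay x powr q) \<partial>(lborel :: (real ^ 'd) measure)"
  have "?I \<noteq> top" using nn_integral_decay_finite[OF q, where 'd = 'd] by (simp add: less_top)
  then obtain I where I: "0 \<le> I" "?I = ennreal I" by (cases ?I) auto
  have "Lpow q S f \<le> ennreal (\<bar>K\<bar> powr q * I)"
    if le: "\<forall>y\<in>S. norm (f y) \<le> K * decay y" for S and f :: "real ^ 'd \<Rightarrow> 'b"
  proof -
    have "Lpow q S f \<le> (\<integral>\<^sup>+y. ennreal (\<bar>K\<bar> powr q) * ennreal (decay y powr q) \<partial>(lborel :: (real ^ 'd) measure))"
      unfolding Lpow_def
    proof (rule nn_integral_mono)
      fix y :: "real ^ 'd"
      show "ennreal (norm (f y) powr q) * indicator S y \<le> ennreal (\<bar>K\<bar> powr q) * ennreal (decay y powr q)"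
      proof (cases "y \<in> S")
        case True
        then have "norm (f y) \<le> K * decay y" using le by blast
        also have "\<dots> \<le> \<bar>K\<bar> * decay y" by (intro mult_right_mono) auto
        finally have "norm (f y) powr q \<le> (\<bar>K\<bar> * decay y) powr q" using q by (intro powr_mono2) auto
        then show ?thesis using True by (simp add: powr_mult ennreal_mult[symmetric] ennreal_leI)
      qed simp
    qed
    also have "\<dots> = ennreal (\<bar>K\<bar> powr q * I)"
      using I by (subst nn_integral_cmult) (auto simp: ennreal_mult)
    finally show ?thesis .
  qed
  then show ?thesis by blast
qed

definition mesh :: "(nat \<Rightarrow> real) \<Rightarrow> bool" where
  "mesh t \<longleftrightarrow> (\<forall>k. 0 < t k) \<and> (\<forall>k. t k \<le> 1) \<and> t \<longlonglongrightarrow> 0"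

lemma meshD:
  assumes "mesh t"
  shows "0 < t k" "t k \<le> 1" "t \<longlonglongrightarrow> 0"
  using assms by (auto simp: mesh_def)

lemma continuous_osc_mesh:
  fixes g :: "real ^ 'd \<Rightarrow> 'y::complex_banach"
  assumes "cont g" "bounded {x. g x \<noteq> 0}" "0 \<le> t"
  shows "cont (osc t g)"
proof (cases "t = 0")
  case True
  obtain C where "wbounded C g" using wbounded_compact_support[OF assms(1,2)] by blast
  then show ?thesis using True continuous_osc_0[OF continuous_imp_ae_cont[OF assms(1)]] by simp
next
  case False
  then have t: "0 < t" using assms(3) by simp
  show ?thesis using osc_eq_trig(2)[OF t assms(2), of g] continuous_trig by simp
qed

lemma osc_mesh_tendsto:
  fixes g :: "real ^ 'd \<Rightarrow> 'y::complex_banach"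
  assumes g: "cont g" "bounded {x. g x \<noteq> 0}" and t: "mesh t"
  shows "(\<lambda>k. osc (t k) g y) \<longlonglongrightarrow> osc 0 g y"
proof -
  obtain C where C: "wbounded C g" using wbounded_compact_support[OF g] by blast
  have ag: "ae_cont g" by (rule continuous_imp_ae_cont[OF g(1)])
  show ?thesis
  proof (rule osc_tendsto[where C = C and N = "{}"])
    show "(\<lambda>k. g (gfloor (t k) z)) \<longlonglongrightarrow> g z" for z
      using g(1) gfloor_tendsto[of t z] meshD[OF t]
      by (intro isCont_tendsto_compose[of _ g]) (auto simp: continuous_on_eq_continuous_at less_imp_le)
  qed (use C ag meshD[OF t] in \<open>auto simp: less_imp_le\<close>)
qed

text \<open>Symbols whose Riemann sums converge to the inverse transform in Lp over the growing
  period cells. Compact support makes these sums trigonometric polynomials, to which periodic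
  inequalities apply.\<close>

definition sampled :: "real \<Rightarrow> (nat \<Rightarrow> real) \<Rightarrow> (real ^ 'd \<Rightarrow> 'y::complex_banach) \<Rightarrow> bool" where
  "sampled p t g \<longleftrightarrow> cont g \<and> bounded {x. g x \<noteq> 0} \<and> Lpow p UNIV (osc 0 g) < \<infinity> \<and>
    (\<lambda>k. Lpow p (torus (t k)) (\<lambda>y. osc (t k) g y - osc 0 g y)) \<longlonglongrightarrow> 0"

text \<open>Replacing sums by integrals costs errors that vanish in Lp of the cells; powers over the
  cells then converge to powers over the space because the limits have finite power.\<close>

lemma sampled_inequality:
  fixes g :: "real ^ 'd \<Rightarrow> 'y::complex_banach" and h :: "real ^ 'd \<Rightarrow> 'x::complex_banach"
  assumes t: "mesh t" and g: "sampled p t g" and h: "sampled p t h" and p: "0 < p" and c: "0 < c"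
    and le: "\<And>k. Lpow p (torus (t k)) (osc (t k) g) \<le> ennreal c * Lpow p (torus (t k)) (osc (t k) h)"
  shows "Lpow p UNIV (osc 0 g) \<le> ennreal c * Lpow p UNIV (osc 0 h)"
proof -
  have gc: "cont (osc 0 g)" "cont (osc (t k) g)"
    and hc: "cont (osc 0 h)" "cont (osc (t k) h)" for k
    using g h meshD(1)[OF t, of k] by (auto simp: sampled_def intro!: continuous_osc_mesh)
  have ex: "(\<lambda>k. Lpow p (torus (t k)) f) \<longlonglongrightarrow> Lpow p UNIV f"
    if "cont f" "Lpow p UNIV f < \<infinity>" for f :: "real ^ 'd \<Rightarrow> 'z::complex_banach"
    by (rule Lpow_dominated_convergence[where w = "\<lambda>y. ennreal (norm (f y) powr p)"])
      (use that p Lpow_measurable[OF that(1), of p] eventually_in_torus[OF meshD(1)[OF t] meshD(3)[OF t]]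
        in \<open>auto simp: Lpow_def\<close>)
  have tri: "norm a \<le> norm b + norm (b - a)" for a b :: 'y
    using norm_triangle_sub[of a b] by (simp add: norm_minus_commute)
  show ?thesis
  proof (rule perturbed_inequality_limit[where a = "\<lambda>k. Lpow p (torus (t k)) (osc (t k) g)"
        and b = "\<lambda>k. Lpow p (torus (t k)) (osc (t k) h)", OF p c _ _ le])
    show "\<exists>D. \<forall>k. Lpow p (torus (t k)) (osc 0 g) \<le> ennreal ((1 + d) powr p) * Lpow p (torus (t k)) (osc (t k) g)
        + ennreal D * Lpow p (torus (t k)) (\<lambda>y. osc (t k) g y - osc 0 g y)" if d: "0 < d" for d
      by (intro exI[of _ "(1 + 1 / d) powr p"] allI Lpow_triangle[OF gc(2) continuous_on_diff[OF gc(2) gc(1)] torus_sets p d])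
        (rule tri)
    show "\<exists>D. \<forall>k. Lpow p (torus (t k)) (osc (t k) h) \<le> ennreal ((1 + d) powr p) * Lpow p (torus (t k)) (osc 0 h)
        + ennreal D * Lpow p (torus (t k)) (\<lambda>y. osc (t k) h y - osc 0 h y)" if d: "0 < d" for d
      by (intro exI[of _ "(1 + 1 / d) powr p"] allI Lpow_triangle[OF hc(1) continuous_on_diff[OF hc(2) hc(1)] torus_sets p d])
        (rule norm_triangle_sub)
    show "(\<lambda>k. Lpow p (torus (t k)) (osc 0 g)) \<longlonglongrightarrow> Lpow p UNIV (osc 0 g)"
      using g by (intro ex gc) (simp add: sampled_def)
    show "(\<lambda>k. Lpow p (torus (t k)) (osc 0 h)) \<longlonglongrightarrow> Lpow p UNIV (osc 0 h)"
      using h by (intro ex hc) (simp add: sampled_def)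
  qed (use g h in \<open>simp_all add: sampled_def\<close>)
qed

lemma sampled_sum:
  fixes g :: "'i \<Rightarrow> real ^ 'd \<Rightarrow> 'y::complex_banach"
  assumes t: "mesh t" and p: "0 < p" and I: "finite I" and g: "\<And>i. i \<in> I \<Longrightarrow> sampled p t (g i)"
  shows "sampled p t (\<lambda>z. \<Sum>i\<in>I. g i z)"
proof -
  have c: "cont (g i)" "bounded {x. g i x \<noteq> 0}" if "i \<in> I" for i
    using g[OF that] by (auto simp: sampled_def)
  have "\<exists>C. \<forall>i\<in>I. wbounded (C i) (g i)"     by (intro bchoice ballI wbounded_compact_support c)
  then obtain C where C: "\<And>i. i \<in> I \<Longrightarrow> wbounded (C i) (g i)" by blast
  have ad: "admissible s (C i) (g i)" if "0 \<le> s" "s \<le> 1" "i \<in> I" for s i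
    using C c continuous_imp_ae_cont that by (auto simp: admissible_def)
  have osc: "osc s (\<lambda>z. \<Sum>i\<in>I. g i z) y = (\<Sum>i\<in>I. osc s (g i) y)" if "0 \<le> s" "s \<le> 1" for s y
    by (rule osc_sum[OF I that ad[OF that]])
  have oc: "cont (osc s (g i))" if "0 \<le> s" "i \<in> I" for s i
    by (intro continuous_osc_mesh c that)
  have t0: "0 \<le> t k" "t k \<le> 1" for k using meshD(1,2)[OF t, of k] by auto
  have "bounded {x. (\<Sum>i\<in>I. g i x) \<noteq> 0}"
  proof (rule bounded_subset)
    show "bounded (\<Union>i\<in>I. {x. g i x \<noteq> 0})" using I c by auto
    show "{x. (\<Sum>i\<in>I. g i x) \<noteq> 0} \<subseteq> (\<Union>i\<in>I. {x. g i x \<noteq> 0})" by (auto dest: sum.not_neutral_contains_not_neutral)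
  qed
  moreover have "Lpow p UNIV (osc 0 (\<lambda>z. \<Sum>i\<in>I. g i z)) < \<infinity>"
  proof -
    have "Lpow p UNIV (osc 0 (\<lambda>z. \<Sum>i\<in>I. g i z)) \<le> ennreal (real (card I) powr p) * (\<Sum>i\<in>I. Lpow p UNIV (osc 0 (g i)))"
    proof (rule Lpow_sum[OF I _ _ p])
      show "norm (osc 0 (\<lambda>z. \<Sum>i\<in>I. g i z) y) \<le> (\<Sum>i\<in>I. norm (osc 0 (g i) y))" for y
        using norm_sum[of "\<lambda>i. osc 0 (g i) y" I] by (simp add: osc)
    qed (simp_all add: oc)
    also have "\<dots> < \<infinity>" using g I by (auto simp: sampled_def ennreal_mult_less_top)
    finally show ?thesis .
  qed
  moreover have "(\<lambda>k. Lpow p (torus (t k)) (\<lambda>y. osc (t k) (\<lambda>z. \<Sum>i\<in>I. g i z) y - osc 0 (\<lambda>z. \<Sum>i\<in>I. g i z) y)) \<longlonglongrightarrow> 0"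
  proof (rule tendsto_sandwich[OF _ _ tendsto_const])
    have "(\<lambda>k. \<Sum>i\<in>I. Lpow p (torus (t k)) (\<lambda>y. osc (t k) (g i) y - osc 0 (g i) y)) \<longlonglongrightarrow> (\<Sum>i\<in>I. 0)"
      using g by (intro tendsto_sum) (simp add: sampled_def)
    then show "(\<lambda>k. ennreal (real (card I) powr p) * (\<Sum>i\<in>I. Lpow p (torus (t k)) (\<lambda>y. osc (t k) (g i) y - osc 0 (g i) y))) \<longlonglongrightarrow> 0"
      by (intro ennreal_tendsto_cmult_0) simp
    show "\<forall>\<^sub>F k in sequentially. Lpow p (torus (t k)) (\<lambda>y. osc (t k) (\<lambda>z. \<Sum>i\<in>I. g i z) y - osc 0 (\<lambda>z. \<Sum>i\<in>I. g i z) y)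
        \<le> ennreal (real (card I) powr p) * (\<Sum>i\<in>I. Lpow p (torus (t k)) (\<lambda>y. osc (t k) (g i) y - osc 0 (g i) y))"
    proof (intro always_eventually allI, rule Lpow_sum[OF I _ torus_sets p])
      fix k y
      show "norm (osc (t k) (\<lambda>z. \<Sum>i\<in>I. g i z) y - osc 0 (\<lambda>z. \<Sum>i\<in>I. g i z) y)
          \<le> (\<Sum>i\<in>I. norm (osc (t k) (g i) y - osc 0 (g i) y))"
        using norm_sum[of "\<lambda>i. osc (t k) (g i) y - osc 0 (g i) y" I] by (simp add: osc t0 sum_subtractf)
    qed (simp add: oc t0 continuous_on_diff)
  qed auto
  moreover have "cont (\<lambda>z. \<Sum>i\<in>I. g i z)" using c by (intro continuous_on_sum) auto
  ultimately show ?thesis by (simp add: sampled_def)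
qed

lemma decay_majorant:
  assumes q: "1 < q"
  shows "\<exists>w. w \<in> borel_measurable borel \<and> (\<integral>\<^sup>+y. w y \<partial>lborel) < \<infinity> \<and>
    (\<forall>x. \<forall>y :: real ^ 'd. 0 \<le> x \<longrightarrow> x \<le> K * decay y \<longrightarrow> ennreal (x powr q) \<le> w y)"
proof (intro exI conjI allI impI)
  let ?w = "\<lambda>y :: real ^ 'd. ennreal (\<bar>K\<bar> powr q) * ennreal (decay y powr q)"
  show "?w \<in> borel_measurable borel" by simp
  show "(\<integral>\<^sup>+y. ?w y \<partial>lborel) < \<infinity>"
    using nn_integral_decay_finite[OF q, where 'd = 'd] by (auto simp: nn_integral_cmult ennreal_mult_less_top)
  fix x and y :: "real ^ 'd"
  assume x: "0 \<le> x" "x \<le> K * decay y"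
  have "K * decay y \<le> \<bar>K\<bar> * decay y" by (intro mult_right_mono) auto
  then have "x powr q \<le> (\<bar>K\<bar> * decay y) powr q" using x q by (intro powr_mono2) auto
  then show "ennreal (x powr q) \<le> ?w y" by (simp add: powr_mult ennreal_mult[symmetric] ennreal_leI)
qed

lemma mixed_lip_torus_decay:
  fixes u :: "real ^ 'd \<Rightarrow> complex"
  assumes u: "cont u" "mixed_lip C u" and t: "mesh t"
  defines "K \<equiv> 3 ^ CARD('d) * C * L1 (weight :: real ^ 'd \<Rightarrow> real)"
  shows "y \<in> torus (t k) \<Longrightarrow> norm (osc (t k) u y) \<le> K * decay y" and "norm (osc 0 u y) \<le> K * decay y"
proof -
  show "norm (osc (t k) u y) \<le> K * decay y" if "y \<in> torus (t k)"
    unfolding K_def using meshD(1,2)[OF t, of k] torus_iff[of "t k" y] that by (intro mixed_lip_decay[OF u]) auto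
  show "norm (osc 0 u y) \<le> K * decay y"
    unfolding K_def by (intro mixed_lip_decay[OF u]) auto
qed

lemma sampled_scaleC_right:
  fixes u :: "real ^ 'd \<Rightarrow> complex"
  assumes u: "sampled p t u" and t: "mesh t"
  shows "sampled p t (\<lambda>z. u z *\<^sub>C a)"
proof -
  have c: "cont u" "bounded {x. u x \<noteq> 0}" using u by (auto simp: sampled_def)
  obtain C where C: "wbounded C u" using wbounded_compact_support[OF c] by blast
  have ad: "admissible s C u" if "0 \<le> s" "s \<le> 1" for s
    using C continuous_imp_ae_cont[OF c(1)] that by (simp add: admissible_def)
  have osc: "osc s (\<lambda>z. u z *\<^sub>C a) y = osc s u y *\<^sub>C a" if "0 \<le> s" "s \<le> 1" for s y
    by (rule osc_scaleC_right[OF ad[OF that]])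
  have t0: "0 \<le> t k" "t k \<le> 1" for k using meshD(1,2)[OF t, of k] by auto
  have oc: "cont (osc s u)" if "0 \<le> s" for s by (rule continuous_osc_mesh[OF c that])
  have "bounded {x. u x *\<^sub>C a \<noteq> 0}" by (rule bounded_subset[OF c(2)]) auto
  moreover have "cont (\<lambda>z. u z *\<^sub>C a)" by (intro scaleC.continuous_on c continuous_on_const)
  moreover have "Lpow p UNIV (osc 0 (\<lambda>z. u z *\<^sub>C a)) < \<infinity>"
  proof -
    have "osc 0 (\<lambda>z. u z *\<^sub>C a) = (\<lambda>y. osc 0 u y *\<^sub>C a)" using osc by auto
    then show ?thesis
      using u Lpow_scaleC_right[OF oc[of 0], of UNIV p a] by (simp add: sampled_def ennreal_mult_less_top)
  qed
  moreover have "(\<lambda>k. Lpow p (torus (t k)) (\<lambda>y. osc (t k) (\<lambda>z. u z *\<^sub>C a) y - osc 0 (\<lambda>z. u z *\<^sub>C a) y)) \<longlonglongrightarrow> 0"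
  proof -
    have "(\<lambda>y. osc (t k) (\<lambda>z. u z *\<^sub>C a) y - osc 0 (\<lambda>z. u z *\<^sub>C a) y) = (\<lambda>y. (osc (t k) u y - osc 0 u y) *\<^sub>C a)" for k
      using osc t0 by (simp add: scaleC.diff_left)
    then have "Lpow p (torus (t k)) (\<lambda>y. osc (t k) (\<lambda>z. u z *\<^sub>C a) y - osc 0 (\<lambda>z. u z *\<^sub>C a) y)
        = ennreal (norm a powr p) * Lpow p (torus (t k)) (\<lambda>y. osc (t k) u y - osc 0 u y)" for k
      using oc t0 by (simp add: Lpow_scaleC_right continuous_on_diff)
    then show ?thesis using u by (simp add: sampled_def ennreal_tendsto_cmult_0)
  qed
  ultimately show ?thesis by (simp add: sampled_def)
qed

lemma mixed_lip_Lpow_tendsto: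
  fixes u :: "real ^ 'd \<Rightarrow> complex"
  assumes u: "cont u" "bounded {x. u x \<noteq> 0}" "mixed_lip C u" and t: "mesh t" and q: "1 < q"
  shows "(\<lambda>k. Lpow q (torus (t k)) (osc (t k) u)) \<longlonglongrightarrow> Lpow q UNIV (osc 0 u)" and "sampled q t u"
proof -
  define K where "K = \<bar>3 ^ CARD('d) * C * L1 (weight :: real ^ 'd \<Rightarrow> real)\<bar>"
  have K: "norm (osc (t k) u y) \<le> K * decay y" if "y \<in> torus (t k)" for k y
    using mixed_lip_torus_decay(1)[OF u(1,3) t that] mult_right_mono[OF abs_ge_self decay_nonneg] unfolding K_def by (rule order_trans)
  have K0: "norm (osc 0 u y) \<le> K * decay y" for y
    using mixed_lip_torus_decay(2)[OF u(1,3) t] mult_right_mono[OF abs_ge_self decay_nonneg] unfolding K_def by (rule order_trans)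
  have oc: "cont (osc s u)" if "0 \<le> s" for s by (rule continuous_osc_mesh[OF u(1,2) that])
  have t0: "0 \<le> t k" for k using meshD(1,2)[OF t, of k] by auto
  \<comment> \<open>A majorant for each multiple of \<open>decay\<close>: K is used for the sums and
    the integral, 2 K for their difference.\<close>
  have "\<exists>w. \<forall>D. w D \<in> borel_measurable borel \<and> (\<integral>\<^sup>+y. w D y \<partial>lborel) < \<infinity> \<and>
      (\<forall>x. \<forall>y :: real ^ 'd. 0 \<le> x \<longrightarrow> x \<le> D * decay y \<longrightarrow> ennreal (x powr q) \<le> w D y)"
    by (intro choice allI decay_majorant q)
  then obtain w where w: "w D \<in> borel_measurable borel" "(\<integral>\<^sup>+y. w D y \<partial>lborel) < \<infinity>"
    and wle: "\<And>x. \<And>y :: real ^ 'd. 0 \<le> x \<Longrightarrow> x \<le> D * decay y \<Longrightarrow> ennreal (x powr q) \<le> w D y" for D by blast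
  have K_nonneg: "0 \<le> K" by (simp add: K_def)
  note ev = eventually_in_torus[OF meshD(1)[OF t] meshD(3)[OF t]]
  show "(\<lambda>k. Lpow q (torus (t k)) (osc (t k) u)) \<longlonglongrightarrow> Lpow q UNIV (osc 0 u)"
    by (rule Lpow_dominated_convergence[where w = "w K"])
      (use q oc t0 ev osc_mesh_tendsto[OF u(1,2) t] w wle K K_nonneg in auto)
  have "(\<lambda>k. Lpow q (torus (t k)) (\<lambda>y. osc (t k) u y - osc 0 u y)) \<longlonglongrightarrow> Lpow q UNIV (\<lambda>y :: real ^ 'd. 0 :: complex)"
  proof (rule Lpow_dominated_convergence[where w = "w (2 * K)"])
    fix k and y :: "real ^ 'd"
    assume y: "y \<in> torus (t k)"
    have "norm (osc (t k) u y - osc 0 u y) \<le> 2 * K * decay y"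
      using norm_triangle_ineq4[of "osc (t k) u y" "osc 0 u y"] K[OF y] K0[of y] by linarith
    then show "ennreal (norm (osc (t k) u y - osc 0 u y) powr q) \<le> w (2 * K) y"
      using K_nonneg by (intro wle) auto
  next
    show "(\<lambda>k. osc (t k) u y - osc 0 u y) \<longlonglongrightarrow> 0" for y
      by (rule LIM_zero[OF osc_mesh_tendsto[OF u(1,2) t]])
  qed (use q oc t0 ev w in \<open>auto intro!: continuous_on_diff\<close>)
  moreover have "Lpow q UNIV (osc 0 u) < \<infinity>"
  proof -
    have "Lpow q UNIV (osc 0 u) \<le> (\<integral>\<^sup>+y. w K y \<partial>lborel)"
      unfolding Lpow_def using wle K0 K_nonneg by (intro nn_integral_mono) simp
    then show ?thesis using w(2)[of K] by (rule order.strict_trans1)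
  qed
  ultimately show "sampled q t u" using u q by (simp add: sampled_def Lpow_def)
qed

lemma C_infinity_compact_mult_trig:
  fixes \<psi> :: "real ^ 'd \<Rightarrow> complex"
  assumes "C_infinity_compact \<psi>"
  shows "C_infinity_compact (\<lambda>x. \<psi> x * trig F c x)"
proof -
  have "C_class k (\<lambda>x. \<Sum>m\<in>F. character m x * c m)" for k
    by (intro C_class_sum C_class_bilinear[OF bounded_bilinear_mult] C_class_character C_class_const)
  then have "C_class k (trig F c)" for k
    by (simp add: trig_def[abs_def] scaleC_complex_def)
  then show ?thesis
    using C_infinity_compact_mult[OF assms, of "trig F c"] by (simp add: mult.commute)
qed

lemma Lpow_scaleC_left:
  fixes f :: "'a::euclidean_space \<Rightarrow> 'b::complex_banach"
  assumes "cont f" "S \<in> sets borel"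
  shows "Lpow p S (\<lambda>x. c *\<^sub>C f x) = ennreal (norm c powr p) * Lpow p S f"
proof -
  have "Lpow p S (\<lambda>x. c *\<^sub>C f x) = (\<integral>\<^sup>+x. ennreal (norm c powr p) * (ennreal (norm (f x) powr p) * indicator S x) \<partial>lborel)"
    by (simp add: Lpow_def norm_scaleC powr_mult ennreal_mult mult.assoc)
  also have "\<dots> = ennreal (norm c powr p) * Lpow p S f"
    using Lpow_measurable[OF assms(1), of p] assms(2) by (subst nn_integral_cmult) (auto simp: Lpow_def)
  finally show ?thesis .
qed

lemma Lq_bounded_scaleC:
  fixes \<phi> :: "real ^ 'd \<Rightarrow> ('x::complex_banach \<Rightarrow>\<^sub>L 'y::complex_banach)"
  assumes \<phi>: "multiplier \<phi> B" and a: "Lq_bounded \<phi> a"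
  shows "Lq_bounded \<phi> (c *\<^sub>C a)"
  unfolding Lq_bounded_def
proof (intro allI impI)
  fix q :: real assume "1 < q"
  then obtain C where C: "\<And>f. C_infinity_compact f \<Longrightarrow>
    Lpow q UNIV (fourier_mult \<phi> (\<lambda>x. f x *\<^sub>C a)) \<le> ennreal C * Lpow q UNIV f"
    using a unfolding Lq_bounded_def by blast
  have "Lpow q UNIV (fourier_mult \<phi> (\<lambda>x. f x *\<^sub>C c *\<^sub>C a)) \<le> ennreal (norm c powr q * max C 0) * Lpow q UNIV f"
    if f: "C_infinity_compact f" for f
  proof -
    have cf: "C_infinity_compact (\<lambda>x. c * f x)" by (rule C_infinity_compact_mult[OF f]) simp
    have "(\<lambda>x. f x *\<^sub>C c *\<^sub>C a) = (\<lambda>x. (c * f x) *\<^sub>C a)" by (simp add: scaleC_scaleC mult.commute)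
    then have "Lpow q UNIV (fourier_mult \<phi> (\<lambda>x. f x *\<^sub>C c *\<^sub>C a)) \<le> ennreal C * Lpow q UNIV (\<lambda>x. c * f x)"
      using C[OF cf] by simp
    also have "Lpow q UNIV (\<lambda>x. c * f x) = ennreal (norm c powr q) * Lpow q UNIV f"
      using Lpow_scaleC_left[OF C_infinity_compactD(2)[OF f], of UNIV q c] by (simp add: scaleC_complex_def)
    also have "ennreal C = ennreal (max C 0)" by (simp add: max_def ennreal_neg)
    finally show ?thesis by (simp add: ennreal_mult mult_ac)
  qed
  then show "\<exists>C. \<forall>f. C_infinity_compact f \<longrightarrow> Lpow q UNIV (fourier_mult \<phi> (\<lambda>x. f x *\<^sub>C c *\<^sub>C a)) \<le> ennreal C * Lpow q UNIV f"
    by blast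
qed

lemma multiplier_sum:
  assumes "multiplier \<phi> B"
  shows "blinfun_apply (\<phi> z) (\<Sum>i\<in>I. c i *\<^sub>C a i) = (\<Sum>i\<in>I. c i *\<^sub>C blinfun_apply (\<phi> z) (a i))"
  by (simp add: blinfun.sum_right multiplier_scaleC[OF assms])

text \<open>Transference of hypothesis (4) to period 1/t, with a constant free of t. Continuity is
  needed only at the sampled points where \<open>u\<close> does not vanish.\<close>

lemma torus_Lq_bound:
  fixes \<phi> :: "real ^ 'd \<Rightarrow> ('x::complex_banach \<Rightarrow>\<^sub>L 'y::complex_banach)" and u :: "real ^ 'd \<Rightarrow> complex"
  assumes \<phi>: "multiplier \<phi> B" and a: "Lq_bounded \<phi> a" and q: "1 < q" and C: "0 < C"
    "\<And>f. C_infinity_compact f \<Longrightarrow> Lpow q UNIV (fourier_mult \<phi> (\<lambda>x. f x *\<^sub>C a)) \<le> ennreal C * Lpow q UNIV f"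
    and u: "cont u" "bounded {x. u x \<noteq> 0}"
    and cont: "\<And>z. u z \<noteq> 0 \<Longrightarrow> isCont (\<lambda>z. blinfun_apply (\<phi> z) a) z" and t: "0 < t" "t \<le> 1"
  shows "Lpow q (torus t) (osc t (\<lambda>z. u z *\<^sub>C blinfun_apply (\<phi> z) a)) \<le> ennreal C * Lpow q (torus t) (osc t u)"
proof (cases "a = 0")
  case True
  then show ?thesis using q by (simp add: Lpow_def)
next
  case False
  define S where "S = {x. u x \<noteq> 0}"
  define F where "F = S \<inter> (\<lambda>m. t *\<^sub>R m) ` int_lattice"
  define c where "c m = of_real (t ^ CARD('d)) * u m" for m
  have S: "bounded S" using u by (simp add: S_def)
  have F: "finite F" "F \<subseteq> (\<lambda>m. (1 / (1 / t)) *\<^sub>R m) ` int_lattice"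
    using osc_eq_trig(1)[OF t(1) S] by (auto simp: F_def)
  have eq: "osc t u = trig F c" "osc t (\<lambda>z. u z *\<^sub>C blinfun_apply (\<phi> z) a) = trig F (\<lambda>m. blinfun_apply (\<phi> m) (c m *\<^sub>C a))"
    using osc_eq_trig(2)[OF t(1) S, of u] osc_eq_trig(2)[OF t(1) S, of "\<lambda>z. u z *\<^sub>C blinfun_apply (\<phi> z) a"]
    by (simp_all add: S_def F_def c_def[abs_def] multiplier_scaleC[OF \<phi>] scaleC_scaleC scaleC_complex_def)
  have tr: "trig F (\<lambda>m. c m *\<^sub>C a) x = trig F c x *\<^sub>C a" for x
    by (simp add: trig_def scaleC.sum_left scaleC_scaleC scaleC_complex_def)
  have na: "0 < norm a powr q" using False by simp
  \<comment> \<open>Transference compares with trig F c times the vector a, whereas hypothesis (4)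
    compares with the scalar function; the division accounts for the factor
    \<open>norm a powr q\<close>, which comes back at the end.\<close>
  define D where "D = C / norm a powr q"
  have D: "0 < D" "D * norm a powr q = C" using na C by (simp_all add: D_def)
  have "Lpow q UNIV (fourier_mult \<phi> (\<lambda>x. \<psi> x *\<^sub>C trig F (\<lambda>m. c m *\<^sub>C a) x))
      \<le> ennreal D * Lpow q UNIV (\<lambda>x. \<psi> x *\<^sub>C trig F (\<lambda>m. c m *\<^sub>C a) x)" if \<psi>: "C_infinity_compact \<psi>" for \<psi>
  proof -
    have \<psi>c: "C_infinity_compact (\<lambda>x. \<psi> x * trig F c x)" by (rule C_infinity_compact_mult_trig[OF \<psi>])
    have "(\<lambda>x. \<psi> x *\<^sub>C trig F (\<lambda>m. c m *\<^sub>C a) x) = (\<lambda>x. (\<psi> x * trig F c x) *\<^sub>C a)"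
      by (simp add: tr scaleC_scaleC)
    moreover have "Lpow q UNIV (\<lambda>x. (\<psi> x * trig F c x) *\<^sub>C a) = ennreal (norm a powr q) * Lpow q UNIV (\<lambda>x. \<psi> x * trig F c x)"
      by (rule Lpow_scaleC_right[OF C_infinity_compactD(2)[OF \<psi>c]]) simp
    moreover have "ennreal C = ennreal D * ennreal (norm a powr q)" using D by (simp add: ennreal_mult[symmetric])
    ultimately show ?thesis using C(2)[OF \<psi>c] by (simp add: mult.assoc)
  qed
  then have "Lpow q (cube (1 / t)) (trig F (\<lambda>m. blinfun_apply (\<phi> m) (c m *\<^sub>C a)))
      \<le> ennreal D * Lpow q (cube (1 / t)) (trig F (\<lambda>m. c m *\<^sub>C a))"
  proof (intro transference(1)[OF \<phi> _ F _ _ q D(1)])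
    show "Lq_bounded \<phi> (c m *\<^sub>C a)" for m by (rule Lq_bounded_scaleC[OF \<phi> a])
    show "isCont (\<lambda>z. blinfun_apply (\<phi> z) (c m *\<^sub>C a)) m" if "m \<in> F" for m
      using cont[of m] that
      by (auto simp: F_def S_def multiplier_scaleC[OF \<phi>] intro!: scaleC.isCont continuous_intros)
  qed (use t in auto)
  also have "Lpow q (cube (1 / t)) (trig F (\<lambda>m. c m *\<^sub>C a)) = ennreal (norm a powr q) * Lpow q (cube (1 / t)) (trig F c)"
    unfolding tr[abs_def] by (rule Lpow_scaleC_right[OF continuous_trig]) simp
  finally have "Lpow q (cube (1 / t)) (trig F (\<lambda>m. blinfun_apply (\<phi> m) (c m *\<^sub>C a))) \<le> ennreal C * Lpow q (cube (1 / t)) (trig F c)"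
    using D by (simp add: mult.assoc[symmetric] ennreal_mult[symmetric])
  then show ?thesis
    unfolding eq using t q F(2) by (subst (1 2) Lpow_torus) (auto intro!: continuous_trig periodic_trig)
qed

text \<open>Near a point outside the open set the product vanishes identically, so the two open sets
  \<open>G\<close> and the complement of the closed support cover everything.\<close>

lemma continuous_symbol:
  fixes \<phi> :: "real ^ 'd \<Rightarrow> ('x::complex_banach \<Rightarrow>\<^sub>L 'y::complex_banach)" and u :: "real ^ 'd \<Rightarrow> complex"
  assumes u: "cont u" and G: "open G" "closure {x. u x \<noteq> 0} \<subseteq> G"
    and cont: "continuous_on G (\<lambda>z. blinfun_apply (\<phi> z) a)"
  shows "cont (\<lambda>z. u z *\<^sub>C blinfun_apply (\<phi> z) a)"
proof -
  let ?g = "\<lambda>z. u z *\<^sub>C blinfun_apply (\<phi> z) a" and ?Z = "- closure {x. u x \<noteq> 0}"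
  have "continuous_on G ?g" by (intro scaleC.continuous_on cont continuous_on_subset[OF u]) auto
  moreover have "continuous_on ?Z ?g"
  proof (rule continuous_on_eq[OF continuous_on_const])
    show "0 = ?g z" if "z \<in> ?Z" for z
      using closed_support_zero[of z u] that by simp
  qed
  ultimately have "continuous_on (G \<union> ?Z) ?g" using G(1) by (intro continuous_on_open_Un) auto
  moreover have "G \<union> ?Z = UNIV" using G(2) by auto
  ultimately show ?thesis by simp
qed

lemma Lq_boundedE:
  assumes "Lq_bounded \<phi> a" "1 < q"
  obtains C where "0 < C" "\<And>f. C_infinity_compact f \<Longrightarrow>
    Lpow q UNIV (fourier_mult \<phi> (\<lambda>x. f x *\<^sub>C a)) \<le> ennreal C * Lpow q UNIV f"
proof -
  obtain C where C: "\<And>f. C_infinity_compact f \<Longrightarrow> Lpow q UNIV (fourier_mult \<phi> (\<lambda>x. f x *\<^sub>C a)) \<le> ennreal C * Lpow q UNIV f"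
    using assms unfolding Lq_bounded_def by blast
  have "ennreal C * X \<le> ennreal (max C 1) * X" for X by (intro mult_right_mono ennreal_leI) auto
  then show thesis using C by (intro that[of "max C 1"]) (auto intro: order_trans)
qed

text \<open>The Lq bounds on the cells pass to the inverse transform by Fatou's lemma, since the
  scalar sums for \<open>u\<close> converge in Lq by product decay. Uniform convergence on the cells
  and the common Lq bound then interpolate to Lp.\<close>

lemma symbol_sampled:
  fixes \<phi> :: "real ^ 'd \<Rightarrow> ('x::complex_banach \<Rightarrow>\<^sub>L 'y::complex_banach)" and u :: "real ^ 'd \<Rightarrow> complex"
  assumes \<phi>: "multiplier \<phi> B" and a: "Lq_bounded \<phi> a"
    and u: "cont u" "bounded {x. u x \<noteq> 0}" "mixed_lip L u"
    and G: "open G" "closure {x. u x \<noteq> 0} \<subseteq> G" and cont: "continuous_on G (\<lambda>z. blinfun_apply (\<phi> z) a)"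
    and t: "mesh t"
  defines "g \<equiv> \<lambda>z. u z *\<^sub>C blinfun_apply (\<phi> z) a"
  shows "\<And>q C. 1 < q \<Longrightarrow> 0 < C \<Longrightarrow>
      (\<And>f. C_infinity_compact f \<Longrightarrow> Lpow q UNIV (fourier_mult \<phi> (\<lambda>x. f x *\<^sub>C a)) \<le> ennreal C * Lpow q UNIV f) \<Longrightarrow>
      Lpow q UNIV (osc 0 g) \<le> ennreal C * Lpow q UNIV (osc 0 u)"
    and "\<And>p. 1 < p \<Longrightarrow> sampled p t g"
proof -
  have gc: "cont g" unfolding g_def by (rule continuous_symbol[OF u(1) G cont])
  have gb: "bounded {x. g x \<noteq> 0}" by (rule bounded_subset[OF u(2)]) (auto simp: g_def)
  have ug: "isCont (\<lambda>z. blinfun_apply (\<phi> z) a) z" if "u z \<noteq> 0" for z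
  proof -
    have "z \<in> G" using that G(2) closure_subset[of "{x. u x \<noteq> 0}"] by blast
    then show ?thesis using cont G(1) by (simp add: continuous_on_eq_continuous_at)
  qed
  note t' = meshD(1,2)[OF t]
  have oc: "cont (osc s g)" if "0 \<le> s" for s by (rule continuous_osc_mesh[OF gc gb that])
  have oc': "cont (osc (t k) g)" for k using oc t'(1)[of k] by simp
  note ev = eventually_in_torus[OF meshD(1)[OF t] meshD(3)[OF t]]
  have T: "Lpow q (torus (t k)) (osc (t k) g) \<le> ennreal C * Lpow q (torus (t k)) (osc (t k) u)"
    if "1 < q" "0 < C" "\<And>f. C_infinity_compact f \<Longrightarrow> Lpow q UNIV (fourier_mult \<phi> (\<lambda>x. f x *\<^sub>C a)) \<le> ennreal C * Lpow q UNIV f" for q C k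
    unfolding g_def by (rule torus_Lq_bound[OF \<phi> a that u(1,2) ug t'])
  have *: "Lpow q UNIV (osc 0 g) \<le> ennreal C * Lpow q UNIV (osc 0 u)"
    if q: "1 < q" "0 < C" "\<And>f. C_infinity_compact f \<Longrightarrow> Lpow q UNIV (fourier_mult \<phi> (\<lambda>x. f x *\<^sub>C a)) \<le> ennreal C * Lpow q UNIV f" for q C
  proof (rule Lpow_fatou[OF oc' torus_sets _ ev _ T[OF q]])
    show "(\<lambda>k. ennreal C * Lpow q (torus (t k)) (osc (t k) u)) \<longlonglongrightarrow> ennreal C * Lpow q UNIV (osc 0 u)"
      by (intro ennreal_tendsto_cmult mixed_lip_Lpow_tendsto[OF u t]) (use q in auto)
    show "(\<lambda>k. osc (t k) g y) \<longlonglongrightarrow> osc 0 g y" for y by (rule osc_mesh_tendsto[OF gc gb t])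
  qed (use q in auto)
  show "Lpow q UNIV (osc 0 g) \<le> ennreal C * Lpow q UNIV (osc 0 u)"
    if q: "1 < q" "0 < C" "\<And>f. C_infinity_compact f \<Longrightarrow> Lpow q UNIV (fourier_mult \<phi> (\<lambda>x. f x *\<^sub>C a)) \<le> ennreal C * Lpow q UNIV f" for q C
    by (rule *[OF q])
  show "sampled p t g" if p: "1 < p" for p
  proof -
    define q where "q = (1 + p) / 2"
    have q: "1 < q" "q < p" using p by (auto simp: q_def)
    obtain C where C: "0 < C" "\<And>f. C_infinity_compact f \<Longrightarrow> Lpow q UNIV (fourier_mult \<phi> (\<lambda>x. f x *\<^sub>C a)) \<le> ennreal C * Lpow q UNIV f"
      using Lq_boundedE[OF a q(1)] by blast
    define K where "K = 3 ^ CARD('d) * L * L1 (weight :: real ^ 'd \<Rightarrow> real)"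
    obtain M where M: "\<And>S (f :: real ^ 'd \<Rightarrow> complex). (\<forall>y\<in>S. norm (f y) \<le> K * decay y) \<Longrightarrow> Lpow q S f \<le> ennreal M"
      using Lpow_decay_bounded[OF q(1), of K] by blast
    have bt: "Lpow q (torus (t k)) (osc (t k) g) \<le> ennreal C * ennreal M" for k
      using mixed_lip_torus_decay(1)[OF u(1,3) t]
      by (intro order_trans[OF T[OF q(1) C]] mult_left_mono M) (auto simp: K_def)
    have b0: "Lpow q UNIV (osc 0 g) \<le> ennreal C * ennreal M"
      using mixed_lip_torus_decay(2)[OF u(1,3) t]
      by (intro order_trans[OF *[OF q(1) C]] mult_left_mono M) (auto simp: K_def)
    obtain W where W: "wbounded W g" using wbounded_compact_support[OF gc gb] by blast
    have ad: "admissible 0 W g" using W continuous_imp_ae_cont[OF gc] by (simp add: admissible_def)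
    have "Lpow p UNIV (osc 0 g) \<le> ennreal (L1 g powr (p - q)) * Lpow q UNIV (osc 0 g)"
      using norm_osc_le[OF ad] q by (intro Lpow_interpolate oc) auto
    also have "\<dots> < \<infinity>" using b0 by (auto simp: ennreal_mult_less_top intro: le_less_trans)
    finally have fin: "Lpow p UNIV (osc 0 g) < \<infinity>" .
    obtain \<sigma> where \<sigma>: "\<sigma> \<longlonglongrightarrow> 0" "\<And>k. 0 \<le> \<sigma> k" "\<And>k y. y \<in> torus (t k) \<Longrightarrow> norm (osc (t k) g y - osc 0 g y) \<le> \<sigma> k"
      using osc_tendsto_uniformly_torus[OF gc gb t' meshD(3)[OF t]] by blast
    have dc: "cont (\<lambda>y. osc (t k) g y - osc 0 g y)" for k
      by (intro continuous_on_diff oc oc') simp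
    define E where "E = (1 + 1) powr q * (max C 0 * max M 0) + (1 + 1 / 1) powr q * (max C 0 * max M 0)"
    have "1 * Lpow q (torus (t k)) (\<lambda>y. osc (t k) g y - osc 0 g y) \<le> ennreal E" for k
    proof -
      have "1 * Lpow q (torus (t k)) (\<lambda>y. osc (t k) g y - osc 0 g y)
          \<le> ennreal ((1 + 1) powr q) * Lpow q (torus (t k)) (osc (t k) g) + ennreal ((1 + 1 / 1) powr q) * Lpow q (torus (t k)) (osc 0 g)"
        unfolding mult_1_left
        by (rule Lpow_triangle[OF oc' oc torus_sets]) (use q in \<open>auto intro: norm_triangle_ineq4\<close>)
      also have "\<dots> \<le> ennreal ((1 + 1) powr q) * (ennreal C * ennreal M) + ennreal ((1 + 1 / 1) powr q) * (ennreal C * ennreal M)"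
        using bt b0 order_trans[OF Lpow_mono_set[of "torus (t k)" UNIV] b0] by (intro add_mono mult_left_mono) auto
      also have "ennreal C * ennreal M = ennreal (max C 0 * max M 0)"
        using C(1) by (cases "0 \<le> M") (auto simp: ennreal_mult ennreal_neg max_def)
      also have "ennreal ((1 + 1) powr q) * ennreal (max C 0 * max M 0) + ennreal ((1 + 1 / 1) powr q) * ennreal (max C 0 * max M 0) = ennreal E"
        unfolding E_def by (subst (1 2) ennreal_mult[symmetric]) (auto intro!: mult_nonneg_nonneg simp: ennreal_plus[symmetric] simp del: ennreal_plus)
      finally show ?thesis .
    qed
    then have "(\<lambda>k. 1 * Lpow p (torus (t k)) (\<lambda>y. osc (t k) g y - osc 0 g y)) \<longlonglongrightarrow> 0"
      by (intro Lpow_interpolate_tendsto_0[OF dc torus_sets _ q(2) \<sigma>(3) \<sigma>(1) \<sigma>(2)]) (use q in auto)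
    then show ?thesis using fin gc gb by (simp add: sampled_def)
  qed
qed

section \<open>Cutting a symbol off near hyperplanes\<close>

lemma L1_triangle:
  fixes f g :: "real ^ 'd \<Rightarrow> 'b::real_normed_vector"
  assumes "cont f" "wbounded C f" "cont g" "wbounded D g"
  shows "L1 (\<lambda>x. f x + g x) \<le> L1 f + L1 g"
proof -
  have i: "integrable lebesgue (\<lambda>x. norm (f x))" "integrable lebesgue (\<lambda>x. norm (g x))"
    by (rule integrable_norm_wbounded[OF continuous_imp_ae_cont[OF assms(1)] assms(2)]
        integrable_norm_wbounded[OF continuous_imp_ae_cont[OF assms(3)] assms(4)])+
  have "integrable lebesgue (\<lambda>x. norm (f x + g x))"
    by (rule integrable_norm_wbounded[OF continuous_imp_ae_cont[OF continuous_on_add[OF assms(1,3)]] wbounded_add[OF assms(2,4)]])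
  then have "L1 (\<lambda>x. f x + g x) \<le> (\<integral>x. norm (f x) + norm (g x) \<partial>lebesgue)"
    unfolding L1_def using i by (intro integral_mono Bochner_Integration.integrable_add norm_triangle_ineq)
  then show ?thesis using i by (simp add: L1_def Bochner_Integration.integral_add)
qed

text \<open>As the width shrinks the removed part tends to 0 almost everywhere, hence in L1, and its
  inverse transform tends to 0 pointwise. The product decay uniform in the width is an Lq majorant,
  so the q-th power of the remainder converges to that of \<open>h\<close> and no constant is
  lost.\<close>

lemma strip_cutoff:
  fixes h :: "real ^ 'd \<Rightarrow> complex"
  assumes h: "cont h" "mixed_lip C h" and q: "1 < q" and e: "0 < e"
  shows "\<exists>d>0. L1 (\<lambda>z. h z * of_real (trapezoid d (z $ i - c))) \<le> e \<and>
    Lpow q UNIV (osc 0 (\<lambda>z. h z * of_real (1 - trapezoid d (z $ i - c)))) \<le> Lpow q UNIV (osc 0 h) + ennreal e"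
proof -
  define d where "d n = inverse (real (Suc n))" for n
  have d: "0 < d n" "d \<longlonglongrightarrow> 0" for n
    using LIMSEQ_inverse_real_of_nat by (simp_all add: d_def[abs_def])
  define v where "v n z = h z * of_real (trapezoid (d n) (z $ i - c))" for n z
  define u where "u n z = h z * of_real (1 - trapezoid (d n) (z $ i - c))" for n z
  have vc: "cont (v n)" for n
    unfolding v_def[abs_def] using d(1)[of n] by (intro continuous_intros h)
  have uv: "u n = (\<lambda>z. h z - v n z)" for n by (simp add: u_def v_def fun_eq_iff algebra_simps)
  have wb: "wbounded C h" by (rule mixed_lip_wbounded[OF h(2)])
  have vb: "wbounded C (v n)" for n
    by (rule wbounded_mono[OF wb]) (simp add: v_def norm_mult trapezoid_bounds mult_left_le)
  have ad: "admissible 0 C h" "admissible 0 C (v n)" for n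
    using wb vb continuous_imp_ae_cont[OF h(1)] continuous_imp_ae_cont[OF vc] by (auto simp: admissible_def)
  have "(\<lambda>n. L1 (v n)) \<longlonglongrightarrow> 0"
  proof (rule L1_tendsto_0[OF continuous_imp_ae_cont[OF vc] vb negligible_coord])
    fix z :: "real ^ 'd" assume "z \<notin> {x. x $ i = c}"
    then have pos: "0 < \<bar>z $ i - c\<bar> / 2" by simp
    have "eventually (\<lambda>n. d n < \<bar>z $ i - c\<bar> / 2) sequentially" by (rule order_tendstoD(2)[OF d(2) pos])
    then have "eventually (\<lambda>n. v n z = 0) sequentially"
      by (rule eventually_mono) (simp add: v_def trapezoid_eq_0 d(1))
    then show "(\<lambda>n. v n z) \<longlonglongrightarrow> 0" by (rule tendsto_eventually)
  qed
  note L1v = this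
  have ou: "osc 0 (u n) y = osc 0 h y - osc 0 (v n) y" for n y
    unfolding uv by (rule osc_diff[OF ad])
  have uc: "cont (osc 0 (u n))" for n
    unfolding ou[abs_def]
    by (intro continuous_on_diff continuous_osc_0[OF _ wb] continuous_osc_0[OF _ vb] continuous_imp_ae_cont h vc)
  obtain K1 where K1: "norm (osc 0 h y) \<le> K1 * decay y" for y
    using mixed_lip_decay[OF h, of 0] by auto
  obtain K2 where K2: "norm (osc 0 (v n) y) \<le> K2 * decay y" for n y
    using trapezoid_decay[OF h, of i c] d(1) unfolding v_def[abs_def] by blast
  obtain w where w: "w \<in> borel_measurable borel" "(\<integral>\<^sup>+y. w y \<partial>lborel) < \<infinity>"
      "\<And>x. \<And>y :: real ^ 'd. 0 \<le> x \<Longrightarrow> x \<le> (K1 + K2) * decay y \<Longrightarrow> ennreal (x powr q) \<le> w y"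
    using decay_majorant[OF q, of "K1 + K2"] by blast
  have lim: "(\<lambda>n. Lpow q UNIV (osc 0 (u n))) \<longlonglongrightarrow> Lpow q UNIV (osc 0 h)"
  proof (rule Lpow_dominated_convergence[OF uc continuous_osc_0[OF continuous_imp_ae_cont[OF h(1)] wb] _ _ _ _ w(1,2)])
    fix y
    have "(\<lambda>n. osc 0 (v n) y) \<longlonglongrightarrow> 0"
    proof (rule Lim_null_comparison[OF always_eventually[OF allI] L1v])
      show "norm (osc 0 (v n) y) \<le> L1 (v n)" for n using norm_osc_le[OF ad(2), of n y] by simp
    qed
    then show "(\<lambda>n. osc 0 (u n) y) \<longlonglongrightarrow> osc 0 h y" unfolding ou by (intro tendsto_eq_intros) auto
  next
    fix n and y :: "real ^ 'd"
    have "norm (osc 0 (u n) y) \<le> (K1 + K2) * decay y"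
      using norm_triangle_ineq4[of "osc 0 h y" "osc 0 (v n) y"] K1[of y] K2[of n y] by (simp add: ou distrib_right)
    then show "ennreal (norm (osc 0 (u n) y) powr q) \<le> w y" by (intro w(3)) auto
  qed (use q in auto)
  have fin: "Lpow q UNIV (osc 0 h) < \<infinity>"
  proof -
    obtain M where "Lpow q UNIV (osc 0 h) \<le> ennreal M" using Lpow_decay_bounded[OF q, of K1] K1 by blast
    then show ?thesis by (rule order.strict_trans1) simp
  qed
  have "Lpow q UNIV (osc 0 h) < Lpow q UNIV (osc 0 h) + ennreal e"
    using fin e by (simp add: ennreal_add_left_cancel_less less_top)
  then have "eventually (\<lambda>n. Lpow q UNIV (osc 0 (u n)) < Lpow q UNIV (osc 0 h) + ennreal e) sequentially"
    by (rule order_tendstoD(2)[OF lim])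
  moreover have "eventually (\<lambda>n. L1 (v n) < e) sequentially" by (rule order_tendstoD(2)[OF L1v e])
  ultimately have "eventually (\<lambda>n. Lpow q UNIV (osc 0 (u n)) < Lpow q UNIV (osc 0 h) + ennreal e \<and> L1 (v n) < e) sequentially"
    by (rule eventually_conj)
  then obtain n where "Lpow q UNIV (osc 0 (u n)) < Lpow q UNIV (osc 0 h) + ennreal e" "L1 (v n) < e"
    using eventually_happens'[OF sequentially_bot] by blast
  then show ?thesis
    using d(1)[of n] by (intro exI[of _ "d n"]) (simp add: u_def[abs_def] v_def[abs_def] less_imp_le)
qed

lemma mixed_lip_strip:
  fixes h :: "real ^ 'd \<Rightarrow> complex"
  assumes h: "mixed_lip C h" and d: "0 < d"
  shows "mixed_lip (C + 3 ^ CARD('d) * C * (1 / d)) (\<lambda>z. h z * of_real (1 - trapezoid d (z $ i - c)))"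
proof (rule mixed_lip_mult_coord[OF h, of "\<lambda>x. 1 - trapezoid d (x - c)"])
  show "\<bar>1 - trapezoid d (x - c)\<bar> \<le> 1" for x using trapezoid_bounds[of d "x - c"] by simp
  show "\<bar>1 - trapezoid d (x - c) - (1 - trapezoid d (x - s - c))\<bar> \<le> 1 / d * s" if "0 \<le> s" for x s
    using trapezoid_lipschitz[OF d that, of "x - c"] by (simp add: algebra_simps abs_minus_commute)
qed (use d in simp)

text \<open>The closed support is required to lie in the open set, so that such a symbol times the
  multiplier is continuous everywhere.\<close>

definition good_symbol :: "(real ^ 'd) set \<Rightarrow> (real ^ 'd \<Rightarrow> complex) \<Rightarrow> bool" where
  "good_symbol G u \<longleftrightarrow> cont u \<and> bounded {x. u x \<noteq> 0} \<and> (\<exists>C. mixed_lip C u) \<and> closure {x. u x \<noteq> 0} \<subseteq> G"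

text \<open>The width of each strip depends on the strips cut out before, so infinitely many strips are
  chosen one after the other; compactness then shows that finitely many of them suffice.\<close>

lemma good_symbol_approximation:
  fixes h :: "real ^ 'd \<Rightarrow> complex"
  assumes h: "cont h" "bounded {x. h x \<noteq> 0}" "mixed_lip C h" and q: "1 < q" and e: "0 < e"
    and G: "open G" "countable S" "\<And>z. z \<notin> G \<Longrightarrow> \<exists>(i, c)\<in>S. z $ i = c"
  shows "\<exists>u. good_symbol G u \<and> L1 (\<lambda>z. h z - u z) \<le> e \<and> Lpow q UNIV (osc 0 u) \<le> Lpow q UNIV (osc 0 h) + ennreal e"
proof -
  \<comment> \<open>An enumeration needs a non-empty set; the added hyperplane only removes one more
    strip.\<close>
  define S' where "S' = insert undefined S"
  have S': "countable S'" "S' \<noteq> {}" using G(2) by (auto simp: S'_def)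
  define s where "s = from_nat_into S'"
  have s: "range s = S'" unfolding s_def by (rule range_from_nat_into[OF S'(2,1)])
  define cut where "cut h d n z = h z * of_real (1 - trapezoid d (z $ fst (s n) - snd (s n)))"
    for h :: "real ^ 'd \<Rightarrow> complex" and d n z
  define ok where "ok u \<longleftrightarrow> cont u \<and> (\<exists>C. mixed_lip C u)" for u :: "real ^ 'd \<Rightarrow> complex"
  have step: "\<exists>d>0. ok (cut u d n) \<and> L1 (\<lambda>z. u z - cut u d n z) \<le> r \<and>
      Lpow q UNIV (osc 0 (cut u d n)) \<le> Lpow q UNIV (osc 0 u) + ennreal r" if u: "ok u" and r: "0 < r" for u n r
  proof -
    obtain D where D: "cont u" "mixed_lip D u" using u by (auto simp: ok_def)
    obtain d where d: "0 < d" "L1 (\<lambda>z. u z * of_real (trapezoid d (z $ fst (s n) - snd (s n)))) \<le> r"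
        "Lpow q UNIV (osc 0 (\<lambda>z. u z * of_real (1 - trapezoid d (z $ fst (s n) - snd (s n))))) \<le> Lpow q UNIV (osc 0 u) + ennreal r"
      using strip_cutoff[OF D q r] by blast
    have "(\<lambda>z. u z - cut u d n z) = (\<lambda>z. u z * of_real (trapezoid d (z $ fst (s n) - snd (s n))))"
      by (simp add: cut_def fun_eq_iff algebra_simps)
    moreover have "cont (cut u d n)"
      unfolding cut_def[abs_def] using d(1) by (intro continuous_intros D)
    moreover have "\<exists>C. mixed_lip C (cut u d n)"
      unfolding cut_def[abs_def] using mixed_lip_strip[OF D(2) d(1)] by blast
    ultimately show ?thesis using d by (intro exI[of _ d]) (simp add: ok_def cut_def[abs_def])
  qed
  \<comment> \<open>A geometric budget: the losses of all steps together stay below e, however many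
    are used in the end.\<close>
  define r where "r n = e * (1 / 2) ^ Suc n" for n
  have r: "0 < r n" for n using e by (simp add: r_def)
  define rel where "rel n x y \<longleftrightarrow> 0 < snd y \<and> fst y = cut (fst x) (snd y) n \<and>
      L1 (\<lambda>z. fst x z - fst y z) \<le> r n \<and> Lpow q UNIV (osc 0 (fst y)) \<le> Lpow q UNIV (osc 0 (fst x)) + ennreal (r n)"
    for n and x y :: "(real ^ 'd \<Rightarrow> complex) \<times> real"
  \<comment> \<open>Dependent choice over pairs of the current symbol and the width of the strip cut
    out last; the width 0 paired with \<open>h\<close> at the start is a dummy.\<close>
  have "\<exists>f. \<forall>n. (ok (fst (f n)) \<and> (n = 0 \<longrightarrow> fst (f n) = h)) \<and> rel n (f n) (f (Suc n))"
  proof (rule dependent_nat_choice)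
    show "\<exists>x :: _ \<times> real. ok (fst x) \<and> (0 = (0::nat) \<longrightarrow> fst x = h)" using h by (intro exI[of _ "(h, 0)"]) (auto simp: ok_def)
    fix x :: "_ \<times> real" and n assume "ok (fst x) \<and> (n = (0::nat) \<longrightarrow> fst x = h)"
    then obtain d where "0 < d" "ok (cut (fst x) d n)" "L1 (\<lambda>z. fst x z - cut (fst x) d n z) \<le> r n"
      "Lpow q UNIV (osc 0 (cut (fst x) d n)) \<le> Lpow q UNIV (osc 0 (fst x)) + ennreal (r n)"
      using step[of "fst x" "r n" n] r by blast
    then show "\<exists>y. (ok (fst y) \<and> (Suc n = 0 \<longrightarrow> fst y = h)) \<and> rel n x y"
      by (intro exI[of _ "(cut (fst x) d n, d)"]) (simp add: rel_def)
  qed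
  then obtain f where f': "\<forall>n. (ok (fst (f n)) \<and> (n = 0 \<longrightarrow> fst (f n) = h)) \<and> rel n (f n) (f (Suc n))" ..
  have f: "ok (fst (f n))" "fst (f 0) = h" "rel n (f n) (f (Suc n))" for n using f' by blast+
  define u where "u n = fst (f n)" for n
  define d where "d n = snd (f (Suc n))" for n
  have u: "ok (u n)" "u 0 = h" "0 < d n" "u (Suc n) = cut (u n) (d n) n"
      "L1 (\<lambda>z. u n z - u (Suc n) z) \<le> r n"
      "Lpow q UNIV (osc 0 (u (Suc n))) \<le> Lpow q UNIV (osc 0 (u n)) + ennreal (r n)" for n
    using f(1)[of n] f(2) f(3)[of n] by (auto simp: u_def d_def rel_def)
  have uc: "cont (u n)" "\<exists>C. mixed_lip C (u n)" for n using u(1) by (auto simp: ok_def)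
  have uw: "\<exists>D. wbounded D (u n)" for n using uc(2) mixed_lip_wbounded by blast
  have sum_r: "(\<Sum>j<n. r j) \<le> e" for n
  proof -
    have "(\<Sum>j<n. r j) = e * (1 - (1 / 2) ^ n)" by (induction n) (simp_all add: r_def algebra_simps)
    also have "\<dots> \<le> e * 1" using e by (intro mult_left_mono) auto
    finally show ?thesis by simp
  qed
  have L: "L1 (\<lambda>z. h z - u n z) \<le> (\<Sum>j<n. r j)" for n
  proof (induction n)
    case 0
    then show ?case by (simp add: u L1_def)
  next
    case (Suc n)
    obtain D0 D1 D2 where D: "wbounded D0 h" "wbounded D1 (u n)" "wbounded D2 (u (Suc n))"
      using mixed_lip_wbounded[OF h(3)] uw by blast
    have "L1 (\<lambda>z. (h z - u n z) + (u n z - u (Suc n) z)) \<le> L1 (\<lambda>z. h z - u n z) + L1 (\<lambda>z. u n z - u (Suc n) z)"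
      by (rule L1_triangle[OF continuous_on_diff[OF h(1) uc(1)] wbounded_diff[OF D(1,2)] continuous_on_diff[OF uc(1) uc(1)] wbounded_diff[OF D(2,3)]])
    then show ?case using Suc u(5)[of n] by simp
  qed
  have P: "Lpow q UNIV (osc 0 (u n)) \<le> Lpow q UNIV (osc 0 h) + ennreal (\<Sum>j<n. r j)" for n
  proof (induction n)
    case 0
    then show ?case by (simp add: u)
  next
    case (Suc n)
    have "Lpow q UNIV (osc 0 (u (Suc n))) \<le> Lpow q UNIV (osc 0 h) + ennreal (\<Sum>j<n. r j) + ennreal (r n)"
      using u(6)[of n] Suc by (meson add_right_mono order_trans)
    also have "\<dots> = Lpow q UNIV (osc 0 h) + ennreal (\<Sum>j<Suc n. r j)"
      using r by (simp add: add.assoc ennreal_plus[symmetric] sum_nonneg less_imp_le del: ennreal_plus)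
    finally show ?case .
  qed
  \<comment> \<open>Every step multiplies by a function, so what has been cut out stays cut
    out.\<close>
  have zero: "u n z = 0" if "h z = 0 \<or> (\<exists>j<n. \<bar>z $ fst (s j) - snd (s j)\<bar> < d j)" for n z
    using that
  proof (induction n)
    case (Suc n)
    consider "h z = 0 \<or> (\<exists>j<n. \<bar>z $ fst (s j) - snd (s j)\<bar> < d j)" | "\<bar>z $ fst (s n) - snd (s n)\<bar> < d n"
      using Suc.prems less_Suc_eq by blast
    then show ?case
    proof cases
      case 1
      then show ?thesis using Suc.IH u(4)[of n] by (simp add: cut_def)
    next
      case 2
      then show ?thesis using u(4)[of n] trapezoid_eq_1[OF u(3)[of n]] by (simp add: cut_def)
    qed
  qed (simp add: u)
  define strip where "strip j = {z :: real ^ 'd. \<bar>z $ fst (s j) - snd (s j)\<bar> < d j}" for j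
  have so: "open (strip j)" for j
    unfolding strip_def by (intro open_Collect_less continuous_intros)
  have "compact (closure {x. h x \<noteq> 0} - G)" using h(2) G(1) by (intro compact_diff) (auto simp: compact_closure)
  moreover have "closure {x. h x \<noteq> 0} - G \<subseteq> (\<Union>j. strip j)"
  proof
    fix z assume "z \<in> closure {x. h x \<noteq> 0} - G"
    then obtain i c where ic: "(i, c) \<in> S" "z $ i = c" using G(3)[of z] by auto
    then obtain j where "s j = (i, c)" using s S'_def by (metis imageE insertCI)
    then have "z \<in> strip j" using ic u(3)[of j] by (simp add: strip_def)
    then show "z \<in> (\<Union>j. strip j)" by blast
  qed
  ultimately obtain J where J: "finite J" "closure {x. h x \<noteq> 0} - G \<subseteq> (\<Union>j\<in>J. strip j)"
    using so by (elim compactE_image) auto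
  obtain n where n: "\<And>j. j \<in> J \<Longrightarrow> j < n" using finite_nat_set_iff_bounded[THEN iffD1, OF J(1)] by auto
  have "closure {x. u n x \<noteq> 0} \<subseteq> closure {x. h x \<noteq> 0} - (\<Union>j\<in>J. strip j)"
  proof (rule closure_minimal)
    have "h x \<noteq> 0" "x \<notin> strip j" if "u n x \<noteq> 0" "j \<in> J" for x j
      using zero[of x n] n[OF that(2)] that(1) by (auto simp: strip_def)
    moreover have "h x \<noteq> 0" if "u n x \<noteq> 0" for x using zero[of x n] that by auto
    ultimately show "{x. u n x \<noteq> 0} \<subseteq> closure {x. h x \<noteq> 0} - (\<Union>j\<in>J. strip j)"
      using closure_subset[of "{x. h x \<noteq> 0}"] by blast
    show "closed (closure {x. h x \<noteq> 0} - (\<Union>j\<in>J. strip j))" using so by (intro closed_Diff open_UN) auto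
  qed
  then have "closure {x. u n x \<noteq> 0} \<subseteq> G" using J(2) by blast
  moreover have "bounded {x. u n x \<noteq> 0}" by (rule bounded_subset[OF h(2)]) (use zero in auto)
  moreover have "Lpow q UNIV (osc 0 (u n)) \<le> Lpow q UNIV (osc 0 h) + ennreal e"
    by (rule order_trans[OF P]) (intro add_left_mono ennreal_leI sum_r)
  ultimately show ?thesis
    using uc[of n] order_trans[OF L sum_r, of n] by (intro exI[of _ "u n"]) (simp add: good_symbol_def)
qed

text \<open>For M >= 1 the Lipschitz constant 1/M of the cut-off is at most 1, which makes the new
  constant independent of M.\<close>

lemma mixed_lip_truncate:
  fixes h :: "real ^ 'd \<Rightarrow> complex"
  assumes h: "mixed_lip C h" and M: "1 \<le> M" and A: "finite A"
  shows "mixed_lip (C * (1 + 3 ^ CARD('d)) ^ card A) (\<lambda>z. h z * of_real (\<Prod>i\<in>A. trapezoid M (z $ i)))"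
  using A
proof induction
  case empty
  then show ?case using h by simp
next
  case (insert i A)
  have "mixed_lip (C * (1 + 3 ^ CARD('d)) ^ card A + 3 ^ CARD('d) * (C * (1 + 3 ^ CARD('d)) ^ card A) * 1)
      (\<lambda>z. (h z * of_real (\<Prod>i\<in>A. trapezoid M (z $ i))) * of_real (trapezoid M (z $ i)))"
  proof (rule mixed_lip_mult_coord[OF insert.IH])
    show "\<bar>trapezoid M x\<bar> \<le> 1" for x using trapezoid_bounds[of M x] by simp
    show "\<bar>trapezoid M x - trapezoid M (x - s)\<bar> \<le> 1 * s" if s: "0 \<le> s" for x s
    proof -
      have "1 / M * s \<le> 1 * s" using M s by (intro mult_right_mono) auto
      then show ?thesis using trapezoid_lipschitz[of M s x] M s by linarith
    qed
  qed simp
  then show ?case using insert.hyps by (simp add: algebra_simps)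
qed

text \<open>Fourier transforms are not compactly supported, so they are truncated before the strips
  are cut out. The point is that K precedes e: both operations keep the Lq bound while the L1 error
  is made small.\<close>

lemma fourier_transform_approximation:
  fixes \<psi> :: "real ^ 'd \<Rightarrow> complex"
  assumes \<psi>: "C_infinity_compact \<psi>" and q: "1 < q"
    and G: "open G" "countable S" "\<And>z. z \<notin> G \<Longrightarrow> \<exists>(i, c)\<in>S. z $ i = c"
  shows "\<exists>K. \<forall>e>0. \<exists>u. good_symbol G u \<and> L1 (\<lambda>z. fourier_transform \<psi> z - u z) \<le> e \<and> Lpow q UNIV (osc 0 u) \<le> ennreal K"
proof -
  define h where "h = fourier_transform \<psi>"
  have hc: "cont h" unfolding h_def by (rule continuous_fourier_transform[OF \<psi>])
  obtain C where C: "mixed_lip C h" using mixed_lip_fourier_transform[OF \<psi>] unfolding h_def by blast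
  define C' where "C' = C * (1 + 3 ^ CARD('d)) ^ CARD('d)"
  define v where "v n z = h z * of_real (\<Prod>i\<in>UNIV. trapezoid (real (Suc n)) (z $ i))" for n and z :: "real ^ 'd"
  have vc: "cont (v n)" for n
    unfolding v_def[abs_def] by (intro continuous_intros hc) auto
  have vC: "mixed_lip C' (v n)" for n
    unfolding v_def[abs_def] C'_def by (rule mixed_lip_truncate[OF C]) auto
  have vb: "bounded {z. v n z \<noteq> 0}" for n
  proof (rule bounded_subset[OF bounded_cbox])
    show "{z. v n z \<noteq> 0} \<subseteq> cbox (\<chi> i. - (2 * real (Suc n))) (\<chi> i. 2 * real (Suc n))"
    proof
      fix z assume "z \<in> {z. v n z \<noteq> 0}"
      then have "trapezoid (real (Suc n)) (z $ i) \<noteq> 0" for i by (auto simp: v_def)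
      then have "\<bar>z $ i\<bar> < 2 * real (Suc n)" for i
        using trapezoid_eq_0[of "real (Suc n)" "z $ i"] by (meson not_le of_nat_0_less_iff zero_less_Suc)
      then have "- (2 * real (Suc n)) \<le> z $ i \<and> z $ i \<le> 2 * real (Suc n)" for i by (meson abs_le_iff less_imp_le minus_le_iff)
      then show "z \<in> cbox (\<chi> i. - (2 * real (Suc n))) (\<chi> i. 2 * real (Suc n))" by (simp add: mem_box_cart)
    qed
  qed
  have dw: "wbounded (C + C') (\<lambda>z. h z - v n z)" and dc: "cont (\<lambda>z. h z - v n z)" for n
    by (rule wbounded_diff[OF mixed_lip_wbounded[OF C] mixed_lip_wbounded[OF vC]], rule continuous_on_diff[OF hc vc])
  have "(\<lambda>n. L1 (\<lambda>z. h z - v n z)) \<longlonglongrightarrow> 0"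
  proof (rule L1_tendsto_0[OF continuous_imp_ae_cont[OF dc] dw negligible_empty])
    fix z :: "real ^ 'd"
    obtain N where N: "norm z \<le> real N" using real_arch_simple by blast
    have "h z - v n z = 0" if "N \<le> n" for n
    proof -
      have "\<bar>z $ i\<bar> \<le> real (Suc n)" for i using component_le_norm_cart[of z i] N that by linarith
      then have "trapezoid (real (Suc n)) (z $ i) = 1" for i by (intro trapezoid_eq_1) auto
      then show ?thesis by (simp add: v_def)
    qed
    then show "(\<lambda>n. h z - v n z) \<longlonglongrightarrow> 0"
      by (intro tendsto_eventually) (auto simp: eventually_sequentially)
  qed
  note L1v = this
  obtain M where M: "\<And>n. Lpow q UNIV (osc 0 (v n)) \<le> ennreal M"
  proof -
    obtain M where "\<And>S (f :: real ^ 'd \<Rightarrow> complex).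
      (\<forall>y\<in>S. norm (f y) \<le> (3 ^ CARD('d) * C' * L1 (weight :: real ^ 'd \<Rightarrow> real)) * decay y) \<Longrightarrow> Lpow q S f \<le> ennreal M"
      using Lpow_decay_bounded[OF q] by meson
    moreover have "norm (osc 0 (v n) y) \<le> (3 ^ CARD('d) * C' * L1 (weight :: real ^ 'd \<Rightarrow> real)) * decay y" for n y
      by (rule mixed_lip_decay[OF vc vC]) auto
    ultimately show ?thesis using that by blast
  qed
  \<comment> \<open>Truncation and strips each receive e/2. Capping the second share by 1 keeps the
    Lq bound below a constant that does not involve e.\<close>
  have "\<exists>u. good_symbol G u \<and> L1 (\<lambda>z. h z - u z) \<le> e \<and> Lpow q UNIV (osc 0 u) \<le> ennreal (max M 0 + 1)"
    if e: "0 < e" for e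
  proof -
    have e2: "0 < e / 2" "0 < min (e / 2) 1" using e by auto
    obtain n where n: "L1 (\<lambda>z. h z - v n z) < e / 2"
      using eventually_happens'[OF sequentially_bot order_tendstoD(2)[OF L1v e2(1)]] by blast
    obtain u where u: "good_symbol G u" "L1 (\<lambda>z. v n z - u z) \<le> min (e / 2) 1"
        "Lpow q UNIV (osc 0 u) \<le> Lpow q UNIV (osc 0 (v n)) + ennreal (min (e / 2) 1)"
      using good_symbol_approximation[OF vc vb vC q e2(2) G] by blast
    obtain D where D: "mixed_lip D u" "cont u" using u(1) by (auto simp: good_symbol_def)
    have "L1 (\<lambda>z. (h z - v n z) + (v n z - u z)) \<le> L1 (\<lambda>z. h z - v n z) + L1 (\<lambda>z. v n z - u z)"
      by (rule L1_triangle[OF dc dw continuous_on_diff[OF vc D(2)] wbounded_diff[OF mixed_lip_wbounded[OF vC] mixed_lip_wbounded[OF D(1)]]])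
    then have "L1 (\<lambda>z. h z - u z) \<le> e" using n u(2) by simp
    moreover have "Lpow q UNIV (osc 0 (v n)) + ennreal (min (e / 2) 1) \<le> ennreal (max M 0) + ennreal 1"
      using M[of n] by (intro add_mono ennreal_leI) (auto simp: max_def ennreal_neg split: if_splits)
    ultimately show ?thesis using u order_trans[OF u(3)] by (intro exI[of _ u]) (simp add: ennreal_plus)
  qed
  then show ?thesis unfolding h_def by blast
qed

section \<open>Approximation of test functions and passage to the limit\<close>

lemma Lpow_diff_tendsto_0:
  fixes f :: "nat \<Rightarrow> 'a::euclidean_space \<Rightarrow> 'b::real_normed_vector"
  assumes c: "\<And>n. cont (f n)" "cont g" and q: "0 < q" "q < p"
    and \<sigma>: "\<And>n y. norm (f n y - g y) \<le> \<sigma> n" "\<sigma> \<longlonglongrightarrow> 0"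
    and K: "\<And>n. Lpow q UNIV (f n) \<le> K" "Lpow q UNIV g < \<infinity>" "K < \<infinity>"
  shows "(\<lambda>n. Lpow p UNIV (\<lambda>y. f n y - g y)) \<longlonglongrightarrow> 0"
proof -
  define E where "E = ennreal ((1 + 1) powr q) * K + ennreal ((1 + 1 / 1) powr q) * Lpow q UNIV g"
  have E: "E = ennreal (enn2real E)" using K by (simp add: E_def ennreal_mult_less_top)
  have dc: "cont (\<lambda>y. f n y - g y)" for n by (intro continuous_on_diff c)
  have "1 * Lpow q UNIV (\<lambda>y. f n y - g y) \<le> ennreal (enn2real E)" for n
  proof -
    have "Lpow q UNIV (\<lambda>y. f n y - g y)
        \<le> ennreal ((1 + 1) powr q) * Lpow q UNIV (f n) + ennreal ((1 + 1 / 1) powr q) * Lpow q UNIV g"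
      by (rule Lpow_triangle[OF c]) (use q in \<open>auto intro: norm_triangle_ineq4\<close>)
    also have "\<dots> \<le> E" unfolding E_def by (intro add_right_mono mult_left_mono K) simp
    finally show ?thesis using E by simp
  qed
  then have "(\<lambda>n. 1 * Lpow p UNIV (\<lambda>y. f n y - g y)) \<longlonglongrightarrow> 0"
    using order_trans[OF norm_ge_zero \<sigma>(1)] by (intro Lpow_interpolate_tendsto_0[OF dc _ q \<sigma>]) auto
  then show ?thesis by simp
qed

lemma Lpow_inequality_limit:
  fixes V :: "nat \<Rightarrow> 'a::euclidean_space \<Rightarrow> 'b::real_normed_vector" and U :: "nat \<Rightarrow> 'a \<Rightarrow> 'c::real_normed_vector"
  assumes c: "\<And>n. cont (V n)" "cont v" "\<And>n. cont (U n)" "cont u"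
    and lim: "(\<lambda>n. Lpow p UNIV (\<lambda>y. V n y - v y)) \<longlonglongrightarrow> 0" "(\<lambda>n. Lpow p UNIV (\<lambda>y. U n y - u y)) \<longlonglongrightarrow> 0"
    and le: "\<And>n. Lpow p UNIV (V n) \<le> ennreal C * Lpow p UNIV (U n)" and p: "0 < p" and C: "0 < C"
  shows "Lpow p UNIV v \<le> ennreal C * Lpow p UNIV u"
proof (rule perturbed_inequality_limit[where a = "\<lambda>n. Lpow p UNIV (V n)" and b = "\<lambda>n. Lpow p UNIV (U n)", OF p C _ _ le lim])
  have tri: "norm a \<le> norm b + norm (b - a)" for a b :: 'b
    using norm_triangle_sub[of a b] by (simp add: norm_minus_commute)
  show "\<exists>D. \<forall>k. Lpow p UNIV v \<le> ennreal ((1 + d) powr p) * Lpow p UNIV (V k) + ennreal D * Lpow p UNIV (\<lambda>y. V k y - v y)"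
    if d: "0 < d" for d
    by (intro exI[of _ "(1 + 1 / d) powr p"] allI Lpow_triangle[OF c(1) continuous_on_diff[OF c(1,2)] _ p d])
      (auto intro: tri)
  show "\<exists>D. \<forall>k. Lpow p UNIV (U k) \<le> ennreal ((1 + d) powr p) * Lpow p UNIV u + ennreal D * Lpow p UNIV (\<lambda>y. U k y - u y)"
    if d: "0 < d" for d
    by (intro exI[of _ "(1 + 1 / d) powr p"] allI Lpow_triangle[OF c(4) continuous_on_diff[OF c(3,4)] _ p d])
      (auto intro: norm_triangle_sub)
qed auto

lemma exists_mesh: "\<exists>t. mesh t"
proof
  show "mesh (\<lambda>n. inverse (real (Suc n)))"
    using LIMSEQ_inverse_real_of_nat by (auto simp: mesh_def inverse_le_1_iff)
qed

text \<open>The same symbols must approximate the function and its image under the operator. Their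
  L1 error bounds both sup norms, the second with the extra factor B |a|, and the common Lq bound
  passes through the operator by \<open>symbol_sampled\<close>.\<close>

lemma good_symbol_sequence:
  fixes \<phi> :: "real ^ 'd \<Rightarrow> ('x::complex_banach \<Rightarrow>\<^sub>L 'y::complex_banach)" and \<psi> :: "real ^ 'd \<Rightarrow> complex"
  assumes \<phi>: "multiplier \<phi> B" and a: "Lq_bounded \<phi> a" and \<psi>: "C_infinity_compact \<psi>" and p: "1 < p"
    and G: "open G" "countable S" "\<And>z. z \<notin> G \<Longrightarrow> \<exists>(i, c)\<in>S. z $ i = c"
    and cont: "continuous_on G (\<lambda>z. blinfun_apply (\<phi> z) a)"
  shows "\<exists>u. (\<forall>n. good_symbol G (u n)) \<and> (\<lambda>n. Lpow p UNIV (\<lambda>y. osc 0 (u n) y - \<psi> y)) \<longlonglongrightarrow> 0 \<and>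
    (\<lambda>n. Lpow p UNIV (\<lambda>y. osc 0 (\<lambda>z. u n z *\<^sub>C blinfun_apply (\<phi> z) a) y - fourier_mult \<phi> (\<lambda>x. \<psi> x *\<^sub>C a) y)) \<longlonglongrightarrow> 0"
proof -
  define q where "q = (1 + p) / 2"
  have q: "1 < q" "q < p" using p by (auto simp: q_def)
  define h where "h = fourier_transform \<psi>"
  obtain t where t: "mesh t" using exists_mesh by blast
  have hc: "cont h" unfolding h_def by (rule continuous_fourier_transform[OF \<psi>])
  obtain Ch where Ch: "admissible 0 Ch h" using admissible_fourier_transform[OF \<psi>] unfolding h_def by blast
  obtain K where K: "\<And>e. 0 < e \<Longrightarrow> \<exists>u. good_symbol G u \<and> L1 (\<lambda>z. h z - u z) \<le> e \<and> Lpow q UNIV (osc 0 u) \<le> ennreal K"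
    using fourier_transform_approximation[OF \<psi> q(1) G] unfolding h_def by blast
  define e where "e n = inverse (real (Suc n))" for n
  have e: "0 < e n" "e \<longlonglongrightarrow> 0" for n using LIMSEQ_inverse_real_of_nat by (simp_all add: e_def[abs_def])
  have "\<exists>u. \<forall>n. good_symbol G (u n) \<and> L1 (\<lambda>z. h z - u n z) \<le> e n \<and> Lpow q UNIV (osc 0 (u n)) \<le> ennreal K"
    by (intro choice allI K e)
  then obtain u where u: "\<And>n. good_symbol G (u n)" "\<And>n. L1 (\<lambda>z. h z - u n z) \<le> e n" "\<And>n. Lpow q UNIV (osc 0 (u n)) \<le> ennreal K"
    by blast
  have uc: "cont (u n)" "bounded {x. u n x \<noteq> 0}" "closure {x. u n x \<noteq> 0} \<subseteq> G" for n
    using u(1)[of n] by (auto simp: good_symbol_def)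
  have "\<exists>C. \<forall>n. wbounded (C n) (u n)" by (intro choice allI wbounded_compact_support uc)
  then obtain C where C: "\<And>n. wbounded (C n) (u n)" by blast
  have ad: "admissible 0 (C n) (u n)" for n using C continuous_imp_ae_cont[OF uc(1)] by (simp add: admissible_def)
  have add: "admissible 0 (Ch + C n) (\<lambda>z. h z - u n z)" for n by (rule admissible_diff[OF Ch ad])
  have oh: "osc 0 h y = \<psi> y" for y unfolding h_def by (rule fourier_inversion[OF \<psi>])
  have oc: "cont (osc 0 (u n))" for n by (rule continuous_osc_mesh[OF uc(1,2)]) simp
  have \<psi>q: "Lpow q UNIV \<psi> < \<infinity>"
    using q by (intro Lpow_compact_support_finite C_infinity_compactD[OF \<psi>]) auto
  have "(\<lambda>n. Lpow p UNIV (\<lambda>y. osc 0 (u n) y - \<psi> y)) \<longlonglongrightarrow> 0"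
  proof (rule Lpow_diff_tendsto_0[OF oc C_infinity_compactD(2)[OF \<psi>] _ q(2) _ e(2) u(3) \<psi>q])
    show "norm (osc 0 (u n) y - \<psi> y) \<le> e n" for n y
      using norm_osc_le[OF add, of n y] u(2)[of n] osc_diff[OF Ch ad, of n y] oh[of y] by (simp add: norm_minus_commute)
  qed (use q in auto)
  moreover have "(\<lambda>n. Lpow p UNIV (\<lambda>y. osc 0 (\<lambda>z. u n z *\<^sub>C blinfun_apply (\<phi> z) a) y - fourier_mult \<phi> (\<lambda>x. \<psi> x *\<^sub>C a) y)) \<longlonglongrightarrow> 0"
  proof -
    let ?g = "\<lambda>n z. u n z *\<^sub>C blinfun_apply (\<phi> z) a"
    obtain D where D: "0 < D" "\<And>f. C_infinity_compact f \<Longrightarrow> Lpow q UNIV (fourier_mult \<phi> (\<lambda>x. f x *\<^sub>C a)) \<le> ennreal D * Lpow q UNIV f"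
      using Lq_boundedE[OF a q(1)] by blast
    have gc: "cont (?g n)" for n by (rule continuous_symbol[OF uc(1) G(1) uc(3) cont])
    have gb: "bounded {x. ?g n x \<noteq> 0}" for n by (rule bounded_subset[OF uc(2)[of n]]) auto
    have ogc: "cont (osc 0 (?g n))" for n by (rule continuous_osc_mesh[OF gc gb]) simp
    have Tq: "Lpow q UNIV (fourier_mult \<phi> (\<lambda>x. \<psi> x *\<^sub>C a)) < \<infinity>"
      using D(2)[OF \<psi>] \<psi>q by (auto intro: le_less_trans simp: ennreal_mult_less_top)
    have bd: "Lpow q UNIV (osc 0 (?g n)) \<le> ennreal D * ennreal K" for n
    proof -
      obtain L where "mixed_lip L (u n)" using u(1)[of n] by (auto simp: good_symbol_def)
      then have "Lpow q UNIV (osc 0 (?g n)) \<le> ennreal D * Lpow q UNIV (osc 0 (u n))"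
        by (intro symbol_sampled(1)[OF \<phi> a uc(1,2) _ G(1) uc(3) cont t q(1) D]) 
      also have "\<dots> \<le> ennreal D * ennreal K" by (intro mult_left_mono u) simp
      finally show ?thesis .
    qed
    have \<sigma>: "norm (osc 0 (?g n) y - fourier_mult \<phi> (\<lambda>x. \<psi> x *\<^sub>C a) y) \<le> B * norm a * e n" for n y
    proof -
      have B: "0 \<le> B" by (rule multiplier_bound_nonneg[OF \<phi>])
      let ?d = "\<lambda>z. (h z - u n z) *\<^sub>C blinfun_apply (\<phi> z) a"
      note adg = multiplier_admissible[OF \<phi> add[of n], of a]
      have "osc 0 ?d y = osc 0 (\<lambda>z. h z *\<^sub>C blinfun_apply (\<phi> z) a) y - osc 0 (?g n) y"
        unfolding scaleC.diff_left by (rule osc_diff[OF multiplier_admissible[OF \<phi> Ch] multiplier_admissible[OF \<phi> ad]])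
      then have "norm (osc 0 (?g n) y - fourier_mult \<phi> (\<lambda>x. \<psi> x *\<^sub>C a) y) = norm (osc 0 ?d y)"
        by (simp add: fourier_mult_scaleC[OF \<phi> \<psi>] h_def norm_minus_commute)
      also have "\<dots> \<le> L1 ?d" using norm_osc_le[OF adg, of y] by simp
      also have "\<dots> \<le> (\<integral>z. B * norm a * norm (h z - u n z) \<partial>lebesgue)"
        unfolding L1_def
      proof (rule integral_mono)
        show "integrable lebesgue (\<lambda>z. norm (?d z))" using adg by (intro integrable_norm_wbounded) (auto simp: admissible_def)
        show "integrable lebesgue (\<lambda>z. B * norm a * norm (h z - u n z))"
          using add[of n] by (intro integrable_mult_right integrable_norm_wbounded) (auto simp: admissible_def)
        show "norm (?d z) \<le> B * norm a * norm (h z - u n z)" for z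
          using mult_left_mono[OF multiplier_norm_le[OF \<phi>, of z a], of "norm (h z - u n z)"] by (simp add: norm_scaleC mult_ac)
      qed
      also have "\<dots> = B * norm a * L1 (\<lambda>z. h z - u n z)" by (simp add: L1_def)
      also have "\<dots> \<le> B * norm a * e n" using B by (intro mult_left_mono u) auto
      finally show ?thesis .
    qed
    have "(\<lambda>n. B * norm a * e n) \<longlonglongrightarrow> B * norm a * 0" by (intro tendsto_intros e)
    then have \<sigma>0: "(\<lambda>n. B * norm a * e n) \<longlonglongrightarrow> 0" by simp
    show ?thesis
      by (rule Lpow_diff_tendsto_0[OF ogc continuous_fourier_mult[OF \<phi> \<psi>] _ q(2) \<sigma> \<sigma>0 bd Tq])
        (use q in \<open>auto simp: ennreal_mult_less_top\<close>)
  qed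
  ultimately show ?thesis using u(1) by blast
qed

text \<open>The scalar approximations of the coefficient functions are recombined. Applying the
  multiplier pointwise to the sum \<open>U n\<close> yields the symbol that approximates the image,
  so one periodic inequality for \<open>U n\<close> relates both.\<close>

lemma test_function_approximation:
  fixes \<phi> :: "real ^ 'd \<Rightarrow> ('x::complex_banach \<Rightarrow>\<^sub>L 'y::complex_banach)" and f :: "real ^ 'd \<Rightarrow> 'x"
  assumes \<phi>: "multiplier \<phi> B" and bd: "\<And>a. Lq_bounded \<phi> a" and f: "f \<in> test_functions" and p: "1 < p"
    and G: "open G" "countable S" "\<And>z. z \<notin> G \<Longrightarrow> \<exists>(i, c)\<in>S. z $ i = c"
    and cont: "\<And>a. continuous_on G (\<lambda>z. blinfun_apply (\<phi> z) a)" and t: "mesh t"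
  defines "V \<equiv> \<lambda>U n z. blinfun_apply (\<phi> z) (U n z)"
  shows "\<exists>U. (\<forall>n. sampled p t (U n) \<and> sampled p t (V U n) \<and> (\<forall>z. \<forall>a. U n z \<noteq> 0 \<longrightarrow> isCont (\<lambda>z. blinfun_apply (\<phi> z) a) z)) \<and>
    cont f \<and> cont (fourier_mult \<phi> f) \<and>
    (\<lambda>n. Lpow p UNIV (\<lambda>y. osc 0 (U n) y - f y)) \<longlonglongrightarrow> 0 \<and>
    (\<lambda>n. Lpow p UNIV (\<lambda>y. osc 0 (V U n) y - fourier_mult \<phi> f y)) \<longlonglongrightarrow> 0"
proof -
  obtain A g where A: "finite A" and g: "\<And>b. b \<in> A \<Longrightarrow> C_infinity_compact (g b)" and fg: "f = (\<lambda>x. \<Sum>b\<in>A. g b x *\<^sub>C b)"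
    using test_function_decomposition[OF f] by blast
  have "\<exists>u. \<forall>b\<in>A. (\<forall>n. good_symbol G (u b n)) \<and> (\<lambda>n. Lpow p UNIV (\<lambda>y. osc 0 (u b n) y - g b y)) \<longlonglongrightarrow> 0 \<and>
    (\<lambda>n. Lpow p UNIV (\<lambda>y. osc 0 (\<lambda>z. u b n z *\<^sub>C blinfun_apply (\<phi> z) b) y - fourier_mult \<phi> (\<lambda>x. g b x *\<^sub>C b) y)) \<longlonglongrightarrow> 0"
    by (intro bchoice ballI good_symbol_sequence[OF \<phi> bd _ p G cont] g)
  then obtain u where u: "\<And>b n. b \<in> A \<Longrightarrow> good_symbol G (u b n)"
    "\<And>b. b \<in> A \<Longrightarrow> (\<lambda>n. Lpow p UNIV (\<lambda>y. osc 0 (u b n) y - g b y)) \<longlonglongrightarrow> 0"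
    "\<And>b. b \<in> A \<Longrightarrow> (\<lambda>n. Lpow p UNIV (\<lambda>y. osc 0 (\<lambda>z. u b n z *\<^sub>C blinfun_apply (\<phi> z) b) y - fourier_mult \<phi> (\<lambda>x. g b x *\<^sub>C b) y)) \<longlonglongrightarrow> 0"
    by blast
  have uc: "cont (u b n)" "bounded {x. u b n x \<noteq> 0}" "closure {x. u b n x \<noteq> 0} \<subseteq> G" "\<exists>C. mixed_lip C (u b n)" if "b \<in> A" for b n
    using u(1)[OF that, of n] by (auto simp: good_symbol_def)
  define U where "U n z = (\<Sum>b\<in>A. u b n z *\<^sub>C b)" for n z
  have VU: "V U n = (\<lambda>z. \<Sum>b\<in>A. u b n z *\<^sub>C blinfun_apply (\<phi> z) b)" for n
    unfolding V_def U_def by (intro ext multiplier_sum[OF \<phi>])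
  have s1: "sampled p t (\<lambda>z. u b n z *\<^sub>C b)" if "b \<in> A" for b n
  proof -
    obtain C where "mixed_lip C (u b n)" using uc(4)[OF \<open>b \<in> A\<close>] by blast
    then show ?thesis using that by (intro sampled_scaleC_right[OF mixed_lip_Lpow_tendsto(2)[OF uc(1,2) _ t p] t])
  qed
  have s2: "sampled p t (\<lambda>z. u b n z *\<^sub>C blinfun_apply (\<phi> z) b)" if "b \<in> A" for b n
  proof -
    obtain C where "mixed_lip C (u b n)" using uc(4)[OF \<open>b \<in> A\<close>] by blast
    then show ?thesis using that by (intro symbol_sampled(2)[OF \<phi> bd uc(1,2) _ G(1) uc(3) cont t p])
  qed
  have sU: "sampled p t (U n)" for n
    unfolding U_def[abs_def] using p by (intro sampled_sum t A s1) auto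
  have sV: "sampled p t (V U n)" for n
    unfolding VU using p by (intro sampled_sum t A s2) auto
  have isc: "isCont (\<lambda>z. blinfun_apply (\<phi> z) a) z" if nz: "U n z \<noteq> 0" for n z a
  proof -
    obtain b where b: "b \<in> A" "u b n z *\<^sub>C b \<noteq> 0" by (rule sum.not_neutral_contains_not_neutral[OF nz[unfolded U_def]])
    then have "z \<in> {x. u b n x \<noteq> 0}" by auto
    then have "z \<in> G" using uc(3)[OF b(1), of n] closure_subset[of "{x. u b n x \<noteq> 0}"] by (meson subsetD)
    then show ?thesis using cont[of a] G(1) by (simp add: continuous_on_eq_continuous_at)
  qed
  have wb: "\<exists>C. admissible 0 C h" if "sampled p t h" for h :: "real ^ 'd \<Rightarrow> 'z::complex_banach"
    using that wbounded_compact_support[of h] continuous_imp_ae_cont[of h] by (auto simp: sampled_def admissible_def)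
  have oc: "cont (osc 0 h)" if "sampled p t h" for h :: "real ^ 'd \<Rightarrow> 'z::complex_banach"
    using that by (intro continuous_osc_mesh) (auto simp: sampled_def)
  have lim: "(\<lambda>n. Lpow p UNIV (\<lambda>y. osc 0 (\<lambda>z. \<Sum>b\<in>A. h b n z) y - (\<Sum>b\<in>A. k b y))) \<longlonglongrightarrow> 0"
    if h: "\<And>b n. b \<in> A \<Longrightarrow> sampled p t (h b n)" and k: "\<And>b. b \<in> A \<Longrightarrow> cont (k b)"
      and hk: "\<And>b. b \<in> A \<Longrightarrow> (\<lambda>n. Lpow p UNIV (\<lambda>y. osc 0 (h b n) y - k b y)) \<longlonglongrightarrow> 0"
    for h :: "'x \<Rightarrow> nat \<Rightarrow> real ^ 'd \<Rightarrow> 'z::complex_banach" and k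
  proof (rule tendsto_sandwich[OF _ _ tendsto_const])
    have "(\<lambda>n. \<Sum>b\<in>A. Lpow p UNIV (\<lambda>y. osc 0 (h b n) y - k b y)) \<longlonglongrightarrow> (\<Sum>b\<in>A. 0)"
      by (intro tendsto_sum hk)
    then show "(\<lambda>n. ennreal (real (card A) powr p) * (\<Sum>b\<in>A. Lpow p UNIV (\<lambda>y. osc 0 (h b n) y - k b y))) \<longlonglongrightarrow> 0"
      by (intro ennreal_tendsto_cmult_0) simp
    show "\<forall>\<^sub>F n in sequentially. Lpow p UNIV (\<lambda>y. osc 0 (\<lambda>z. \<Sum>b\<in>A. h b n z) y - (\<Sum>b\<in>A. k b y))
        \<le> ennreal (real (card A) powr p) * (\<Sum>b\<in>A. Lpow p UNIV (\<lambda>y. osc 0 (h b n) y - k b y))"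
    proof (intro always_eventually allI, rule Lpow_sum[OF A])
      fix n y
      have "\<exists>C. \<forall>b\<in>A. admissible 0 (C b) (h b n)" by (intro bchoice ballI wb h)
      then obtain C where C: "\<And>b. b \<in> A \<Longrightarrow> admissible 0 (C b) (h b n)" by blast
      have "osc 0 (\<lambda>z. \<Sum>b\<in>A. h b n z) y = (\<Sum>b\<in>A. osc 0 (h b n) y)" by (rule osc_sum[OF A _ _ C]) auto
      then show "norm (osc 0 (\<lambda>z. \<Sum>b\<in>A. h b n z) y - (\<Sum>b\<in>A. k b y)) \<le> (\<Sum>b\<in>A. norm (osc 0 (h b n) y - k b y))"
        using norm_sum[of "\<lambda>b. osc 0 (h b n) y - k b y" A] by (simp add: sum_subtractf)
    qed (use p oc[OF h] k in \<open>auto intro: continuous_on_diff\<close>)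
  qed auto
  have gc: "cont (\<lambda>x. g b x *\<^sub>C b)" if "b \<in> A" for b
    by (intro scaleC.continuous_on C_infinity_compactD(2)[OF g[OF that]] continuous_on_const)
  have Tg: "cont (fourier_mult \<phi> (\<lambda>x. g b x *\<^sub>C b))" if "b \<in> A" for b
    by (rule continuous_fourier_mult[OF \<phi> g[OF that]])
  have fm: "fourier_mult \<phi> f = (\<lambda>y. \<Sum>b\<in>A. fourier_mult \<phi> (\<lambda>x. g b x *\<^sub>C b) y)"
    unfolding fg using fourier_mult_sum[OF \<phi> A g] by auto
  have "(\<lambda>n. Lpow p UNIV (\<lambda>y. osc 0 (U n) y - f y)) \<longlonglongrightarrow> 0"
    unfolding U_def[abs_def] fg
  proof (rule lim[OF s1 gc])
    fix b assume b: "b \<in> A"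
    have "Lpow p UNIV (\<lambda>y. osc 0 (\<lambda>z. u b n z *\<^sub>C b) y - g b y *\<^sub>C b)
        = ennreal (norm b powr p) * Lpow p UNIV (\<lambda>y. osc 0 (u b n) y - g b y)" for n
    proof -
      have c: "cont (\<lambda>y. osc 0 (u b n) y - g b y)"
        by (intro continuous_on_diff continuous_osc_mesh uc b C_infinity_compactD(2)[OF g[OF b]]) simp
      obtain C where C: "wbounded C (u b n)" using wbounded_compact_support[OF uc(1,2)[OF b]] by blast
      have "admissible 0 C (u b n)" using C continuous_imp_ae_cont[OF uc(1)[OF b]] by (simp add: admissible_def)
      then have "osc 0 (\<lambda>z. u b n z *\<^sub>C b) y - g b y *\<^sub>C b = (osc 0 (u b n) y - g b y) *\<^sub>C b" for y
        by (simp add: osc_scaleC_right scaleC.diff_left)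
      then show ?thesis using Lpow_scaleC_right[OF c, of UNIV p b] by simp
    qed
    then show "(\<lambda>n. Lpow p UNIV (\<lambda>y. osc 0 (\<lambda>z. u b n z *\<^sub>C b) y - g b y *\<^sub>C b)) \<longlonglongrightarrow> 0"
      using ennreal_tendsto_cmult_0[OF u(2)[OF b]] by simp
  qed
  moreover have "(\<lambda>n. Lpow p UNIV (\<lambda>y. osc 0 (V U n) y - fourier_mult \<phi> f y)) \<longlonglongrightarrow> 0"
    unfolding VU fm by (rule lim[OF s2 Tg u(3)])
  moreover have "cont f" unfolding fg by (intro continuous_on_sum gc)
  moreover have "cont (fourier_mult \<phi> f)" unfolding fm by (intro continuous_on_sum Tg)
  ultimately show ?thesis using sU sV isc by (intro exI[of _ U]) blast
qed

text \<open>Two limits in this order: for a fixed approximation the mesh tends to 0, which gives the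
  inequality between inverse transforms of compactly supported symbols; then the approximation
  converges to the test function.\<close>

lemma inequality_from_periodic:
  fixes \<phi> :: "real ^ 'd \<Rightarrow> ('x::complex_banach \<Rightarrow>\<^sub>L 'y::complex_banach)" and f :: "real ^ 'd \<Rightarrow> 'x"
  assumes \<phi>: "multiplier \<phi> B" and bd: "\<And>a. Lq_bounded \<phi> a" and f: "f \<in> test_functions" and p: "1 < p" and c: "0 < c"
    and G: "open G" "countable S" "\<And>z. z \<notin> G \<Longrightarrow> \<exists>(i, c)\<in>S. z $ i = c"
    and cont: "\<And>a. continuous_on G (\<lambda>z. blinfun_apply (\<phi> z) a)" and t: "mesh t"
  shows "(\<And>k F a. finite F \<Longrightarrow> F \<subseteq> (\<lambda>m. t k *\<^sub>R m) ` int_lattice \<Longrightarrow>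
      Lpow p (cube (1 / t k)) (trig F (\<lambda>m. blinfun_apply (\<phi> m) (a m))) \<le> ennreal c * Lpow p (cube (1 / t k)) (trig F a)) \<Longrightarrow>
      Lpow p UNIV (fourier_mult \<phi> f) \<le> ennreal c * Lpow p UNIV f"
    and "(\<And>k F a. finite F \<Longrightarrow> F \<subseteq> (\<lambda>m. t k *\<^sub>R m) ` int_lattice \<Longrightarrow>
      Lpow p (cube (1 / t k)) (trig F a) \<le> ennreal c * Lpow p (cube (1 / t k)) (trig F (\<lambda>m. blinfun_apply (\<phi> m) (a m)))) \<Longrightarrow>
      Lpow p UNIV f \<le> ennreal c * Lpow p UNIV (fourier_mult \<phi> f)"
proof -
  obtain U where U: "\<And>n. sampled p t (U n)" "\<And>n. sampled p t (\<lambda>z. blinfun_apply (\<phi> z) (U n z))"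
    and lim: "(\<lambda>n. Lpow p UNIV (\<lambda>y. osc 0 (U n) y - f y)) \<longlonglongrightarrow> 0"
    "(\<lambda>n. Lpow p UNIV (\<lambda>y. osc 0 (\<lambda>z. blinfun_apply (\<phi> z) (U n z)) y - fourier_mult \<phi> f y)) \<longlonglongrightarrow> 0"
    and fc: "cont f" "cont (fourier_mult \<phi> f)"
    using test_function_approximation[OF \<phi> bd f p G cont t] by blast
  let ?V = "\<lambda>n z. blinfun_apply (\<phi> z) (U n z)"
  have p0: "0 < p" using p by simp
  have oc: "cont (osc 0 h)" if "sampled p t h" for h :: "real ^ 'd \<Rightarrow> 'z::complex_banach"
    using that by (intro continuous_osc_mesh) (auto simp: sampled_def)
  define F where "F n k = {x. U n x \<noteq> 0} \<inter> (\<lambda>m. t k *\<^sub>R m) ` int_lattice" for n k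
  define a where "a n k m = of_real (t k ^ CARD('d)) *\<^sub>C U n m" for n k m
  have F: "finite (F n k)" "F n k \<subseteq> (\<lambda>m. t k *\<^sub>R m) ` int_lattice" for n k
    using osc_eq_trig(1)[OF meshD(1)[OF t]] U(1)[of n] by (auto simp: F_def sampled_def)
  have eqU: "Lpow p (torus (t k)) (osc (t k) (U n)) = Lpow p (cube (1 / t k)) (trig (F n k) (a n k))"
    and eqV: "Lpow p (torus (t k)) (osc (t k) (?V n)) = Lpow p (cube (1 / t k)) (trig (F n k) (\<lambda>m. blinfun_apply (\<phi> m) (a n k m)))" for n k
  proof -
    have b: "bounded {x. U n x \<noteq> 0}" using U(1)[of n] by (auto simp: sampled_def)
    have "osc (t k) (U n) = trig (F n k) (a n k)"
      unfolding F_def a_def by (rule osc_eq_trig(2)[OF meshD(1)[OF t] b]) auto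
    moreover have "osc (t k) (?V n) = trig (F n k) (\<lambda>m. blinfun_apply (\<phi> m) (a n k m))"
      unfolding F_def a_def multiplier_scaleC[OF \<phi>] by (rule osc_eq_trig(2)[OF meshD(1)[OF t] b]) auto
    moreover have L: "0 < 1 / t k" "F n k \<subseteq> (\<lambda>m. (1 / (1 / t k)) *\<^sub>R m) ` int_lattice"
      using F(2) meshD(1)[OF t, of k] by auto
    ultimately show "Lpow p (torus (t k)) (osc (t k) (U n)) = Lpow p (cube (1 / t k)) (trig (F n k) (a n k))"
      "Lpow p (torus (t k)) (osc (t k) (?V n)) = Lpow p (cube (1 / t k)) (trig (F n k) (\<lambda>m. blinfun_apply (\<phi> m) (a n k m)))"
      by (simp_all add: Lpow_torus[OF continuous_trig periodic_trig[OF L] meshD(1)[OF t] p0])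
  qed
  show "Lpow p UNIV (fourier_mult \<phi> f) \<le> ennreal c * Lpow p UNIV f"
    if "\<And>k F a. finite F \<Longrightarrow> F \<subseteq> (\<lambda>m. t k *\<^sub>R m) ` int_lattice \<Longrightarrow>
      Lpow p (cube (1 / t k)) (trig F (\<lambda>m. blinfun_apply (\<phi> m) (a m))) \<le> ennreal c * Lpow p (cube (1 / t k)) (trig F a)"
  proof (rule Lpow_inequality_limit[OF oc[OF U(2)] fc(2) oc[OF U(1)] fc(1) lim(2,1) _ p0 c])
    show "Lpow p UNIV (osc 0 (?V n)) \<le> ennreal c * Lpow p UNIV (osc 0 (U n))" for n
      by (rule sampled_inequality[OF t U(2) U(1) p0 c]) (simp add: eqU eqV that F)
  qed
  show "Lpow p UNIV f \<le> ennreal c * Lpow p UNIV (fourier_mult \<phi> f)"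
    if "\<And>k F a. finite F \<Longrightarrow> F \<subseteq> (\<lambda>m. t k *\<^sub>R m) ` int_lattice \<Longrightarrow>
      Lpow p (cube (1 / t k)) (trig F a) \<le> ennreal c * Lpow p (cube (1 / t k)) (trig F (\<lambda>m. blinfun_apply (\<phi> m) (a m)))"
  proof (rule Lpow_inequality_limit[OF oc[OF U(1)] fc(1) oc[OF U(2)] fc(2) lim _ p0 c])
    show "Lpow p UNIV (osc 0 (U n)) \<le> ennreal c * Lpow p UNIV (osc 0 (?V n))" for n
      by (rule sampled_inequality[OF t U(1) U(2) p0 c]) (simp add: eqU eqV that F)
  qed
qed

section \<open>Multipliers on rectangles and their operator norms\<close>

lemma interval_boundary:
  fixes I :: "real set"
  assumes I: "is_interval I" "bounded I" and x: "x \<in> I" "x \<notin> interior I"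
  shows "x = Inf I \<or> x = Sup I"
proof (rule ccontr)
  assume neq: "\<not> (x = Inf I \<or> x = Sup I)"
  have b: "bdd_below I" "bdd_above I" using I(2) by (auto intro: bounded_imp_bdd_below bounded_imp_bdd_above)
  have "Inf I < x" "x < Sup I" using cInf_lower[OF x(1) b(1)] cSup_upper[OF x(1) b(2)] neq by linarith+
  have ne: "I \<noteq> {}" using x(1) by blast
  obtain y z where yz: "y \<in> I" "y < x" "z \<in> I" "x < z"
    using cInf_less_iff[OF ne b(1), of x] less_cSup_iff[OF ne b(2), of x] \<open>Inf I < x\<close> \<open>x < Sup I\<close> by blast
  have "{y<..<z} \<subseteq> I"
  proof
    fix w assume "w \<in> {y<..<z}"
    then show "w \<in> I" using mem_is_interval_1_I[OF I(1) yz(1,3), of w] by simp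
  qed
  then have "x \<in> interior I" using yz by (intro interiorI[of "{y<..<z}"]) auto
  then show False using x(2) by simp
qed

text \<open>A point that is not interior to its own rectangle has a coordinate that is an endpoint
  of the corresponding side, and countably many rectangles have countably many endpoints. Degenerate
  rectangles are covered since their interior is empty.\<close>

lemma rectangle_partition_hyperplanes:
  fixes \<R> :: "(real ^ 'd) set set"
  assumes "rectangle_partition \<R>"
  shows "\<exists>S. countable S \<and> (\<forall>z. z \<notin> (\<Union>R\<in>\<R>. interior R) \<longrightarrow> (\<exists>(i, c)\<in>S. z $ i = c))"
proof -
  have \<R>: "\<Union>\<R> = UNIV" "countable \<R>" "\<And>R. R \<in> \<R> \<Longrightarrow> bounded_rectangle R"
    using assms by (auto simp: rectangle_partition_def partition_on_def)
  have "\<forall>R\<in>\<R>. \<exists>I. (\<forall>i. is_interval (I i) \<and> bounded (I i)) \<and> R = {x. \<forall>i. x $ i \<in> I i}"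
    using \<R>(3) by (simp add: bounded_rectangle_def)
  then have "\<exists>I. \<forall>R\<in>\<R>. (\<forall>i. is_interval (I R i) \<and> bounded (I R i)) \<and> R = {x. \<forall>i. x $ i \<in> I R i}"
    by (rule bchoice)
  then obtain I where I0: "\<forall>R\<in>\<R>. (\<forall>i. is_interval (I R i) \<and> bounded (I R i)) \<and> R = {x. \<forall>i. x $ i \<in> I R i}" ..
  have I: "is_interval (I R i)" "bounded (I R i)" "R = {x. \<forall>i. x $ i \<in> I R i}" if "R \<in> \<R>" for R i
    by (rule bspec[OF I0 that, THEN conjunct1, rule_format, THEN conjunct1] bspec[OF I0 that, THEN conjunct1, rule_format, THEN conjunct2]
        bspec[OF I0 that, THEN conjunct2])+
  define S where "S = (\<Union>R\<in>\<R>. \<Union>i. {(i, Inf (I R i)), (i, Sup (I R i))})"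
  have "countable S" unfolding S_def using \<R>(2) by (intro countable_UN) (auto intro: countable_finite)
  moreover have "\<exists>(i, c)\<in>S. z $ i = c" if z: "z \<notin> (\<Union>R\<in>\<R>. interior R)" for z
  proof -
    obtain R where R: "R \<in> \<R>" "z \<in> R" using \<R>(1) by blast
    have RI: "x \<in> R \<longleftrightarrow> (\<forall>i. x $ i \<in> I R i)" for x by (subst I(3)[OF R(1)]) simp
    have "\<exists>i. z $ i \<notin> interior (I R i)"
    proof (rule ccontr)
      assume "\<not> ?thesis"
      then have "z \<in> {x. \<forall>i. x $ i \<in> interior (I R i)}" by simp
      moreover have "open {x :: real ^ 'd. \<forall>i. x $ i \<in> interior (I R i)}" by (rule open_vector_box) simp
      moreover have "{x. \<forall>i. x $ i \<in> interior (I R i)} \<subseteq> R"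
        unfolding subset_iff RI mem_Collect_eq by (meson interior_subset subsetD)
      ultimately have "z \<in> interior R" by (intro interiorI)
      then show False using z R(1) by blast
    qed
    then obtain i where i: "z $ i \<notin> interior (I R i)" by blast
    have "z $ i \<in> I R i" using R(2) by (simp add: RI)
    then have "z $ i = Inf (I R i) \<or> z $ i = Sup (I R i)"
      by (intro interval_boundary I R(1) i)
    moreover have "(i, Inf (I R i)) \<in> S" "(i, Sup (I R i)) \<in> S" using R(1) by (auto simp: S_def)
    ultimately show ?thesis by auto
  qed
  ultimately show ?thesis by blast
qed

section \<open>Periodic multipliers on trigonometric polynomials\<close>

lemma fourier_coeff_trig:
  fixes a :: "real ^ 'd \<Rightarrow> 'x::complex_banach"
  assumes F: "finite F" "F \<subseteq> int_lattice" and m: "m \<in> int_lattice"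
  shows "fourier_coeff (trig F a) m = (if m \<in> F then a m else 0)"
proof -
  have "unit_cube = (cbox 0 (\<chi> i. 1) :: (real ^ 'd) set)" by (auto simp: unit_cube_def mem_box_cart)
  note cube = this
  have km: "k - m \<in> int_lattice" if "k \<in> F" for k using that F(2) m by (auto simp: int_lattice_def)
  have hi: "((\<lambda>x. character (k - m) x *\<^sub>C a k) has_integral (if k = m then a k else 0)) (cbox 0 (\<chi> i. 1))" if "k \<in> F" for k
  proof -
    have "character (k - m) integrable_on cbox 0 (\<chi> i. 1)"
      by (intro integrable_continuous continuous_intros)
    then have "(character (k - m) has_integral integral (cbox 0 (\<chi> i. 1)) (character (k - m))) (cbox 0 (\<chi> i. 1))"
      by (rule integrable_integral)
    moreover have "integral (cbox 0 (\<chi> i. 1)) (character (k - m)) = (if k = m then 1 else 0)"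
      using integral_character_cube[OF zero_less_one km[OF that], of 0] by simp
    ultimately have "(character (k - m) has_integral (if k = m then 1 else 0)) (cbox 0 (\<chi> i. 1))" by simp
    from has_integral_linear[OF this scaleC.bounded_linear_left[of "a k"]]
    show ?thesis by (simp add: o_def scaleC_one split: if_splits)
  qed
  have "fourier_coeff (trig F a) m = integral (cbox 0 (\<chi> i. 1)) (\<lambda>x. \<Sum>k\<in>F. character (k - m) x *\<^sub>C a k)"
    unfolding fourier_coeff_def cube trig_def
    by (simp add: scaleC.sum_right scaleC_scaleC character_add_left[symmetric])
  also have "\<dots> = (\<Sum>k\<in>F. if k = m then a k else 0)"
    by (intro integral_unique has_integral_sum F hi)
  finally show ?thesis using F(1) by simp
qed

lemma periodic_mult_trig:
  fixes \<phi> :: "real ^ 'd \<Rightarrow> ('x::complex_banach \<Rightarrow>\<^sub>L 'y::complex_banach)"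
  assumes F: "finite F" "F \<subseteq> int_lattice"
  shows "periodic_mult \<phi> (trig F a) = trig F (\<lambda>m. blinfun_apply (\<phi> m) (a m))"
proof
  fix x
  \<comment> \<open>Frequencies with zero coefficient drop out of the defining sum; they are put
    back below because the multiplier sends 0 to 0.\<close>
  have "{m. m \<in> int_lattice \<and> fourier_coeff (trig F a) m \<noteq> 0} = {m \<in> F. a m \<noteq> 0}"
    using F(2) fourier_coeff_trig[OF F, of _ a] by (auto split: if_splits)
  then have "periodic_mult \<phi> (trig F a) x = (\<Sum>m\<in>{m \<in> F. a m \<noteq> 0}. character m x *\<^sub>C blinfun_apply (\<phi> m) (a m))"
    unfolding periodic_mult_def using F(2) fourier_coeff_trig[OF F, of _ a] by (intro sum.cong) (auto split: if_splits)
  also have "\<dots> = trig F (\<lambda>m. blinfun_apply (\<phi> m) (a m)) x"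
    unfolding trig_def using F(1) by (intro sum.mono_neutral_left) auto
  finally show "periodic_mult \<phi> (trig F a) x = trig F (\<lambda>m. blinfun_apply (\<phi> m) (a m)) x" .
qed

section \<open>Best constants as infima of sets of bounds\<close>

lemma inverse_mult_le_iff_ennreal:
  assumes "0 < c"
  shows "inverse (ennreal c) * X \<le> Y \<longleftrightarrow> X \<le> ennreal c * Y"
proof -
  have inv: "inverse (ennreal c) = ennreal (inverse c)" using assms by (simp add: inverse_ennreal)
  have 1: "ennreal c * (ennreal (inverse c) * Z) = Z" "ennreal (inverse c) * (ennreal c * Z) = Z" for Z
    using assms by (simp_all add: mult.assoc[symmetric] ennreal_mult[symmetric])
  show ?thesis
    unfolding inv using 1 mult_left_mono[of "ennreal (inverse c) * X" Y "ennreal c"] mult_left_mono[of X "ennreal c * Y" "ennreal (inverse c)"]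
    by auto
qed

text \<open>This and the next three predicates are the membership conditions of the sets whose
  infima are the best constants, named so that bounds can be transferred one constant at a
  time.\<close>

definition torus_bound :: "real \<Rightarrow> (real ^ 'd \<Rightarrow> ('x::complex_banach \<Rightarrow>\<^sub>L 'y::complex_banach)) \<Rightarrow> ennreal \<Rightarrow> bool" where
  "torus_bound p \<phi> \<beta> \<longleftrightarrow> \<beta> < \<infinity> \<and> (\<forall>f\<in>trig_polynomials. Lp_norm p unit_cube (periodic_mult \<phi> f) \<le> \<beta> * Lp_norm p unit_cube f)"

definition torus_inverse_bound :: "real \<Rightarrow> (real ^ 'd \<Rightarrow> ('x::complex_banach \<Rightarrow>\<^sub>L 'y::complex_banach)) \<Rightarrow> ennreal \<Rightarrow> bool" where
  "torus_inverse_bound p \<phi> \<alpha> \<longleftrightarrow> \<alpha> < \<infinity> \<and> (\<forall>f\<in>trig_polynomials. inverse \<alpha> * Lp_norm p unit_cube f \<le> Lp_norm p unit_cube (periodic_mult \<phi> f))"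

definition space_bound :: "real \<Rightarrow> (real ^ 'd \<Rightarrow> ('x::complex_banach \<Rightarrow>\<^sub>L 'y::complex_banach)) \<Rightarrow> ennreal \<Rightarrow> bool" where
  "space_bound p \<phi> \<beta> \<longleftrightarrow> \<beta> < \<infinity> \<and> (\<forall>f\<in>test_functions. Lp_norm p UNIV (fourier_mult \<phi> f) \<le> \<beta> * Lp_norm p UNIV f)"

definition space_inverse_bound :: "real \<Rightarrow> (real ^ 'd \<Rightarrow> ('x::complex_banach \<Rightarrow>\<^sub>L 'y::complex_banach)) \<Rightarrow> ennreal \<Rightarrow> bool" where
  "space_inverse_bound p \<phi> \<alpha> \<longleftrightarrow> \<alpha> < \<infinity> \<and> (\<forall>f\<in>test_functions. inverse \<alpha> * Lp_norm p UNIV f \<le> Lp_norm p UNIV (fourier_mult \<phi> f))"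

lemma bounds_upward_closed:
  assumes "b < ennreal c"
  shows "torus_bound p \<phi> b \<Longrightarrow> torus_bound p \<phi> (ennreal c)"
    and "torus_inverse_bound p \<phi> b \<Longrightarrow> torus_inverse_bound p \<phi> (ennreal c)"
    and "space_bound p \<phi> b \<Longrightarrow> space_bound p \<phi> (ennreal c)"
    and "space_inverse_bound p \<phi> b \<Longrightarrow> space_inverse_bound p \<phi> (ennreal c)"
proof -
  have 1: "x \<le> ennreal c * y" if "x \<le> b * y" for x y :: ennreal
    by (rule order_trans[OF that mult_right_mono]) (use assms in auto)
  have 2: "inverse (ennreal c) * y \<le> x" if "inverse b * y \<le> x" for x y :: ennreal
  proof (rule order_trans[OF mult_right_mono that])
    show "inverse (ennreal c) \<le> inverse b"
    \<comment> \<open>For \<open>b = 0\<close> the inverse is infinite and the comparison is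
      trivial.\<close>
    proof (cases "b = 0")
      case False
      then obtain r where "b = ennreal r" "0 < r" using assms by (cases b) auto
      then show ?thesis using assms by (simp add: inverse_ennreal ennreal_less_iff ennreal_leI le_imp_inverse_le)
    qed simp
  qed simp
  show "torus_bound p \<phi> b \<Longrightarrow> torus_bound p \<phi> (ennreal c)" using 1 by (auto simp: torus_bound_def)
  show "torus_inverse_bound p \<phi> b \<Longrightarrow> torus_inverse_bound p \<phi> (ennreal c)" using 2 by (auto simp: torus_inverse_bound_def)
  show "space_bound p \<phi> b \<Longrightarrow> space_bound p \<phi> (ennreal c)" using 1 by (auto simp: space_bound_def)
  show "space_inverse_bound p \<phi> b \<Longrightarrow> space_inverse_bound p \<phi> (ennreal c)" using 2 by (auto simp: space_inverse_bound_def)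
qed

lemma trig_polynomials_eq: "trig_polynomials = {trig F a | F a. finite F \<and> F \<subseteq> int_lattice}"
  by (simp add: trig_polynomials_def trig_def[abs_def])

lemma unit_cube_eq: "unit_cube = cube 1"
  by (auto simp: unit_cube_def mem_box_cart)

lemma torus_bound_iff:
  assumes p: "0 < p" and c: "0 < c"
  shows "torus_bound p \<phi> (ennreal c) \<longleftrightarrow> (\<forall>F a. finite F \<and> F \<subseteq> int_lattice \<longrightarrow>
      Lpow p (cube 1) (trig F (\<lambda>m. blinfun_apply (\<phi> m) (a m))) \<le> ennreal (c powr p) * Lpow p (cube 1) (trig F a))"
    and "torus_inverse_bound p \<phi> (ennreal c) \<longleftrightarrow> (\<forall>F a. finite F \<and> F \<subseteq> int_lattice \<longrightarrow>
      Lpow p (cube 1) (trig F a) \<le> ennreal (c powr p) * Lpow p (cube 1) (trig F (\<lambda>m. blinfun_apply (\<phi> m) (a m))))"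
  unfolding torus_bound_def torus_inverse_bound_def inverse_mult_le_iff_ennreal[OF c] Lp_norm_le_iff[OF p c] trig_polynomials_eq unit_cube_eq
  by (fastforce simp: periodic_mult_trig)+

lemma space_bound_iff:
  assumes p: "0 < p" and c: "0 < c"
  shows "space_bound p \<phi> (ennreal c) \<longleftrightarrow>
      (\<forall>f\<in>test_functions. Lpow p UNIV (fourier_mult \<phi> f) \<le> ennreal (c powr p) * Lpow p UNIV f)"
    and "space_inverse_bound p \<phi> (ennreal c) \<longleftrightarrow>
      (\<forall>f\<in>test_functions. Lpow p UNIV f \<le> ennreal (c powr p) * Lpow p UNIV (fourier_mult \<phi> f))"
  unfolding space_bound_def space_inverse_bound_def inverse_mult_le_iff_ennreal[OF c] Lp_norm_le_iff[OF p c] by auto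

text \<open>Upward closure means that only positive finite constants have to be transferred, and
  that the infimum need not be attained.\<close>

lemma Inf_le_Inf_transfer:
  fixes A B :: "ennreal set"
  assumes up: "\<And>b c. b \<in> B \<Longrightarrow> b < ennreal c \<Longrightarrow> ennreal c \<in> B" and tr: "\<And>c. 0 < c \<Longrightarrow> ennreal c \<in> B \<Longrightarrow> ennreal c \<in> A"
  shows "Inf A \<le> Inf B"
proof (rule Inf_greatest)
  fix b assume b: "b \<in> B"
  show "Inf A \<le> b"
  proof (rule dense_ge)
    fix y assume y: "b < y"
    show "Inf A \<le> y"
    proof (cases y)
      case (real c)
      then have "0 < c" using y by (cases "c = 0") auto
      then have "y \<in> A" using tr up b y real by blast
      then show ?thesis by (rule Inf_lower)
    qed simp
  qed
qed

text \<open>If the inequality fails, some y below Inf A bounds Inf (B t) for arbitrarily small t. A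
  constant c strictly between y and Inf A then belongs, by upward closure, to B t along a whole mesh
  sequence, and transfer puts it into A, a contradiction. One constant serves for all k, as the
  limit argument requires.\<close>

lemma Inf_le_Liminf_transfer:
  fixes A :: "ennreal set" and B :: "real \<Rightarrow> ennreal set"
  assumes up: "\<And>t b c. b \<in> B t \<Longrightarrow> b < ennreal c \<Longrightarrow> ennreal c \<in> B t"
    and tr: "\<And>c t. 0 < c \<Longrightarrow> mesh t \<Longrightarrow> (\<And>k. ennreal c \<in> B (t k)) \<Longrightarrow> ennreal c \<in> A"
  shows "Inf A \<le> Liminf (at_right 0) (\<lambda>t. Inf (B t))"
  unfolding le_Liminf_iff
proof (intro allI impI, rule ccontr)
  fix y assume y: "y < Inf A" and ne: "\<not> (\<forall>\<^sub>F t in at_right 0. y < Inf (B t))"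
  obtain z where z: "y < z" "z < Inf A" using dense[OF y] by blast
  obtain c where c: "z = ennreal c" "0 \<le> c" using z(2) by (cases z) auto
  have c0: "0 < c" using z(1) c by (cases "c = 0") auto
  \<comment> \<open>The bound 1/(k+1) forces t to 0 and keeps it below 1, which makes the chosen
    sequence a mesh.\<close>
  have "\<exists>t. 0 < t \<and> t < inverse (real (Suc k)) \<and> ennreal c \<in> B t" for k
  proof -
    have "\<not> (\<forall>t>0. t < inverse (real (Suc k)) \<longrightarrow> y < Inf (B t))"
      using ne unfolding eventually_at_right[OF zero_less_one] by (metis inverse_positive_iff_positive of_nat_0_less_iff zero_less_Suc)
    then obtain t where t: "0 < t" "t < inverse (real (Suc k))" "Inf (B t) \<le> y" by (meson not_le)
    then have "Inf (B t) < z" using z(1) by (meson le_less_trans)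
    then obtain b where "b \<in> B t" "b < z" by (meson Inf_less_iff)
    then show ?thesis using up t c by blast
  qed
  then obtain t where t: "\<And>k. 0 < t k" "\<And>k. t k < inverse (real (Suc k))" "\<And>k. ennreal c \<in> B (t k)" by metis
  have "t \<longlonglongrightarrow> 0"
    by (rule tendsto_sandwich[OF _ _ tendsto_const LIMSEQ_inverse_real_of_nat])
      (intro always_eventually allI less_imp_le t)+
  moreover have "t k \<le> 1" for k
    using t(2)[of k] le_imp_inverse_le[of 1 "real (Suc k)"] by simp
  ultimately have "mesh t" using t by (simp add: mesh_def)
  then have "z \<in> A" using tr c0 t(3) c by blast
  then show False using z(2) Inf_lower[of z A] by simp
qed

lemma mult_trig_in_test_functions:
  fixes a :: "real ^ 'd \<Rightarrow> 'x::complex_banach"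
  assumes \<psi>: "C_infinity_compact \<psi>" and F: "finite F"
  shows "(\<lambda>x. \<psi> x *\<^sub>C trig F a x) \<in> test_functions"
proof -
  have "C_class k (\<lambda>x. \<Sum>m\<in>F. character m x *\<^sub>C a m)" for k
    by (intro C_class_sum C_class_bilinear[OF bounded_bilinear_scaleC] C_class_character C_class_const)
  then have "C_class k (trig F a)" for k by (simp add: trig_def[abs_def])
  then have "C_class k (\<lambda>x. \<psi> x *\<^sub>C trig F a x)" for k
    using C_class_bilinear[OF bounded_bilinear_scaleC C_infinity_compactD(1)[OF \<psi>]] by blast
  then have "C_infinity_compact (\<lambda>x. \<psi> x *\<^sub>C trig F a x)"
    by (rule C_infinity_compact_mono[OF \<psi>]) simp
  moreover have "range (\<lambda>x. \<psi> x *\<^sub>C trig F a x) \<subseteq> cspan (a ` F)"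
    unfolding trig_def
    by (intro image_subsetI complex_vector.span_scale complex_vector.span_sum complex_vector.span_base) auto
  ultimately show ?thesis using F by (auto simp: test_functions_def in_fin_dim_def)
qed

section \<open>Dilation between period 1/t and the unit cube\<close>

lemma trig_scale:
  fixes F :: "(real ^ 'd) set"
  assumes F: "F \<subseteq> (\<lambda>m. t *\<^sub>R m) ` int_lattice" and t: "0 < t"
  defines "E \<equiv> (\<lambda>m. (1 / t) *\<^sub>R m) ` F"
  shows "E \<subseteq> int_lattice" "trig F a y = trig E (\<lambda>m. a (t *\<^sub>R m)) (t *\<^sub>R y)"
proof -
  show "E \<subseteq> int_lattice" using F t by (auto simp: E_def)
  have "inj_on (\<lambda>m. (1 / t) *\<^sub>R m) F" using t by (simp add: inj_on_def)
  then show "trig F a y = trig E (\<lambda>m. a (t *\<^sub>R m)) (t *\<^sub>R y)"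
    unfolding trig_def E_def using t by (simp add: sum.reindex character_scaleR[symmetric])
qed

lemma Lpow_cube_scale:
  fixes P :: "real ^ 'd \<Rightarrow> 'b::real_normed_vector"
  assumes "cont P" "0 < t"
  shows "Lpow p (cube 1) P = ennreal (t ^ CARD('d)) * Lpow p (cube (1 / t)) (\<lambda>y. P (t *\<^sub>R y))"
proof -
  have "{x. t *\<^sub>R x \<in> cube 1} = (cube (1 / t) :: (real ^ 'd) set)"
    using assms(2) by (auto simp: mem_box_cart field_simps zero_le_mult_iff)
  then show ?thesis using Lpow_scale[OF assms(1) _ assms(2), of "cube 1" p] by simp
qed

text \<open>Frequencies in t Z^d on the cell of side 1/t correspond to integer frequencies on the
  unit cube, with the multiplier dilated by t. Both powers acquire the same factor t^d, which
  cancels.\<close>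

lemma dilated_torus_bound:
  fixes F :: "(real ^ 'd) set" and \<phi> :: "real ^ 'd \<Rightarrow> ('x::complex_banach \<Rightarrow>\<^sub>L 'y::complex_banach)"
  assumes F: "finite F" "F \<subseteq> (\<lambda>m. t *\<^sub>R m) ` int_lattice" and t: "0 < t" and p: "0 < p" and c: "0 < c"
  shows "torus_bound p (\<lambda>z. \<phi> (t *\<^sub>R z)) (ennreal c) \<Longrightarrow>
      Lpow p (cube (1 / t)) (trig F (\<lambda>m. blinfun_apply (\<phi> m) (a m))) \<le> ennreal (c powr p) * Lpow p (cube (1 / t)) (trig F a)"
    and "torus_inverse_bound p (\<lambda>z. \<phi> (t *\<^sub>R z)) (ennreal c) \<Longrightarrow>
      Lpow p (cube (1 / t)) (trig F a) \<le> ennreal (c powr p) * Lpow p (cube (1 / t)) (trig F (\<lambda>m. blinfun_apply (\<phi> m) (a m)))"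
proof -
  define E where "E = (\<lambda>m. (1 / t) *\<^sub>R m) ` F"
  define u where "u = trig E (\<lambda>m. a (t *\<^sub>R m))"
  define v where "v = trig E (\<lambda>m. blinfun_apply (\<phi> (t *\<^sub>R m)) (a (t *\<^sub>R m)))"
  have E: "finite E" "E \<subseteq> int_lattice" using F(1) trig_scale(1)[OF F(2) t] by (auto simp: E_def)
  have u: "trig F a = (\<lambda>y. u (t *\<^sub>R y))" "Lpow p (cube 1) u = ennreal (t ^ CARD('d)) * Lpow p (cube (1 / t)) (trig F a)"
    using ext[of "trig F a", OF trig_scale(2)[OF F(2) t, of a]] Lpow_cube_scale[OF continuous_trig t, of p E "\<lambda>m. a (t *\<^sub>R m)"] by (auto simp: u_def E_def)
  have v: "Lpow p (cube 1) v = ennreal (t ^ CARD('d)) * Lpow p (cube (1 / t)) (trig F (\<lambda>m. blinfun_apply (\<phi> m) (a m)))"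
    using ext[of "trig F _", OF trig_scale(2)[OF F(2) t, of "\<lambda>m. blinfun_apply (\<phi> m) (a m)"]]
      Lpow_cube_scale[OF continuous_trig t, of p E "\<lambda>m. blinfun_apply (\<phi> (t *\<^sub>R m)) (a (t *\<^sub>R m))"]
    by (auto simp: v_def E_def)
  have cancel: "x \<le> ennreal C * y" if "ennreal (t ^ CARD('d)) * x \<le> ennreal C * (ennreal (t ^ CARD('d)) * y)" for x y C
    by (rule mult_cancel_le_ennreal[of "ennreal (t ^ CARD('d))" x 1]) (use that t in auto)
  show "Lpow p (cube (1 / t)) (trig F (\<lambda>m. blinfun_apply (\<phi> m) (a m))) \<le> ennreal (c powr p) * Lpow p (cube (1 / t)) (trig F a)"
    if "torus_bound p (\<lambda>z. \<phi> (t *\<^sub>R z)) (ennreal c)"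
  proof (rule cancel)
    have "Lpow p (cube 1) v \<le> ennreal (c powr p) * Lpow p (cube 1) u"
      using iffD1[OF torus_bound_iff(1)[OF p c] that, rule_format, OF conjI[OF E]] by (simp add: u_def v_def)
    then show "ennreal (t ^ CARD('d)) * Lpow p (cube (1 / t)) (trig F (\<lambda>m. blinfun_apply (\<phi> m) (a m)))
        \<le> ennreal (c powr p) * (ennreal (t ^ CARD('d)) * Lpow p (cube (1 / t)) (trig F a))"
      by (simp only: u(2) v)
  qed
  show "Lpow p (cube (1 / t)) (trig F a) \<le> ennreal (c powr p) * Lpow p (cube (1 / t)) (trig F (\<lambda>m. blinfun_apply (\<phi> m) (a m)))"
    if "torus_inverse_bound p (\<lambda>z. \<phi> (t *\<^sub>R z)) (ennreal c)"
  proof (rule cancel)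
    have "Lpow p (cube 1) u \<le> ennreal (c powr p) * Lpow p (cube 1) v"
      using iffD1[OF torus_bound_iff(2)[OF p c] that, rule_format, OF conjI[OF E]] by (simp add: u_def v_def)
    then show "ennreal (t ^ CARD('d)) * Lpow p (cube (1 / t)) (trig F a)
        \<le> ennreal (c powr p) * (ennreal (t ^ CARD('d)) * Lpow p (cube (1 / t)) (trig F (\<lambda>m. blinfun_apply (\<phi> m) (a m))))"
      by (simp only: u(2) v)
  qed
qed

lemma norm_le_imp_Lq_bounded:
  fixes \<phi> :: "real ^ 'd \<Rightarrow> ('x::complex_banach \<Rightarrow>\<^sub>L 'y::complex_banach)"
  assumes "\<And>q :: real. 1 < q \<Longrightarrow> \<exists>C::real. \<forall>f :: real ^ 'd \<Rightarrow> complex. C_infinity_compact f \<longrightarrow>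
    Lp_norm q UNIV (fourier_mult \<phi> (\<lambda>x. f x *\<^sub>C a)) \<le> ennreal C * Lp_norm q UNIV f"
  shows "Lq_bounded \<phi> a"
  unfolding Lq_bounded_def
proof (intro allI impI)
  fix q :: real assume q: "1 < q"
  obtain C where C: "\<And>f. C_infinity_compact f \<Longrightarrow>
      Lp_norm q UNIV (fourier_mult \<phi> (\<lambda>x. f x *\<^sub>C a)) \<le> ennreal C * Lp_norm q UNIV f" using assms[OF q] by blast
  have "Lpow q UNIV (fourier_mult \<phi> (\<lambda>x. f x *\<^sub>C a)) \<le> ennreal (max C 1 powr q) * Lpow q UNIV f"
    if "C_infinity_compact f" for f
  proof -
    have "ennreal C * Lp_norm q UNIV f \<le> ennreal (max C 1) * Lp_norm q UNIV f"
      by (intro mult_right_mono ennreal_leI) auto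
    then have "Lp_norm q UNIV (fourier_mult \<phi> (\<lambda>x. f x *\<^sub>C a)) \<le> ennreal (max C 1) * Lp_norm q UNIV f"
      using C[OF that] by (rule order_trans[rotated])
    then show ?thesis using q by (subst (asm) Lp_norm_le_iff) auto
  qed
  then show "\<exists>C. \<forall>f. C_infinity_compact f \<longrightarrow> Lpow q UNIV (fourier_mult \<phi> (\<lambda>x. f x *\<^sub>C a)) \<le> ennreal C * Lpow q UNIV f"
    by blast
qed

theorem theorem14:
  fixes \<phi> :: "real ^ 'd \<Rightarrow> ('x::complex_banach \<Rightarrow>\<^sub>L 'y::complex_banach)"
    and \<R> :: "(real ^ 'd) set set"
    and p :: real
  assumes ops: "\<And>\<xi>. \<phi> \<xi> \<in> bounded_clinear_ops"
    and meas: "\<And>a. (\<lambda>\<xi>. blinfun_apply (\<phi> \<xi>) a) \<in> borel_measurable lebesgue"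
    and bdd: "bounded (range \<phi>)"
    and part: "rectangle_partition \<R>"
    and cont: "\<And>R a. R \<in> \<R> \<Longrightarrow> continuous_on R (\<lambda>\<xi>. blinfun_apply (\<phi> \<xi>) a)"
    and findim: "\<And>R a. R \<in> \<R> \<Longrightarrow> in_fin_dim ((\<lambda>\<xi>. blinfun_apply (\<phi> \<xi>) a) ` R)"
    and mult: "\<And>(q::real) a. 1 < q \<Longrightarrow>
      \<exists>C::real. \<forall>f :: real ^ 'd \<Rightarrow> complex. C_infinity_compact f \<longrightarrow>
        Lp_norm q UNIV (fourier_mult \<phi> (\<lambda>x. f x *\<^sub>C a)) \<le> ennreal C * Lp_norm q UNIV f"
    and p: "1 < p"
  shows "((\<forall>m\<in>int_lattice. \<forall>a. isCont (\<lambda>\<xi>. blinfun_apply (\<phi> \<xi>) a) m) \<longrightarrow>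
            M_norm p \<phi> \<le> T_norm p \<phi> \<and> M_inv_norm p \<phi> \<le> T_inv_norm p \<phi>) \<and>
         T_norm p \<phi> \<le> Liminf (at_right 0) (\<lambda>t::real. M_norm p (\<lambda>\<xi>. \<phi> (t *\<^sub>R \<xi>))) \<and>
         T_inv_norm p \<phi> \<le> Liminf (at_right 0) (\<lambda>t::real. M_inv_norm p (\<lambda>\<xi>. \<phi> (t *\<^sub>R \<xi>)))"
proof -
  \<comment> \<open>Continuity on a rectangle gives continuity at its interior points, so the
    multiplier is strongly continuous on this open set; everything else lies on countably many
    hyperplanes.\<close>
  define G where "G = (\<Union>R\<in>\<R>. interior R)"
  have G: "open G" by (auto simp: G_def)
  obtain S where S: "countable S" "\<And>\<xi>. \<xi> \<notin> G \<Longrightarrow> \<exists>(i, c)\<in>S. \<xi> $ i = c"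
    using rectangle_partition_hyperplanes[OF part] unfolding G_def by blast
  have Gc: "continuous_on G (\<lambda>\<xi>. blinfun_apply (\<phi> \<xi>) a)" for a
    unfolding G_def by (intro continuous_on_open_UN open_interior continuous_on_subset[OF cont interior_subset])
  obtain B where B: "\<And>\<xi>. norm (\<phi> \<xi>) \<le> B" using bdd unfolding bounded_iff by blast
  \<comment> \<open>The null set is the countable union of these hyperplanes, the same for every
    vector.\<close>
  have \<phi>: "multiplier \<phi> B"
    unfolding multiplier_def
  proof (intro conjI allI ops B exI[of _ "\<Union>((\<lambda>(i, c). {x :: real ^ 'd. x $ i = c}) ` S)"])
    show "negligible (\<Union>((\<lambda>(i, c). {x :: real ^ 'd. x $ i = c}) ` S))"
      using S(1) by (intro negligible_countable_Union) (auto simp: negligible_coord)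
    fix \<xi>
    have "\<xi> \<in> G" if "\<xi> \<notin> (\<Union>((\<lambda>(i, c). {x. x $ i = c}) ` S))" using S(2)[of \<xi>] that by auto
    then show "\<xi> \<notin> (\<Union>((\<lambda>(i, c). {x. x $ i = c}) ` S)) \<longrightarrow> (\<forall>a. isCont (\<lambda>\<xi>. blinfun_apply (\<phi> \<xi>) a) \<xi>)"
      using Gc G by (auto simp: continuous_on_eq_continuous_at)
  qed
  have bd: "Lq_bounded \<phi> a" for a by (rule norm_le_imp_Lq_bounded[OF mult])
  have p0: "0 < p" using p by simp
  have norms: "M_norm p = (\<lambda>\<phi>. Inf {\<beta>. torus_bound p (\<phi> :: real ^ 'd \<Rightarrow> ('x \<Rightarrow>\<^sub>L 'y)) \<beta>})"
      "M_inv_norm p = (\<lambda>\<phi>. Inf {\<alpha>. torus_inverse_bound p (\<phi> :: real ^ 'd \<Rightarrow> ('x \<Rightarrow>\<^sub>L 'y)) \<alpha>})"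
      "T_norm p = (\<lambda>\<phi>. Inf {\<beta>. space_bound p (\<phi> :: real ^ 'd \<Rightarrow> ('x \<Rightarrow>\<^sub>L 'y)) \<beta>})"
      "T_inv_norm p = (\<lambda>\<phi>. Inf {\<alpha>. space_inverse_bound p (\<phi> :: real ^ 'd \<Rightarrow> ('x \<Rightarrow>\<^sub>L 'y)) \<alpha>})"
    by (simp_all add: M_norm_def M_inv_norm_def T_norm_def T_inv_norm_def torus_bound_def torus_inverse_bound_def
        space_bound_def space_inverse_bound_def fun_eq_iff)
  have cp: "0 < c powr p" if "0 < c" for c :: real using that by simp
  \<comment> \<open>Transference with L = 1, where the frequencies are the integer points at which
    continuity is assumed.\<close>
  have periodic: "M_norm p \<phi> \<le> T_norm p \<phi> \<and> M_inv_norm p \<phi> \<le> T_inv_norm p \<phi>"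
    if lattice: "\<forall>m\<in>int_lattice. \<forall>a. isCont (\<lambda>\<xi>. blinfun_apply (\<phi> \<xi>) a) m"
    unfolding norms
  proof (intro conjI Inf_le_Inf_transfer)
    show "ennreal c \<in> {\<beta>. torus_bound p \<phi> \<beta>}" if c: "0 < c" "ennreal c \<in> {\<beta>. space_bound p \<phi> \<beta>}" for c
      unfolding mem_Collect_eq torus_bound_iff(1)[OF p0 c(1)]
    proof (intro allI impI, elim conjE)
      fix F :: "(real ^ 'd) set" and a :: "real ^ 'd \<Rightarrow> 'x" assume F: "finite F" "F \<subseteq> int_lattice"
      show "Lpow p (cube 1) (trig F (\<lambda>m. blinfun_apply (\<phi> m) (a m))) \<le> ennreal (c powr p) * Lpow p (cube 1) (trig F a)"
        using c(2) space_bound_iff(1)[OF p0 c(1), of \<phi>] F lattice mult_trig_in_test_functions[OF _ F(1), of _ a]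
        by (intro transference(1)[OF \<phi> zero_less_one F(1) _ bd _ p cp[OF c(1)]]) auto
    qed
    show "ennreal c \<in> {\<alpha>. torus_inverse_bound p \<phi> \<alpha>}" if c: "0 < c" "ennreal c \<in> {\<alpha>. space_inverse_bound p \<phi> \<alpha>}" for c
      unfolding mem_Collect_eq torus_bound_iff(2)[OF p0 c(1)]
    proof (intro allI impI, elim conjE)
      fix F :: "(real ^ 'd) set" and a :: "real ^ 'd \<Rightarrow> 'x" assume F: "finite F" "F \<subseteq> int_lattice"
      show "Lpow p (cube 1) (trig F a) \<le> ennreal (c powr p) * Lpow p (cube 1) (trig F (\<lambda>m. blinfun_apply (\<phi> m) (a m)))"
        using c(2) space_bound_iff(2)[OF p0 c(1), of \<phi>] F lattice mult_trig_in_test_functions[OF _ F(1), of _ a]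
        by (intro transference(2)[OF \<phi> zero_less_one F(1) _ bd _ p cp[OF c(1)]]) auto
    qed
  qed (auto intro: bounds_upward_closed)
  have space: "T_norm p \<phi> \<le> Liminf (at_right 0) (\<lambda>t::real. M_norm p (\<lambda>\<xi>. \<phi> (t *\<^sub>R \<xi>)))"
    unfolding norms
  proof (rule Inf_le_Liminf_transfer)
    fix c :: real and t assume c: "0 < c" and t: "mesh t"
      and b: "\<And>k. ennreal c \<in> {\<beta>. torus_bound p (\<lambda>\<xi>. \<phi> (t k *\<^sub>R \<xi>)) \<beta>}"
    have "Lpow p UNIV (fourier_mult \<phi> f) \<le> ennreal (c powr p) * Lpow p UNIV f" if "f \<in> test_functions" for f
      using b by (intro inequality_from_periodic(1)[OF \<phi> bd that p cp[OF c] G S Gc t]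
          dilated_torus_bound(1)[OF _ _ meshD(1)[OF t] p0 c]) auto
    then show "ennreal c \<in> {\<beta>. space_bound p \<phi> \<beta>}" using space_bound_iff(1)[OF p0 c, of \<phi>] by simp
  qed (auto intro: bounds_upward_closed)
  have space_inverse: "T_inv_norm p \<phi> \<le> Liminf (at_right 0) (\<lambda>t::real. M_inv_norm p (\<lambda>\<xi>. \<phi> (t *\<^sub>R \<xi>)))"
    unfolding norms
  proof (rule Inf_le_Liminf_transfer)
    fix c :: real and t assume c: "0 < c" and t: "mesh t"
      and b: "\<And>k. ennreal c \<in> {\<alpha>. torus_inverse_bound p (\<lambda>\<xi>. \<phi> (t k *\<^sub>R \<xi>)) \<alpha>}"
    have "Lpow p UNIV f \<le> ennreal (c powr p) * Lpow p UNIV (fourier_mult \<phi> f)" if "f \<in> test_functions" for f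
      using b by (intro inequality_from_periodic(2)[OF \<phi> bd that p cp[OF c] G S Gc t]
          dilated_torus_bound(2)[OF _ _ meshD(1)[OF t] p0 c]) auto
    then show "ennreal c \<in> {\<alpha>. space_inverse_bound p \<phi> \<alpha>}" using space_bound_iff(2)[OF p0 c, of \<phi>] by simp
  qed (auto intro: bounds_upward_closed)
  show ?thesis using periodic space space_inverse by blast
qed

end
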